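(* Let $u$ be the solution of the Helmholtz problem $-\Delta u-k^2u=f$ in $\Omega$, $\frac{\partial u}{\partial n}+\mathbf{i}ku=g$ on $\Gamma=\partial\Omega$, let $u_I\in V_h$ be the linear (nodal) interpolant of $u$ on $\mathcal{T}_h$, and let $G_h$ be the polynomial preserving recovery (PPR) gradient recovery operator. Then there is a constant $C>0$ independent of $k$, $h$, $f$ and $g$ such that $$\|G_hu_I-\nabla u\|_{L^2(\Omega)}\le C(kh)^2\,C_{u,g}.$$
   Context: Setting. $\Omega\subset\mathbb{R}^2$ is a bounded polygon with boundary $\Gamma$, strictly star-shaped: there are $x_\Omega\in\Omega$ and $c_\Omega>0$ depending only on $\Omega$ with $(x-x_\Omega)\cdot n\ge c_\Omega$ for all $x\in\Gamma$, $n$ the unit outward normal. The wave number $k$ is a constant with $k\gg1$ (in particular bounded below by a fixed positive constant). Functions are complex valued, $\mathbf{i}=\sqrt{-1}$; $\|\cdot\|_j$ is the $H^j(\Omega)$ norm. The datum $f$ is sufficiently smooth and $g\in H^2(\Gamma)$, such that $u\in H^3(\Omega)$. $\mathcal{T}_h$ is a regular (conforming, shape-regular) triangulation of $\Omega$ with set of nodes $\mathcal{N}_h$, $h=\max_\tau h_\tau$ with $h_\tau=\mathrm{diam}(\tau)$, and $h_\tau$ is comparable to $h$ for all $\tau\in\mathcal{T}_h$ uniformly. $V_h=\{v_h\in H^1(\Omega): v_h|_\tau\in P_1(\tau)\ \forall\tau\in\mathcal{T}_h\}$. $C_{u,g}=\sum_{j=1}^3k^{-(j-1)}\|u\|_j+\sum_{j=1}^2k^{-j}|g|_{H^j(\Gamma)}$.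 PPR operator $G_h:C(\Omega)\to V_h\times V_h$: for each node $z\in\mathcal{N}_h$ select $n\ge6$ sampling nodes $z_1,\dots,z_n\in\mathcal{N}_h$ (one of them $z$), not all on one conic, in an element patch $\omega_z$ containing $z$ (a union of a uniformly bounded number of mesh elements around $z$). For $w\in C(\Omega)$ let $p_2\in P_2(\omega_z)$ be the quadratic polynomial minimizing $\sum_{j=1}^n(q-w)^2(z_j)$ over quadratic polynomials $q$ (least squares fit), and set $(G_hw)(z)=(\nabla p_2)(z)$; $G_hw$ is the continuous piecewise linear field with these nodal values. Known properties of $G_h$ taken for granted: (i) $\|G_hv_h\|_{L^2(\Omega)}\le C\|\nabla v_h\|_{L^2(\Omega)}$ for all $v_h\in V_h$; (ii) $(G_hp)(z)=\nabla p(z)$ for each node $z$ and $p\in P_j(\omega_z)$, $j=1,2$; (iii) $G_hw=G_hI_h^jw$ for $w\in C(\Omega)$, $I_h^1,I_h^2$ the linear and quadratic nodal interpolation operators. The constant $C$ may depend on $\Omega$, on the shape-regularity/quasi-uniformity constants and on those associated with $G_h$. *)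

theory Defs
  imports "HOL-Analysis.Analysis"
begin

section \<open>Square integrable functions, weak derivatives, Sobolev norms\<close>

definition l2_norm :: "'a::euclidean_space set \<Rightarrow> ('a \<Rightarrow> 'b::real_normed_vector) \<Rightarrow> real" where
  "l2_norm S u = sqrt (\<integral>x. (norm (u x))\<^sup>2 \<partial>lebesgue_on S)"

definition L2 :: "'a::euclidean_space set \<Rightarrow> ('a \<Rightarrow> complex) set" where
  "L2 S = {u \<in> borel_measurable (lebesgue_on S). integrable (lebesgue_on S) (\<lambda>x. (norm (u x))\<^sup>2)}"

text \<open>A list of basis vectors stands for an iterated partial derivative.\<close>

definition iterated_deriv ::
    "'a::euclidean_space list \<Rightarrow> ('a \<Rightarrow> 'b::real_normed_vector) \<Rightarrow> 'a \<Rightarrow> 'b" where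
  "iterated_deriv bs f = foldr (\<lambda>b f x. frechet_derivative f (at x) b) bs f"

text \<open>Differentiability of all iterated partial derivatives makes each of them
  continuous, so this is the class of infinitely differentiable functions.\<close>

definition smooth :: "('a::euclidean_space \<Rightarrow> 'b::real_normed_vector) \<Rightarrow> bool" where
  "smooth f \<longleftrightarrow> (\<forall>bs x. set bs \<subseteq> Basis \<longrightarrow> iterated_deriv bs f differentiable (at x))"

definition test_functions :: "'a::euclidean_space set \<Rightarrow> ('a \<Rightarrow> real) set" where
  "test_functions S = {\<phi>. smooth \<phi> \<and> compact (closure {x. \<phi> x \<noteq> 0}) \<and> closure {x. \<phi> x \<noteq> 0} \<subseteq> S}"

text \<open>Real test functions suffice for complex valued \<open>u\<close>, by linearity.\<close>

definition has_weak_deriv ::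
    "'a::euclidean_space set \<Rightarrow> 'a list \<Rightarrow> ('a \<Rightarrow> complex) \<Rightarrow> ('a \<Rightarrow> complex) \<Rightarrow> bool" where
  "has_weak_deriv S bs u v \<longleftrightarrow> u \<in> L2 S \<and> v \<in> L2 S \<and>
     (\<forall>\<phi>\<in>test_functions S.
        (\<integral>x. iterated_deriv bs \<phi> x *\<^sub>R u x \<partial>lebesgue_on S)
          = (- 1) ^ length bs * (\<integral>x. \<phi> x *\<^sub>R v x \<partial>lebesgue_on S))"

text \<open>Weak derivatives are unique up to null sets; one representative is chosen.\<close>

definition weak_deriv :: "'a::euclidean_space set \<Rightarrow> 'a list \<Rightarrow> ('a \<Rightarrow> complex) \<Rightarrow> 'a \<Rightarrow> complex" where
  "weak_deriv S bs u = (SOME v. has_weak_deriv S bs u v)"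

text \<open>The multi-index \<open>(a, b)\<close> in the plane.\<close>

definition dirs :: "nat \<Rightarrow> nat \<Rightarrow> (real^2) list" where
  "dirs a b = replicate a (axis 1 1) @ replicate b (axis 2 1)"

definition sobolev :: "nat \<Rightarrow> (real^2) set \<Rightarrow> (real^2 \<Rightarrow> complex) set" where
  "sobolev m \<Omega> = {u \<in> L2 \<Omega>. \<forall>a b. a + b \<le> m \<longrightarrow> (\<exists>v. has_weak_deriv \<Omega> (dirs a b) u v)}"

definition sobolev_norm :: "nat \<Rightarrow> (real^2) set \<Rightarrow> (real^2 \<Rightarrow> complex) \<Rightarrow> real" where
  "sobolev_norm m \<Omega> u =
     sqrt (\<Sum>(a, b)\<in>{(a, b). a + b \<le> m}. (l2_norm \<Omega> (weak_deriv \<Omega> (dirs a b) u))\<^sup>2)"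

definition weak_grad :: "(real^2) set \<Rightarrow> (real^2 \<Rightarrow> complex) \<Rightarrow> real^2 \<Rightarrow> complex^2" where
  "weak_grad \<Omega> u x = (\<chi> i. weak_deriv \<Omega> [axis i 1] u x)"

definition weak_laplacian :: "(real^2) set \<Rightarrow> (real^2 \<Rightarrow> complex) \<Rightarrow> real^2 \<Rightarrow> complex" where
  "weak_laplacian \<Omega> u x = weak_deriv \<Omega> (dirs 2 0) u x + weak_deriv \<Omega> (dirs 0 2) u x"


section \<open>Polygons and function spaces on their boundary\<close>

text \<open>A polygon is given by the cyclic list of its vertices.\<close>

definition edge_start :: "(real^2) list \<Rightarrow> nat \<Rightarrow> real^2" where
  "edge_start vs i = vs ! i"

definition edge_end :: "(real^2) list \<Rightarrow> nat \<Rightarrow> real^2" where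
  "edge_end vs i = vs ! (Suc i mod length vs)"

definition edge :: "(real^2) list \<Rightarrow> nat \<Rightarrow> (real^2) set" where
  "edge vs i = closed_segment (edge_start vs i) (edge_end vs i)"

text \<open>Two different edges meet exactly in their common end points, i.e. the closed chain is simple.\<close>

definition polygon :: "(real^2) list \<Rightarrow> (real^2) set \<Rightarrow> bool" where
  "polygon vs \<Omega> \<longleftrightarrow> 3 \<le> length vs \<and> distinct vs \<and>
     (\<forall>i<length vs. \<forall>j<length vs. i \<noteq> j \<longrightarrow>
        edge vs i \<inter> edge vs j
          = {edge_start vs i, edge_end vs i} \<inter> {edge_start vs j, edge_end vs j}) \<and>
     \<Omega> = inside (\<Union>i<length vs. edge vs i)"

text \<open>Near \<open>x\<close> the domain is a half disc with outer unit normal \<open>n\<close>. On the boundary of a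
  polygon such an \<open>n\<close> is unique, and exists except at the corners.\<close>

definition outward_normal :: "(real^2) set \<Rightarrow> real^2 \<Rightarrow> real^2 \<Rightarrow> bool" where
  "outward_normal \<Omega> x n \<longleftrightarrow> norm n = 1 \<and>
     (\<exists>r>0. \<Omega> \<inter> ball x r = {y \<in> ball x r. (y - x) \<bullet> n < 0})"

definition strictly_star_shaped :: "(real^2) set \<Rightarrow> real^2 \<Rightarrow> real \<Rightarrow> bool" where
  "strictly_star_shaped \<Omega> x\<^sub>\<Omega> c \<longleftrightarrow> x\<^sub>\<Omega> \<in> \<Omega> \<and> c > 0 \<and>
     (\<forall>x\<in>frontier \<Omega>. \<forall>n. outward_normal \<Omega> x n \<longrightarrow> (x - x\<^sub>\<Omega>) \<bullet> n \<ge> c)"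

text \<open>Arc length parametrisation of the edges; boundary norms and spaces are taken edge by edge.\<close>

definition edge_dom :: "(real^2) list \<Rightarrow> nat \<Rightarrow> real set" where
  "edge_dom vs i = {0<..<dist (edge_start vs i) (edge_end vs i)}"

definition edge_param :: "(real^2) list \<Rightarrow> nat \<Rightarrow> real \<Rightarrow> real^2" where
  "edge_param vs i s = edge_start vs i
     + (s / dist (edge_start vs i) (edge_end vs i)) *\<^sub>R (edge_end vs i - edge_start vs i)"

definition bdry_L2 :: "(real^2) list \<Rightarrow> (real^2 \<Rightarrow> complex) set" where
  "bdry_L2 vs = {g. \<forall>i<length vs. g \<circ> edge_param vs i \<in> L2 (edge_dom vs i)}"

definition bdry_l2_norm :: "(real^2) list \<Rightarrow> (real^2 \<Rightarrow> complex) \<Rightarrow> real" where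
  "bdry_l2_norm vs g = sqrt (\<Sum>i<length vs. (l2_norm (edge_dom vs i) (g \<circ> edge_param vs i))\<^sup>2)"

definition bdry_sobolev :: "nat \<Rightarrow> (real^2) list \<Rightarrow> (real^2 \<Rightarrow> complex) set" where
  "bdry_sobolev m vs = {g \<in> bdry_L2 vs. \<forall>i<length vs. \<forall>j\<le>m.
     \<exists>v. has_weak_deriv (edge_dom vs i) (replicate j 1) (g \<circ> edge_param vs i) v}"

definition bdry_seminorm :: "nat \<Rightarrow> (real^2) list \<Rightarrow> (real^2 \<Rightarrow> complex) \<Rightarrow> real" where
  "bdry_seminorm j vs g = sqrt (\<Sum>i<length vs.
     (l2_norm (edge_dom vs i)
        (weak_deriv (edge_dom vs i) (replicate j 1) (g \<circ> edge_param vs i)))\<^sup>2)"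

text \<open>The trace is the continuous extension of the restriction map from functions that are smooth
  up to the boundary, with respect to the norms of \<open>H\<^sup>1(\<Omega>)\<close> and \<open>L\<^sup>2(\<Gamma>)\<close>.\<close>

definition has_trace ::
    "(real^2) list \<Rightarrow> (real^2) set \<Rightarrow> (real^2 \<Rightarrow> complex) \<Rightarrow> (real^2 \<Rightarrow> complex) \<Rightarrow> bool" where
  "has_trace vs \<Omega> w t \<longleftrightarrow> w \<in> sobolev 1 \<Omega> \<and> t \<in> bdry_L2 vs \<and>
     (\<exists>\<phi> :: nat \<Rightarrow> real^2 \<Rightarrow> complex. (\<forall>n. smooth (\<phi> n)) \<and>
        (\<lambda>n. sobolev_norm 1 \<Omega> (\<lambda>x. \<phi> n x - w x)) \<longlonglongrightarrow> 0 \<and>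
        (\<lambda>n. bdry_l2_norm vs (\<lambda>x. \<phi> n x - t x)) \<longlonglongrightarrow> 0)"


section \<open>The Helmholtz problem\<close>

text \<open>As \<open>H\<^sup>3(\<Omega>)\<close> embeds into \<open>C(closure \<Omega>)\<close>, the solution is taken to be its continuous
  representative; so its point values at nodes and its boundary values make sense.\<close>

definition helmholtz_solution ::
    "(real^2) list \<Rightarrow> (real^2) set \<Rightarrow> real \<Rightarrow> (real^2 \<Rightarrow> complex) \<Rightarrow> (real^2 \<Rightarrow> complex)
       \<Rightarrow> (real^2 \<Rightarrow> complex) \<Rightarrow> bool" where
  "helmholtz_solution vs \<Omega> k f g u \<longleftrightarrow>
     u \<in> sobolev 3 \<Omega> \<and> continuous_on (closure \<Omega>) u \<and>
     (AE x in lebesgue_on \<Omega>. - weak_laplacian \<Omega> u x - of_real (k\<^sup>2) * u x = f x) \<and>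
     (\<exists>t :: real^2 \<Rightarrow> complex^2.
        (\<forall>j. has_trace vs \<Omega> (\<lambda>x. weak_grad \<Omega> u x $ j) (\<lambda>x. t x $ j)) \<and>
        (\<forall>i<length vs. AE s in lebesgue_on (edge_dom vs i).
           \<forall>n. outward_normal \<Omega> (edge_param vs i s) n \<longrightarrow>
             (\<Sum>j\<in>UNIV. of_real (n $ j) * t (edge_param vs i s) $ j)
               + \<i> * of_real k * u (edge_param vs i s) = g (edge_param vs i s)))"

definition C_ug ::
    "(real^2) list \<Rightarrow> (real^2) set \<Rightarrow> real \<Rightarrow> (real^2 \<Rightarrow> complex) \<Rightarrow> (real^2 \<Rightarrow> complex) \<Rightarrow> real" where
  "C_ug vs \<Omega> k u g =
     (\<Sum>j=1..3. sobolev_norm j \<Omega> u / k ^ (j - 1)) + (\<Sum>j=1..2. bdry_seminorm j vs g / k ^ j)"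


section \<open>Linear finite elements\<close>

definition P1 :: "(real^2 \<Rightarrow> 'b::real_vector) set" where
  "P1 = {\<lambda>x. c\<^sub>0 + x$1 *\<^sub>R c\<^sub>1 + x$2 *\<^sub>R c\<^sub>2 | c\<^sub>0 c\<^sub>1 c\<^sub>2. True}"

definition P2 :: "(real^2 \<Rightarrow> 'b::real_vector) set" where
  "P2 = {\<lambda>x. c\<^sub>0 + x$1 *\<^sub>R c\<^sub>1 + x$2 *\<^sub>R c\<^sub>2
            + (x$1)\<^sup>2 *\<^sub>R c\<^sub>3 + (x$1 * x$2) *\<^sub>R c\<^sub>4 + (x$2)\<^sup>2 *\<^sub>R c\<^sub>5
         | c\<^sub>0 c\<^sub>1 c\<^sub>2 c\<^sub>3 c\<^sub>4 c\<^sub>5. True}"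

definition mesh_size :: "(real^2) set set \<Rightarrow> real" where
  "mesh_size \<T> = Max (diameter ` \<T>)"

text \<open>Conformity is part of the library notion \<^const>\<open>triangulation\<close>; \<open>\<sigma>\<close> bounds the ratio of
  the diameter of a triangle and the radius of an inscribed disc, \<open>\<kappa>\<close> the ratio of the mesh size
  and the diameter of a triangle.\<close>

definition regular_mesh :: "real \<Rightarrow> real \<Rightarrow> (real^2) set \<Rightarrow> (real^2) set set \<Rightarrow> bool" where
  "regular_mesh \<sigma> \<kappa> \<Omega> \<T> \<longleftrightarrow>
     triangulation \<T> \<and> (\<forall>\<tau>\<in>\<T>. 2 simplex \<tau>) \<and> \<Union>\<T> = closure \<Omega> \<and>
     (\<forall>\<tau>\<in>\<T>. \<exists>x. \<exists>r>0. ball x r \<subseteq> \<tau> \<and> diameter \<tau> \<le> \<sigma> * r) \<and>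
     (\<forall>\<tau>\<in>\<T>. mesh_size \<T> \<le> \<kappa> * diameter \<tau>)"

definition nodes :: "(real^2) set set \<Rightarrow> (real^2) set" where
  "nodes \<T> = {z. \<exists>\<tau>\<in>\<T>. z extreme_point_of \<tau>}"

definition fe_space :: "(real^2) set \<Rightarrow> (real^2) set set \<Rightarrow> (real^2 \<Rightarrow> complex) set" where
  "fe_space \<Omega> \<T> = {v \<in> sobolev 1 \<Omega>. \<forall>\<tau>\<in>\<T>. \<exists>p\<in>P1. \<forall>x\<in>\<tau>. v x = p x}"

text \<open>On \<open>closure \<Omega>\<close> the choice is unique.\<close>

definition nodal_interp ::
    "(real^2) set \<Rightarrow> (real^2) set set \<Rightarrow> (real^2 \<Rightarrow> complex) \<Rightarrow> real^2 \<Rightarrow> complex" where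
  "nodal_interp \<Omega> \<T> w = (SOME v. v \<in> fe_space \<Omega> \<T> \<and> (\<forall>z\<in>nodes \<T>. v z = w z))"


section \<open>Polynomial preserving recovery\<close>

text \<open>\<open>N z\<close> is the set of sampling nodes of \<open>z\<close>, \<open>\<P>\<close> the set of elements that make up the patch of
  \<open>z\<close>. Connectedness expresses that the patch consists of elements around \<open>z\<close>.\<close>

definition ppr_sampling :: "nat \<Rightarrow> (real^2) set set \<Rightarrow> (real^2 \<Rightarrow> (real^2) set) \<Rightarrow> bool" where
  "ppr_sampling M \<T> N \<longleftrightarrow> (\<forall>z\<in>nodes \<T>.
     z \<in> N z \<and> N z \<subseteq> nodes \<T> \<and> 6 \<le> card (N z) \<and>
     \<not> (\<exists>q :: real^2 \<Rightarrow> real. q \<in> P2 \<and> q \<noteq> (\<lambda>x. 0) \<and> (\<forall>y\<in>N z. q y = 0)) \<and>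
     (\<exists>\<P>\<subseteq>\<T>. card \<P> \<le> M \<and> connected (\<Union>\<P>) \<and> z \<in> \<Union>\<P> \<and> N z \<subseteq> \<Union>\<P>))"

definition ls_fit :: "(real^2) set \<Rightarrow> (real^2 \<Rightarrow> complex) \<Rightarrow> real^2 \<Rightarrow> complex" where
  "ls_fit Y w = arg_min_on (\<lambda>q. \<Sum>y\<in>Y. (norm (q y - w y))\<^sup>2) P2"

definition ppr ::
    "(real^2) set \<Rightarrow> (real^2) set set \<Rightarrow> (real^2 \<Rightarrow> (real^2) set)
       \<Rightarrow> (real^2 \<Rightarrow> complex) \<Rightarrow> real^2 \<Rightarrow> complex^2" where
  "ppr \<Omega> \<T> N w x =
     (\<chi> i. nodal_interp \<Omega> \<T> (\<lambda>z. frechet_derivative (ls_fit (N z) w) (at z) (axis i 1)) x)"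

text \<open>The \<open>L\<^sup>2\<close> stability of the recovery operator on the finite element space.\<close>

definition ppr_bounded ::
    "real \<Rightarrow> (real^2) set \<Rightarrow> (real^2) set set \<Rightarrow> (real^2 \<Rightarrow> (real^2) set) \<Rightarrow> bool" where
  "ppr_bounded B \<Omega> \<T> N \<longleftrightarrow>
     (\<forall>v\<in>fe_space \<Omega> \<T>. l2_norm \<Omega> (ppr \<Omega> \<T> N v) \<le> B * l2_norm \<Omega> (weak_grad \<Omega> v))"

end

theory Submission
  imports Defs "HOL-Real_Asymp.Real_Asymp"
begin

text \<open>As \<open>k\<close> is bounded below and \<open>C_ug\<close> contains \<open>k\<^sup>-\<^sup>2\<parallel>u\<parallel>\<^sub>3\<close>, it suffices to bound the error by \<open>C h\<^sup>2 \<parallel>u\<parallel>\<^sub>3\<close>.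

  Strict star-shapedness makes \<open>\<Omega>\<close> star-shaped with respect to every point of the disc of radius \<open>c\<^sub>\<Omega>\<close>
  around \<open>x\<^sub>\<Omega>\<close>. Hence for a point \<open>a\<close> of the domain and small \<open>\<rho>\<close>, the patch \<open>\<Omega> \<inter> ball a \<rho>\<close> lies in a part
  of \<open>\<Omega>\<close> of diameter \<open>O(\<rho>)\<close> that is star-shaped with respect to a disc of radius of order \<open>\<rho>\<close>. Expanding
  mollifications of \<open>u\<close> at a suitable point of that disc, found by averaging over it, shows that an
  explicit quadratic interpolant \<open>q\<close> satisfies \<open>\<bar>u - q\<bar> \<le> C \<rho>\<^sup>2 E\<close> and \<open>\<bar>\<nabla>u - \<nabla>q\<bar> \<le> C \<rho> E\<close> on the patch, where
  \<open>E\<close> is the \<open>L\<^sup>2\<close> norm of the third derivatives near the patch.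

  On the side of the recovery, \<open>L\<^sup>2\<close> stability applied to the nodal interpolant of the values at the
  sampling nodes of \<open>z\<close>, extended by zero, bounds the recovered gradient at \<open>z\<close> by \<open>C / h\<close> times the
  maximum of those values. As quadratics are reproduced, replacing \<open>u\<close> by \<open>u - q\<close> gives an error of
  order \<open>h E\<close> at every point of a triangle. Disjointness of the inscribed discs bounds the overlap of the
  patches and the area of each triangle contributes the second factor \<open>h\<close>.\<close>

section \<open>Smooth bump and step functions\<close>

text \<open>The estimates compare a maximum over a patch with an \<open>L\<^sup>2\<close> norm of
  third derivatives. In the plane this just works: the remainder of the gradient carries the weight
  \<open>1 - t\<close>, whose square is the Jacobian of \<open>y \<mapsto> y + t (x - y)\<close>, so
  integrating over the centre \<open>y\<close> makes up for the loss near the end point. The centre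
  found by averaging, and with it the Taylor polynomial, changes with the mollification parameter.
  The polynomial \<open>q\<close> therefore interpolates point values of \<open>u\<close> on a fixed
  grid and survives the limit. Mollification is harmless only away from the boundary, so compact
  subsets of the patch are treated, with bounds independent of the subset. In the limit values
  converge uniformly, while gradients are compared by testing, since weak derivatives are known only
  through integrals. Test functions are tensor products, for which iterated derivatives can be
  computed. Star-shapedness is given through normals only; the Jordan curve theorem is needed to
  know that the domain lies on exactly one side of an edge.\<close>

definition flat_exp :: "real poly \<Rightarrow> real \<Rightarrow> real" where
  "flat_exp p x = (if x > 0 then poly p (1/x) * exp (- 1/x) else 0)"

lemma flat_exp_tendsto: "((\<lambda>x. poly p (1/x) * exp (- 1/x)) \<longlongrightarrow> (0::real)) (at_right 0)"
proof -
  have "((\<lambda>t. poly p t * exp (- t)) \<longlongrightarrow> (0::real)) at_top"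
  proof -
    have "((\<lambda>t. \<Sum>i\<le>degree p. coeff p i * (t ^ i * exp (- t))) \<longlongrightarrow> (\<Sum>i\<le>degree p. coeff p i * 0)) (at_top::real filter)"
      by (intro tendsto_sum tendsto_mult tendsto_const) real_asymp
    then show ?thesis by (simp add: poly_altdef sum_distrib_right mult.assoc)
  qed
  moreover have "filterlim (\<lambda>x::real. 1/x) at_top (at_right 0)" by real_asymp
  ultimately show ?thesis by (auto dest: filterlim_compose)
qed

text \<open>For \<open>x > 0\<close> the derivative of \<open>p(1/x) exp(-1/x)\<close> is
  \<open>(p - p')(1/x) exp(-1/x) / x\<^sup>2\<close>, and \<open>1/x\<^sup>2\<close> is the
  polynomial \<open>[:0,0,1:]\<close> evaluated at \<open>1/x\<close>. Admitting arbitrary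
  polynomial prefactors is what closes the class under differentiation.\<close>

lemma flat_exp_deriv:
  "(flat_exp p has_real_derivative flat_exp ([:0,0,1:] * (p - pderiv p)) x) (at x)"
proof -
  consider "x > 0" | "x < 0" | "x = 0" by linarith
  then show ?thesis
  proof cases
    case 1
    have "((\<lambda>x. poly p (1/x) * exp (- 1/x)) has_real_derivative
        flat_exp ([:0,0,1:] * (p - pderiv p)) x) (at x)"
      using 1 by (auto intro!: derivative_eq_intros DERIV_chain2[OF poly_DERIV]
        simp: flat_exp_def field_simps power2_eq_square)
    then show ?thesis
      by (rule has_field_derivative_transform_within_open[where S="{0<..}"])
        (use 1 in \<open>auto simp: flat_exp_def\<close>)
  next
    case 2
    have "((\<lambda>x. 0) has_real_derivative flat_exp ([:0,0,1:] * (p - pderiv p)) x) (at x)"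
      using 2 by (auto simp: flat_exp_def)
    then show ?thesis
      by (rule has_field_derivative_transform_within_open[where S="{..<0}"])
        (use 2 in \<open>auto simp: flat_exp_def\<close>)
  next
    case 3
    \<comment> \<open>The quotient by \<open>h\<close> has the same form with the polynomial
      \<open>[:0,1:] * p\<close>, so the limit at zero known for the whole class applies.\<close>
    have "((\<lambda>h. flat_exp p h / h) \<longlongrightarrow> 0) (at_right 0)"
    proof (rule Lim_transform_eventually[OF flat_exp_tendsto[of "[:0,1:] * p"]])
      show "\<forall>\<^sub>F x in at_right 0. poly ([:0, 1:] * p) (1 / x) * exp (- 1 / x) = flat_exp p x / x"
        using eventually_at_right_less[of "0::real"]
        by eventually_elim (auto simp: flat_exp_def)
    qed
    moreover have "((\<lambda>h. flat_exp p h / h) \<longlongrightarrow> 0) (at_left 0)"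
    proof (rule Lim_transform_eventually[OF tendsto_const])
      show "\<forall>\<^sub>F x in at_left 0. 0 = flat_exp p x / x"
        using eventually_at_left_real[of "-1" 0] by (auto elim!: eventually_mono simp: flat_exp_def)
    qed
    ultimately have "((\<lambda>h. flat_exp p h / h) \<longlongrightarrow> 0) (at 0)"
      by (simp add: filterlim_split_at)
    then show ?thesis
      using 3 by (simp add: has_field_derivative_iff) (simp add: flat_exp_def)
  qed
qed

text \<open>The bump function is \<open>flat_exp 1 (1 + x) * flat_exp 1 (1 - x)\<close>; this class contains it and is
  closed under differentiation.\<close>

inductive_set bump_class :: "(real \<Rightarrow> real) set" where
  prod: "(\<lambda>x. flat_exp p (1 + x) * flat_exp q (1 - x)) \<in> bump_class"
| add: "f \<in> bump_class \<Longrightarrow> g \<in> bump_class \<Longrightarrow> (\<lambda>x. f x + g x) \<in> bump_class"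

lemma bump_class_deriv:
  "f \<in> bump_class \<Longrightarrow> \<exists>g\<in>bump_class. \<forall>x. (f has_real_derivative g x) (at x)"
proof (induction rule: bump_class.induct)
  case (prod p q)
  define D :: "real poly \<Rightarrow> real poly" where "D p = [:0,0,1:] * (p - pderiv p)" for p
  have fe: "(flat_exp p has_real_derivative flat_exp (D p) x) (at x)" for p x
    unfolding D_def by (rule flat_exp_deriv)
  have neg: "flat_exp (- q) x = - flat_exp q x" for q x by (simp add: flat_exp_def)
  \<comment> \<open>The sign produced by \<open>1 - x\<close> goes into the polynomial as
    \<open>- D q\<close>, since the class has no rule for scalar factors.\<close>
  let ?g = "\<lambda>x. flat_exp (D p) (1 + x) * flat_exp q (1 - x) + flat_exp p (1 + x) * flat_exp (- D q) (1 - x)"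
  have "?g \<in> bump_class" by (intro bump_class.intros)
  moreover have "((\<lambda>x. flat_exp p (1 + x) * flat_exp q (1 - x)) has_real_derivative ?g x) (at x)" for x
    by (auto intro!: derivative_eq_intros DERIV_chain2[OF fe] simp: neg)
  ultimately show ?case by (intro bexI[of _ ?g] allI)
next
  case (add f g)
  then obtain f' g' where "f' \<in> bump_class" "g' \<in> bump_class"
    "\<forall>x. (f has_real_derivative f' x) (at x)" "\<forall>x. (g has_real_derivative g' x) (at x)" by blast
  then show ?case
    by (intro bexI[of _ "\<lambda>x. f' x + g' x"]) (auto intro: bump_class.add DERIV_add)
qed

lemma bump_class_support: "f \<in> bump_class \<Longrightarrow> \<bar>x\<bar> \<ge> 1 \<Longrightarrow> f x = 0"
  by (induction rule: bump_class.induct) (auto simp: flat_exp_def)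

text \<open>A choice of derivative inside \<open>bump_class\<close>, iterated from the basic bump,
  yields the function together with all its derivatives; dividing by the positive integral of the
  basic bump normalises the mass. The explicit sequence spares any reasoning about iterated
  derivative operators on the line.\<close>

lemma smooth_bump_exists:
  "\<exists>\<beta> :: nat \<Rightarrow> real \<Rightarrow> real. (\<forall>n x. (\<beta> n has_real_derivative \<beta> (Suc n) x) (at x)) \<and>
     (\<forall>n x. \<bar>x\<bar> \<ge> 1 \<longrightarrow> \<beta> n x = 0) \<and> (\<forall>x. \<beta> 0 x \<ge> 0) \<and> (\<beta> 0 has_integral 1) {-1..1}"
proof -
  define f0 where "f0 x = flat_exp 1 (1 + x) * flat_exp 1 (1 - x)" for x
  have f0: "f0 \<in> bump_class" unfolding f0_def by (rule bump_class.prod)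
  define d where "d f = (SOME g. g \<in> bump_class \<and> (\<forall>x. (f has_real_derivative g x) (at x)))" for f :: "real \<Rightarrow> real"
  have d: "d f \<in> bump_class \<and> (\<forall>x. (f has_real_derivative d f x) (at x))" if f: "f \<in> bump_class" for f
  proof -
    obtain g where "g \<in> bump_class \<and> (\<forall>x. (f has_real_derivative g x) (at x))"
      using bump_class_deriv[OF f] by blast
    then show ?thesis unfolding d_def
      by (rule someI[where P="\<lambda>g. g \<in> bump_class \<and> (\<forall>x. (f has_real_derivative g x) (at x))"])
  qed
  define F where "F n = (d ^^ n) f0" for n
  have F: "F n \<in> bump_class" for n by (induction n) (auto simp: F_def f0 d)
  have F': "(F n has_real_derivative F (Suc n) x) (at x)" for n x
    using d[OF F[of n]] by (simp add: F_def)
  have cont: "continuous_on S f0" for S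
    using F'[of 0] unfolding F_def by (intro DERIV_continuous_on) (auto intro: has_field_derivative_at_within)
  have nn: "f0 x \<ge> 0" for x by (simp add: f0_def flat_exp_def)
  have int: "f0 integrable_on {-1..1}" by (intro integrable_continuous_real cont)
  have "integral {-1..1} f0 \<noteq> 0"
  proof
    assume "integral {-1..1} f0 = 0"
    then have "(f0 has_integral 0) (cbox (-1) 1)" using int by (metis integrable_integral cbox_interval)
    then have "f0 0 = 0"
      by (intro has_integral_0_cbox_imp_0[OF _ _ _ , of "-1" 1 f0]) (auto intro!: cont nn)
    then show False by (simp add: f0_def flat_exp_def)
  qed
  moreover have "integral {-1..1} f0 \<ge> 0" by (intro integral_nonneg int) (auto simp: nn)
  ultimately have pos: "integral {-1..1} f0 > 0" by simp
  define I where "I = integral {-1..1} f0"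
  have "((\<lambda>x. f0 x / I) has_integral I / I) {-1..1}"
    unfolding I_def by (intro has_integral_divide integrable_integral int)
  with pos have "((\<lambda>x. F 0 x / I) has_integral 1) {-1..1}" by (simp add: F_def I_def)
  moreover have "((\<lambda>x. F n x / I) has_real_derivative F (Suc n) x / I) (at x)" for n x
    by (intro DERIV_cdivide F')
  moreover have "F n x / I = 0" if "\<bar>x\<bar> \<ge> 1" for n x using bump_class_support[OF F that] by simp
  moreover have "F 0 x / I \<ge> 0" for x using nn pos by (simp add: F_def I_def)
  ultimately show ?thesis by (intro exI[of _ "\<lambda>n x. F n x / I"]) auto
qed

definition bump :: "nat \<Rightarrow> real \<Rightarrow> real" where
  "bump = (SOME \<beta>. (\<forall>n x. (\<beta> n has_real_derivative \<beta> (Suc n) x) (at x)) \<and>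
     (\<forall>n x. \<bar>x\<bar> \<ge> 1 \<longrightarrow> \<beta> n x = 0) \<and> (\<forall>x. \<beta> 0 x \<ge> 0) \<and> (\<beta> 0 has_integral 1) {-1..1})"

lemma bump_deriv: "(bump n has_real_derivative bump (Suc n) x) (at x)"
  and bump_support: "\<bar>x\<bar> \<ge> 1 \<Longrightarrow> bump n x = 0"
  and bump_nonneg: "bump 0 x \<ge> 0"
  and bump_has_integral: "(bump 0 has_integral 1) {-1..1}"
  using someI_ex[OF smooth_bump_exists] unfolding bump_def[symmetric] by blast+

lemma bump_continuous: "continuous_on S (bump n)"
  using bump_deriv by (intro DERIV_continuous_on) (auto intro: has_field_derivative_at_within)

lemma bump_bounded: "\<exists>K. \<forall>x. \<bar>bump n x\<bar> \<le> K"
proof -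
  have "compact (bump n ` {-1..1})" by (intro compact_continuous_image bump_continuous) auto
  then obtain K where K: "\<And>x. x \<in> {-1..1} \<Longrightarrow> \<bar>bump n x\<bar> \<le> K"
    by (metis bounded_iff compact_imp_bounded image_eqI real_norm_def)
  have "\<bar>bump n x\<bar> \<le> \<bar>K\<bar>" for x
    using K[of x] bump_support[of x n] by (cases "\<bar>x\<bar> \<ge> 1") fastforce+
  then show ?thesis by blast
qed

text \<open>A smooth Heaviside function: the primitive of the bump, rising from 0 to 1 between -1
  and 1. For \<open>x < -1\<close> the interval of integration is empty, so the value 0 comes out
  without a case distinction.\<close>

definition step :: "nat \<Rightarrow> real \<Rightarrow> real" where
  "step n = (case n of 0 \<Rightarrow> (\<lambda>x. integral {-1..x} (bump 0)) | Suc m \<Rightarrow> bump m)"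

lemma step_0: "x \<le> -1 \<Longrightarrow> step 0 x = 0"
  by (cases "x = -1") (auto simp: step_def)

lemma step_1: "x \<ge> 1 \<Longrightarrow> step 0 x = 1"
proof -
  assume x: "x \<ge> 1"
  have "integral {-1..x} (bump 0) = integral {-1..1} (bump 0) + integral {1..x} (bump 0)"
    by (rule Henstock_Kurzweil_Integration.integral_combine[symmetric])
      (use x in \<open>auto intro!: integrable_continuous_real bump_continuous\<close>)
  also have "integral {1..x} (bump 0) = integral {1..x} (\<lambda>_. 0)"
    by (intro Henstock_Kurzweil_Integration.integral_cong) (auto simp: bump_support)
  finally show ?thesis using bump_has_integral by (simp add: step_def integral_unique)
qed

lemma step_mono: "x \<le> y \<Longrightarrow> step 0 x \<le> step 0 y"
  unfolding step_def
  by (auto intro!: integral_subset_le integrable_continuous_real bump_continuous simp: bump_nonneg)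

lemma step_deriv: "(step n has_real_derivative step (Suc n) x) (at x)"
proof (cases n)
  case (Suc m) then show ?thesis using bump_deriv by (simp add: step_def)
next
  case 0
  show ?thesis
  proof (cases "x < -1")
    case True
    have "((\<lambda>x. 0) has_real_derivative step (Suc n) x) (at x)"
      using True 0 by (simp add: step_def bump_support)
    then show ?thesis unfolding 0
      by (rule has_field_derivative_transform_within_open[where S="{..<-1}"])
        (use True in \<open>auto simp: step_0\<close>)
  next
    case False
    \<comment> \<open>The lower limit -2 makes every \<open>x \<ge> -1\<close> an interior point of
      the interval, so the derivative of the integral is two-sided.\<close>
    have "((\<lambda>u. integral {-2..u} (bump 0)) has_real_derivative bump 0 x) (at x within {-2..x+1})"
      using False by (intro integral_has_real_derivative bump_continuous) auto
    then have "((\<lambda>u. integral {-2..u} (bump 0)) has_real_derivative bump 0 x) (at x)"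
      using False by (subst (asm) at_within_interior) auto
    moreover have "integral {-2..u} (bump 0) = step 0 u" if "u > -2" for u
    proof (cases "u \<ge> -1")
      case True
      have "integral {-2..u} (bump 0) = integral {-2..-1} (bump 0) + integral {-1..u} (bump 0)"
        by (rule Henstock_Kurzweil_Integration.integral_combine[symmetric])
          (use True in \<open>auto intro!: integrable_continuous_real bump_continuous\<close>)
      also have "integral {-2..-1} (bump 0) = integral {-2..-1::real} (\<lambda>_. 0)"
        by (intro Henstock_Kurzweil_Integration.integral_cong) (auto simp: bump_support)
      finally show ?thesis by (simp add: step_def)
    next
      case False
      have "integral {-2..u} (bump 0) = integral {-2..u} (\<lambda>_. 0)"
        using False by (intro Henstock_Kurzweil_Integration.integral_cong) (auto simp: bump_support)
      then show ?thesis using False by (simp add: step_0)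
    qed
    ultimately have "(step 0 has_real_derivative bump 0 x) (at x)"
      using False by (intro has_field_derivative_transform_within_open[where S="{-2<..}" and g="step 0"
          and f="\<lambda>u. integral {-2..u} (bump 0)"]) auto
    then show ?thesis unfolding 0 by (simp add: step_def)
  qed
qed

text \<open>A smooth function of one variable is carried along with all its derivatives,
  \<open>A n\<close> being the derivative of order \<open>n\<close> of \<open>A 0\<close>.\<close>

definition deriv_family :: "(nat \<Rightarrow> real \<Rightarrow> real) \<Rightarrow> bool" where
  "deriv_family A \<longleftrightarrow> (\<forall>n x. (A n has_real_derivative A (Suc n) x) (at x))"

lemma deriv_family_affine:
  assumes "deriv_family A"
  shows "deriv_family (\<lambda>n t. c * m ^ n * A n (m * t + b))"
  unfolding deriv_family_def
proof (intro allI)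
  fix n x
  have A: "(A n has_real_derivative A (Suc n) x) (at x)" for x
    using assms by (simp add: deriv_family_def)
  show "((\<lambda>t. c * m ^ n * A n (m * t + b)) has_real_derivative c * m ^ Suc n * A (Suc n) (m * x + b)) (at x)"
    by (auto intro!: derivative_eq_intros DERIV_chain2[OF A])
qed

lemma deriv_family_diff:
  "deriv_family A \<Longrightarrow> deriv_family B \<Longrightarrow> deriv_family (\<lambda>n t. A n t - B n t)"
  by (auto simp: deriv_family_def intro!: DERIV_diff)

lemma deriv_family_bump: "deriv_family bump"
  by (simp add: deriv_family_def bump_deriv)

lemma deriv_family_step: "deriv_family step"
  by (simp add: deriv_family_def step_deriv)

lemma deriv_family_continuous:
  assumes "deriv_family A" shows "continuous_on S (A n)"
  using assms unfolding deriv_family_def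
  by (intro DERIV_continuous_on) (auto intro: has_field_derivative_at_within)

section \<open>Test functions in the plane\<close>

text \<open>The partial derivative of order \<open>(i, j)\<close> of the product
  \<open>A 0 (x$1) * B 0 (x$2)\<close>. Products of this kind suffice as test functions and as
  mollifiers.\<close>

definition tensor :: "(nat \<Rightarrow> real \<Rightarrow> real) \<Rightarrow> (nat \<Rightarrow> real \<Rightarrow> real) \<Rightarrow> nat \<Rightarrow> nat \<Rightarrow> real^2 \<Rightarrow> real" where
  "tensor A B i j x = A i (x$1) * B j (x$2)"

lemma tensor_has_derivative:
  assumes "deriv_family A" "deriv_family B"
  shows "(tensor A B i j has_derivative
     (\<lambda>h. h$1 * tensor A B (Suc i) j x + h$2 * tensor A B i (Suc j) x)) (at x)"
proof -
  have A: "(A i has_derivative (\<lambda>h. A (Suc i) t * h)) (at t)"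
   and B: "(B j has_derivative (\<lambda>h. B (Suc j) t * h)) (at t)" for t
    using assms by (simp_all add: deriv_family_def has_field_derivative_def)
  have 1: "((\<lambda>x::real^2. A i (x$1)) has_derivative (\<lambda>h. A (Suc i) (x$1) * h$1)) (at x)"
    by (rule has_derivative_compose[OF _ A]) (auto intro!: derivative_eq_intros bounded_linear_imp_has_derivative)
  have 2: "((\<lambda>x::real^2. B j (x$2)) has_derivative (\<lambda>h. B (Suc j) (x$2) * h$2)) (at x)"
    by (rule has_derivative_compose[OF _ B]) (auto intro!: derivative_eq_intros bounded_linear_imp_has_derivative)
  show ?thesis
    using has_derivative_mult[OF 1 2] unfolding tensor_def
    by (rule has_derivative_eq_rhs) (auto simp: algebra_simps)
qed

lemma Basis_real2: "Basis = {axis 1 1, axis 2 1 :: real^2}"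
  by (auto simp: Basis_vec_def UNIV_2)

lemma axis_real2 [simp]:
  "(axis 1 1 :: real^2) $ 1 = 1" "(axis 1 1 :: real^2) $ 2 = 0" "(axis 2 1 :: real^2) $ 1 = 0"
  "(axis 2 1 :: real^2) $ 2 = 1" "axis 1 1 \<noteq> (axis 2 1 :: real^2)" "axis 2 1 \<noteq> (axis 1 1 :: real^2)"
  by (auto simp: axis_def vec_eq_iff)

text \<open>By their explicit form the partial derivatives of such products commute, so only the
  number of occurrences of each axis in the list matters. This is the bridge from
  \<open>iterated_deriv\<close>, on which weak derivatives are based, to formulas.\<close>

lemma iterated_deriv_tensor:
  assumes "deriv_family A" "deriv_family B" "set bs \<subseteq> Basis"
  shows "iterated_deriv bs (tensor A B i j) =
     tensor A B (i + count_list bs (axis 1 1)) (j + count_list bs (axis 2 1))"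
  using assms(3)
proof (induction bs)
  case Nil show ?case by (simp add: iterated_deriv_def)
next
  case (Cons b bs)
  let ?i = "i + count_list bs (axis 1 1)" and ?j = "j + count_list bs (axis 2 1)"
  have "iterated_deriv (b # bs) (tensor A B i j) = (\<lambda>x. frechet_derivative (tensor A B ?i ?j) (at x) b)"
    using Cons by (simp add: iterated_deriv_def)
  also have "\<dots> = (\<lambda>x. b$1 * tensor A B (Suc ?i) ?j x + b$2 * tensor A B ?i (Suc ?j) x)"
    by (simp add: frechet_derivative_at[OF tensor_has_derivative[OF assms(1,2)], symmetric])
  finally show ?case using Cons.prems by (auto simp: Basis_real2)
qed

lemma iterated_deriv_dirs_tensor:
  assumes "deriv_family A" "deriv_family B"
  shows "iterated_deriv (dirs a b) (tensor A B 0 0) = tensor A B a b"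
proof -
  have c: "count_list (replicate n x) y = (if x = y then n else 0)" for n and x y :: "real^2"
    by (induction n) auto
  have "set (dirs a b) \<subseteq> Basis" by (auto simp: dirs_def Basis_real2)
  then show ?thesis using iterated_deriv_tensor[OF assms, of "dirs a b" 0 0]
    by (simp add: dirs_def c)
qed

lemma smooth_tensor:
  assumes "deriv_family A" "deriv_family B" shows "smooth (tensor A B i j)"
  unfolding smooth_def iterated_deriv_tensor[OF assms]
  by (auto simp: iterated_deriv_tensor[OF assms] differentiable_def intro: tensor_has_derivative[OF assms])

lemma tensor_test_function:
  assumes "deriv_family A" "deriv_family B"
    and "\<And>t. t \<notin> {a$1..b$1} \<Longrightarrow> A 0 t = 0" "\<And>t. t \<notin> {a$2..b$2} \<Longrightarrow> B 0 t = 0"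
    and "cbox a b \<subseteq> S"
  shows "tensor A B 0 0 \<in> test_functions S"
proof -
  have "{x. tensor A B 0 0 x \<noteq> 0} \<subseteq> cbox a b"
    using assms(3,4) by (force simp: tensor_def mem_box_cart forall_2)
  then have "closure {x. tensor A B 0 0 x \<noteq> 0} \<subseteq> cbox a b"
    by (intro closure_minimal closed_cbox)
  moreover from this have "compact (closure {x. tensor A B 0 0 x \<noteq> 0})"
    by (meson bounded_cbox bounded_subset closed_closure compact_eq_bounded_closed)
  ultimately show ?thesis using assms(5) smooth_tensor[OF assms(1,2)] by (auto simp: test_functions_def)
qed

text \<open>For large \<open>m\<close> this difference of two steps rises on
  \<open>[a, a + 2/m]\<close> and falls on \<open>[b - 2/m, b]\<close>; it tends to the indicator of
  the open interval. The condition \<open>m * (b - a) \<ge> 2\<close> in the lemmas about it ensures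
  that the subtracted step never exceeds the other one. The factors \<open>1 *\<close> fit the shape
  of \<open>deriv_family_affine\<close>.\<close>

definition box_family :: "real \<Rightarrow> real \<Rightarrow> real \<Rightarrow> nat \<Rightarrow> real \<Rightarrow> real" where
  "box_family a b m n t = 1 * m ^ n * step n (m * t + (- m * a - 1)) - 1 * m ^ n * step n (m * t + (1 - m * b))"

lemma deriv_family_box: "deriv_family (box_family a b m)"
  unfolding box_family_def[abs_def]
  by (intro deriv_family_diff deriv_family_affine deriv_family_step)

lemma box_family_0: "box_family a b m 0 t = step 0 (m * (t - a) - 1) - step 0 (m * (t - b) + 1)"
  by (simp add: box_family_def algebra_simps)

lemma step_bounds: "0 \<le> step 0 x" "step 0 x \<le> 1"
  using step_mono[of "min x (-1)" x] step_mono[of x "max x 1"] by (auto simp: step_0 step_1)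

lemma box_family_bounds:
  assumes "m * (b - a) \<ge> 2" shows "0 \<le> box_family a b m 0 t" "box_family a b m 0 t \<le> 1"
  using step_mono[of "m * (t - b) + 1" "m * (t - a) - 1"] step_bounds[of "m * (t - b) + 1"]
    step_bounds[of "m * (t - a) - 1"] assms
  by (auto simp: box_family_0 algebra_simps)

lemma box_family_support:
  assumes "m * (b - a) \<ge> 2" "t \<notin> {a<..<b}" "a < b"
  shows "box_family a b m 0 t = 0"
proof -
  have m: "m > 0" using assms by (smt (verit) mult_nonpos_nonneg)
  show ?thesis
  proof (cases "t \<le> a")
    case True
    then have "m * (t - a) \<le> 0" using m by (auto intro: mult_nonneg_nonpos)
    then have "m * (t - a) - 1 \<le> -1" "m * (t - b) + 1 \<le> -1" using assms by (auto simp: algebra_simps)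
    then show ?thesis by (simp add: box_family_0 step_0)
  next
    case False
    then have "m * (t - b) \<ge> 0" using assms m by auto
    then have "m * (t - a) - 1 \<ge> 1" "m * (t - b) + 1 \<ge> 1" using assms by (auto simp: algebra_simps)
    then show ?thesis by (simp add: box_family_0 step_1)
  qed
qed

lemma box_family_tendsto:
  assumes "a < t" "t < b" shows "eventually (\<lambda>m. box_family a b m 0 t = 1) at_top"
proof -
  define M where "M = max (2 / (t - a)) (2 / (b - t))"
  have "box_family a b m 0 t = 1" if "m \<ge> M" for m
  proof -
    have "m \<ge> 2 / (t - a)" "m \<ge> 2 / (b - t)" using that by (auto simp: M_def)
    then have "m * (t - a) - 1 \<ge> 1" "m * (t - b) + 1 \<le> -1" using assms by (auto simp: field_simps)
    then show ?thesis by (simp add: box_family_0 step_0 step_1)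
  qed
  then show ?thesis by (auto simp: eventually_at_top_linorder)
qed

text \<open>Tensor products of \<open>box_family\<close> functions converge to the indicator of the
  open box while staying below it, so the assumed inequality passes to the limit by dominated
  convergence with the majorant \<open>\<bar>w\<bar>\<close>.\<close>

lemma test_function_bound_box:
  fixes w :: "real^2 \<Rightarrow> real"
  assumes X: "open X" and w: "integrable (lebesgue_on X) w"
    and bound: "\<And>\<phi>. \<phi> \<in> test_functions X \<Longrightarrow> (\<And>x. 0 \<le> \<phi> x) \<Longrightarrow>
      (\<integral>x. \<phi> x * w x \<partial>lebesgue_on X) \<le> K * (\<integral>x. \<phi> x \<partial>lebesgue_on X)"
    and sub: "cbox a b \<subseteq> X" and ab: "a$1 < b$1" "a$2 < b$2"
  shows "(\<integral>x. indicator (box a b) x * w x \<partial>lebesgue_on X) \<le> K * measure lebesgue (box a b)"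
proof -
  define \<psi> where "\<psi> m = tensor (box_family (a$1) (b$1) (real m)) (box_family (a$2) (b$2) (real m)) 0 0" for m
  \<comment> \<open>From this threshold on both factors satisfy the condition
    \<open>m * (b - a) \<ge> 2\<close> of the \<open>box_family\<close> lemmas.\<close>
  define M where "M = max (2 / (b$1 - a$1)) (2 / (b$2 - a$2))"
  obtain M0 :: nat where M0: "real M0 \<ge> M" using real_arch_simple by blast
  have large: "real m * (b$1 - a$1) \<ge> 2" "real m * (b$2 - a$2) \<ge> 2" if "m \<ge> M0" for m
  proof -
    have "real m \<ge> 2 / (b$1 - a$1)" "real m \<ge> 2 / (b$2 - a$2)" using that M0 by (auto simp: M_def)
    then show "real m * (b$1 - a$1) \<ge> 2" "real m * (b$2 - a$2) \<ge> 2" using ab by (auto simp: field_simps)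
  qed
  have test: "\<psi> m \<in> test_functions X" if "m \<ge> M0" for m
    unfolding \<psi>_def
    by (rule tensor_test_function[OF deriv_family_box deriv_family_box _ _ sub])
      (auto intro!: box_family_support large[OF that] ab)
  have pos: "0 \<le> \<psi> m x" "\<psi> m x \<le> indicator (box a b) x" if "m \<ge> M0" for m x
  proof -
    show "0 \<le> \<psi> m x" unfolding \<psi>_def tensor_def
      by (intro mult_nonneg_nonneg box_family_bounds large that)
    have "box_family (a$i) (b$i) m 0 (x$i) \<le> indicator {a$i<..<b$i} (x$i)"
         "0 \<le> box_family (a$i) (b$i) m 0 (x$i)" for i
      using box_family_bounds[of m "b$i" "a$i" "x$i"] box_family_support[of m "b$i" "a$i" "x$i"]
        large[OF that] ab exhaust_2[of i] by (auto simp: indicator_def)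
    from mult_mono[OF this(1)[of 1] this(1)[of 2] _ this(2)]
    have "\<psi> m x \<le> indicator {a$1<..<b$1} (x$1) * indicator {a$2<..<b$2} (x$2)"
      unfolding \<psi>_def tensor_def by simp
    also have "\<dots> = indicator (box a b) x" by (auto simp: indicator_def mem_box_cart forall_2)
    finally show "\<psi> m x \<le> indicator (box a b) x" .
  qed
  have lim: "(\<lambda>m. \<psi> m x) \<longlonglongrightarrow> indicator (box a b) x" for x
  proof (cases "x \<in> box a b")
    case True
    have "eventually (\<lambda>m. box_family (a$i) (b$i) (real m) 0 (x$i) = 1) sequentially" for i
      using True by (intro eventually_compose_filterlim[OF box_family_tendsto filterlim_real_sequentially]) (auto simp: mem_box_cart)
    from this[of 1] this[of 2] have "eventually (\<lambda>m. \<psi> m x = 1) sequentially"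
      by eventually_elim (simp add: \<psi>_def tensor_def)
    then show ?thesis using True by (simp add: tendsto_eventually)
  next
    case False
    have "\<psi> m x = 0" if "m \<ge> M0" for m using pos[OF that, of x] False by simp
    then have "eventually (\<lambda>m. \<psi> m x = 0) sequentially" by (auto simp: eventually_sequentially)
    then show ?thesis using False by (simp add: tendsto_eventually)
  qed
  have cont: "continuous_on UNIV (\<psi> m)" for m
    unfolding \<psi>_def by (intro continuous_at_imp_continuous_on ballI
        has_derivative_continuous[OF tensor_has_derivative[OF deriv_family_box deriv_family_box]])
  have meas: "\<psi> m \<in> borel_measurable (lebesgue_on X)" for m
    by (rule measurable_restrict_space1) (use borel_measurable_continuous_onI[OF cont] in \<open>auto intro: measurable_completion\<close>)
  have X': "X \<in> sets lebesgue" using X by auto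
  have boxX: "box a b \<subseteq> X" using sub box_subset_cbox by blast
  have ib: "(indicator (box a b) :: _ \<Rightarrow> real) \<in> borel_measurable (lebesgue_on X)"
    by (rule measurable_restrict_space1) (auto intro!: borel_measurable_indicator)
  have intb: "integrable (lebesgue_on X) (indicator (box a b) :: _ \<Rightarrow> real)"
    using X' boxX lmeasurable_box[of a b]
    by (subst integrable_restrict_space)
      (auto simp: indicator_inter_arith[symmetric] inf_absorb2 fmeasurable_def intro!: integrable_real_indicator)
  have wm: "w \<in> borel_measurable (lebesgue_on X)" using w by auto
  have b1: "\<bar>\<psi> (m + M0) x\<bar> \<le> 1" for m x
  proof -
    have "\<psi> (m + M0) x \<le> indicator (box a b) x" "0 \<le> \<psi> (m + M0) x" by (rule pos; simp)+
    then show ?thesis by (cases "x \<in> box a b") auto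
  qed
  have 1: "(\<lambda>m. \<integral>x. \<psi> (m + M0) x * w x \<partial>lebesgue_on X) \<longlonglongrightarrow> (\<integral>x. indicator (box a b) x * w x \<partial>lebesgue_on X)"
  proof (rule integral_dominated_convergence[where w="\<lambda>x. \<bar>w x\<bar>"])
    show "AE x in lebesgue_on X. (\<lambda>m. \<psi> (m + M0) x * w x) \<longlonglongrightarrow> indicator (box a b) x * w x"
      by (intro AE_I2 tendsto_mult LIMSEQ_ignore_initial_segment[OF lim] tendsto_const)
    show "AE x in lebesgue_on X. norm (\<psi> (m + M0) x * w x) \<le> \<bar>w x\<bar>" for m
      by (rule AE_I2) (simp only: real_norm_def abs_mult, rule mult_left_le_one_le, simp_all add: b1)
    show "integrable (lebesgue_on X) (\<lambda>x. \<bar>w x\<bar>)" using w by simp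
    show "(\<lambda>x. \<psi> (m + M0) x * w x) \<in> borel_measurable (lebesgue_on X)" for m
      by (rule borel_measurable_times[OF meas wm])
    show "(\<lambda>x. indicator (box a b) x * w x) \<in> borel_measurable (lebesgue_on X)"
      by (rule borel_measurable_times[OF ib wm])
  qed
  have 2: "(\<lambda>m. \<integral>x. \<psi> (m + M0) x \<partial>lebesgue_on X) \<longlonglongrightarrow> (\<integral>x. indicator (box a b) x \<partial>lebesgue_on X)"
  proof (rule integral_dominated_convergence[where w="indicator (box a b)"])
    show "AE x in lebesgue_on X. (\<lambda>m. \<psi> (m + M0) x) \<longlonglongrightarrow> indicator (box a b) x"
      by (intro AE_I2 LIMSEQ_ignore_initial_segment[OF lim])
    show "AE x in lebesgue_on X. norm (\<psi> (m + M0) x) \<le> indicator (box a b) x" for m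
    proof (rule AE_I2)
      fix x
      have "\<psi> (m + M0) x \<le> indicator (box a b) x" "0 \<le> \<psi> (m + M0) x" by (rule pos; simp)+
      then show "norm (\<psi> (m + M0) x) \<le> indicator (box a b) x" by simp
    qed
  qed (rule ib meas intb)+
  have "(\<integral>x. indicator (box a b) x * w x \<partial>lebesgue_on X) \<le> K * (\<integral>x. indicator (box a b) x \<partial>lebesgue_on X)"
  proof (rule LIMSEQ_le[OF 1 tendsto_mult[OF tendsto_const 2]], intro exI[of _ 0] allI impI)
    fix m
    show "(\<integral>x. \<psi> (m + M0) x * w x \<partial>lebesgue_on X) \<le> K * (\<integral>x. \<psi> (m + M0) x \<partial>lebesgue_on X)"
      by (rule bound[OF test pos(1)]) simp_all
  qed
  also have "(\<integral>x. indicator (box a b) x \<partial>lebesgue_on X) = measure (lebesgue_on X) (box a b \<inter> X)"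
    by (metis Bochner_Integration.integral_indicator space_lebesgue_on)
  also have "\<dots> = measure lebesgue (box a b)"
    using boxX X' by (simp add: measure_restrict_space inf_absorb1)
  finally show ?thesis .
qed

text \<open>By the box version the averages of \<open>w\<close> over small cubes are at most
  \<open>K\<close>, and by Lebesgue differentiation they converge to \<open>w x\<close> outside a
  null set.\<close>

lemma test_function_bound_AE:
  fixes w :: "real^2 \<Rightarrow> real"
  assumes X: "open X" and w: "integrable (lebesgue_on X) w"
    and bound: "\<And>\<phi>. \<phi> \<in> test_functions X \<Longrightarrow> (\<And>x. 0 \<le> \<phi> x) \<Longrightarrow>
      (\<integral>x. \<phi> x * w x \<partial>lebesgue_on X) \<le> K * (\<integral>x. \<phi> x \<partial>lebesgue_on X)"
  shows "AE x in lebesgue_on X. w x \<le> K"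
proof -
  \<comment> \<open>Extended by zero, since the differentiation theorem is applied in the whole
    plane.\<close>
  define w0 where "w0 x = (if x \<in> X then w x else 0)" for x
  have X': "X \<in> sets lebesgue" using X by auto
  have iw: "w0 absolutely_integrable_on UNIV"
    unfolding w0_def absolutely_integrable_restrict_UNIV
    using w X' by (simp add: absolutely_integrable_on_def set_integrable_def integrable_restrict_space absolutely_integrable_measurable)
  have "w0 integrable_on cbox a b" for a b
    using iw by (meson absolutely_integrable_on_def integrable_on_subcbox set_lebesgue_integral_eq_integral(1) subset_UNIV)
  from integrable_ccontinuous_explicit[of w0, OF this] obtain N where N: "negligible N"
    "\<And>x e. \<lbrakk>x \<notin> N; 0 < e\<rbrakk> \<Longrightarrow> \<exists>d>0. \<forall>h. 0 < h \<and> h < d \<longrightarrow>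
        norm(integral (cbox x (x + h *\<^sub>R One)) w0 /\<^sub>R h ^ DIM(real^2) - w0 x) < e" by metis
  have "w x \<le> K" if x: "x \<in> X" "x \<notin> N" for x
  proof (rule field_le_epsilon)
    fix e :: real assume "e > 0"
    obtain d where d: "d > 0" "\<And>h. 0 < h \<Longrightarrow> h < d \<Longrightarrow>
        norm(integral (cbox x (x + h *\<^sub>R One)) w0 /\<^sub>R h ^ DIM(real^2) - w0 x) < e"
      using N(2)[OF x(2) \<open>e > 0\<close>] by blast
    obtain r where r: "r > 0" "ball x r \<subseteq> X" using X x(1) openE by blast
    \<comment> \<open>A cube of side \<open>h\<close> with corner \<open>x\<close> stays within
      distance \<open>2 * h\<close> of \<open>x\<close>, by comparison with the l1 norm, so
      \<open>r/4\<close> keeps it in \<open>X\<close>; \<open>d/2\<close> gives the accuracy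
      \<open>e\<close>.\<close>
    define h where "h = min (d/2) (r/4)"
    have h: "0 < h" "h < d" using d r by (auto simp: h_def)
    have One: "(\<Sum>x\<in>(Basis::(real^2) set). x $ i) = 1" for i using exhaust_2[of i] by (auto simp: Basis_real2)
    define b where "b = x + h *\<^sub>R One"
    have bi: "b $ i = x $ i + h" for i by (simp add: b_def One)
    have sub: "cbox x b \<subseteq> X"
    proof
      fix y assume "y \<in> cbox x b"
      then have "\<bar>(y - x) $ 1\<bar> \<le> h" "\<bar>(y - x) $ 2\<bar> \<le> h" by (auto simp: mem_box_cart bi forall_2)
      then have "norm (y - x) \<le> h + h" using norm_le_l1_cart[of "y - x"] by (simp add: sum_2)
      then show "y \<in> X" using r by (auto simp: h_def dist_norm norm_minus_commute subset_iff)
    qed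
    have vol: "measure lebesgue (box x b) = h ^ 2"
      using content_cbox_plus[of x h] h by (simp add: b_def measure_lborel_box_eq measure_lborel_cbox_eq)
    have "set_integrable lebesgue (box x b) w0"
      using iw by (rule set_integrable_subset) auto
    note box_eq = set_lebesgue_integral_eq_integral(2)[OF this]
    have "(\<integral>x'. indicator (box x b) x' * w x' \<partial>lebesgue_on X)
        = (\<integral>x'. indicator X x' *\<^sub>R (indicator (box x b) x' * w x') \<partial>lebesgue)"
      using X' by (intro integral_restrict_space) auto
    also have "\<dots> = (LINT x':box x b|lebesgue. w0 x')"
      unfolding set_lebesgue_integral_def using sub box_subset_cbox[of x b]
      by (intro Bochner_Integration.integral_cong) (auto simp: w0_def indicator_def)
    also have "\<dots> = integral (cbox x b) w0"
      using box_eq by (simp add: integral_open_interval)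
    finally have "integral (cbox x b) w0 = (\<integral>x'. indicator (box x b) x' * w x' \<partial>lebesgue_on X)" ..
    also have "\<dots> \<le> K * measure lebesgue (box x b)"
      by (rule test_function_bound_box[OF X w bound sub]) (use h in \<open>auto simp: bi\<close>)
    finally have "integral (cbox x b) w0 / h^2 \<le> K" using h by (simp add: vol field_simps)
    moreover have "\<bar>integral (cbox x b) w0 / h ^ 2 - w x\<bar> < e"
      using d(2)[OF h] x(1) by (simp add: b_def w0_def divide_inverse_commute)
    ultimately show "w x \<le> K + e" by linarith
  qed
  then have "{x \<in> X. \<not> w x \<le> K} \<subseteq> N" by auto
  then show ?thesis using N(1)
    by (subst AE_restrict_space_iff) (auto simp: X' negligible_iff_null_sets eventually_ae_filter intro!: bexI[of _ N] )
qed

lemma test_function_measurable: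
  assumes "\<phi> \<in> test_functions S" shows "\<phi> \<in> borel_measurable (lebesgue_on X)"
proof -
  have "\<forall>x. \<phi> differentiable (at x)"
    using assms by (auto simp: test_functions_def smooth_def iterated_deriv_def dest: spec[of _ "[]"])
  then have "continuous_on UNIV \<phi>"
    by (meson continuous_at_imp_continuous_on differentiable_imp_continuous_within)
  then show ?thesis
    by (intro measurable_restrict_space1 measurable_completion) (simp add: borel_measurable_continuous_onI)
qed

lemma test_function_bounded:
  assumes "\<phi> \<in> test_functions S" shows "\<exists>K. \<forall>x. \<bar>\<phi> x\<bar> \<le> K"
proof -
  have "\<forall>x. \<phi> differentiable (at x)"
    using assms by (auto simp: test_functions_def smooth_def iterated_deriv_def dest: spec[of _ "[]"])
  then have c: "continuous_on T \<phi>" for T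
    by (meson continuous_at_imp_continuous_on differentiable_imp_continuous_within)
  have "compact (\<phi> ` closure {x. \<phi> x \<noteq> 0})"
    using assms by (intro compact_continuous_image c) (simp add: test_functions_def)
  then obtain K where K: "\<And>x. x \<in> closure {x. \<phi> x \<noteq> 0} \<Longrightarrow> \<bar>\<phi> x\<bar> \<le> K"
    by (metis bounded_iff compact_imp_bounded image_eqI real_norm_def)
  have "\<bar>\<phi> x\<bar> \<le> max K 0" for x
    using K[of x] closure_subset[of "{x. \<phi> x \<noteq> 0}"] by (cases "\<phi> x = 0") auto
  then show ?thesis by blast
qed

lemma integrable_test_scaleR:
  fixes w :: "'a::euclidean_space \<Rightarrow> 'b::{banach,second_countable_topology}"
  assumes "integrable (lebesgue_on X) w" "\<phi> \<in> test_functions S"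
  shows "integrable (lebesgue_on X) (\<lambda>x. \<phi> x *\<^sub>R w x)"
proof -
  obtain K where K: "\<And>x. \<bar>\<phi> x\<bar> \<le> K" using test_function_bounded[OF assms(2)] by blast
  then have K0: "K \<ge> 0" using abs_ge_zero order_trans by blast
  show ?thesis
  proof (rule Bochner_Integration.integrable_bound)
    show "integrable (lebesgue_on X) (\<lambda>x. K *\<^sub>R norm (w x))" using assms(1) by auto
    show "(\<lambda>x. \<phi> x *\<^sub>R w x) \<in> borel_measurable (lebesgue_on X)"
      using assms by (intro borel_measurable_scaleR test_function_measurable) auto
    show "AE x in lebesgue_on X. norm (\<phi> x *\<^sub>R w x) \<le> norm (K *\<^sub>R norm (w x))"
      using K K0 by (intro AE_I2) (auto intro: mult_right_mono)
  qed
qed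

text \<open>The real case is applied to \<open>Re\<close>, \<open>- Re\<close>, \<open>Im\<close>
  and \<open>- Im\<close>, each dominated by the norm. The factor 2 is the price of recombining real
  and imaginary part by \<open>\<bar>Re\<bar> + \<bar>Im\<bar>\<close>.\<close>

lemma test_function_bound_AE_complex:
  fixes w :: "real^2 \<Rightarrow> complex"
  assumes X: "open X" and w: "integrable (lebesgue_on X) w"
    and bound: "\<And>\<phi>. \<phi> \<in> test_functions X \<Longrightarrow> (\<And>x. 0 \<le> \<phi> x) \<Longrightarrow>
      norm (\<integral>x. \<phi> x *\<^sub>R w x \<partial>lebesgue_on X) \<le> K * (\<integral>x. \<phi> x \<partial>lebesgue_on X)"
  shows "AE x in lebesgue_on X. norm (w x) \<le> 2 * K"
proof -
  have R: "AE x in lebesgue_on X. l (w x) \<le> K"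
    if l: "bounded_linear l" and nl: "\<And>z. l z \<le> norm z" for l :: "complex \<Rightarrow> real"
  proof (rule test_function_bound_AE[OF X])
    show "integrable (lebesgue_on X) (\<lambda>x. l (w x))"
      using w by (rule integrable_bounded_linear[OF l])
    fix \<phi> assume \<phi>: "\<phi> \<in> test_functions X" "\<And>x. 0 \<le> (\<phi> x :: real)"
    have "(\<integral>x. \<phi> x * l (w x) \<partial>lebesgue_on X) = (\<integral>x. l (\<phi> x *\<^sub>R w x) \<partial>lebesgue_on X)"
      using l by (simp add: linear_cmul bounded_linear.linear)
    also have "\<dots> = l (\<integral>x. \<phi> x *\<^sub>R w x \<partial>lebesgue_on X)"
      by (intro integral_bounded_linear[OF l] integrable_test_scaleR[OF w \<phi>(1)])
    also have "\<dots> \<le> K * (\<integral>x. \<phi> x \<partial>lebesgue_on X)"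
      using nl bound[OF \<phi>] order_trans by blast
    finally show "(\<integral>x. \<phi> x * l (w x) \<partial>lebesgue_on X) \<le> K * (\<integral>x. \<phi> x \<partial>lebesgue_on X)" .
  qed
  have "AE x in lebesgue_on X. Re (w x) \<le> K" "AE x in lebesgue_on X. - Re (w x) \<le> K"
    "AE x in lebesgue_on X. Im (w x) \<le> K" "AE x in lebesgue_on X. - Im (w x) \<le> K"
    by (rule R; auto intro: bounded_linear_Re bounded_linear_Im bounded_linear_minus complex_Re_le_cmod
      order_trans[OF _ abs_Re_le_cmod] order_trans[OF _ abs_Im_le_cmod] )+
  then show ?thesis
  proof eventually_elim
    case (elim x)
    then show ?case using cmod_le[of "w x"] by linarith
  qed
qed

lemma L2_integrable:
  assumes "u \<in> L2 S" "S \<in> lmeasurable" shows "integrable (lebesgue_on S) u"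
proof (rule Bochner_Integration.integrable_bound)
  interpret finite_measure "lebesgue_on S" by (rule finite_measure_lebesgue_on[OF assms(2)])
  show "integrable (lebesgue_on S) (\<lambda>x. 1 + (norm (u x))\<^sup>2)" using assms(1) by (auto simp: L2_def)
  show "u \<in> borel_measurable (lebesgue_on S)" using assms by (auto simp: L2_def)
  have "norm z \<le> norm (1 + (norm z)\<^sup>2)" for z :: complex
  proof -
    have "0 \<le> (norm z - 1)\<^sup>2" "0 \<le> (norm z)\<^sup>2" by simp_all
    then have "norm z \<le> 1 + (norm z)\<^sup>2" using norm_ge_zero[of z] unfolding power2_diff one_power2 by linarith
    then show ?thesis by simp
  qed
  then show "AE x in lebesgue_on S. norm (u x) \<le> norm (1 + (norm (u x))\<^sup>2)" by simp
qed

text \<open>The difference of two candidates integrates to zero against every test function, so the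
  preceding bound holds with \<open>K = 0\<close>. This ties the arbitrary choice in
  \<open>weak_deriv\<close> to an explicitly known derivative.\<close>

lemma weak_deriv_unique:
  fixes S :: "(real^2) set"
  assumes S: "open S" "bounded S" and v: "has_weak_deriv S bs u v" "has_weak_deriv S bs u v'"
  shows "AE x in lebesgue_on S. v x = (v' x :: complex)"
proof -
  have "S \<in> lmeasurable" using S by (simp add: lmeasurable_open)
  then have i: "integrable (lebesgue_on S) v" "integrable (lebesgue_on S) v'"
    using v by (auto simp: has_weak_deriv_def intro!: L2_integrable)
  have "AE x in lebesgue_on S. norm (v x - v' x) \<le> 2 * 0"
  proof (rule test_function_bound_AE_complex[OF S(1)])
    fix \<phi> assume \<phi>: "\<phi> \<in> test_functions S"
    have "(\<integral>x. \<phi> x *\<^sub>R v x \<partial>lebesgue_on S) = (\<integral>x. \<phi> x *\<^sub>R v' x \<partial>lebesgue_on S)"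
    proof -
      have "(\<integral>x. iterated_deriv bs \<phi> x *\<^sub>R u x \<partial>lebesgue_on S)
          = (- 1) ^ length bs * (\<integral>x. \<phi> x *\<^sub>R v x \<partial>lebesgue_on S)"
        "(\<integral>x. iterated_deriv bs \<phi> x *\<^sub>R u x \<partial>lebesgue_on S)
          = (- 1) ^ length bs * (\<integral>x. \<phi> x *\<^sub>R v' x \<partial>lebesgue_on S)"
        using v \<phi> unfolding has_weak_deriv_def by auto
      then show ?thesis by simp
    qed
    then have "(\<integral>x. \<phi> x *\<^sub>R (v x - v' x) \<partial>lebesgue_on S) = 0"
      by (simp add: scaleR_diff_right integrable_test_scaleR[OF i(1) \<phi>] integrable_test_scaleR[OF i(2) \<phi>])
    then show "norm (\<integral>x. \<phi> x *\<^sub>R (v x - v' x) \<partial>lebesgue_on S) \<le> 0 * (\<integral>x. \<phi> x \<partial>lebesgue_on S)" by simp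
  qed (use i in auto)
  then show ?thesis by eventually_elim simp
qed

section \<open>Mollification\<close>

text \<open>The function \<open>bump 0 (t / \<epsilon>) / \<epsilon>\<close> of mass one, with its
  derivatives; the form, including \<open>+ 0\<close>, is that of
  \<open>deriv_family_affine\<close>.\<close>

definition scaled_bump :: "real \<Rightarrow> nat \<Rightarrow> real \<Rightarrow> real" where
  "scaled_bump \<epsilon> n t = (1/\<epsilon>) * (1/\<epsilon>) ^ n * bump n ((1/\<epsilon>) * t + 0)"

definition mollifier :: "real \<Rightarrow> nat \<Rightarrow> nat \<Rightarrow> real^2 \<Rightarrow> real" where
  "mollifier \<epsilon> = tensor (scaled_bump \<epsilon>) (scaled_bump \<epsilon>)"

text \<open>Convolution with \<open>u\<close> extended by zero outside \<open>\<Omega>\<close>. The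
  indices differentiate the kernel, so this is the partial derivative of order \<open>(a, b)\<close>
  of the mollified function.\<close>

definition mollify :: "(real^2) set \<Rightarrow> real \<Rightarrow> nat \<Rightarrow> nat \<Rightarrow> (real^2 \<Rightarrow> 'b::{banach,second_countable_topology}) \<Rightarrow> real^2 \<Rightarrow> 'b" where
  "mollify \<Omega> \<epsilon> a b u x = (\<integral>y. mollifier \<epsilon> a b (x - y) *\<^sub>R u y \<partial>lebesgue_on \<Omega>)"

lemma deriv_family_scaled_bump: "deriv_family (scaled_bump \<epsilon>)"
  unfolding scaled_bump_def[abs_def] by (intro deriv_family_affine deriv_family_bump)

lemma mollifier_has_derivative:
  "(mollifier \<epsilon> a b has_derivative
     (\<lambda>h. h$1 * mollifier \<epsilon> (Suc a) b x + h$2 * mollifier \<epsilon> a (Suc b) x)) (at x)"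
  unfolding mollifier_def by (intro tensor_has_derivative deriv_family_scaled_bump)

lemma mollifier_continuous: "continuous_on S (mollifier \<epsilon> a b)"
  by (intro continuous_at_imp_continuous_on ballI has_derivative_continuous[OF mollifier_has_derivative])

lemma mollifier_bounded: "\<exists>K\<ge>0. \<forall>x. \<bar>mollifier \<epsilon> a b x\<bar> \<le> K"
proof -
  have "\<exists>K. \<forall>t. \<bar>scaled_bump \<epsilon> n t\<bar> \<le> K" for n
  proof -
    obtain K where "\<And>x. \<bar>bump n x\<bar> \<le> K" using bump_bounded by blast
    then have "\<bar>scaled_bump \<epsilon> n t\<bar> \<le> \<bar>(1/\<epsilon>) * (1/\<epsilon>) ^ n\<bar> * K" for t
      unfolding scaled_bump_def abs_mult by (intro mult_mono) auto
    then show ?thesis by blast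
  qed
  then obtain K where K: "\<And>n t. \<bar>scaled_bump \<epsilon> n t\<bar> \<le> K n" by metis
  have K0: "K n \<ge> 0" for n using K abs_ge_zero order_trans by blast
  have "\<bar>mollifier \<epsilon> a b x\<bar> \<le> K a * K b" for x
    unfolding mollifier_def tensor_def abs_mult by (intro mult_mono K K0) auto
  then show ?thesis using K0 by (intro exI[of _ "K a * K b"]) auto
qed

lemma mollifier_lipschitz: "\<exists>L\<ge>0. \<forall>x y. \<bar>mollifier \<epsilon> a b x - mollifier \<epsilon> a b y\<bar> \<le> L * norm (x - y)"
proof -
  obtain K1 K2 where K: "K1 \<ge> 0" "K2 \<ge> 0" "\<And>x. \<bar>mollifier \<epsilon> (Suc a) b x\<bar> \<le> K1" "\<And>x. \<bar>mollifier \<epsilon> a (Suc b) x\<bar> \<le> K2"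
    using mollifier_bounded by metis
  have "norm (mollifier \<epsilon> a b x - mollifier \<epsilon> a b y) \<le> (K1 + K2) * norm (x - y)" for x y
  proof (rule differentiable_bound[where S=UNIV
        and f'="\<lambda>z h. h$1 * mollifier \<epsilon> (Suc a) b z + h$2 * mollifier \<epsilon> a (Suc b) z"])
    fix z :: "real^2"
    show "(mollifier \<epsilon> a b has_derivative
     (\<lambda>h. h$1 * mollifier \<epsilon> (Suc a) b z + h$2 * mollifier \<epsilon> a (Suc b) z)) (at z within UNIV)"
      using mollifier_has_derivative by simp
    show "onorm (\<lambda>h :: real^2. h$1 * mollifier \<epsilon> (Suc a) b z + h$2 * mollifier \<epsilon> a (Suc b) z) \<le> K1 + K2"
    proof (rule onorm_le)
      fix h :: "real^2"
      have "\<bar>h$1 * mollifier \<epsilon> (Suc a) b z\<bar> \<le> norm h * K1" "\<bar>h$2 * mollifier \<epsilon> a (Suc b) z\<bar> \<le> norm h * K2"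
        unfolding abs_mult by (intro mult_mono K component_le_norm_cart; simp)+
      then show "norm (h$1 * mollifier \<epsilon> (Suc a) b z + h$2 * mollifier \<epsilon> a (Suc b) z) \<le> (K1 + K2) * norm h"
        by (simp add: algebra_simps)
    qed
  qed auto
  then show ?thesis using K by (intro exI[of _ "K1 + K2"]) auto
qed

lemma mollifier_measurable: "(\<lambda>y. mollifier \<epsilon> a b (x - y)) \<in> borel_measurable (lebesgue_on S)"
proof -
  have "continuous_on UNIV (\<lambda>y. mollifier \<epsilon> a b (x - y))"
    by (intro continuous_on_compose2[OF mollifier_continuous[of UNIV]] continuous_intros) auto
  then show ?thesis
    by (intro measurable_restrict_space1 measurable_completion) (simp add: borel_measurable_continuous_onI)
qed

lemma mollify_integrable:
  fixes u :: "real^2 \<Rightarrow> 'b::{banach,second_countable_topology}"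
  assumes "integrable (lebesgue_on \<Omega>) u"
  shows "integrable (lebesgue_on \<Omega>) (\<lambda>y. mollifier \<epsilon> a b (x - y) *\<^sub>R u y)"
proof -
  obtain K where K: "K \<ge> 0" "\<And>x. \<bar>mollifier \<epsilon> a b x\<bar> \<le> K" using mollifier_bounded by metis
  show ?thesis
  proof (rule Bochner_Integration.integrable_bound)
    show "integrable (lebesgue_on \<Omega>) (\<lambda>y. K *\<^sub>R norm (u y))" using assms by auto
    show "(\<lambda>y. mollifier \<epsilon> a b (x - y) *\<^sub>R u y) \<in> borel_measurable (lebesgue_on \<Omega>)"
      using assms by (intro borel_measurable_scaleR mollifier_measurable) auto
    show "AE y in lebesgue_on \<Omega>. norm (mollifier \<epsilon> a b (x - y) *\<^sub>R u y) \<le> norm (K *\<^sub>R norm (u y))"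
      using K by (intro AE_I2) (auto intro: mult_right_mono)
  qed
qed

text \<open>Differentiation under the integral sign: the kernel is globally Lipschitz with bounded
  derivatives, so the remainder \<open>r\<close> of its linearisation, divided by
  \<open>norm h\<close>, is uniformly bounded and tends to zero pointwise. Dominated convergence
  with a multiple of \<open>norm (u y)\<close> finishes.\<close>

lemma mollify_has_derivative:
  assumes u: "integrable (lebesgue_on \<Omega>) u"
  shows "(mollify \<Omega> \<epsilon> a b u has_derivative
     (\<lambda>h. h$1 *\<^sub>R mollify \<Omega> \<epsilon> (Suc a) b u x + h$2 *\<^sub>R mollify \<Omega> \<epsilon> a (Suc b) u x)) (at x)"
    (is "(_ has_derivative ?D) _")
  unfolding has_derivative_at
proof
  show "bounded_linear ?D"
    by (intro bounded_linear_add bounded_linear_scaleR_const bounded_linear_vec_nth)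
  obtain L where L: "L \<ge> 0" "\<And>x y. \<bar>mollifier \<epsilon> a b x - mollifier \<epsilon> a b y\<bar> \<le> L * norm (x - y)"
    using mollifier_lipschitz by metis
  obtain K1 K2 where K: "K1 \<ge> 0" "K2 \<ge> 0" "\<And>x. \<bar>mollifier \<epsilon> (Suc a) b x\<bar> \<le> K1" "\<And>x. \<bar>mollifier \<epsilon> a (Suc b) x\<bar> \<le> K2"
    using mollifier_bounded by metis
  define d where "d h z = h$1 * mollifier \<epsilon> (Suc a) b z + h$2 * mollifier \<epsilon> a (Suc b) z" for h z :: "real^2"
  define r where "r h z = (mollifier \<epsilon> a b (z + h) - mollifier \<epsilon> a b z - d h z) / norm h" for h z
  have dbound: "\<bar>d h z\<bar> \<le> (K1 + K2) * norm h" for h z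
  proof -
    have "\<bar>h$1 * mollifier \<epsilon> (Suc a) b z\<bar> \<le> norm h * K1" "\<bar>h$2 * mollifier \<epsilon> a (Suc b) z\<bar> \<le> norm h * K2"
      unfolding abs_mult by (intro mult_mono K component_le_norm_cart; simp)+
    then show ?thesis by (simp add: d_def algebra_simps)
  qed
  have rbound: "\<bar>r h z\<bar> \<le> L + K1 + K2" for h z
  proof -
    have "\<bar>mollifier \<epsilon> a b (z + h) - mollifier \<epsilon> a b z - d h z\<bar> \<le> (L + K1 + K2) * norm h"
      using L(2)[of "z + h" z] dbound[of h z] by (simp add: algebra_simps)
    then show ?thesis using L K by (cases "h = 0") (auto simp: r_def field_simps)
  qed
  have rlim: "((\<lambda>h. r h z) \<longlongrightarrow> 0) (at 0)" for z
  proof -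
    have "((\<lambda>h. \<bar>mollifier \<epsilon> a b (z + h) - mollifier \<epsilon> a b z - d h z\<bar> / norm h) \<longlongrightarrow> 0) (at 0)"
      using mollifier_has_derivative[of \<epsilon> a b z] unfolding has_derivative_at d_def by simp
    then have "((\<lambda>h. \<bar>r h z\<bar>) \<longlongrightarrow> 0) (at 0)" by (simp add: r_def)
    then show ?thesis by (simp add: tendsto_rabs_zero_iff)
  qed
  have rmeas: "(\<lambda>y. r h (x - y)) \<in> borel_measurable (lebesgue_on \<Omega>)" for h
    using mollifier_measurable[of \<epsilon> a b "x + h" \<Omega>] unfolding r_def d_def
    by (intro borel_measurable_divide borel_measurable_diff borel_measurable_add borel_measurable_times mollifier_measurable)
      (auto simp: algebra_simps)
  have um: "u \<in> borel_measurable (lebesgue_on \<Omega>)" using u by auto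
  have eq: "(mollify \<Omega> \<epsilon> a b u (x + h) - mollify \<Omega> \<epsilon> a b u x - ?D h) /\<^sub>R norm h
     = (\<integral>y. r h (x - y) *\<^sub>R u y \<partial>lebesgue_on \<Omega>)" for h
  proof -
    have "(mollify \<Omega> \<epsilon> a b u (x + h) - mollify \<Omega> \<epsilon> a b u x - ?D h) /\<^sub>R norm h =
      (\<integral>y. (mollifier \<epsilon> a b (x + h - y) *\<^sub>R u y - mollifier \<epsilon> a b (x - y) *\<^sub>R u y
        - (h$1 *\<^sub>R (mollifier \<epsilon> (Suc a) b (x - y) *\<^sub>R u y) + h$2 *\<^sub>R (mollifier \<epsilon> a (Suc b) (x - y) *\<^sub>R u y))) /\<^sub>R norm h \<partial>lebesgue_on \<Omega>)"
      unfolding mollify_def using mollify_integrable[OF u] by (simp del: scaleR_scaleR)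
    also have "\<dots> = (\<integral>y. r h (x - y) *\<^sub>R u y \<partial>lebesgue_on \<Omega>)"
      by (intro Bochner_Integration.integral_cong refl) (simp add: r_def d_def algebra_simps divide_inverse)
    finally show ?thesis .
  qed
  have "((\<lambda>h. (\<integral>y. r h (x - y) *\<^sub>R u y \<partial>lebesgue_on \<Omega>)) \<longlongrightarrow> 0) (at 0)"
    unfolding tendsto_at_iff_sequentially
  proof (intro allI impI)
    fix X :: "nat \<Rightarrow> real^2" assume X: "\<forall>i. X i \<in> UNIV - {0}" "X \<longlonglongrightarrow> 0"
    have "(\<lambda>n. (\<integral>y. r (X n) (x - y) *\<^sub>R u y \<partial>lebesgue_on \<Omega>)) \<longlonglongrightarrow> (\<integral>y. 0 \<partial>lebesgue_on \<Omega>)"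
    proof (rule integral_dominated_convergence[where w="\<lambda>y. (L + K1 + K2) * norm (u y)"])
      show "AE y in lebesgue_on \<Omega>. (\<lambda>n. r (X n) (x - y) *\<^sub>R u y) \<longlonglongrightarrow> 0"
      proof (intro AE_I2)
        fix y
        have "(\<lambda>n. r (X n) (x - y)) \<longlonglongrightarrow> 0"
          using rlim[of "x - y"] X unfolding tendsto_at_iff_sequentially comp_def by blast
        then show "(\<lambda>n. r (X n) (x - y) *\<^sub>R u y) \<longlonglongrightarrow> 0"
            using tendsto_scaleR[OF _ tendsto_const[of "u y"], of "\<lambda>n. r (X n) (x - y)" 0] by simp
      qed
      show "AE y in lebesgue_on \<Omega>. norm (r (X n) (x - y) *\<^sub>R u y) \<le> (L + K1 + K2) * norm (u y)" for n
        using rbound by (intro AE_I2) (auto intro: mult_right_mono)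
      show "(\<lambda>y. r (X n) (x - y) *\<^sub>R u y) \<in> borel_measurable (lebesgue_on \<Omega>)" for n
        by (intro borel_measurable_scaleR rmeas um)
    qed (use u in auto)
    then show "((\<lambda>h. (\<integral>y. r h (x - y) *\<^sub>R u y \<partial>lebesgue_on \<Omega>)) \<circ> X) \<longlonglongrightarrow> 0" by (simp add: comp_def)
  qed
  then have "((\<lambda>h. norm (\<integral>y. r h (x - y) *\<^sub>R u y \<partial>lebesgue_on \<Omega>)) \<longlongrightarrow> 0) (at 0)"
    by (simp add: tendsto_norm_zero_iff)
  then show "((\<lambda>h. norm (mollify \<Omega> \<epsilon> a b u (x + h) - mollify \<Omega> \<epsilon> a b u x - ?D h) / norm h) \<longlongrightarrow> 0) (at 0)"
    unfolding eq[symmetric] by (simp add: divide_inverse mult.commute)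
qed

lemma mollify_continuous:
  assumes "integrable (lebesgue_on \<Omega>) u" shows "continuous_on S (mollify \<Omega> \<epsilon> a b u)"
  by (intro continuous_at_imp_continuous_on ballI has_derivative_continuous[OF mollify_has_derivative[OF assms]])

text \<open>The kernel \<open>mollifier \<epsilon> 0 0 (x - y)\<close>, as a function of
  \<open>y\<close>, is itself an admissible test function: its supporting square has half side
  \<open>\<epsilon>\<close> and lies in the disc of radius \<open>2 * \<epsilon>\<close>.
  Differentiating in \<open>y\<close> instead of \<open>x\<close> produces the sign
  \<open>(-1)^(a+b)\<close>, which cancels the one in the definition of the weak derivative.\<close>

lemma mollify_weak_deriv:
  assumes \<epsilon>: "\<epsilon> > 0" and sub: "cball x (2 * \<epsilon>) \<subseteq> \<Omega>" and v: "has_weak_deriv \<Omega> (dirs a b) u v"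
  shows "mollify \<Omega> \<epsilon> a b u x = mollify \<Omega> \<epsilon> 0 0 v x"
proof -
  \<comment> \<open>One factor of the reflected kernel, as a function of the coordinate
    \<open>t\<close> of \<open>y\<close>; the inner slope \<open>- 1/\<epsilon>\<close> accounts for
    the sign of each derivative.\<close>
  define A where "A i = (\<lambda>n t. (1/\<epsilon>) * (- 1/\<epsilon>) ^ n * bump n ((- 1/\<epsilon>) * t + x$i/\<epsilon>))" for i
  have A: "deriv_family (A i)" for i
    unfolding A_def by (intro deriv_family_affine deriv_family_bump)
  have "A i n t = (-1) ^ n * scaled_bump \<epsilon> n (x$i - t)" for i n t
    by (simp add: A_def scaled_bump_def diff_divide_distrib power_divide power_minus' minus_divide_left[symmetric] power_minus[of "1/\<epsilon>"] field_simps)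
  then have eq: "tensor (A 1) (A 2) i j y = (-1) ^ (i + j) * mollifier \<epsilon> i j (x - y)" for i j y
    by (simp add: tensor_def mollifier_def power_add)
  define c :: "real^2" where "c = (\<chi> i. x $ i - \<epsilon>)"
  define d :: "real^2" where "d = (\<chi> i. x $ i + \<epsilon>)"
  have "cbox c d \<subseteq> cball x (2 * \<epsilon>)"
  proof
    fix y assume "y \<in> cbox c d"
    then have "\<bar>(y - x) $ 1\<bar> \<le> \<epsilon>" "\<bar>(y - x) $ 2\<bar> \<le> \<epsilon>" by (auto simp: mem_box_cart forall_2 c_def d_def)
    then have "norm (y - x) \<le> 2 * \<epsilon>" using norm_le_l1_cart[of "y - x"] by (simp add: sum_2)
    then show "y \<in> cball x (2 * \<epsilon>)" by (simp add: dist_norm norm_minus_commute)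
  qed
  with sub have sub': "cbox c d \<subseteq> \<Omega>" by blast
  have A0: "A i 0 t = 0" if "t \<notin> {c$i..d$i}" for i t
  proof -
    have "\<bar>(x$i - t) / \<epsilon>\<bar> \<ge> 1" using that \<epsilon> by (auto simp: c_def d_def)
    then show ?thesis using \<epsilon> by (simp add: A_def bump_support diff_divide_distrib)
  qed
  have "tensor (A 1) (A 2) 0 0 \<in> test_functions \<Omega>"
    by (rule tensor_test_function[OF A A _ _ sub']) (simp_all add: A0)
  with v have "(\<integral>y. iterated_deriv (dirs a b) (tensor (A 1) (A 2) 0 0) y *\<^sub>R u y \<partial>lebesgue_on \<Omega>)
          = (- 1) ^ length (dirs a b) * (\<integral>y. tensor (A 1) (A 2) 0 0 y *\<^sub>R v y \<partial>lebesgue_on \<Omega>)"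
    unfolding has_weak_deriv_def by blast
  then have "(\<integral>y. (-1) ^ (a + b) *\<^sub>R mollifier \<epsilon> a b (x - y) *\<^sub>R u y \<partial>lebesgue_on \<Omega>)
      = (- 1) ^ (a + b) * (\<integral>y. mollifier \<epsilon> 0 0 (x - y) *\<^sub>R v y \<partial>lebesgue_on \<Omega>)"
    unfolding iterated_deriv_dirs_tensor[OF A A] eq by (simp add: dirs_def)
  then show ?thesis unfolding mollify_def integral_scaleR_right
    by (cases "even (a + b)") auto
qed

lemma nn_integral_affine:
  fixes f :: "'a::euclidean_space \<Rightarrow> ennreal"
  assumes [measurable]: "f \<in> borel_measurable borel" and c: "c \<noteq> 0"
  shows "(\<integral>\<^sup>+x. f x \<partial>lborel) = ennreal (\<bar>c\<bar> ^ DIM('a)) * (\<integral>\<^sup>+x. f (t + c *\<^sub>R x) \<partial>lborel)"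
  by (subst lborel_affine[OF c, of t])
    (simp add: nn_integral_density nn_integral_distr nn_integral_cmult)

lemma mollifier_nonneg: "\<epsilon> > 0 \<Longrightarrow> 0 \<le> mollifier \<epsilon> 0 0 x"
  unfolding mollifier_def tensor_def scaled_bump_def by (intro mult_nonneg_nonneg bump_nonneg) auto

lemma mollifier_support: "\<epsilon> > 0 \<Longrightarrow> norm x > 2 * \<epsilon> \<Longrightarrow> mollifier \<epsilon> a b x = 0"
proof -
  assume \<epsilon>: "\<epsilon> > 0" and x: "norm x > 2 * \<epsilon>"
  have "norm x \<le> \<bar>x$1\<bar> + \<bar>x$2\<bar>" using norm_le_l1_cart[of x] by (simp add: sum_2)
  with x have "\<bar>x$1\<bar> > \<epsilon> \<or> \<bar>x$2\<bar> > \<epsilon>" by linarith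
  then have "\<bar>(1/\<epsilon>) * x$1 + 0\<bar> \<ge> 1 \<or> \<bar>(1/\<epsilon>) * x$2 + 0\<bar> \<ge> 1" using \<epsilon> by (auto simp: abs_mult)
  then show ?thesis by (auto simp: mollifier_def tensor_def scaled_bump_def bump_support simp del: add_0_right)
qed

lemma nn_integral_scaled_bump:
  assumes "\<epsilon> > 0" shows "(\<integral>\<^sup>+t. ennreal (scaled_bump \<epsilon> 0 t) \<partial>lborel) = 1"
proof -
  have b: "bump 0 \<in> borel_measurable borel"
    by (intro borel_measurable_continuous_onI bump_continuous)
  have "(bump 0 has_integral 1) UNIV"
    using bump_has_integral by (rule has_integral_on_superset) (auto simp: bump_support)
  from nn_integral_has_integral_lborel[OF b bump_nonneg this]
  have 1: "(\<integral>\<^sup>+t. ennreal (bump 0 t) \<partial>lborel) = 1" by simp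
  have "(\<integral>\<^sup>+t. ennreal (scaled_bump \<epsilon> 0 t) \<partial>lborel) = (\<integral>\<^sup>+t. ennreal (1/\<epsilon>) * ennreal (bump 0 (0 + (1/\<epsilon>) * t)) \<partial>lborel)"
    using assms by (intro nn_integral_cong) (simp add: scaled_bump_def ennreal_mult[symmetric] bump_nonneg)
  also have "\<dots> = ennreal \<bar>1/\<epsilon>\<bar> * (\<integral>\<^sup>+t. ennreal (bump 0 (0 + (1/\<epsilon>) * t)) \<partial>lborel)"
    using assms b by (subst nn_integral_cmult) auto
  also have "\<dots> = (\<integral>\<^sup>+t. ennreal (bump 0 t) \<partial>lborel)"
    using assms b by (intro nn_integral_real_affine[symmetric]) auto
  finally show ?thesis using 1 by simp
qed

lemma nn_integral_mollifier:
  assumes "\<epsilon> > 0" shows "(\<integral>\<^sup>+x. ennreal (mollifier \<epsilon> 0 0 x) \<partial>lborel) = 1"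
proof -
  have m: "scaled_bump \<epsilon> 0 \<in> borel_measurable borel"
    by (intro borel_measurable_continuous_onI deriv_family_continuous deriv_family_scaled_bump)
  have nn: "0 \<le> scaled_bump \<epsilon> 0 t" for t using assms by (simp add: scaled_bump_def bump_nonneg)
  have "ennreal (mollifier \<epsilon> 0 0 x) = (\<Prod>b\<in>Basis. ennreal (scaled_bump \<epsilon> 0 (x \<bullet> b)))" for x :: "real^2"
    by (simp add: Basis_real2 mollifier_def tensor_def inner_axis ennreal_mult nn)
  then have "(\<integral>\<^sup>+x. ennreal (mollifier \<epsilon> 0 0 x) \<partial>lborel)
      = (\<integral>\<^sup>+x. (\<Prod>b\<in>Basis. ennreal (scaled_bump \<epsilon> 0 (x \<bullet> b))) \<partial>(lborel :: (real^2) measure))" by simp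
  also have "\<dots> = (\<Prod>b\<in>(Basis::(real^2) set). (\<integral>\<^sup>+t. ennreal (scaled_bump \<epsilon> 0 t) \<partial>lborel))"
    using m by (intro nn_integral_lborel_prod) auto
  finally show ?thesis by (simp add: nn_integral_scaled_bump[OF assms])
qed

lemma nn_integral_mollifier_shift:
  assumes "\<epsilon> > 0"
  shows "(\<integral>\<^sup>+x. ennreal (mollifier \<epsilon> 0 0 (x - y)) \<partial>lborel) = 1"
    "(\<integral>\<^sup>+y. ennreal (mollifier \<epsilon> 0 0 (x - y)) \<partial>lborel) = 1"
proof -
  have m: "mollifier \<epsilon> 0 0 \<in> borel_measurable borel"
    by (intro borel_measurable_continuous_onI mollifier_continuous)
  show "(\<integral>\<^sup>+x. ennreal (mollifier \<epsilon> 0 0 (x - y)) \<partial>lborel) = 1"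
    using nn_integral_affine[of "\<lambda>x. ennreal (mollifier \<epsilon> 0 0 x)" 1 "- y"] m nn_integral_mollifier[OF assms]
    by simp
  show "(\<integral>\<^sup>+y. ennreal (mollifier \<epsilon> 0 0 (x - y)) \<partial>lborel) = 1"
    using nn_integral_affine[of "\<lambda>x. ennreal (mollifier \<epsilon> 0 0 x)" "-1" x] m nn_integral_mollifier[OF assms]
    by simp
qed

text \<open>Tonelli, as the kernel has mass one in \<open>x\<close> for each fixed \<open>y\<close>.
  Because the mass does not depend on \<open>\<epsilon>\<close>, the energy bounds are uniform in
  the mollification.\<close>

lemma nn_integral_mollify:
  fixes H :: "real^2 \<Rightarrow> real"
  assumes \<epsilon>: "\<epsilon> > 0" and \<Omega>: "\<Omega> \<in> sets lebesgue" and H: "integrable (lebesgue_on \<Omega>) H" "\<And>y. 0 \<le> H y"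
  shows "(\<integral>\<^sup>+x. ennreal (mollify \<Omega> \<epsilon> 0 0 H x) \<partial>lborel) = ennreal (\<integral>y. H y \<partial>lebesgue_on \<Omega>)"
proof -
  have Hm: "H \<in> borel_measurable (lebesgue_on \<Omega>)" using H by auto
  have "(\<lambda>y. ennreal (H y) * indicator \<Omega> y) \<in> borel_measurable lebesgue"
  proof -
    have "(\<lambda>y. if y \<in> \<Omega> then H y else 0) \<in> borel_measurable lebesgue"
      using Hm \<Omega> by (simp add: borel_measurable_if)
    then have "(\<lambda>y. ennreal (if y \<in> \<Omega> then H y else 0)) \<in> borel_measurable lebesgue" by measurable
    then show ?thesis by (rule back_subst[where P="\<lambda>f. f \<in> borel_measurable lebesgue"]) (auto simp: fun_eq_iff)
  qed
  \<comment> \<open>Tonelli's theorem is applied to the Borel product measure, so the Lebesgue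
    measurable integrand is exchanged for a Borel function that equals it almost everywhere.\<close>
  then obtain g where g[measurable]: "g \<in> borel_measurable lborel"
    and ge: "AE y in lborel. ennreal (H y) * indicator \<Omega> y = g y"
    using completion_ex_borel_measurable by blast
  have [measurable]: "mollifier \<epsilon> 0 0 \<in> borel_measurable borel"
    by (intro borel_measurable_continuous_onI mollifier_continuous)
  have eq: "ennreal (mollify \<Omega> \<epsilon> 0 0 H x) = (\<integral>\<^sup>+y. ennreal (mollifier \<epsilon> 0 0 (x - y)) * g y \<partial>lborel)" for x
  proof -
    have "ennreal (mollify \<Omega> \<epsilon> 0 0 H x) = (\<integral>\<^sup>+y. ennreal (mollifier \<epsilon> 0 0 (x - y) *\<^sub>R H y) \<partial>lebesgue_on \<Omega>)"
      unfolding mollify_def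
      by (intro nn_integral_eq_integral[symmetric] mollify_integrable H AE_I2)
        (simp add: H mollifier_nonneg[OF \<epsilon>])
    also have "\<dots> = (\<integral>\<^sup>+y. ennreal (mollifier \<epsilon> 0 0 (x - y)) * (ennreal (H y) * indicator \<Omega> y) \<partial>lborel)"
      using \<Omega> by (simp add: nn_integral_restrict_space nn_integral_completion ennreal_mult H mollifier_nonneg[OF \<epsilon>] mult.assoc)
    also have "\<dots> = (\<integral>\<^sup>+y. ennreal (mollifier \<epsilon> 0 0 (x - y)) * g y \<partial>lborel)"
      by (intro nn_integral_cong_AE) (use ge in eventually_elim, simp)
    finally show ?thesis .
  qed
  have "(\<integral>\<^sup>+x. ennreal (mollify \<Omega> \<epsilon> 0 0 H x) \<partial>lborel)
      = (\<integral>\<^sup>+x. \<integral>\<^sup>+y. ennreal (mollifier \<epsilon> 0 0 (x - y)) * g y \<partial>lborel \<partial>lborel)"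
    by (simp add: eq)
  also have "\<dots> = (\<integral>\<^sup>+y. \<integral>\<^sup>+x. ennreal (mollifier \<epsilon> 0 0 (x - y)) * g y \<partial>lborel \<partial>lborel)"
    by (intro lborel_pair.Fubini') measurable
  also have "\<dots> = (\<integral>\<^sup>+y. (\<integral>\<^sup>+x. ennreal (mollifier \<epsilon> 0 0 (x - y)) \<partial>lborel) * g y \<partial>lborel)"
    by (intro nn_integral_cong nn_integral_multc) measurable
  also have "\<dots> = (\<integral>\<^sup>+y. g y \<partial>lborel)" by (simp add: nn_integral_mollifier_shift[OF \<epsilon>])
  also have "\<dots> = (\<integral>\<^sup>+y. ennreal (H y) * indicator \<Omega> y \<partial>lborel)"
    by (intro nn_integral_cong_AE) (use ge in eventually_elim, simp)
  also have "\<dots> = (\<integral>\<^sup>+y. ennreal (H y) \<partial>lebesgue_on \<Omega>)"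
    using \<Omega> by (simp add: nn_integral_restrict_space nn_integral_completion)
  also have "\<dots> = ennreal (\<integral>y. H y \<partial>lebesgue_on \<Omega>)"
    using H by (intro nn_integral_eq_integral) auto
  finally show ?thesis .
qed

lemma integrable_mollifier_shift:
  assumes \<epsilon>: "\<epsilon> > 0" and \<Omega>: "\<Omega> \<in> sets lebesgue"
  shows "integrable (lebesgue_on \<Omega>) (\<lambda>y. mollifier \<epsilon> 0 0 (x - y))"
    "(\<integral>y. mollifier \<epsilon> 0 0 (x - y) \<partial>lebesgue_on \<Omega>) \<le> 1"
    "cball x (2 * \<epsilon>) \<subseteq> \<Omega> \<Longrightarrow> (\<integral>y. mollifier \<epsilon> 0 0 (x - y) \<partial>lebesgue_on \<Omega>) = 1"
proof -
  let ?f = "\<lambda>y. mollifier \<epsilon> 0 0 (x - y)"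
  have e: "(\<integral>\<^sup>+y. ennreal (?f y) \<partial>lebesgue_on \<Omega>) = (\<integral>\<^sup>+y. ennreal (?f y) * indicator \<Omega> y \<partial>lborel)"
    using \<Omega> by (simp add: nn_integral_restrict_space nn_integral_completion)
  also have "\<dots> \<le> (\<integral>\<^sup>+y. ennreal (?f y) \<partial>lborel)"
    by (intro nn_integral_mono) (auto simp: indicator_def)
  finally have le: "(\<integral>\<^sup>+y. ennreal (?f y) \<partial>lebesgue_on \<Omega>) \<le> 1"
    by (simp add: nn_integral_mollifier_shift[OF \<epsilon>])
  then have lt: "(\<integral>\<^sup>+y. ennreal (?f y) \<partial>lebesgue_on \<Omega>) < \<infinity>"
    by (metis ennreal_one_less_top infinity_ennreal_def order_le_less_trans)
  show int: "integrable (lebesgue_on \<Omega>) ?f"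
    by (intro integrableI_nonneg mollifier_measurable lt AE_I2 mollifier_nonneg \<epsilon>)
  have eq: "(\<integral>\<^sup>+y. ennreal (?f y) \<partial>lebesgue_on \<Omega>) = ennreal (\<integral>y. ?f y \<partial>lebesgue_on \<Omega>)"
    by (intro nn_integral_eq_integral int AE_I2 mollifier_nonneg \<epsilon>)
  show "(\<integral>y. ?f y \<partial>lebesgue_on \<Omega>) \<le> 1" using le unfolding eq by simp
  assume sub: "cball x (2 * \<epsilon>) \<subseteq> \<Omega>"
  have "ennreal (?f y) * indicator \<Omega> y = ennreal (?f y)" for y
  proof (cases "y \<in> \<Omega>")
    case False
    then have "norm (x - y) > 2 * \<epsilon>" using sub by (force simp: dist_norm subset_iff)
    then show ?thesis by (simp add: mollifier_support[OF \<epsilon>])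
  qed auto
  then have "ennreal (\<integral>y. ?f y \<partial>lebesgue_on \<Omega>) = 1"
    unfolding eq[symmetric] e by (simp add: nn_integral_mollifier_shift[OF \<epsilon>])
  then show "(\<integral>y. ?f y \<partial>lebesgue_on \<Omega>) = 1" by simp
qed

text \<open>The kernel is a probability density on the disc of radius \<open>2 * \<epsilon>\<close>,
  so the mean deviates from \<open>u x\<close> by no more than the values do.\<close>

lemma mollify_close:
  fixes u :: "real^2 \<Rightarrow> 'b::{banach,second_countable_topology}"
  assumes \<epsilon>: "\<epsilon> > 0" and \<Omega>: "\<Omega> \<in> sets lebesgue" and u: "integrable (lebesgue_on \<Omega>) u"
    and sub: "cball x (2 * \<epsilon>) \<subseteq> \<Omega>" and e: "\<And>y. y \<in> cball x (2 * \<epsilon>) \<Longrightarrow> norm (u y - u x) \<le> e"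
  shows "norm (mollify \<Omega> \<epsilon> 0 0 u x - u x) \<le> e"
proof -
  note m = integrable_mollifier_shift[OF \<epsilon> \<Omega>, of x]
  have mx: "integrable (lebesgue_on \<Omega>) (\<lambda>y. mollifier \<epsilon> 0 0 (x - y) *\<^sub>R u x)"
    using m(1) by (intro integrable_scaleR_left) auto
  have "u x = (\<integral>y. mollifier \<epsilon> 0 0 (x - y) *\<^sub>R u x \<partial>lebesgue_on \<Omega>)"
    using m(1) m(3)[OF sub] by (subst integral_scaleR_left) auto
  then have "mollify \<Omega> \<epsilon> 0 0 u x - u x = (\<integral>y. mollifier \<epsilon> 0 0 (x - y) *\<^sub>R (u y - u x) \<partial>lebesgue_on \<Omega>)"
    unfolding mollify_def scaleR_diff_right
    using Bochner_Integration.integral_diff[OF mollify_integrable[OF u] mx] by simp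
  also have "norm \<dots> \<le> (\<integral>y. e * mollifier \<epsilon> 0 0 (x - y) \<partial>lebesgue_on \<Omega>)"
  proof (rule Bochner_Integration.integral_norm_bound_integral)
    show "integrable (lebesgue_on \<Omega>) (\<lambda>y. mollifier \<epsilon> 0 0 (x - y) *\<^sub>R (u y - u x))"
      unfolding scaleR_diff_right by (intro Bochner_Integration.integrable_diff mollify_integrable u mx)
    show "integrable (lebesgue_on \<Omega>) (\<lambda>y. e * mollifier \<epsilon> 0 0 (x - y))" using m(1) by simp
    fix y
    show "norm (mollifier \<epsilon> 0 0 (x - y) *\<^sub>R (u y - u x)) \<le> e * mollifier \<epsilon> 0 0 (x - y)"
    proof (cases "y \<in> cball x (2 * \<epsilon>)")
      case True
      then show ?thesis using e[OF True] mollifier_nonneg[OF \<epsilon>, of "x - y"]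
        by (simp add: mult.commute mult_right_mono)
    next
      case False
      then show ?thesis by (simp add: mollifier_support[OF \<epsilon>] dist_norm)
    qed
  qed
  also have "\<dots> = e" using m(3)[OF sub] by simp
  finally show ?thesis .
qed

text \<open>Young's inequality \<open>2 * norm v \<le> l + (norm v)\<^sup>2 / l\<close>, averaged
  with the kernel, replaces the Cauchy-Schwarz inequality. The parameter \<open>l\<close> stays free
  because it is chosen later according to the position on a segment, which produces the weight
  needed there.\<close>

lemma mollify_bound:
  fixes v :: "real^2 \<Rightarrow> complex" and H :: "real^2 \<Rightarrow> real"
  assumes \<epsilon>: "\<epsilon> > 0" and \<Omega>: "\<Omega> \<in> sets lebesgue" and v: "integrable (lebesgue_on \<Omega>) v"
    and H: "integrable (lebesgue_on \<Omega>) H" and l: "l > 0"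
    and le: "\<And>y. y \<in> cball x (2 * \<epsilon>) \<Longrightarrow> (norm (v y))\<^sup>2 \<le> H y"
  shows "norm (mollify \<Omega> \<epsilon> 0 0 v x) \<le> (l + mollify \<Omega> \<epsilon> 0 0 H x / l) / 2"
proof -
  note m = integrable_mollifier_shift[OF \<epsilon> \<Omega>, of x]
  note mH = mollify_integrable[OF H, of \<epsilon> 0 0 x]
  have "norm (mollify \<Omega> \<epsilon> 0 0 v x) \<le> (\<integral>y. (l/2) * mollifier \<epsilon> 0 0 (x - y) + (1/(2*l)) * (mollifier \<epsilon> 0 0 (x - y) *\<^sub>R H y) \<partial>lebesgue_on \<Omega>)"
    unfolding mollify_def
  proof (rule Bochner_Integration.integral_norm_bound_integral)
    show "integrable (lebesgue_on \<Omega>) (\<lambda>y. mollifier \<epsilon> 0 0 (x - y) *\<^sub>R v y)" by (rule mollify_integrable[OF v])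
    show "integrable (lebesgue_on \<Omega>) (\<lambda>y. (l/2) * mollifier \<epsilon> 0 0 (x - y) + (1/(2*l)) * (mollifier \<epsilon> 0 0 (x - y) *\<^sub>R H y))"
      by (intro Bochner_Integration.integrable_add integrable_mult_right mH m)
    fix y
    show "norm (mollifier \<epsilon> 0 0 (x - y) *\<^sub>R v y) \<le> (l/2) * mollifier \<epsilon> 0 0 (x - y) + (1/(2*l)) * (mollifier \<epsilon> 0 0 (x - y) *\<^sub>R H y)"
    proof (cases "y \<in> cball x (2 * \<epsilon>)")
      case True
      have "0 \<le> (l - norm (v y))\<^sup>2" by simp
      then have "2 * (l * norm (v y)) \<le> l * l + H y" using le[OF True] unfolding power2_diff by (simp add: power2_eq_square)
      then have "norm (v y) \<le> l/2 + (1/(2*l)) * H y" using l by (simp add: field_simps)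
      from mult_left_mono[OF this mollifier_nonneg[OF \<epsilon>, of "x - y"]] show ?thesis
        using mollifier_nonneg[OF \<epsilon>, of "x - y"] by (simp add: algebra_simps)
    next
      case False
      then show ?thesis by (simp add: mollifier_support[OF \<epsilon>] dist_norm)
    qed
  qed
  also have "\<dots> = (l/2) * (\<integral>y. mollifier \<epsilon> 0 0 (x - y) \<partial>lebesgue_on \<Omega>) + (1/(2*l)) * mollify \<Omega> \<epsilon> 0 0 H x"
    unfolding mollify_def
    by (subst Bochner_Integration.integral_add[OF integrable_mult_right[OF m(1)] integrable_mult_right[OF mH]])
      (simp only: integral_mult_right_zero)
  also have "\<dots> \<le> (l/2) * 1 + (1/(2*l)) * mollify \<Omega> \<epsilon> 0 0 H x"
    using l m(2) by (intro add_right_mono mult_left_mono) auto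
  also have "\<dots> = (l + mollify \<Omega> \<epsilon> 0 0 H x / l) / 2" using l by (simp add: field_simps)
  finally show ?thesis .
qed

section \<open>Quadratic interpolation on a grid\<close>

text \<open>The planar counterpart of \<open>deriv_family\<close>: \<open>g a b\<close> is the
  partial derivative of order \<open>(a, b)\<close> of \<open>g 0 0\<close>.\<close>

definition deriv_family2 :: "(nat \<Rightarrow> nat \<Rightarrow> real^2 \<Rightarrow> complex) \<Rightarrow> bool" where
  "deriv_family2 g \<longleftrightarrow> (\<forall>a b x. (g a b has_derivative
     (\<lambda>h. h$1 *\<^sub>R g (Suc a) b x + h$2 *\<^sub>R g a (Suc b) x)) (at x))"

definition centred_quad :: "real^2 \<Rightarrow> complex \<Rightarrow> complex \<Rightarrow> complex \<Rightarrow> complex \<Rightarrow> complex \<Rightarrow> complex \<Rightarrow> real^2 \<Rightarrow> complex" where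
  "centred_quad y c0 c1 c2 c3 c4 c5 x = c0 + (x$1 - y$1) *\<^sub>R c1 + (x$2 - y$2) *\<^sub>R c2 + (x$1 - y$1)\<^sup>2 *\<^sub>R c3
     + ((x$1 - y$1) * (x$2 - y$2)) *\<^sub>R c4 + (x$2 - y$2)\<^sup>2 *\<^sub>R c5"

definition pt :: "real^2 \<Rightarrow> real \<Rightarrow> real \<Rightarrow> real \<Rightarrow> real^2" where
  "pt y \<rho> s t = y + (\<rho> * s) *\<^sub>R axis 1 1 + (\<rho> * t) *\<^sub>R axis 2 1"

text \<open>Difference quotients on a square grid give the quadratic interpolant explicitly, so that no
  linear system has to be estimated.\<close>

definition grid_interp :: "real^2 \<Rightarrow> real \<Rightarrow> (real^2 \<Rightarrow> complex) \<Rightarrow> real^2 \<Rightarrow> complex" where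
  "grid_interp y \<rho> w = centred_quad y (w (pt y \<rho> 0 0))
     ((1/\<rho>) *\<^sub>R ((w (pt y \<rho> 1 0) - w (pt y \<rho> (-1) 0)) / 2))
     ((1/\<rho>) *\<^sub>R ((w (pt y \<rho> 0 1) - w (pt y \<rho> 0 (-1))) / 2))
     ((1/\<rho>\<^sup>2) *\<^sub>R ((w (pt y \<rho> 1 0) + w (pt y \<rho> (-1) 0) - 2 * w (pt y \<rho> 0 0)) / 2))
     ((1/\<rho>\<^sup>2) *\<^sub>R (w (pt y \<rho> 1 1) - w (pt y \<rho> 1 0) - w (pt y \<rho> 0 1) + w (pt y \<rho> 0 0)))
     ((1/\<rho>\<^sup>2) *\<^sub>R ((w (pt y \<rho> 0 1) + w (pt y \<rho> 0 (-1)) - 2 * w (pt y \<rho> 0 0)) / 2))"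

text \<open>Together with \<open>grid_interp2\<close> the gradient of \<open>grid_interp\<close>,
  written out because its components serve as affine approximations of the weak gradient.\<close>

definition grid_interp1 :: "real^2 \<Rightarrow> real \<Rightarrow> (real^2 \<Rightarrow> complex) \<Rightarrow> real^2 \<Rightarrow> complex" where
  "grid_interp1 y \<rho> w x = (1/\<rho>) *\<^sub>R ((w (pt y \<rho> 1 0) - w (pt y \<rho> (-1) 0)) / 2)
     + ((x$1 - y$1)/\<rho>\<^sup>2) *\<^sub>R (w (pt y \<rho> 1 0) + w (pt y \<rho> (-1) 0) - 2 * w (pt y \<rho> 0 0))
     + ((x$2 - y$2)/\<rho>\<^sup>2) *\<^sub>R (w (pt y \<rho> 1 1) - w (pt y \<rho> 1 0) - w (pt y \<rho> 0 1) + w (pt y \<rho> 0 0))"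

definition grid_interp2 :: "real^2 \<Rightarrow> real \<Rightarrow> (real^2 \<Rightarrow> complex) \<Rightarrow> real^2 \<Rightarrow> complex" where
  "grid_interp2 y \<rho> w x = (1/\<rho>) *\<^sub>R ((w (pt y \<rho> 0 1) - w (pt y \<rho> 0 (-1))) / 2)
     + ((x$2 - y$2)/\<rho>\<^sup>2) *\<^sub>R (w (pt y \<rho> 0 1) + w (pt y \<rho> 0 (-1)) - 2 * w (pt y \<rho> 0 0))
     + ((x$1 - y$1)/\<rho>\<^sup>2) *\<^sub>R (w (pt y \<rho> 1 1) - w (pt y \<rho> 1 0) - w (pt y \<rho> 0 1) + w (pt y \<rho> 0 0))"

lemma pt_nth [simp]: "pt y \<rho> s t $ 1 = y$1 + \<rho> * s" "pt y \<rho> s t $ 2 = y$2 + \<rho> * t"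
  by (simp_all add: pt_def)

lemma centred_quad_has_derivative:
  "(centred_quad y c0 c1 c2 c3 c4 c5 has_derivative
     (\<lambda>h. h$1 *\<^sub>R (c1 + (2 * (x$1 - y$1)) *\<^sub>R c3 + (x$2 - y$2) *\<^sub>R c4)
        + h$2 *\<^sub>R (c2 + (x$1 - y$1) *\<^sub>R c4 + (2 * (x$2 - y$2)) *\<^sub>R c5))) (at x)"
  unfolding centred_quad_def[abs_def] power2_eq_square
  by (auto intro!: derivative_eq_intros bounded_linear_imp_has_derivative[OF bounded_linear_vec_nth] simp: algebra_simps)

lemma grid_interp_has_derivative:
  "(grid_interp y \<rho> w has_derivative (\<lambda>h. h$1 *\<^sub>R grid_interp1 y \<rho> w x + h$2 *\<^sub>R grid_interp2 y \<rho> w x)) (at x)"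
proof -
  have h: "(2 * s / t) *\<^sub>R (z / 2) = (s/t) *\<^sub>R z" "s *\<^sub>R ((1/t) *\<^sub>R z) = (s/t) *\<^sub>R z"
    for s t and z :: complex by (simp_all add: scaleR_conv_of_real)
  show ?thesis
    unfolding grid_interp_def
    by (rule has_derivative_eq_rhs[OF centred_quad_has_derivative])
      (simp only: h fun_eq_iff grid_interp1_def grid_interp2_def ac_simps simp_thms)
qed

lemma centred_quad_in_P2: "centred_quad y c0 c1 c2 c3 c4 c5 \<in> P2"
proof -
  have "centred_quad y c0 c1 c2 c3 c4 c5 = (\<lambda>x. (c0 - y$1 *\<^sub>R c1 - y$2 *\<^sub>R c2 + (y$1)\<^sup>2 *\<^sub>R c3 + (y$1 * y$2) *\<^sub>R c4 + (y$2)\<^sup>2 *\<^sub>R c5)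
     + x$1 *\<^sub>R (c1 - (2 * y$1) *\<^sub>R c3 - y$2 *\<^sub>R c4) + x$2 *\<^sub>R (c2 - y$1 *\<^sub>R c4 - (2 * y$2) *\<^sub>R c5)
     + (x$1)\<^sup>2 *\<^sub>R c3 + (x$1 * x$2) *\<^sub>R c4 + (x$2)\<^sup>2 *\<^sub>R c5)"
    by (auto simp: fun_eq_iff centred_quad_def scaleR_conv_of_real power2_eq_square algebra_simps)
  then show ?thesis unfolding P2_def by blast
qed

lemma grid_interp_diff: "grid_interp y \<rho> (\<lambda>x. v x - w x) x = grid_interp y \<rho> v x - grid_interp y \<rho> w x" (is ?A)
  and grid_interp1_diff: "grid_interp1 y \<rho> (\<lambda>x. v x - w x) x = grid_interp1 y \<rho> v x - grid_interp1 y \<rho> w x" (is ?B)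
  and grid_interp2_diff: "grid_interp2 y \<rho> (\<lambda>x. v x - w x) x = grid_interp2 y \<rho> v x - grid_interp2 y \<rho> w x" (is ?C)
proof -
  have l: "s *\<^sub>R ((a - a' - (b - b')) / 2) = s *\<^sub>R ((a - b) / 2) - s *\<^sub>R ((a' - b') / 2)"
    "s *\<^sub>R ((a - a' + (b - b') - 2 * (c - c')) / 2) = s *\<^sub>R ((a + b - 2 * c) / 2) - s *\<^sub>R ((a' + b' - 2 * c') / 2)"
    "s *\<^sub>R (a - a' + (b - b') - 2 * (c - c')) = s *\<^sub>R (a + b - 2 * c) - s *\<^sub>R (a' + b' - 2 * c')"
    "s *\<^sub>R (a - a' - (b - b') - (c - c') + (d - d')) = s *\<^sub>R (a - b - c + d) - s *\<^sub>R (a' - b' - c' + d')"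
    for s and a b c d a' b' c' d' :: complex
    by (simp_all add: scaleR_conv_of_real diff_divide_distrib add_divide_distrib ring_distribs)
  have "centred_quad y (a0 - b0) (a1 - b1) (a2 - b2) (a3 - b3) (a4 - b4) (a5 - b5) x = centred_quad y a0 a1 a2 a3 a4 a5 x - centred_quad y b0 b1 b2 b3 b4 b5 x"
    for a0 a1 a2 a3 a4 a5 b0 b1 b2 b3 b4 b5
    by (simp add: centred_quad_def scaleR_diff_right)
  then show ?A by (simp only: grid_interp_def l)
  show ?B ?C by (simp_all only: grid_interp1_def grid_interp2_def l) simp_all
qed

text \<open>On quadratics the difference quotients are exact. The numbers \<open>a\<close> and
  \<open>b\<close> are the offset between the centre of the grid and that of the polynomial;
  \<open>scaleR\<close> is avoided so that ring normalisation applies.\<close>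

lemma grid_coeffs:
  fixes c :: "nat \<Rightarrow> complex" and r a b :: complex
  assumes "r \<noteq> 0"
  defines "q \<equiv> \<lambda>s t. c 0 + (a + r * s) * c 1 + (b + r * t) * c 2 + (a + r * s)\<^sup>2 * c 3 + (a + r * s) * (b + r * t) * c 4 + (b + r * t)\<^sup>2 * c 5"
  shows "(q 1 0 - q (-1) 0) / 2 = r * (c 1 + 2 * a * c 3 + b * c 4)"
    "(q 0 1 - q 0 (-1)) / 2 = r * (c 2 + a * c 4 + 2 * b * c 5)"
    "(q 1 0 + q (-1) 0 - 2 * q 0 0) / 2 = r\<^sup>2 * c 3"
    "q 1 0 + q (-1) 0 - 2 * q 0 0 = 2 * r\<^sup>2 * c 3"
    "q 1 1 - q 1 0 - q 0 1 + q 0 0 = r\<^sup>2 * c 4"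
    "(q 0 1 + q 0 (-1) - 2 * q 0 0) / 2 = r\<^sup>2 * c 5"
    "q 0 1 + q 0 (-1) - 2 * q 0 0 = 2 * r\<^sup>2 * c 5"
  unfolding q_def by (simp_all add: field_simps power2_eq_square)

text \<open>Exactness of the difference quotients makes interpolation reproduce quadratics wherever
  they are centred. This is what allows a Taylor polynomial with an unspecified centre
  \<open>y\<close> to be subtracted inside a grid around \<open>y0\<close>.\<close>

lemma
  assumes "\<rho> \<noteq> 0"
  shows grid_interp_centred_quad: "grid_interp y0 \<rho> (centred_quad y c0 c1 c2 c3 c4 c5) x = centred_quad y c0 c1 c2 c3 c4 c5 x" (is ?A)
    and grid_interp1_centred_quad: "grid_interp1 y0 \<rho> (centred_quad y c0 c1 c2 c3 c4 c5) x = c1 + (2 * (x$1 - y$1)) *\<^sub>R c3 + (x$2 - y$2) *\<^sub>R c4" (is ?B)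
    and grid_interp2_centred_quad: "grid_interp2 y0 \<rho> (centred_quad y c0 c1 c2 c3 c4 c5) x = c2 + (x$1 - y$1) *\<^sub>R c4 + (2 * (x$2 - y$2)) *\<^sub>R c5" (is ?C)
proof -
  define c where "c n = (if n = 0 then c0 else if n = 1 then c1 else if n = 2 then c2 else if n = 3 then c3 else if n = 4 then c4 else c5)" for n :: nat
  define a where "a = complex_of_real (y0$1 - y$1)"
  define b where "b = complex_of_real (y0$2 - y$2)"
  define r where "r = complex_of_real \<rho>"
  have r: "r \<noteq> 0" using assms by (simp add: r_def)
  have q: "centred_quad y c0 c1 c2 c3 c4 c5 (pt y0 \<rho> s t) = c 0 + (a + r * of_real s) * c 1 + (b + r * of_real t) * c 2
      + (a + r * of_real s)\<^sup>2 * c 3 + (a + r * of_real s) * (b + r * of_real t) * c 4 + (b + r * of_real t)\<^sup>2 * c 5" for s t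
    by (simp add: centred_quad_def c_def a_def b_def r_def scaleR_conv_of_real power2_eq_square algebra_simps)
  note co = grid_coeffs[OF r, of c a b]
  let ?q = "centred_quad y c0 c1 c2 c3 c4 c5"
  have e: "(?q (pt y0 \<rho> 1 0) - ?q (pt y0 \<rho> (-1) 0)) / 2 = r * (c 1 + 2 * a * c 3 + b * c 4)"
    "(?q (pt y0 \<rho> 0 1) - ?q (pt y0 \<rho> 0 (-1))) / 2 = r * (c 2 + a * c 4 + 2 * b * c 5)"
    "(?q (pt y0 \<rho> 1 0) + ?q (pt y0 \<rho> (-1) 0) - 2 * ?q (pt y0 \<rho> 0 0)) / 2 = r\<^sup>2 * c 3"
    "?q (pt y0 \<rho> 1 0) + ?q (pt y0 \<rho> (-1) 0) - 2 * ?q (pt y0 \<rho> 0 0) = 2 * r\<^sup>2 * c 3"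
    "?q (pt y0 \<rho> 1 1) - ?q (pt y0 \<rho> 1 0) - ?q (pt y0 \<rho> 0 1) + ?q (pt y0 \<rho> 0 0) = r\<^sup>2 * c 4"
    "(?q (pt y0 \<rho> 0 1) + ?q (pt y0 \<rho> 0 (-1)) - 2 * ?q (pt y0 \<rho> 0 0)) / 2 = r\<^sup>2 * c 5"
    "?q (pt y0 \<rho> 0 1) + ?q (pt y0 \<rho> 0 (-1)) - 2 * ?q (pt y0 \<rho> 0 0) = 2 * r\<^sup>2 * c 5"
    unfolding q using co by simp_all
  have q0: "?q (pt y0 \<rho> 0 0) = c 0 + a * c 1 + b * c 2 + a\<^sup>2 * c 3 + a * b * c 4 + b\<^sup>2 * c 5" by (simp add: q)
  have x: "complex_of_real (x$1) = complex_of_real (y$1) + a + (of_real (x$1) - of_real (y0$1))"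
    "complex_of_real (x$2) = complex_of_real (y$2) + b + (of_real (x$2) - of_real (y0$2))"
    by (simp_all add: a_def b_def)
  have r1: "(1/\<rho>) *\<^sub>R (r * z) = z" "(1/\<rho>\<^sup>2) *\<^sub>R (r\<^sup>2 * z) = z"
    "(u/\<rho>\<^sup>2) *\<^sub>R (2 * r\<^sup>2 * z) = of_real u * 2 * z" "(u/\<rho>\<^sup>2) *\<^sub>R (r\<^sup>2 * z) = of_real u * z" for z u
    using assms by (simp_all add: r_def scaleR_conv_of_real field_simps)
  show ?A unfolding grid_interp_def e(1,2,3,5,6) r1 unfolding q0 unfolding centred_quad_def
    by (simp add: scaleR_conv_of_real a_def b_def c_def power2_eq_square algebra_simps)
  show ?B unfolding grid_interp1_def e r1
    by (simp add: scaleR_conv_of_real a_def b_def c_def power2_eq_square algebra_simps)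
  show ?C unfolding grid_interp2_def e r1
    by (simp add: scaleR_conv_of_real a_def b_def c_def power2_eq_square algebra_simps)
qed

text \<open>The conditions on \<open>s\<close> and \<open>t\<close> select exactly the six points
  used: the centre, its four neighbours and \<open>(1, 1)\<close>. With \<open>K\<close> bounding
  the distance of \<open>x\<close> in units of the grid step, the terms add up to
  \<open>1 + 2 * K + 8 * K\<^sup>2\<close> and \<open>1 + 8 * K\<close>, which
  \<open>K \<ge> 1\<close> turns into the stated constants.\<close>

lemma grid_interp_bound:
  assumes \<rho>: "\<rho> > 0" and K: "K \<ge> 1" "\<bar>x$1 - y$1\<bar> \<le> K * \<rho>" "\<bar>x$2 - y$2\<bar> \<le> K * \<rho>"
    and w: "\<And>s t. s \<in> {-1,0,1} \<Longrightarrow> t \<in> {-1,0,1} \<Longrightarrow> s * t \<noteq> -1 \<Longrightarrow> s + t \<ge> -1 \<Longrightarrow> norm (w (pt y \<rho> s t)) \<le> m"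
  shows "norm (grid_interp y \<rho> w x) \<le> 11 * K\<^sup>2 * m"
    "norm (grid_interp1 y \<rho> w x) \<le> 9 * K * m / \<rho>"
    "norm (grid_interp2 y \<rho> w x) \<le> 9 * K * m / \<rho>"
proof -
  have n: "norm (w (pt y \<rho> 0 0)) \<le> m" "norm (w (pt y \<rho> 1 0)) \<le> m" "norm (w (pt y \<rho> (-1) 0)) \<le> m"
    "norm (w (pt y \<rho> 0 1)) \<le> m" "norm (w (pt y \<rho> 0 (-1))) \<le> m" "norm (w (pt y \<rho> 1 1)) \<le> m"
    using w by auto
  have m0: "0 \<le> m" using n(1) norm_ge_zero order_trans by blast
  have d1: "norm ((z1 - z2) / 2) \<le> m" if "norm z1 \<le> m" "norm z2 \<le> m" for z1 z2 :: complex
    using norm_triangle_ineq4[of z1 z2] that by (simp add: norm_divide)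
  have d2: "norm (z1 + z2 - 2 * z3) \<le> 4 * m" if "norm z1 \<le> m" "norm z2 \<le> m" "norm z3 \<le> m" for z1 z2 z3 :: complex
    using norm_triangle_ineq4[of "z1 + z2" "2 * z3"] norm_triangle_ineq[of z1 z2] that by (simp add: norm_mult)
  have d3: "norm (z1 - z2 - z3 + z4) \<le> 4 * m" if "norm z1 \<le> m" "norm z2 \<le> m" "norm z3 \<le> m" "norm z4 \<le> m" for z1 z2 z3 z4 :: complex
    using norm_triangle_ineq4[of z1 z2] norm_triangle_ineq4[of "z1 - z2" z3] norm_triangle_ineq[of "z1 - z2 - z3" z4] that by linarith
  define \<xi> where "\<xi> i = (x$i - y$i) / \<rho>" for i
  have \<xi>: "\<bar>\<xi> 1\<bar> \<le> K" "\<bar>\<xi> 2\<bar> \<le> K" using K \<rho> by (simp_all add: \<xi>_def field_simps)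
  have \<xi>\<xi>: "\<bar>\<xi> 1 * \<xi> 1\<bar> \<le> K * K" "\<bar>\<xi> 1 * \<xi> 2\<bar> \<le> K * K" "\<bar>\<xi> 2 * \<xi> 2\<bar> \<le> K * K"
    unfolding abs_mult by (intro mult_mono' \<xi> abs_ge_zero)+
  have KK: "1 \<le> K\<^sup>2" "K \<le> K\<^sup>2" using K(1) by (auto simp: power2_eq_square mult_le_cancel_left1 intro: order_trans)
  have sc: "norm (s *\<^sub>R z) \<le> k * l" if "\<bar>s\<bar> \<le> k" "norm z \<le> l" for s k l and z :: complex
    using that by (simp add: mult_mono')
  define w0 where "w0 = w (pt y \<rho> 0 0)"
  define z1 where "z1 = (w (pt y \<rho> 1 0) - w (pt y \<rho> (-1) 0)) / 2"
  define z2 where "z2 = (w (pt y \<rho> 0 1) - w (pt y \<rho> 0 (-1))) / 2"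
  define z3 where "z3 = w (pt y \<rho> 1 0) + w (pt y \<rho> (-1) 0) - 2 * w (pt y \<rho> 0 0)"
  define z4 where "z4 = w (pt y \<rho> 1 1) - w (pt y \<rho> 1 0) - w (pt y \<rho> 0 1) + w (pt y \<rho> 0 0)"
  define z5 where "z5 = w (pt y \<rho> 0 1) + w (pt y \<rho> 0 (-1)) - 2 * w (pt y \<rho> 0 0)"
  have z: "norm w0 \<le> m" "norm z1 \<le> m" "norm z2 \<le> m" "norm z3 \<le> 4 * m" "norm z4 \<le> 4 * m" "norm z5 \<le> 4 * m"
    unfolding w0_def z1_def z2_def z3_def z4_def z5_def by (intro n d1 d2 d3)+
  have "grid_interp y \<rho> w x = w0 + \<xi> 1 *\<^sub>R z1 + \<xi> 2 *\<^sub>R z2 + (\<xi> 1 * \<xi> 1) *\<^sub>R (z3 / 2) + (\<xi> 1 * \<xi> 2) *\<^sub>R z4 + (\<xi> 2 * \<xi> 2) *\<^sub>R (z5 / 2)"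
    unfolding grid_interp_def centred_quad_def w0_def[symmetric] z1_def[symmetric] z2_def[symmetric]
      z3_def[unfolded w0_def[symmetric], symmetric] z4_def[unfolded w0_def[symmetric], symmetric] z5_def[unfolded w0_def[symmetric], symmetric]
    by (simp add: \<xi>_def power2_eq_square)
  also have "norm \<dots> \<le> m + K * m + K * m + (K * K) * (2 * m) + (K * K) * (4 * m) + (K * K) * (2 * m)"
    using z by (intro norm_triangle_mono sc \<xi> \<xi>\<xi>) (auto simp: norm_divide)
  also have "\<dots> = (1 + K + K + 8 * K\<^sup>2) * m" by (simp add: power2_eq_square algebra_simps)
  also have "\<dots> \<le> (11 * K\<^sup>2) * m" using KK m0 by (intro mult_right_mono) auto
  finally show "norm (grid_interp y \<rho> w x) \<le> 11 * K\<^sup>2 * m" .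
  have K9: "m + K * (4 * m) + K * (4 * m) \<le> 9 * K * m"
    using mult_right_mono[OF K(1) m0] by simp
  have "grid_interp1 y \<rho> w x = (1/\<rho>) *\<^sub>R (z1 + \<xi> 1 *\<^sub>R z3 + \<xi> 2 *\<^sub>R z4)"
    unfolding grid_interp1_def z1_def[symmetric] z3_def[symmetric] z4_def[symmetric]
    by (simp add: \<xi>_def power2_eq_square scaleR_add_right)
  then have "norm (grid_interp1 y \<rho> w x) = norm (z1 + \<xi> 1 *\<^sub>R z3 + \<xi> 2 *\<^sub>R z4) / \<rho>" using \<rho> by simp
  also have "\<dots> \<le> (m + K * (4 * m) + K * (4 * m)) / \<rho>"
    using z \<rho> by (intro divide_right_mono norm_triangle_mono sc \<xi>) auto
  also have "\<dots> \<le> 9 * K * m / \<rho>" using K9 \<rho> by (intro divide_right_mono) auto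
  finally show "norm (grid_interp1 y \<rho> w x) \<le> 9 * K * m / \<rho>" .
  have "grid_interp2 y \<rho> w x = (1/\<rho>) *\<^sub>R (z2 + \<xi> 2 *\<^sub>R z5 + \<xi> 1 *\<^sub>R z4)"
    unfolding grid_interp2_def z2_def[symmetric] z5_def[symmetric] z4_def[symmetric]
    by (simp add: \<xi>_def power2_eq_square scaleR_add_right)
  then have "norm (grid_interp2 y \<rho> w x) = norm (z2 + \<xi> 2 *\<^sub>R z5 + \<xi> 1 *\<^sub>R z4) / \<rho>" using \<rho> by simp
  also have "\<dots> \<le> (m + K * (4 * m) + K * (4 * m)) / \<rho>"
    using z \<rho> by (intro divide_right_mono norm_triangle_mono sc \<xi>) auto
  also have "\<dots> \<le> 9 * K * m / \<rho>" using K9 \<rho> by (intro divide_right_mono) auto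
  finally show "norm (grid_interp2 y \<rho> w x) \<le> 9 * K * m / \<rho>" .
qed

section \<open>Averaged Taylor remainders\<close>

lemma line_avg_meas:
  fixes h :: "real^2 \<Rightarrow> real"
  assumes "continuous_on UNIV h"
  shows "(\<lambda>(t, y). ennreal ((1 - t)\<^sup>2 * h (y + t *\<^sub>R (p - y)))) \<in> borel_measurable (borel \<Otimes>\<^sub>M borel)"
proof -
  have "continuous_on UNIV (\<lambda>z :: real \<times> (real^2). (1 - fst z)\<^sup>2 * h (snd z + fst z *\<^sub>R (p - snd z)))"
    by (intro continuous_intros continuous_on_compose2[OF assms]) auto
  then have "(\<lambda>z :: real \<times> (real^2). (1 - fst z)\<^sup>2 * h (snd z + fst z *\<^sub>R (p - snd z))) \<in> borel_measurable borel"
    by (rule borel_measurable_continuous_onI)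
  then show ?thesis by (simp add: borel_prod case_prod_beta')
qed

text \<open>The weight is the Jacobian determinant of
  \<open>y \<mapsto> y + t *\<^sub>R (p - y)\<close> in the plane, so that integrating over all
  \<open>y\<close> never gives more than the integral of \<open>h\<close>.\<close>

definition line_avg :: "(real^2 \<Rightarrow> real) \<Rightarrow> real^2 \<Rightarrow> real^2 \<Rightarrow> real" where
  "line_avg h p y = integral {0..1} (\<lambda>t. (1 - t)\<^sup>2 * h (y + t *\<^sub>R (p - y)))"

lemma line_avg_integrable:
  fixes h :: "real^2 \<Rightarrow> real"
  assumes "continuous_on UNIV h"
  shows "(\<lambda>t. (1 - t)\<^sup>2 * h (y + t *\<^sub>R (p - y))) integrable_on {0..1}"
  by (intro integrable_continuous_real continuous_intros continuous_on_compose2[OF assms]) auto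

lemma line_avg_nonneg:
  assumes "continuous_on UNIV h" "\<And>x. 0 \<le> h x" shows "0 \<le> line_avg h p y"
  unfolding line_avg_def by (intro integral_nonneg line_avg_integrable assms) (simp add: assms)

lemma ennreal_line_avg:
  assumes h: "continuous_on UNIV h" "\<And>x. 0 \<le> h x"
  shows "ennreal (line_avg h p y) = (\<integral>\<^sup>+t. ennreal ((1 - t)\<^sup>2 * h (y + t *\<^sub>R (p - y))) * indicator {0..1} t \<partial>lborel)"
proof -
  have "((\<lambda>t. (1 - t)\<^sup>2 * h (y + t *\<^sub>R (p - y))) has_integral line_avg h p y) {0..1}"
    unfolding line_avg_def by (intro integrable_integral line_avg_integrable h)
  from nn_integral_has_integral_lebesgue'[OF _ this] show ?thesis using h(2) by simp
qed

text \<open>After Tonelli, for fixed \<open>t\<close> the substitution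
  \<open>x = t p + (1 - t) y\<close> absorbs the weight and leaves the full integral of
  \<open>h\<close>; the interval for \<open>t\<close> has length one. The map degenerates only at
  \<open>t = 1\<close>, a null set.\<close>

lemma nn_integral_line_avg:
  assumes h: "continuous_on UNIV h" "\<And>x. 0 \<le> h x"
  shows "(\<integral>\<^sup>+y. ennreal (line_avg h p y) \<partial>lborel) \<le> (\<integral>\<^sup>+x. ennreal (h x) \<partial>lborel)"
    and "(\<lambda>y. ennreal (line_avg h p y)) \<in> borel_measurable borel"
proof -
  define f where "f = (\<lambda>(t::real, y). ennreal ((1 - t)\<^sup>2 * h (y + t *\<^sub>R (p - y))) * indicator {0..1} t)"
  have fm: "f \<in> borel_measurable (lborel \<Otimes>\<^sub>M lborel)"
  proof -
    have [measurable]: "(\<lambda>(t, y). ennreal ((1 - t)\<^sup>2 * h (y + t *\<^sub>R (p - y)))) \<in> borel_measurable (lborel \<Otimes>\<^sub>M lborel)"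
      using line_avg_meas[OF h(1)] by (simp cong: measurable_cong_sets)
    have "(\<lambda>z. (case z of (t, y) \<Rightarrow> ennreal ((1 - t)\<^sup>2 * h (y + t *\<^sub>R (p - y)))) * indicator {0..1} (fst z)) \<in> borel_measurable (lborel \<Otimes>\<^sub>M lborel)"
      by measurable
    then show ?thesis by (simp add: f_def case_prod_beta')
  qed
  have e: "ennreal (line_avg h p y) = (\<integral>\<^sup>+t. f (t, y) \<partial>lborel)" for y
    unfolding ennreal_line_avg[OF h] f_def by simp
  have fm': "(\<lambda>(y, t). f (t, y)) \<in> borel_measurable (lborel \<Otimes>\<^sub>M lborel)"
    using measurable_compose[OF measurable_pair_swap' fm] by (simp add: case_prod_beta')
  show "(\<lambda>y. ennreal (line_avg h p y)) \<in> borel_measurable borel"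
    unfolding e using lborel.borel_measurable_nn_integral[OF fm'] by simp
  have inner: "(\<integral>\<^sup>+y. f (t, y) \<partial>lborel) \<le> (\<integral>\<^sup>+x. ennreal (h x) \<partial>lborel) * indicator {0..1} t" if "t \<noteq> 1" for t
  proof (cases "t \<in> {0..1}")
    case True
    have hm: "(\<lambda>x. ennreal (h x)) \<in> borel_measurable borel"
      using borel_measurable_continuous_onI[OF h(1)] by simp
    have "(\<integral>\<^sup>+x. ennreal (h x) \<partial>lborel) = ennreal (\<bar>1 - t\<bar> ^ DIM(real^2)) * (\<integral>\<^sup>+y. ennreal (h (t *\<^sub>R p + (1 - t) *\<^sub>R y)) \<partial>lborel)"
      using that by (intro nn_integral_affine hm) auto
    also have "\<dots> = (\<integral>\<^sup>+y. ennreal ((1 - t)\<^sup>2) * ennreal (h (t *\<^sub>R p + (1 - t) *\<^sub>R y)) \<partial>lborel)"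
      using hm by (subst nn_integral_cmult) (auto intro: measurable_compose)
    also have "\<dots> = (\<integral>\<^sup>+y. f (t, y) \<partial>lborel)"
      using True by (intro nn_integral_cong) (simp add: f_def ennreal_mult[symmetric] h algebra_simps)
    finally show ?thesis using True by simp
  qed (simp add: f_def)
  have "(\<integral>\<^sup>+y. ennreal (line_avg h p y) \<partial>lborel) = (\<integral>\<^sup>+y. \<integral>\<^sup>+t. f (t, y) \<partial>lborel \<partial>lborel)"
    by (simp add: e)
  also have "\<dots> = (\<integral>\<^sup>+t. \<integral>\<^sup>+y. f (t, y) \<partial>lborel \<partial>lborel)"
    using lborel_pair.Fubini'[of "\<lambda>t y. f (t, y)"] fm by simp
  also have "\<dots> \<le> (\<integral>\<^sup>+t. (\<integral>\<^sup>+x. ennreal (h x) \<partial>lborel) * indicator {0..1::real} t \<partial>lborel)"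
    by (intro nn_integral_mono_AE, rule AE_mp[OF AE_lborel_singleton[of 1]]) (auto intro!: inner)
  also have "\<dots> = (\<integral>\<^sup>+x. ennreal (h x) \<partial>lborel)"
    by (subst nn_integral_cmult) auto
  finally show "(\<integral>\<^sup>+y. ennreal (line_avg h p y) \<partial>lborel) \<le> (\<integral>\<^sup>+x. ennreal (h x) \<partial>lborel)" .
qed

text \<open>Otherwise the sum would exceed \<open>t\<close> on the whole disc, and its integral, at
  most \<open>card ps * A\<close>, would be at least \<open>t\<close> times the area. Summing over
  \<open>ps\<close> provides one centre that serves all end points at once.\<close>

lemma good_centre_exists:
  assumes h: "continuous_on UNIV h" "\<And>x. 0 \<le> h x" and A: "(\<integral>\<^sup>+x. ennreal (h x) \<partial>lborel) \<le> ennreal A" "0 \<le> A"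
    and r: "r > 0" and ps: "finite ps" and t: "real (card ps) * A < t * (pi * r\<^sup>2)"
  shows "\<exists>y\<in>ball (y0::real^2) r. (\<Sum>p\<in>ps. line_avg h p y) \<le> t"
proof (rule ccontr)
  assume "\<not> ?thesis"
  then have gt: "t \<le> (\<Sum>p\<in>ps. line_avg h p y)" if "y \<in> ball y0 r" for y using that by force
  have t0: "0 \<le> t"
  proof -
    have "0 \<le> real (card ps) * A" using A(2) by simp
    then have "0 < t * (pi * r\<^sup>2)" using t by linarith
    then show ?thesis using r by (auto simp: zero_less_mult_iff mult_less_0_iff)
  qed
  have v: "emeasure lborel (ball y0 r) = ennreal (pi * r\<^sup>2)"
    using r by (simp add: emeasure_ball unit_ball_vol_2)
  have "ennreal (t * (pi * r\<^sup>2)) = (\<integral>\<^sup>+y. ennreal t * indicator (ball y0 r) y \<partial>lborel)"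
    using t0 by (simp add: nn_integral_cmult_indicator v ennreal_mult)
  also have "\<dots> \<le> (\<integral>\<^sup>+y. (\<Sum>p\<in>ps. ennreal (line_avg h p y)) \<partial>lborel)"
    by (intro nn_integral_mono) (auto simp: indicator_def line_avg_nonneg[OF h] sum_ennreal intro!: ennreal_leI gt)
  also have "\<dots> = (\<Sum>p\<in>ps. \<integral>\<^sup>+y. ennreal (line_avg h p y) \<partial>lborel)"
    using nn_integral_line_avg(2)[OF h] by (intro nn_integral_sum) simp
  also have "\<dots> \<le> (\<Sum>p\<in>ps. ennreal A)"
    by (intro sum_mono order_trans[OF nn_integral_line_avg(1)[OF h] A(1)])
  also have "\<dots> = ennreal (real (card ps) * A)"
    by (simp add: A(2) ennreal_mult ennreal_of_nat_eq_real_of_nat)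
  finally have "t * (pi * r\<^sup>2) \<le> real (card ps) * A" using A(2) by (simp add: ennreal_le_iff)
  with t show False by simp
qed

lemma deriv_family2_line:
  assumes "deriv_family2 g"
  shows "((\<lambda>t. g a b (y + t *\<^sub>R d)) has_vector_derivative
     (d$1 *\<^sub>R g (Suc a) b (y + t *\<^sub>R d) + d$2 *\<^sub>R g a (Suc b) (y + t *\<^sub>R d))) (at t within S)"
proof -
  have 1: "(g a b has_derivative (\<lambda>h. h$1 *\<^sub>R g (Suc a) b (y + t *\<^sub>R d) + h$2 *\<^sub>R g a (Suc b) (y + t *\<^sub>R d))) (at (y + t *\<^sub>R d))"
    using assms by (simp add: deriv_family2_def)
  have 2: "((\<lambda>t. y + t *\<^sub>R d) has_derivative (\<lambda>s. s *\<^sub>R d)) (at t within S)"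
    by (auto intro!: derivative_eq_intros)
  show ?thesis
    unfolding has_vector_derivative_def
    by (rule has_derivative_eq_rhs[OF has_derivative_compose[OF 2 1]]) (auto simp: algebra_simps)
qed

text \<open>The remainder is controlled by the weighted average \<open>line_avg\<close>: at distance parameter \<open>s = 1 - t\<close> from
  the end point the bound on the derivative is used with \<open>l = \<mu> / s\<close>, which absorbs the weight.\<close>

lemma weighted_bound:
  assumes l: "\<And>l. l > 0 \<Longrightarrow> z \<le> (l + H / l) / (2::real)" and s: "0 \<le> s" and \<mu>: "\<mu> > 0" and H: "0 \<le> H"
  shows "s * z \<le> (\<mu> + s\<^sup>2 * H / \<mu>) / 2"
proof (cases "s = 0")
  case False
  then have s0: "s > 0" using s by simp
  have "s * z \<le> s * ((\<mu>/s + H / (\<mu>/s)) / 2)" by (intro mult_left_mono l) (use s0 \<mu> in auto)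
  also have "\<dots> = (\<mu> + s\<^sup>2 * H / \<mu>) / 2" using s0 \<mu> by (simp add: field_simps power2_eq_square)
  finally show ?thesis .
qed (use \<mu> H in simp)

lemma integral_weighted_bound:
  fixes f :: "real \<Rightarrow> complex"
  assumes h: "continuous_on UNIV h" and f: "f integrable_on {0..1}"
    and le: "\<And>t. 0 \<le> t \<Longrightarrow> t \<le> 1 \<Longrightarrow> norm (f t) \<le> c * ((\<mu> + (1 - t)\<^sup>2 * h (y + t *\<^sub>R (p - y)) / \<mu>) / 2)"
  shows "norm (integral {0..1} f) \<le> c * ((\<mu> + line_avg h p y / \<mu>) / 2)"
proof -
  note i = line_avg_integrable[OF h, of y p]
  have j: "((\<lambda>t. c * ((\<mu> + (1 - t)\<^sup>2 * h (y + t *\<^sub>R (p - y)) / \<mu>) / 2)) has_integral c * (((1 - 0) *\<^sub>R \<mu> + line_avg h p y / \<mu>) / 2)) {0..1}"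
    unfolding line_avg_def
    by (intro has_integral_mult_right has_integral_divide has_integral_add integrable_integral[OF i])
      (use has_integral_const_real[of \<mu> 0 1] in simp)
  have "norm (integral {0..1} f) \<le> integral {0..1} (\<lambda>t. c * ((\<mu> + (1 - t)\<^sup>2 * h (y + t *\<^sub>R (p - y)) / \<mu>) / 2))"
    by (intro Henstock_Kurzweil_Integration.integral_norm_bound_integral f has_integral_integrable[OF j]) (simp only: atLeastAtMost_iff le)
  also have "\<dots> = c * ((\<mu> + line_avg h p y / \<mu>) / 2)" using integral_unique[OF j] by simp
  finally show ?thesis .
qed

definition taylor2 :: "(nat \<Rightarrow> nat \<Rightarrow> real^2 \<Rightarrow> complex) \<Rightarrow> real^2 \<Rightarrow> real^2 \<Rightarrow> complex" where
  "taylor2 g y = centred_quad y (g 0 0 y) (g 1 0 y) (g 0 1 y) ((1/2) *\<^sub>R g 2 0 y) (g 1 1 y) ((1/2) *\<^sub>R g 0 2 y)"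

text \<open>Of the weight \<open>(1 - t) ^ (p - 1)\<close> in the integral remainder only one factor
  \<open>1 - t\<close> is kept: it is what the weight in \<open>line_avg\<close> requires, and it is
  present for order two as well as for order three.\<close>

lemma taylor_remainder_bound:
  fixes D :: "nat \<Rightarrow> real \<Rightarrow> complex"
  assumes h: "continuous_on UNIV h" and p: "p > 1"
    and D: "\<And>m t. m < p \<Longrightarrow> (D m has_vector_derivative D (Suc m) t) (at t within {0..1})"
    and le: "\<And>t. 0 \<le> t \<Longrightarrow> t \<le> 1 \<Longrightarrow> (1 - t) * norm (D p t) \<le> c * ((\<mu> + (1 - t)\<^sup>2 * h (y + t *\<^sub>R (x - y)) / \<mu>) / 2)"
  shows "norm (D 0 1 - (\<Sum>i<p. D i 0 /\<^sub>R fact i)) \<le> c * ((\<mu> + line_avg h x y / \<mu>) / 2)"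
proof -
  let ?f = "\<lambda>t. ((1 - t) ^ (p - 1) / fact (p - 1)) *\<^sub>R D p t"
  have T: "D 0 1 = (\<Sum>i<p. ((1 - 0) ^ i / fact i) *\<^sub>R D i 0) + integral {0..1} ?f"
    by (rule Taylor_integral) (use p D in auto)
  have i: "?f integrable_on {0..1}" by (rule Taylor_integrable[of p D "D 0"]) (use p D in auto)
  have "norm (integral {0..1} ?f) \<le> c * ((\<mu> + line_avg h x y / \<mu>) / 2)"
  proof (rule integral_weighted_bound[OF h i])
    fix t :: real assume t: "0 \<le> t" "t \<le> 1"
    have "(1 - t) ^ (p - 1) / fact (p - 1) \<le> (1 - t) / 1"
    proof (rule frac_le)
      have "(1 - t) ^ (p - 1) \<le> (1 - t) ^ 1" using t p by (intro power_decreasing) auto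
      then show "(1 - t) ^ (p - 1) \<le> 1 - t" by simp
    qed (use t in \<open>auto simp: fact_ge_1\<close>)
    then have "norm (?f t) \<le> (1 - t) * norm (D p t)"
      using mult_right_mono[OF _ norm_ge_zero, of "(1 - t) ^ (p - 1) / fact (p - 1)" "1 - t" "D p t"] t
      by (simp add: abs_mult)
    also note le[OF t]
    finally show "norm (?f t) \<le> c * ((\<mu> + (1 - t)\<^sup>2 * h (y + t *\<^sub>R (x - y)) / \<mu>) / 2)" .
  qed
  then show ?thesis using T by (simp add: inverse_eq_divide)
qed

text \<open>The coefficients \<open>1 + 3 + 3 + 1 = 8\<close> of the third directional derivative,
  halved by Young's inequality, give the constant 4.\<close>

lemma taylor2_remainder:
  assumes g: "deriv_family2 g" and h: "continuous_on UNIV h" "\<And>x. 0 \<le> h x"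
    and bound: "\<And>z a b l. z \<in> closed_segment y x \<Longrightarrow> a + b = 3 \<Longrightarrow> l > 0 \<Longrightarrow> norm (g a b z) \<le> (l + h z / l) / 2"
    and d: "norm (x - y) \<le> d" and \<mu>: "\<mu> > 0"
  shows "norm (g 0 0 x - taylor2 g y x) \<le> 4 * d ^ 3 * (\<mu> + line_avg h x y / \<mu>)"
proof -
  define e where "e = x - y"
  let ?z = "\<lambda>t. y + t *\<^sub>R e"
  let ?G = "\<lambda>a b t. g a b (?z t)"
  \<comment> \<open>The successive derivatives of \<open>t \<mapsto> g 0 0 (y + t e)\<close>,
    expanded by the binomial formula in the partial derivatives of \<open>g\<close>.\<close>
  define D where "D n = (if n = 0 then ?G 0 0
     else if n = 1 then (\<lambda>t. e$1 *\<^sub>R ?G 1 0 t + e$2 *\<^sub>R ?G 0 1 t)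
     else if n = 2 then (\<lambda>t. (e$1)^2 *\<^sub>R ?G 2 0 t + (2 * e$1 * e$2) *\<^sub>R ?G 1 1 t + (e$2)^2 *\<^sub>R ?G 0 2 t)
     else (\<lambda>t. (e$1)^3 *\<^sub>R ?G 3 0 t + (3 * (e$1)^2 * e$2) *\<^sub>R ?G 2 1 t + (3 * e$1 * (e$2)^2) *\<^sub>R ?G 1 2 t + (e$2)^3 *\<^sub>R ?G 0 3 t))" for n :: nat
  have D: "D 0 = ?G 0 0" "D 1 = (\<lambda>t. e$1 *\<^sub>R ?G 1 0 t + e$2 *\<^sub>R ?G 0 1 t)"
    "D 2 = (\<lambda>t. (e$1)^2 *\<^sub>R ?G 2 0 t + (2 * e$1 * e$2) *\<^sub>R ?G 1 1 t + (e$2)^2 *\<^sub>R ?G 0 2 t)"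
    "D 3 = (\<lambda>t. (e$1)^3 *\<^sub>R ?G 3 0 t + (3 * (e$1)^2 * e$2) *\<^sub>R ?G 2 1 t + (3 * e$1 * (e$2)^2) *\<^sub>R ?G 1 2 t + (e$2)^3 *\<^sub>R ?G 0 3 t)"
    by (simp_all add: D_def)
  have G': "((\<lambda>t. c *\<^sub>R ?G a b t) has_vector_derivative c *\<^sub>R (e$1 *\<^sub>R ?G (Suc a) b t + e$2 *\<^sub>R ?G a (Suc b) t)) (at t within S)" for a b t S c
    by (intro bounded_linear.has_vector_derivative[OF bounded_linear_scaleR_right] deriv_family2_line[OF g])
  have D': "(D m has_vector_derivative D (Suc m) t) (at t within {0..1})" if "m < 3" for m t
  proof -
    consider "m = 0" | "m = 1" | "m = 2" using \<open>m < 3\<close> by linarith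
    then show ?thesis
    proof cases
      case 1
      then show ?thesis using G'[of 1 0 0 t] by (simp add: D_def)
    next
      case 2
      have eq: "D 2 t = e$1 *\<^sub>R (e$1 *\<^sub>R ?G (Suc 1) 0 t + e$2 *\<^sub>R ?G 1 (Suc 0) t) + e$2 *\<^sub>R (e$1 *\<^sub>R ?G (Suc 0) 1 t + e$2 *\<^sub>R ?G 0 (Suc 1) t)"
        unfolding D by (simp add: numeral_2_eq_2 power2_eq_square scaleR_conv_of_real algebra_simps)
      have "(D 1 has_vector_derivative D 2 t) (at t within {0..1})" unfolding eq unfolding D
        by (intro has_vector_derivative_add G')
      then show ?thesis using 2 by (simp add: numeral_2_eq_2)
    next
      case 3
      have eq: "D 3 t = (e$1)^2 *\<^sub>R (e$1 *\<^sub>R ?G (Suc 2) 0 t + e$2 *\<^sub>R ?G 2 (Suc 0) t)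
          + (2 * e$1 * e$2) *\<^sub>R (e$1 *\<^sub>R ?G (Suc 1) 1 t + e$2 *\<^sub>R ?G 1 (Suc 1) t)
          + (e$2)^2 *\<^sub>R (e$1 *\<^sub>R ?G (Suc 0) 2 t + e$2 *\<^sub>R ?G 0 (Suc 2) t)"
        unfolding D by (simp add: numeral_2_eq_2 numeral_3_eq_3 scaleR_conv_of_real algebra_simps)
      have "(D 2 has_vector_derivative D 3 t) (at t within {0..1})" unfolding eq unfolding D
        by (intro has_vector_derivative_add G')
      then show ?thesis using 3 by (simp add: numeral_3_eq_3 numeral_2_eq_2)
    qed
  qed
  have en: "\<bar>e$1\<bar> \<le> d" "\<bar>e$2\<bar> \<le> d" using d component_le_norm_cart[of e] by (auto simp: e_def intro: order_trans)
  have "norm (D 0 1 - (\<Sum>i<3. D i 0 /\<^sub>R fact i)) \<le> (8 * d ^ 3) * ((\<mu> + line_avg h x y / \<mu>) / 2)"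
  proof (rule taylor_remainder_bound[OF h(1)])
    fix t :: real assume t: "0 \<le> t" "t \<le> 1"
    define W where "W = (\<mu> + (1 - t)\<^sup>2 * h (y + t *\<^sub>R (x - y)) / \<mu>) / 2"
    have z: "?z t \<in> closed_segment y x"
      using t by (auto simp: e_def closed_segment_def algebra_simps intro!: exI[of _ t])
    have W: "(1 - t) * norm (?G a b t) \<le> W" if "a + b = 3" for a b
      unfolding W_def e_def[symmetric]
      by (rule weighted_bound[OF bound[OF z that]]) (use t \<mu> h(2) in auto)
    have s: "(1 - t) * norm (s *\<^sub>R ?G a b t) \<le> k * d ^ 3 * W" if "a + b = 3" "\<bar>s\<bar> \<le> k * d ^ 3" for a b s k
    proof -
      have "(1 - t) * norm (s *\<^sub>R ?G a b t) = \<bar>s\<bar> * ((1 - t) * norm (?G a b t))" by simp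
      also have "\<dots> \<le> (k * d ^ 3) * W" using that W[OF that(1)] t by (intro mult_mono) (auto intro: order_trans[OF abs_ge_zero])
      finally show ?thesis .
    qed
    have e3: "\<bar>e$i * e$j * e$k\<bar> \<le> d * d * d" for i j k
      using en exhaust_2[of i] exhaust_2[of j] exhaust_2[of k] unfolding abs_mult
      by (intro mult_mono) auto
    have "(1 - t) * norm (D 3 t) \<le> (1 - t) * (norm ((e$1)^3 *\<^sub>R ?G 3 0 t) + norm ((3 * (e$1)^2 * e$2) *\<^sub>R ?G 2 1 t)
        + norm ((3 * e$1 * (e$2)^2) *\<^sub>R ?G 1 2 t) + norm ((e$2)^3 *\<^sub>R ?G 0 3 t))"
      unfolding D using t by (intro mult_left_mono norm_triangle_le add_mono order_refl) auto
    also have "\<dots> = (1 - t) * norm ((e$1)^3 *\<^sub>R ?G 3 0 t) + (1 - t) * norm ((3 * (e$1)^2 * e$2) *\<^sub>R ?G 2 1 t)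
        + (1 - t) * norm ((3 * e$1 * (e$2)^2) *\<^sub>R ?G 1 2 t) + (1 - t) * norm ((e$2)^3 *\<^sub>R ?G 0 3 t)" by (simp only: distrib_left)
    also have "\<dots> \<le> 1 * d ^ 3 * W + 3 * d ^ 3 * W + 3 * d ^ 3 * W + 1 * d ^ 3 * W"
      using e3[of 1 1 1] e3[of 1 1 2] e3[of 1 2 2] e3[of 2 2 2]
      by (intro add_mono s) (auto simp: power3_eq_cube power2_eq_square abs_mult mult.assoc)
    finally show "(1 - t) * norm (D 3 t) \<le> 8 * d ^ 3 * ((\<mu> + (1 - t)\<^sup>2 * h (y + t *\<^sub>R (x - y)) / \<mu>) / 2)"
      by (simp add: W_def[symmetric] mult_ac)
  qed (auto intro: D')
  moreover have "D 0 1 = g 0 0 x" by (simp add: D e_def)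
  moreover have "(\<Sum>i<3. D i 0 /\<^sub>R fact i) = taylor2 g y x"
  proof -
    have "(\<Sum>i<3. D i 0 /\<^sub>R fact i) = D 0 0 + D 1 0 + (1/2) *\<^sub>R D 2 0"
      by (simp add: numeral_3_eq_3 numeral_2_eq_2)
    also have "\<dots> = taylor2 g y x"
      unfolding D by (simp add: taylor2_def centred_quad_def e_def scaleR_conv_of_real power2_eq_square algebra_simps)
    finally show ?thesis .
  qed
  ultimately show ?thesis by simp
qed

text \<open>The same argument one order lower, meant for the first derivatives of a function whose
  third derivatives are controlled; the coefficients \<open>1 + 2 + 1\<close> lead to the constant
  2.\<close>

lemma taylor1_remainder:
  assumes g: "deriv_family2 g" and h: "continuous_on UNIV h" "\<And>x. 0 \<le> h x"
    and bound: "\<And>z a b l. z \<in> closed_segment y x \<Longrightarrow> a + b = 2 \<Longrightarrow> l > 0 \<Longrightarrow> norm (g a b z) \<le> (l + h z / l) / 2"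
    and d: "norm (x - y) \<le> d" and \<mu>: "\<mu> > 0"
  shows "norm (g 0 0 x - (g 0 0 y + (x$1 - y$1) *\<^sub>R g 1 0 y + (x$2 - y$2) *\<^sub>R g 0 1 y)) \<le> 2 * d\<^sup>2 * (\<mu> + line_avg h x y / \<mu>)"
proof -
  define e where "e = x - y"
  let ?z = "\<lambda>t. y + t *\<^sub>R e"
  let ?G = "\<lambda>a b t. g a b (?z t)"
  define D where "D n = (if n = 0 then ?G 0 0
     else if n = 1 then (\<lambda>t. e$1 *\<^sub>R ?G 1 0 t + e$2 *\<^sub>R ?G 0 1 t)
     else (\<lambda>t. (e$1)^2 *\<^sub>R ?G 2 0 t + (2 * e$1 * e$2) *\<^sub>R ?G 1 1 t + (e$2)^2 *\<^sub>R ?G 0 2 t))" for n :: nat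
  have D: "D 0 = ?G 0 0" "D 1 = (\<lambda>t. e$1 *\<^sub>R ?G 1 0 t + e$2 *\<^sub>R ?G 0 1 t)"
    "D 2 = (\<lambda>t. (e$1)^2 *\<^sub>R ?G 2 0 t + (2 * e$1 * e$2) *\<^sub>R ?G 1 1 t + (e$2)^2 *\<^sub>R ?G 0 2 t)"
    by (simp_all add: D_def)
  have G': "((\<lambda>t. c *\<^sub>R ?G a b t) has_vector_derivative c *\<^sub>R (e$1 *\<^sub>R ?G (Suc a) b t + e$2 *\<^sub>R ?G a (Suc b) t)) (at t within S)" for a b t S c
    by (intro bounded_linear.has_vector_derivative[OF bounded_linear_scaleR_right] deriv_family2_line[OF g])
  have D': "(D m has_vector_derivative D (Suc m) t) (at t within {0..1})" if "m < 2" for m t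
  proof -
    consider "m = 0" | "m = 1" using \<open>m < 2\<close> by linarith
    then show ?thesis
    proof cases
      case 1
      then show ?thesis using G'[of 1 0 0 t] by (simp add: D_def)
    next
      case 2
      have eq: "D 2 t = e$1 *\<^sub>R (e$1 *\<^sub>R ?G (Suc 1) 0 t + e$2 *\<^sub>R ?G 1 (Suc 0) t) + e$2 *\<^sub>R (e$1 *\<^sub>R ?G (Suc 0) 1 t + e$2 *\<^sub>R ?G 0 (Suc 1) t)"
        unfolding D by (simp add: numeral_2_eq_2 power2_eq_square scaleR_conv_of_real algebra_simps)
      have "(D 1 has_vector_derivative D 2 t) (at t within {0..1})" unfolding eq unfolding D
        by (intro has_vector_derivative_add G')
      then show ?thesis using 2 by (simp add: numeral_2_eq_2)
    qed
  qed
  have en: "\<bar>e$1\<bar> \<le> d" "\<bar>e$2\<bar> \<le> d" using d component_le_norm_cart[of e] by (auto simp: e_def intro: order_trans)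
  have "norm (D 0 1 - (\<Sum>i<2. D i 0 /\<^sub>R fact i)) \<le> (4 * d\<^sup>2) * ((\<mu> + line_avg h x y / \<mu>) / 2)"
  proof (rule taylor_remainder_bound[OF h(1)])
    fix t :: real assume t: "0 \<le> t" "t \<le> 1"
    define W where "W = (\<mu> + (1 - t)\<^sup>2 * h (y + t *\<^sub>R (x - y)) / \<mu>) / 2"
    have z: "?z t \<in> closed_segment y x"
      using t by (auto simp: e_def closed_segment_def algebra_simps intro!: exI[of _ t])
    have W: "(1 - t) * norm (?G a b t) \<le> W" if "a + b = 2" for a b
      unfolding W_def e_def[symmetric]
      by (rule weighted_bound[OF bound[OF z that]]) (use t \<mu> h(2) in auto)
    have s: "(1 - t) * norm (s *\<^sub>R ?G a b t) \<le> k * d\<^sup>2 * W" if "a + b = 2" "\<bar>s\<bar> \<le> k * d\<^sup>2" for a b s k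
    proof -
      have "(1 - t) * norm (s *\<^sub>R ?G a b t) = \<bar>s\<bar> * ((1 - t) * norm (?G a b t))" by simp
      also have "\<dots> \<le> (k * d\<^sup>2) * W" using that W[OF that(1)] t by (intro mult_mono) (auto intro: order_trans[OF abs_ge_zero])
      finally show ?thesis .
    qed
    have e3: "\<bar>e$i * e$j\<bar> \<le> d * d" for i j
      using en exhaust_2[of i] exhaust_2[of j] unfolding abs_mult
      by (intro mult_mono) auto
    have "(1 - t) * norm (D 2 t) \<le> (1 - t) * (norm ((e$1)^2 *\<^sub>R ?G 2 0 t) + norm ((2 * e$1 * e$2) *\<^sub>R ?G 1 1 t)
        + norm ((e$2)^2 *\<^sub>R ?G 0 2 t))"
      unfolding D using t by (intro mult_left_mono norm_triangle_le add_mono order_refl) auto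
    also have "\<dots> = (1 - t) * norm ((e$1)^2 *\<^sub>R ?G 2 0 t) + (1 - t) * norm ((2 * e$1 * e$2) *\<^sub>R ?G 1 1 t)
        + (1 - t) * norm ((e$2)^2 *\<^sub>R ?G 0 2 t)" by (simp only: distrib_left)
    also have "\<dots> \<le> 1 * d\<^sup>2 * W + 2 * d\<^sup>2 * W + 1 * d\<^sup>2 * W"
      using e3[of 1 1] e3[of 1 2] e3[of 2 2]
      by (intro add_mono s) (auto simp: power2_eq_square abs_mult mult.assoc)
    finally show "(1 - t) * norm (D 2 t) \<le> 4 * d\<^sup>2 * ((\<mu> + (1 - t)\<^sup>2 * h (y + t *\<^sub>R (x - y)) / \<mu>) / 2)"
      by (simp add: W_def[symmetric] mult_ac)
  qed (auto intro: D')
  moreover have "D 0 1 = g 0 0 x" by (simp add: D e_def)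
  moreover have "(\<Sum>i<2. D i 0 /\<^sub>R fact i) = g 0 0 y + (x$1 - y$1) *\<^sub>R g 1 0 y + (x$2 - y$2) *\<^sub>R g 0 1 y"
  proof -
    have "(\<Sum>i<2. D i 0 /\<^sub>R fact i) = D 0 0 + D 1 0"
      by (simp add: numeral_2_eq_2)
    then show ?thesis unfolding D by (simp add: e_def)
  qed
  ultimately show ?thesis by simp
qed

text \<open>One centre \<open>y\<close> is good for \<open>x\<close> and the six grid points
  simultaneously. The Taylor polynomial at \<open>y\<close> is reproduced by interpolation, so the
  error of \<open>g\<close> equals that of the remainder \<open>e\<close>, which is small at all
  seven points. The bounds no longer mention \<open>y\<close>.\<close>

lemma smooth_interp_error:
  fixes y0 x :: "real^2"
  assumes g: "deriv_family2 g" and h: "continuous_on UNIV h" "\<And>x. 0 \<le> h x"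
    and A: "(\<integral>\<^sup>+x. ennreal (h x) \<partial>lborel) \<le> ennreal A" "0 \<le> A" "A < A'"
    and r: "r > 0"
    and bound: "\<And>z a b l. z \<in> S \<Longrightarrow> a + b = 3 \<Longrightarrow> l > 0 \<Longrightarrow> norm (g a b z) \<le> (l + h z / l) / 2"
    and seg: "\<And>p y. p \<in> insert x (ball y0 r) \<Longrightarrow> y \<in> ball y0 r \<Longrightarrow> closed_segment y p \<subseteq> S"
    and d: "\<And>y. y \<in> ball y0 r \<Longrightarrow> norm (x - y) \<le> d" "2 * r \<le> d"
  shows "norm (g 0 0 x - grid_interp y0 (r/2) (g 0 0) x) \<le> 768 * d ^ 5 / r ^ 3 * sqrt A'"
    "norm (g 1 0 x - grid_interp1 y0 (r/2) (g 0 0) x) \<le> 600 * d ^ 4 / r ^ 3 * sqrt A'"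
    "norm (g 0 1 x - grid_interp2 y0 (r/2) (g 0 0) x) \<le> 600 * d ^ 4 / r ^ 3 * sqrt A'"
proof -
  \<comment> \<open>With half the radius as grid step, the corner point at distance
    \<open>sqrt 2 * \<rho>\<close> is still inside the disc of radius \<open>r\<close>.\<close>
  define \<rho> where "\<rho> = r / 2"
  define qs where "qs = [pt y0 \<rho> 0 0, pt y0 \<rho> 1 0, pt y0 \<rho> (-1) 0, pt y0 \<rho> 0 1, pt y0 \<rho> 0 (-1), pt y0 \<rho> 1 1]"
  define ps where "ps = insert x (set qs)"
  have "card ps \<le> length (x # qs)" unfolding ps_def using card_length[of "x # qs"] by simp
  then have card: "finite ps" "real (card ps) \<le> 7" by (auto simp: ps_def qs_def)
  have qb: "q \<in> ball y0 r" if "q \<in> set qs" for q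
  proof -
    have "norm ((\<rho> * s) *\<^sub>R axis 1 1 + (\<rho> * t) *\<^sub>R axis 2 1 :: real^2) < r" if "\<bar>s\<bar> \<le> 1" "\<bar>t\<bar> \<le> 1" for s t
    proof -
      have sq: "(\<rho> * s)\<^sup>2 \<le> \<rho>\<^sup>2" if "\<bar>s\<bar> \<le> 1" for s
        using that power_mono[of "\<bar>s\<bar>" 1 2] by (auto simp: power_mult_distrib intro: mult_left_le)
      have "(norm ((\<rho> * s) *\<^sub>R axis 1 1 + (\<rho> * t) *\<^sub>R axis 2 1 :: real^2))\<^sup>2 = (\<rho> * s)\<^sup>2 + (\<rho> * t)\<^sup>2"
        by (simp add: norm_vec_def L2_set_def sum_2)
      also have "\<dots> \<le> \<rho>\<^sup>2 + \<rho>\<^sup>2" by (intro add_mono sq that)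
      also have "\<dots> < r\<^sup>2" using r by (simp add: \<rho>_def power2_eq_square field_simps)
      finally show ?thesis using r by (simp add: power_less_imp_less_base)
    qed
    from this[of 0 0] this[of 1 0] this[of "-1" 0] this[of 0 1] this[of 0 "-1"] this[of 1 1] that
    show ?thesis by (auto simp: qs_def pt_def dist_norm norm_minus_commute add.assoc)
  qed
  \<comment> \<open>At most seven end points are involved; \<open>A < A'\<close> supplies the strict
    inequality that the choice of the centre demands.\<close>
  define t where "t = 7 * A' / (pi * r\<^sup>2)"
  have A'0: "A' > 0" using A by simp
  have t: "real (card ps) * A < t * (pi * r\<^sup>2)"
  proof -
    have "real (card ps) * A \<le> 7 * A" using card A by (intro mult_right_mono) auto
    also have "\<dots> < t * (pi * r\<^sup>2)" using A r by (simp add: t_def)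
    finally show ?thesis .
  qed
  obtain y where y: "y \<in> ball y0 r" "(\<Sum>p\<in>ps. line_avg h p y) \<le> t"
    using good_centre_exists[OF h A(1,2) r card(1) t] by blast
  \<comment> \<open>The parameter of Young's inequality. As \<open>7 / pi < 3\<close>, each line
    average is at most \<open>3 * s\<^sup>2\<close>, so the two terms of
    \<open>s + line_avg h p y / s\<close> are balanced.\<close>
  define s where "s = sqrt A' / r"
  have s: "s > 0" using A'0 r by (simp add: s_def)
  have LA: "s + line_avg h p y / s \<le> 4 * s" if p: "p \<in> ps" for p
  proof -
    have "line_avg h p y \<le> (\<Sum>p\<in>ps. line_avg h p y)"
      by (rule member_le_sum[OF p]) (auto intro: line_avg_nonneg h card)
    also have "\<dots> \<le> t" by (rule y)
    also have "t = (7 / pi) * s\<^sup>2" using A'0 r by (simp add: t_def s_def power_divide field_simps)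
    also have "\<dots> \<le> 3 * s\<^sup>2" using pi_gt3 by (intro mult_right_mono) (auto simp: field_simps)
    finally have "line_avg h p y / s \<le> 3 * s" using s by (simp add: field_simps power2_eq_square)
    then show ?thesis by simp
  qed
  have d0: "d > 0" using r d by simp
  have dp: "norm (p - y) \<le> d" if "p \<in> ps" for p
  proof (cases "p = x")
    case False
    then have "dist y0 p < r" "dist y0 y < r" using that qb y by (auto simp: ps_def)
    then have "norm (p - y) < 2 * r" using dist_triangle3[of p y y0] by (simp add: dist_norm)
    then show ?thesis using d by simp
  qed (use d y in auto)
  have segp: "closed_segment y p \<subseteq> S" if "p \<in> ps" for p
    using that qb y by (intro seg) (auto simp: ps_def)
  define e where "e = (\<lambda>p. g 0 0 p - taylor2 g y p)"
  define m where "m = 16 * d ^ 3 * s"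
  have m0: "m > 0" using d0 s by (simp add: m_def)
  have em: "norm (e p) \<le> m" if "p \<in> ps" for p
  proof -
    have "norm (e p) \<le> 4 * d ^ 3 * (s + line_avg h p y / s)" unfolding e_def
      by (rule taylor2_remainder[OF g h _ dp[OF that] s]) (use bound segp[OF that] in blast)
    also have "\<dots> \<le> 4 * d ^ 3 * (4 * s)" using d0 LA[OF that] by (intro mult_left_mono) auto
    finally show ?thesis by (simp add: m_def)
  qed
  define K where "K = 2 * d / r"
  have K: "K \<ge> 1" using d r by (simp add: K_def field_simps)
  have "norm (x - y0) \<le> d" using d r by auto
  then have xK: "\<bar>x$1 - y0$1\<bar> \<le> K * \<rho>" "\<bar>x$2 - y0$2\<bar> \<le> K * \<rho>"
    using component_le_norm_cart[of "x - y0" 1] component_le_norm_cart[of "x - y0" 2] r by (auto simp: K_def \<rho>_def)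
  have \<rho>: "\<rho> > 0" using r by (simp add: \<rho>_def)
  have em': "norm (e (pt y0 \<rho> s t)) \<le> m" if "s \<in> {-1,0,1}" "t \<in> {-1,0,1}" "s * t \<noteq> -1" "s + t \<ge> -1" for s t
  proof -
    have "pt y0 \<rho> s t \<in> ps" using that by (auto simp: ps_def qs_def)
    then show ?thesis by (rule em)
  qed
  have gb: "norm (grid_interp y0 \<rho> e x) \<le> 11 * K\<^sup>2 * m"
    "norm (grid_interp1 y0 \<rho> e x) \<le> 9 * K * m / \<rho>" "norm (grid_interp2 y0 \<rho> e x) \<le> 9 * K * m / \<rho>"
    by (rule grid_interp_bound[OF \<rho> K xK]; rule em'; assumption)+
  have x: "x \<in> ps" by (simp add: ps_def)
  have KK: "1 \<le> K\<^sup>2" using K by (simp add: one_le_power)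
  have "g 0 0 x - grid_interp y0 \<rho> (g 0 0) x = e x - grid_interp y0 \<rho> e x"
    unfolding e_def grid_interp_diff using \<rho> by (simp add: taylor2_def grid_interp_centred_quad)
  also have "norm \<dots> \<le> m + 11 * K\<^sup>2 * m" using em[OF x] gb(1) norm_triangle_ineq4 order_trans add_mono by meson
  also have "\<dots> \<le> 12 * K\<^sup>2 * m" using mult_right_mono[OF KK, of m] m0 by simp
  \<comment> \<open>The constant is \<open>12 * 4 * 16\<close>, from \<open>K = 2 * d / r\<close>
    and \<open>m = 16 * d ^ 3 * s\<close>.\<close>
  also have "\<dots> = 768 * d ^ 5 / r ^ 3 * sqrt A'" using r by (simp add: K_def m_def s_def power_divide eval_nat_numeral field_simps)
  finally show "norm (g 0 0 x - grid_interp y0 (r/2) (g 0 0) x) \<le> 768 * d ^ 5 / r ^ 3 * sqrt A'" by (simp add: \<rho>_def)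
  \<comment> \<open>Interpolating the remainder contributes 576, and 24 generously covers the Taylor
    remainder of the gradient, where \<open>r \<le> d\<close> raises the power of
    \<open>d\<close>.\<close>
  have fin: "2 * d\<^sup>2 * (4 * s) + 9 * K * m / \<rho> \<le> 600 * d ^ 4 / r ^ 3 * sqrt A'"
  proof -
    have "9 * K * m / \<rho> = 576 * d ^ 4 / r ^ 3 * sqrt A'" using r by (simp add: K_def m_def s_def \<rho>_def eval_nat_numeral field_simps)
    moreover have "2 * d\<^sup>2 * (4 * s) \<le> 24 * d ^ 4 / r ^ 3 * sqrt A'"
    proof -
      have "r\<^sup>2 \<le> d\<^sup>2" using d r by (intro power_mono) auto
      then have "8 * (d\<^sup>2 * r\<^sup>2) \<le> 24 * (d\<^sup>2 * d\<^sup>2)" by (intro mult_mono) auto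
      then have "8 * (d\<^sup>2 * r\<^sup>2) / r ^ 3 * sqrt A' \<le> 24 * (d\<^sup>2 * d\<^sup>2) / r ^ 3 * sqrt A'"
        using r A'0 by (intro mult_right_mono divide_right_mono) auto
      then show ?thesis using r by (simp add: s_def eval_nat_numeral field_simps)
    qed
    moreover have "24 * d ^ 4 / r ^ 3 * sqrt A' + 576 * d ^ 4 / r ^ 3 * sqrt A' = 600 * d ^ 4 / r ^ 3 * sqrt A'"
      by (simp add: divide_inverse algebra_simps)
    ultimately show ?thesis by linarith
  qed
  have t1: "norm (g a b x - (g a b y + (x$1 - y$1) *\<^sub>R g (Suc a) b y + (x$2 - y$2) *\<^sub>R g a (Suc b) y)) \<le> 2 * d\<^sup>2 * (4 * s)"
    if ab: "a + b = 1" for a b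
  proof -
    \<comment> \<open>Shifting both indices turns the derivatives of \<open>g a b\<close> into a
      family of their own, whose second derivatives are third derivatives of
      \<open>g 0 0\<close>.\<close>
    have "deriv_family2 (\<lambda>i j. g (i + a) (j + b))" using g by (auto simp: deriv_family2_def)
    from taylor1_remainder[OF this h, of y x d s] have
      "norm (g a b x - (g a b y + (x$1 - y$1) *\<^sub>R g (Suc a) b y + (x$2 - y$2) *\<^sub>R g a (Suc b) y)) \<le> 2 * d\<^sup>2 * (s + line_avg h x y / s)"
      using bound segp[OF x] dp[OF x] s ab by (auto simp: subset_iff)
    also have "\<dots> \<le> 2 * d\<^sup>2 * (4 * s)" using LA[OF x] by (intro mult_left_mono) auto
    finally show ?thesis .
  qed
  have "g 1 0 x - grid_interp1 y0 \<rho> (g 0 0) x = (g 1 0 x - (g 1 0 y + (x$1 - y$1) *\<^sub>R g (Suc 1) 0 y + (x$2 - y$2) *\<^sub>R g 1 (Suc 0) y)) - grid_interp1 y0 \<rho> e x"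
    unfolding e_def grid_interp1_diff using \<rho> by (simp add: taylor2_def grid_interp1_centred_quad numeral_2_eq_2)
  also have "norm \<dots> \<le> 2 * d\<^sup>2 * (4 * s) + 9 * K * m / \<rho>"
    by (rule order_trans[OF norm_triangle_ineq4 add_mono[OF t1[of 1 0] gb(2)]]) simp
  also note fin
  finally show "norm (g 1 0 x - grid_interp1 y0 (r/2) (g 0 0) x) \<le> 600 * d ^ 4 / r ^ 3 * sqrt A'" by (simp add: \<rho>_def)
  have "g 0 1 x - grid_interp2 y0 \<rho> (g 0 0) x = (g 0 1 x - (g 0 1 y + (x$1 - y$1) *\<^sub>R g (Suc 0) 1 y + (x$2 - y$2) *\<^sub>R g 0 (Suc 1) y)) - grid_interp2 y0 \<rho> e x"
    unfolding e_def grid_interp2_diff using \<rho> by (simp add: taylor2_def grid_interp2_centred_quad numeral_2_eq_2)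
  also have "norm \<dots> \<le> 2 * d\<^sup>2 * (4 * s) + 9 * K * m / \<rho>"
    by (rule order_trans[OF norm_triangle_ineq4 add_mono[OF t1[of 0 1] gb(3)]]) simp
  also note fin
  finally show "norm (g 0 1 x - grid_interp2 y0 (r/2) (g 0 0) x) \<le> 600 * d ^ 4 / r ^ 3 * sqrt A'" by (simp add: \<rho>_def)
qed

section \<open>Integration by parts for weak derivatives\<close>

lemma lebesgue_integral_translation:
  fixes f :: "'a::euclidean_space \<Rightarrow> 'b::{banach,second_countable_topology}"
  assumes f: "f \<in> borel_measurable lebesgue"
  shows "(\<integral>x. f (a + x) \<partial>lebesgue) = (\<integral>x. f x \<partial>lebesgue)"
    and "(\<lambda>x. f (a + x)) \<in> borel_measurable lebesgue"
proof -
  have T: "(\<lambda>x. a + x) \<in> lebesgue \<rightarrow>\<^sub>M lebesgue"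
    using lebesgue_affine_measurable[of "\<lambda>_. 1" a] by (simp add: euclidean_representation)
  have L: "lebesgue = distr lebesgue lebesgue (\<lambda>x. a + x)"
    using lebesgue_affine_euclidean[of "\<lambda>_. 1" a] by (simp add: euclidean_representation density_1)
  have "(\<integral>x. f x \<partial>lebesgue) = (\<integral>x. f x \<partial>distr lebesgue lebesgue (\<lambda>x. a + x))" using L by simp
  also have "\<dots> = (\<integral>x. f (a + x) \<partial>lebesgue)" by (rule integral_distr[OF T f])
  finally show "(\<integral>x. f (a + x) \<partial>lebesgue) = (\<integral>x. f x \<partial>lebesgue)" ..
  show "(\<lambda>x. f (a + x)) \<in> borel_measurable lebesgue" by (rule measurable_compose[OF T f])
qed

text \<open>The direction is appended to the list of derivatives, so smoothness persists; where
  \<open>\<phi>\<close> vanishes near a point so does its derivative, so the support does not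
  grow.\<close>

lemma test_function_deriv:
  fixes \<phi> :: "'a::euclidean_space \<Rightarrow> real"
  assumes \<phi>: "\<phi> \<in> test_functions S" and e: "e \<in> Basis"
  shows "iterated_deriv [e] \<phi> \<in> test_functions S" "continuous_on T (iterated_deriv [e] \<phi>)"
    "((\<lambda>s. \<phi> (x + s *\<^sub>R e)) has_real_derivative iterated_deriv [e] \<phi> (x + s *\<^sub>R e)) (at s)"
proof -
  have s: "iterated_deriv bs \<phi> differentiable (at x)" if "set bs \<subseteq> Basis" for bs x
    using \<phi> that by (simp add: test_functions_def smooth_def)
  have d: "\<phi> differentiable (at x)" for x using s[of "[]"] by (simp add: iterated_deriv_def)
  have "smooth (iterated_deriv [e] \<phi>)" unfolding smooth_def
  proof (intro allI impI)
    fix bs :: "'a list" and x assume "set bs \<subseteq> Basis"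
    then show "iterated_deriv bs (iterated_deriv [e] \<phi>) differentiable (at x)"
      using s[of "bs @ [e]" x] e by (simp add: iterated_deriv_def)
  qed
  moreover have "closure {x. iterated_deriv [e] \<phi> x \<noteq> 0} \<subseteq> closure {x. \<phi> x \<noteq> 0}"
  proof (rule closure_minimal)
    show "{x. iterated_deriv [e] \<phi> x \<noteq> 0} \<subseteq> closure {x. \<phi> x \<noteq> 0}"
    proof
      fix x assume x: "x \<in> {x. iterated_deriv [e] \<phi> x \<noteq> 0}"
      show "x \<in> closure {x. \<phi> x \<noteq> 0}"
      proof (rule ccontr)
        assume n: "x \<notin> closure {x. \<phi> x \<noteq> 0}"
        have "((\<lambda>x. 0) has_derivative (\<lambda>h. 0)) (at x)" by simp
        then have "(\<phi> has_derivative (\<lambda>h. 0)) (at x)"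
          by (rule has_derivative_transform_within_open[where s="- closure {x. \<phi> x \<noteq> 0}"])
            (use n closure_subset[of "{x. \<phi> x \<noteq> 0}"] in auto)
        from frechet_derivative_at[OF this] have "frechet_derivative \<phi> (at x) e = 0" by (metis)
        then show False using x by (simp add: iterated_deriv_def)
      qed
    qed
  qed simp
  moreover from this have "compact (closure {x. iterated_deriv [e] \<phi> x \<noteq> 0})"
    using \<phi> compact_Int_closed[of "closure {x. \<phi> x \<noteq> 0}" "closure {x. iterated_deriv [e] \<phi> x \<noteq> 0}"]
    by (simp add: test_functions_def inf_absorb2)
  ultimately show "iterated_deriv [e] \<phi> \<in> test_functions S"
    using \<phi> by (auto simp: test_functions_def)
  show "continuous_on T (iterated_deriv [e] \<phi>)"
    using s[of "[e]"] e by (intro continuous_at_imp_continuous_on ballI differentiable_imp_continuous_within) simp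
  have "(\<phi> has_derivative frechet_derivative \<phi> (at (x + s *\<^sub>R e))) (at (x + s *\<^sub>R e))"
    using d[of "x + s *\<^sub>R e"] by (simp add: frechet_derivative_works[symmetric])
  moreover have "((\<lambda>s. x + s *\<^sub>R e) has_derivative (\<lambda>t. t *\<^sub>R e)) (at s)"
    by (auto intro!: derivative_eq_intros)
  ultimately have "((\<lambda>s. \<phi> (x + s *\<^sub>R e)) has_derivative (\<lambda>t. frechet_derivative \<phi> (at (x + s *\<^sub>R e)) (t *\<^sub>R e))) (at s)"
    by (rule has_derivative_compose[rotated])
  moreover have "frechet_derivative \<phi> (at (x + s *\<^sub>R e)) (t *\<^sub>R e) = t * frechet_derivative \<phi> (at (x + s *\<^sub>R e)) e" for t
    using linear_frechet_derivative[OF d] by (simp add: linear_cmul)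
  ultimately show "((\<lambda>s. \<phi> (x + s *\<^sub>R e)) has_real_derivative iterated_deriv [e] \<phi> (x + s *\<^sub>R e)) (at s)"
    by (simp add: has_field_derivative_def iterated_deriv_def mult_commute_abs)
qed

text \<open>A difference quotient is moved from \<open>\<phi>\<close> to \<open>v\<close> by
  translation invariance of Lebesgue measure, and both sides converge by dominated convergence. The
  hypotheses, a local Lipschitz bound along \<open>e\<close> and a directional derivative almost
  everywhere, fit smooth functions and continuous piecewise affine ones alike.\<close>

lemma weak_deriv_ibp:
  fixes v g :: "'a::euclidean_space \<Rightarrow> complex"
  assumes \<Omega>: "open \<Omega>" and v: "integrable (lebesgue_on \<Omega>) v" and gm: "g \<in> borel_measurable (lebesgue_on \<Omega>)"
    and e: "e \<in> Basis"
    and lip: "\<And>K. compact K \<Longrightarrow> K \<subseteq> \<Omega> \<Longrightarrow> \<exists>L \<delta>. \<delta> > 0 \<and> (\<forall>x\<in>K. \<forall>t. \<bar>t\<bar> < \<delta> \<longrightarrow> norm (v (x + t *\<^sub>R e) - v x) \<le> L * \<bar>t\<bar>)"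
    and der: "AE x in lebesgue_on \<Omega>. ((\<lambda>t. (v (x + t *\<^sub>R e) - v x) /\<^sub>R t) \<longlongrightarrow> g x) (at 0)"
    and \<phi>: "\<phi> \<in> test_functions \<Omega>"
  shows "(\<integral>x. iterated_deriv [e] \<phi> x *\<^sub>R v x \<partial>lebesgue_on \<Omega>) = - (\<integral>x. \<phi> x *\<^sub>R g x \<partial>lebesgue_on \<Omega>)"
proof -
  define K where "K = closure {x. \<phi> x \<noteq> 0}"
  have K: "compact K" "K \<subseteq> \<Omega>" using \<phi> by (auto simp: K_def test_functions_def)
  have \<phi>0: "\<phi> x = 0" if "x \<notin> K" for x using that closure_subset[of "{x. \<phi> x \<noteq> 0}"] by (auto simp: K_def)
  obtain L0 \<delta>0 where L0: "\<delta>0 > 0" "\<And>x t. x \<in> K \<Longrightarrow> \<bar>t\<bar> < \<delta>0 \<Longrightarrow> norm (v (x + t *\<^sub>R e) - v x) \<le> L0 * \<bar>t\<bar>"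
    using lip[OF K] by blast
  obtain \<delta>1 where \<delta>1: "\<delta>1 > 0" "\<And>x. x \<in> K \<Longrightarrow> ball x \<delta>1 \<subseteq> \<Omega>"
    using Heine_Borel_lemma[OF K(1), of "{\<Omega>}"] K(2) \<Omega> by auto
  define \<delta> where "\<delta> = min \<delta>0 \<delta>1"
  have \<delta>: "\<delta> > 0" using L0 \<delta>1 by (simp add: \<delta>_def)
  have ne: "norm e = 1" using e by simp
  \<comment> \<open>A null sequence of positive shifts below \<open>\<delta>\<close>, so that
    \<open>K\<close> shifted by \<open>X n\<close> along \<open>e\<close> stays in
    \<open>\<Omega>\<close>, where \<open>v0\<close> agrees with \<open>v\<close>.\<close>
  define X where "X n = \<delta> / (real n + 2)" for n
  have X: "X n > 0" "X n < \<delta>" for n using \<delta> by (auto simp: X_def field_simps intro: add_pos_nonneg)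
  have X0: "X \<longlonglongrightarrow> 0" unfolding X_def by real_asymp
  have shift: "x + t *\<^sub>R e \<in> \<Omega>" if "x \<in> K" "\<bar>t\<bar> < \<delta>" for x t
    using \<delta>1(2)[OF that(1)] that(2) ne by (auto simp: \<delta>_def subset_iff dist_norm)
  have \<Omega>': "\<Omega> \<in> sets lebesgue" using \<Omega> by auto
  define v0 where "v0 x = (if x \<in> \<Omega> then v x else 0)" for x
  have v0m: "v0 \<in> borel_measurable lebesgue"
    using borel_measurable_integrable[OF v] \<Omega>' unfolding v0_def by (simp add: borel_measurable_if)
  have v0i: "integrable lebesgue v0"
  proof -
    have "integrable lebesgue (\<lambda>x. indicator \<Omega> x *\<^sub>R v x)" using v \<Omega>' by (simp add: integrable_restrict_space)
    then show ?thesis by (rule Bochner_Integration.integrable_cong[THEN iffD1, rotated -1]) (auto simp: v0_def)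
  qed
  have restr: "(\<integral>x. f x *\<^sub>R v x \<partial>lebesgue_on \<Omega>) = (\<integral>x. f x *\<^sub>R v0 x \<partial>lebesgue)" for f :: "'a \<Rightarrow> real"
    using \<Omega>' by (subst integral_restrict_space) (auto intro!: Bochner_Integration.integral_cong simp: v0_def indicator_def)
  have \<phi>t: "\<phi> \<in> borel_measurable lebesgue"
    using test_function_measurable[OF \<phi>, of UNIV] by (simp add: lebesgue_on_UNIV_eq)
  define \<phi>' where "\<phi>' = iterated_deriv [e] \<phi>"
  have \<phi>'T: "\<phi>' \<in> test_functions \<Omega>" unfolding \<phi>'_def by (rule test_function_deriv[OF \<phi> e])
  obtain B where B: "\<And>x. \<bar>\<phi>' x\<bar> \<le> B" using test_function_bounded[OF \<phi>'T] by blast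
  obtain B0 where B0: "\<And>x. \<bar>\<phi> x\<bar> \<le> B0" using test_function_bounded[OF \<phi>] by blast
  have diff: "((\<lambda>s. \<phi> (x + s *\<^sub>R e)) has_real_derivative \<phi>' (x + s *\<^sub>R e)) (at s)" for x s
    unfolding \<phi>'_def by (rule test_function_deriv[OF \<phi> e])
  have \<phi>lip: "\<bar>\<phi> (x + s *\<^sub>R e) - \<phi> x\<bar> \<le> B * \<bar>s\<bar>" for x s
    using field_differentiable_bound[of UNIV "\<lambda>s. \<phi> (x + s *\<^sub>R e)" "\<lambda>s. \<phi>' (x + s *\<^sub>R e)" B s 0] diff B
    by (auto intro: has_field_derivative_at_within)
  have \<phi>sm: "(\<lambda>x. \<phi> (a + x)) \<in> borel_measurable lebesgue" for a by (rule lebesgue_integral_translation[OF \<phi>t])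
  have \<phi>sm': "(\<lambda>x. \<phi> (x + a)) \<in> borel_measurable lebesgue" for a using \<phi>sm[of a] by (simp add: add.commute)
  have pint: "integrable lebesgue (\<lambda>x. \<phi> (x + a) *\<^sub>R v0 x)" for a
    by (rule Bochner_Integration.integrable_bound[of lebesgue "\<lambda>x. B0 *\<^sub>R v0 x"])
      (use v0i v0m \<phi>sm' B0 in \<open>auto intro!: mult_right_mono AE_I2 order_trans[OF B0 abs_ge_self]\<close>)
  have tr: "(\<integral>x. \<phi> (x + (- t) *\<^sub>R e) *\<^sub>R v0 x \<partial>lebesgue) = (\<integral>x. \<phi> x *\<^sub>R v0 (x + t *\<^sub>R e) \<partial>lebesgue)" for t
  proof -
    have "(\<lambda>x. \<phi> (x + (- t) *\<^sub>R e) *\<^sub>R v0 x) \<in> borel_measurable lebesgue" using \<phi>sm' v0m by (intro borel_measurable_scaleR)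
    from lebesgue_integral_translation(1)[OF this, of "t *\<^sub>R e"] show ?thesis by (simp add: add.commute)
  qed
  have pint2: "integrable lebesgue (\<lambda>x. \<phi> x *\<^sub>R v0 (x + t *\<^sub>R e))" for t
  proof -
    have v0s: "integrable lebesgue (\<lambda>x. v0 (t *\<^sub>R e + x))"
    proof -
      have T: "(\<lambda>x. t *\<^sub>R e + x) \<in> lebesgue \<rightarrow>\<^sub>M lebesgue"
        using lebesgue_affine_measurable[of "\<lambda>_. 1" "t *\<^sub>R e"] by (simp add: euclidean_representation)
      have L: "lebesgue = distr lebesgue lebesgue (\<lambda>x. t *\<^sub>R e + x)"
        using lebesgue_affine_euclidean[of "\<lambda>_. 1" "t *\<^sub>R e"] by (simp add: euclidean_representation density_1)
      have "integrable (distr lebesgue lebesgue (\<lambda>x. t *\<^sub>R e + x)) v0" using v0i L by simp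
      then show ?thesis using integrable_distr[OF T] by blast
    qed
    show ?thesis
      by (rule Bochner_Integration.integrable_bound[of lebesgue "\<lambda>x. B0 *\<^sub>R v0 (t *\<^sub>R e + x)"])
        (use v0s borel_measurable_integrable[OF v0s] \<phi>t B0 in \<open>auto simp: add.commute intro!: mult_right_mono AE_I2 order_trans[OF B0 abs_ge_self] borel_measurable_scaleR\<close>)
  qed
  \<comment> \<open>Summation by parts: \<open>x + X n e\<close> is substituted for \<open>x\<close>
    in the term with the shifted \<open>\<phi>\<close>.\<close>
  have key: "(\<integral>x. ((\<phi> (x + (- X n) *\<^sub>R e) - \<phi> x) / (- X n)) *\<^sub>R v0 x \<partial>lebesgue)
     = - (\<integral>x. \<phi> x *\<^sub>R ((v0 (x + X n *\<^sub>R e) - v0 x) /\<^sub>R X n) \<partial>lebesgue)" for n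
  proof -
    have p0: "integrable lebesgue (\<lambda>x. \<phi> x *\<^sub>R v0 x)" using pint[of 0] by simp
    have "(\<integral>x. ((\<phi> (x + (- X n) *\<^sub>R e) - \<phi> x) / (- X n)) *\<^sub>R v0 x \<partial>lebesgue)
      = (\<integral>x. (- 1 / X n) *\<^sub>R (\<phi> (x + (- X n) *\<^sub>R e) *\<^sub>R v0 x - \<phi> x *\<^sub>R v0 x) \<partial>lebesgue)"
      by (intro Bochner_Integration.integral_cong refl) (simp add: scaleR_diff_left[symmetric] diff_divide_distrib[symmetric])
    also have "\<dots> = (- 1 / X n) *\<^sub>R ((\<integral>x. \<phi> (x + (- X n) *\<^sub>R e) *\<^sub>R v0 x \<partial>lebesgue) - (\<integral>x. \<phi> x *\<^sub>R v0 x \<partial>lebesgue))"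
      by (simp only: integral_scaleR_right Bochner_Integration.integral_diff[OF pint p0])
    also have "\<dots> = (- 1 / X n) *\<^sub>R (\<integral>x. \<phi> x *\<^sub>R v0 (x + X n *\<^sub>R e) - \<phi> x *\<^sub>R v0 x \<partial>lebesgue)"
      by (simp only: tr Bochner_Integration.integral_diff[OF pint2 p0])
    also have "\<dots> = (\<integral>x. - (\<phi> x *\<^sub>R ((v0 (x + X n *\<^sub>R e) - v0 x) /\<^sub>R X n)) \<partial>lebesgue)"
      unfolding integral_scaleR_right[symmetric]
      by (intro Bochner_Integration.integral_cong refl) (simp add: scaleR_diff_right[symmetric] divide_inverse mult.commute)
    finally show ?thesis by simp
  qed
  have L: "(\<lambda>n. \<integral>x. ((\<phi> (x + (- X n) *\<^sub>R e) - \<phi> x) / (- X n)) *\<^sub>R v0 x \<partial>lebesgue) \<longlonglongrightarrow> (\<integral>x. \<phi>' x *\<^sub>R v0 x \<partial>lebesgue)"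
  proof (rule integral_dominated_convergence[where w="\<lambda>x. B * norm (v0 x)"])
    show "AE x in lebesgue. (\<lambda>n. ((\<phi> (x + (- X n) *\<^sub>R e) - \<phi> x) / (- X n)) *\<^sub>R v0 x) \<longlonglongrightarrow> \<phi>' x *\<^sub>R v0 x"
    proof (rule AE_I2)
      fix x
      have "((\<lambda>h. (\<phi> (x + h *\<^sub>R e) - \<phi> x) / h) \<longlongrightarrow> \<phi>' x) (at 0)"
        using diff[of x 0] by (simp add: DERIV_def)
      moreover have "filterlim (\<lambda>n. - X n) (at 0) sequentially"
        unfolding filterlim_at using X tendsto_minus[OF X0] by (auto intro!: always_eventually simp: less_imp_neq[symmetric])
      ultimately have "(\<lambda>n. (\<phi> (x + (- X n) *\<^sub>R e) - \<phi> x) / (- X n)) \<longlonglongrightarrow> \<phi>' x"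
        by (rule filterlim_compose)
      then show "(\<lambda>n. ((\<phi> (x + (- X n) *\<^sub>R e) - \<phi> x) / (- X n)) *\<^sub>R v0 x) \<longlonglongrightarrow> \<phi>' x *\<^sub>R v0 x"
        by (intro tendsto_scaleR tendsto_const)
    qed
    show "AE x in lebesgue. norm (((\<phi> (x + (- X n) *\<^sub>R e) - \<phi> x) / (- X n)) *\<^sub>R v0 x) \<le> B * norm (v0 x)" for n
    proof (rule AE_I2)
      fix x
      have "\<bar>(\<phi> (x + (- X n) *\<^sub>R e) - \<phi> x) / (- X n)\<bar> \<le> B"
        using \<phi>lip[of x "- X n"] X[of n] by (simp add: abs_divide field_simps)
      then show "norm (((\<phi> (x + (- X n) *\<^sub>R e) - \<phi> x) / (- X n)) *\<^sub>R v0 x) \<le> B * norm (v0 x)"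
        unfolding norm_scaleR by (intro mult_right_mono) auto
    qed
    show "(\<lambda>x. ((\<phi> (x + (- X n) *\<^sub>R e) - \<phi> x) / (- X n)) *\<^sub>R v0 x) \<in> borel_measurable lebesgue" for n
      by (intro borel_measurable_scaleR borel_measurable_divide borel_measurable_diff \<phi>sm' \<phi>t v0m borel_measurable_const)
    show "(\<lambda>x. \<phi>' x *\<^sub>R v0 x) \<in> borel_measurable lebesgue"
      using test_function_measurable[OF \<phi>'T, of UNIV] v0m by (simp add: lebesgue_on_UNIV_eq)
  qed (use v0i in auto)
  define g0 where "g0 x = (if x \<in> \<Omega> then g x else 0)" for x
  \<comment> \<open>The integrand vanishes off the support \<open>K\<close> of
    \<open>\<phi>\<close>, so the Lipschitz bound on \<open>K\<close> alone gives an integrable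
    majorant.\<close>
  have R: "(\<lambda>n. \<integral>x. \<phi> x *\<^sub>R ((v0 (x + X n *\<^sub>R e) - v0 x) /\<^sub>R X n) \<partial>lebesgue) \<longlonglongrightarrow> (\<integral>x. \<phi> x *\<^sub>R g0 x \<partial>lebesgue)"
  proof (rule integral_dominated_convergence[where w="\<lambda>x. (B0 * \<bar>L0\<bar>) * indicator K x"])
    have "AE x in lebesgue. x \<in> \<Omega> \<longrightarrow> ((\<lambda>t. (v (x + t *\<^sub>R e) - v x) /\<^sub>R t) \<longlongrightarrow> g x) (at 0)"
      using der \<Omega>' by (simp add: AE_restrict_space_iff)
    then show "AE x in lebesgue. (\<lambda>n. \<phi> x *\<^sub>R ((v0 (x + X n *\<^sub>R e) - v0 x) /\<^sub>R X n)) \<longlonglongrightarrow> \<phi> x *\<^sub>R g0 x"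
    proof eventually_elim
      case (elim x)
      show ?case
      proof (cases "x \<in> K")
        case True
        have "filterlim X (at 0) sequentially"
          unfolding filterlim_at using X X0 by (auto intro!: always_eventually simp: less_imp_neq[symmetric])
        moreover have "((\<lambda>t. (v (x + t *\<^sub>R e) - v x) /\<^sub>R t) \<longlongrightarrow> g x) (at 0)" using elim True K by blast
        ultimately have "(\<lambda>n. (v (x + X n *\<^sub>R e) - v x) /\<^sub>R X n) \<longlonglongrightarrow> g x" by (rule filterlim_compose[rotated])
        moreover have "v0 (x + X n *\<^sub>R e) = v (x + X n *\<^sub>R e)" for n
          using shift[OF True, of "X n"] X[of n] by (simp add: v0_def)
        moreover have "v0 x = v x" "g0 x = g x" using True K by (auto simp: v0_def g0_def)
        ultimately show ?thesis by (intro tendsto_scaleR tendsto_const) simp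
      qed (simp add: \<phi>0)
    qed
    show "AE x in lebesgue. norm (\<phi> x *\<^sub>R ((v0 (x + X n *\<^sub>R e) - v0 x) /\<^sub>R X n)) \<le> (B0 * \<bar>L0\<bar>) * indicator K x" for n
    proof (rule AE_I2)
      fix x
      show "norm (\<phi> x *\<^sub>R ((v0 (x + X n *\<^sub>R e) - v0 x) /\<^sub>R X n)) \<le> (B0 * \<bar>L0\<bar>) * indicator K x"
      proof (cases "x \<in> K")
        case True
        have "v0 (x + X n *\<^sub>R e) = v (x + X n *\<^sub>R e)" "v0 x = v x"
          using shift[OF True, of "X n"] X[of n] True K by (auto simp: v0_def)
        moreover have "norm (v (x + X n *\<^sub>R e) - v x) \<le> \<bar>L0\<bar> * X n"
          using L0(2)[OF True, of "X n"] X[of n] by (auto simp: \<delta>_def intro: order_trans[OF _ mult_right_mono[OF abs_ge_self]])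
        ultimately have "norm ((v0 (x + X n *\<^sub>R e) - v0 x) /\<^sub>R X n) \<le> \<bar>L0\<bar>"
          using X[of n] by (simp only: norm_scaleR) (simp add: field_simps)
        then have "\<bar>\<phi> x\<bar> * norm ((v0 (x + X n *\<^sub>R e) - v0 x) /\<^sub>R X n) \<le> B0 * \<bar>L0\<bar>"
          by (intro mult_mono B0) (auto intro: order_trans[OF abs_ge_zero B0])
        then show ?thesis using True by (simp add: abs_mult mult.assoc)
      qed (simp add: \<phi>0)
    qed
    have v0t: "(\<lambda>x. v0 (x + t *\<^sub>R e)) \<in> borel_measurable lebesgue" for t
      using lebesgue_integral_translation(2)[OF v0m, of "t *\<^sub>R e"] by (simp add: add.commute)
    show "(\<lambda>x. \<phi> x *\<^sub>R ((v0 (x + X n *\<^sub>R e) - v0 x) /\<^sub>R X n)) \<in> borel_measurable lebesgue" for n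
      by (intro borel_measurable_scaleR \<phi>t borel_measurable_diff v0t v0m borel_measurable_const)
    have "g0 \<in> borel_measurable lebesgue" unfolding g0_def using gm \<Omega>' by (simp add: borel_measurable_if)
    then show "(\<lambda>x. \<phi> x *\<^sub>R g0 x) \<in> borel_measurable lebesgue" by (intro borel_measurable_scaleR \<phi>t)
    have "K \<in> lmeasurable" using K(1) by (simp add: lmeasurable_compact)
    then show "integrable lebesgue (\<lambda>x. (B0 * \<bar>L0\<bar>) * indicator K x)"
      by (intro integrable_mult_right integrable_real_indicator) (auto simp: fmeasurable_def)
  qed
  have "(\<integral>x. \<phi>' x *\<^sub>R v0 x \<partial>lebesgue) = - (\<integral>x. \<phi> x *\<^sub>R g0 x \<partial>lebesgue)"
    by (rule LIMSEQ_unique[OF L]) (unfold key, rule tendsto_minus[OF R])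
  moreover have "(\<integral>x. \<phi> x *\<^sub>R g x \<partial>lebesgue_on \<Omega>) = (\<integral>x. \<phi> x *\<^sub>R g0 x \<partial>lebesgue)"
    using \<Omega>' by (subst integral_restrict_space) (auto intro!: Bochner_Integration.integral_cong simp: g0_def indicator_def)
  ultimately show ?thesis by (simp add: restr \<phi>'_def)
qed

lemma weak_deriv_works:
  assumes "u \<in> sobolev m \<Omega>" "a + b \<le> m"
  shows "has_weak_deriv \<Omega> (dirs a b) u (weak_deriv \<Omega> (dirs a b) u)"
proof -
  have "\<exists>v. has_weak_deriv \<Omega> (dirs a b) u v" using assms by (auto simp: sobolev_def)
  then show ?thesis unfolding weak_deriv_def by (rule someI_ex)
qed

lemma dirs_unit: "dirs (Suc 0) 0 = [axis 1 1]" "dirs 0 (Suc 0) = [axis 2 1]"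
  by (simp_all add: dirs_def)

definition third_sq :: "(real^2) set \<Rightarrow> (real^2 \<Rightarrow> complex) \<Rightarrow> real^2 \<Rightarrow> real" where
  "third_sq \<Omega> u x = (\<Sum>a\<le>3. (norm (weak_deriv \<Omega> (dirs a (3 - a)) u x))\<^sup>2)"

lemma third_sq_integrable:
  assumes "u \<in> sobolev 3 \<Omega>" shows "integrable (lebesgue_on \<Omega>) (third_sq \<Omega> u)"
  unfolding third_sq_def
proof (intro Bochner_Integration.integrable_sum)
  fix a :: nat assume "a \<in> {..3}"
  then have "weak_deriv \<Omega> (dirs a (3 - a)) u \<in> L2 \<Omega>"
    using weak_deriv_works[OF assms, of a "3 - a"] by (auto simp: has_weak_deriv_def)
  then show "integrable (lebesgue_on \<Omega>) (\<lambda>x. (norm (weak_deriv \<Omega> (dirs a (3 - a)) u x))\<^sup>2)"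
    by (simp add: L2_def)
qed

lemma third_sq_nonneg: "0 \<le> third_sq \<Omega> u x"
  by (simp add: third_sq_def sum_nonneg)

lemma third_sq_ge:
  assumes "a + b = 3" shows "(norm (weak_deriv \<Omega> (dirs a b) u x))\<^sup>2 \<le> third_sq \<Omega> u x"
proof -
  have b: "b = 3 - a" using assms by simp
  have "a \<in> {..3}" using assms by simp
  then show ?thesis unfolding third_sq_def b by (rule member_le_sum) auto
qed

text \<open>The Lipschitz bound comes from the maximum of the derivatives on a disc containing
  \<open>K\<close> with a margin of one, the directional derivative from the chain rule.\<close>

lemma weak_deriv_ibp_C1:
  fixes v g1 g2 :: "real^2 \<Rightarrow> complex"
  assumes \<Omega>: "open \<Omega>" "bounded \<Omega>" and \<phi>: "\<phi> \<in> test_functions \<Omega>"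
    and v: "\<And>x. (v has_derivative (\<lambda>h. h$1 *\<^sub>R g1 x + h$2 *\<^sub>R g2 x)) (at x)"
    and g: "continuous_on UNIV g1" "continuous_on UNIV g2"
  shows "(\<integral>x. iterated_deriv [axis 1 1] \<phi> x *\<^sub>R v x \<partial>lebesgue_on \<Omega>) = - (\<integral>x. \<phi> x *\<^sub>R g1 x \<partial>lebesgue_on \<Omega>)"
    "(\<integral>x. iterated_deriv [axis 2 1] \<phi> x *\<^sub>R v x \<partial>lebesgue_on \<Omega>) = - (\<integral>x. \<phi> x *\<^sub>R g2 x \<partial>lebesgue_on \<Omega>)"
proof -
  have cv: "continuous_on UNIV v"
    by (intro continuous_at_imp_continuous_on ballI has_derivative_continuous[OF v])
  have meas: "f \<in> borel_measurable (lebesgue_on \<Omega>)" if "continuous_on UNIV f" for f :: "real^2 \<Rightarrow> complex"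
    using borel_measurable_continuous_onI[OF that] by (intro measurable_restrict_space1 measurable_completion) simp
  have fin: "finite_measure (lebesgue_on \<Omega>)"
    using \<Omega> by (intro finite_measure_lebesgue_on) (simp add: lmeasurable_open)
  have vi: "integrable (lebesgue_on \<Omega>) v"
  proof -
    have "compact (v ` closure \<Omega>)" using \<Omega> cv by (intro compact_continuous_image) (auto intro: continuous_on_subset)
    then obtain B where "\<And>x. x \<in> closure \<Omega> \<Longrightarrow> norm (v x) \<le> B" by (metis bounded_iff compact_imp_bounded image_eqI)
    then show ?thesis
      by (intro finite_measure.integrable_const_bound[OF fin, of _ B] meas cv AE_I2) (use closure_subset in auto)
  qed
  have lip: "\<exists>L \<delta>. \<delta> > 0 \<and> (\<forall>x\<in>K. \<forall>t. \<bar>t\<bar> < \<delta> \<longrightarrow> norm (v (x + t *\<^sub>R e) - v x) \<le> L * \<bar>t\<bar>)"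
    if K: "compact K" and e: "e \<in> Basis" for K and e :: "real^2"
  proof -
    obtain R where R: "\<And>x. x \<in> K \<Longrightarrow> norm x \<le> R" using compact_imp_bounded[OF K] bounded_iff by blast
    have "compact (g1 ` cball 0 (R + 1))" "compact (g2 ` cball 0 (R + 1))"
      using g by (auto intro!: compact_continuous_image intro: continuous_on_subset)
    then obtain B1 B2 where B: "\<And>x. norm x \<le> R + 1 \<Longrightarrow> norm (g1 x) \<le> B1" "\<And>x. norm x \<le> R + 1 \<Longrightarrow> norm (g2 x) \<le> B2"
      by (metis (no_types, lifting) bounded_iff compact_imp_bounded image_eqI mem_cball_0)
    have "norm (v (x + t *\<^sub>R e) - v x) \<le> (B1 + B2) * \<bar>t\<bar>" if "x \<in> K" "\<bar>t\<bar> < 1" for x t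
    proof -
      have "norm (v (x + t *\<^sub>R e) - v x) \<le> (B1 + B2) * norm (x + t *\<^sub>R e - x)"
      proof (rule differentiable_bound[where S="cball 0 (R + 1)" and f'="\<lambda>x h. h$1 *\<^sub>R g1 x + h$2 *\<^sub>R g2 x"])
        fix z :: "real^2" assume z: "z \<in> cball 0 (R + 1)"
        show "(v has_derivative (\<lambda>h. h$1 *\<^sub>R g1 z + h$2 *\<^sub>R g2 z)) (at z within cball 0 (R + 1))"
          by (rule has_derivative_at_withinI[OF v])
        show "onorm (\<lambda>h :: real^2. h$1 *\<^sub>R g1 z + h$2 *\<^sub>R g2 z) \<le> B1 + B2"
        proof (rule onorm_le)
          fix h :: "real^2"
          have "norm (h$1 *\<^sub>R g1 z) \<le> norm h * B1" "norm (h$2 *\<^sub>R g2 z) \<le> norm h * B2"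
            unfolding norm_scaleR real_norm_def[symmetric] using z B[of z] component_le_norm_cart[of h]
            by (auto intro!: mult_mono)
          then show "norm (h$1 *\<^sub>R g1 z + h$2 *\<^sub>R g2 z) \<le> (B1 + B2) * norm h"
            using norm_triangle_ineq[of "h$1 *\<^sub>R g1 z" "h$2 *\<^sub>R g2 z"] by (simp add: algebra_simps)
        qed
      next
        have "norm (x + t *\<^sub>R e) \<le> norm x + norm (t *\<^sub>R e)" by (rule norm_triangle_ineq)
        then show "x + t *\<^sub>R e \<in> cball 0 (R + 1)" using R[OF that(1)] that e by simp
        show "x \<in> cball 0 (R + 1)" using R[OF that(1)] by simp
      qed simp
      then show ?thesis using e by simp
    qed
    then show ?thesis by (intro exI[of _ "B1 + B2"] exI[of _ 1]) auto
  qed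
  have der: "((\<lambda>t. (v (x + t *\<^sub>R e) - v x) /\<^sub>R t) \<longlongrightarrow> e$1 *\<^sub>R g1 x + e$2 *\<^sub>R g2 x) (at 0)" for x e
  proof -
    have "((\<lambda>t. x + t *\<^sub>R e) has_derivative (\<lambda>t. t *\<^sub>R e)) (at 0)" by (auto intro!: derivative_eq_intros)
    from has_derivative_compose[OF this, of v "\<lambda>h. h$1 *\<^sub>R g1 x + h$2 *\<^sub>R g2 x"] v[of x]
    have "((\<lambda>t. v (x + t *\<^sub>R e)) has_derivative (\<lambda>t. t *\<^sub>R (e$1 *\<^sub>R g1 x + e$2 *\<^sub>R g2 x))) (at 0)"
      by (simp add: scaleR_add_right)
    then have L: "((\<lambda>t. norm (v (x + t *\<^sub>R e) - v x - t *\<^sub>R (e$1 *\<^sub>R g1 x + e$2 *\<^sub>R g2 x)) / norm t) \<longlongrightarrow> 0) (at 0)"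
      unfolding has_derivative_at by simp
    have "((\<lambda>t. norm ((v (x + t *\<^sub>R e) - v x) /\<^sub>R t - (e$1 *\<^sub>R g1 x + e$2 *\<^sub>R g2 x))) \<longlongrightarrow> 0) (at 0)"
    proof (rule Lim_transform_eventually[OF L])
      have "norm (a - t *\<^sub>R b) / norm t = norm (a /\<^sub>R t - b)" if "t \<noteq> 0" for a b :: complex and t
      proof -
        have "a /\<^sub>R t - b = (a - t *\<^sub>R b) /\<^sub>R t" using that by (simp add: scaleR_diff_right)
        then show ?thesis by (simp only: norm_scaleR) (simp add: divide_inverse mult.commute)
      qed
      then show "\<forall>\<^sub>F t in at 0. norm (v (x + t *\<^sub>R e) - v x - t *\<^sub>R (e$1 *\<^sub>R g1 x + e$2 *\<^sub>R g2 x)) / norm t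
          = norm ((v (x + t *\<^sub>R e) - v x) /\<^sub>R t - (e$1 *\<^sub>R g1 x + e$2 *\<^sub>R g2 x))"
        by (auto simp: eventually_at_filter)
    qed
    then show ?thesis by (rule LIM_zero_cancel[OF tendsto_norm_zero_cancel])
  qed
  have "(\<integral>x. iterated_deriv [e] \<phi> x *\<^sub>R v x \<partial>lebesgue_on \<Omega>) = - (\<integral>x. \<phi> x *\<^sub>R (e$1 *\<^sub>R g1 x + e$2 *\<^sub>R g2 x) \<partial>lebesgue_on \<Omega>)"
    if e: "e \<in> Basis" for e
    by (rule weak_deriv_ibp[OF \<Omega>(1) vi _ e _ _ \<phi>])
      (auto intro!: lip e AE_I2 der meas continuous_intros g)
  from this[of "axis 1 1"] this[of "axis 2 1"]
  show "(\<integral>x. iterated_deriv [axis 1 1] \<phi> x *\<^sub>R v x \<partial>lebesgue_on \<Omega>) = - (\<integral>x. \<phi> x *\<^sub>R g1 x \<partial>lebesgue_on \<Omega>)"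
    "(\<integral>x. iterated_deriv [axis 2 1] \<phi> x *\<^sub>R v x \<partial>lebesgue_on \<Omega>) = - (\<integral>x. \<phi> x *\<^sub>R g2 x \<partial>lebesgue_on \<Omega>)"
    by (simp_all add: Basis_real2)
qed

text \<open>Removes the slack \<open>A' > A\<close>, which the strict inequality in the choice of a
  good centre forces.\<close>

lemma sqrt_limit_le:
  assumes "0 \<le> A" "\<And>A'. A' > A \<Longrightarrow> x \<le> c * sqrt A'" shows "x \<le> c * sqrt A"
proof (rule LIMSEQ_le_const)
  show "(\<lambda>n. c * sqrt (A + 1 / (real n + 1))) \<longlonglongrightarrow> c * sqrt A"
  proof -
    have "(\<lambda>n. A + 1 / (real n + 1)) \<longlonglongrightarrow> A + 0" by (intro tendsto_add tendsto_const) real_asymp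
    then show ?thesis by (intro tendsto_mult tendsto_const tendsto_real_sqrt) simp
  qed
  show "\<exists>N. \<forall>n\<ge>N. x \<le> c * sqrt (A + 1 / (real n + 1))"
    by (intro exI[of _ 0] allI impI assms(2)) (simp add: add_pos_nonneg)
qed

section \<open>Interpolation error on a star-shaped patch\<close>

text \<open>\<open>X\<close> is the patch on which the error is estimated, \<open>cball y0 r\<close>
  the disc of expansion centres, and \<open>W\<close> the region in which third derivatives may
  enter. Closed discs in \<open>seg\<close> let the segments in question fill compact sets.\<close>

locale local_patch =
  fixes \<Omega> W X :: "(real^2) set" and u :: "real^2 \<Rightarrow> complex" and y0 :: "real^2" and r d :: real
  assumes open_dom: "open \<Omega>" and bounded_dom: "bounded \<Omega>" and open_W: "open W"
    and u: "u \<in> sobolev 3 \<Omega>" and cont_u: "continuous_on (closure \<Omega>) u"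
    and r: "r > 0" and d: "2 * r \<le> d"
    and open_X: "open X"
    and dist: "\<And>x y. x \<in> X \<Longrightarrow> y \<in> ball y0 r \<Longrightarrow> norm (x - y) \<le> d"
    and seg: "\<And>p y. p \<in> X \<union> cball y0 r \<Longrightarrow> y \<in> cball y0 r \<Longrightarrow> closed_segment y p \<subseteq> \<Omega> \<inter> W"
begin

definition energy :: real where
  "energy = (\<integral>x. third_sq \<Omega> u x * indicator W x \<partial>lebesgue_on \<Omega>)"

lemma X_sub: "X \<subseteq> \<Omega>"
proof
  fix x assume "x \<in> X"
  then have "closed_segment y0 x \<subseteq> \<Omega> \<inter> W" using r by (intro seg) auto
  then show "x \<in> \<Omega>" by auto
qed

lemma dom_measurable: "\<Omega> \<in> sets lebesgue" "\<Omega> \<in> lmeasurable"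
  using open_dom bounded_dom by (auto simp: lmeasurable_open)

lemma u_integrable: "integrable (lebesgue_on \<Omega>) u"
  using u dom_measurable by (intro L2_integrable) (auto simp: sobolev_def)

lemma energy_nonneg: "0 \<le> energy"
  unfolding energy_def by (intro integral_nonneg_AE AE_I2) (simp add: third_sq_nonneg)

lemma energy_integrable: "integrable (lebesgue_on \<Omega>) (\<lambda>x. third_sq \<Omega> u x * indicator W x)"
proof (rule Bochner_Integration.integrable_bound[OF third_sq_integrable[OF u]])
  have "(indicator W :: _ \<Rightarrow> real) \<in> borel_measurable (lebesgue_on \<Omega>)"
    using open_W by (intro measurable_restrict_space1 borel_measurable_indicator) auto
  then show "(\<lambda>x. third_sq \<Omega> u x * indicator W x) \<in> borel_measurable (lebesgue_on \<Omega>)"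
    using third_sq_integrable[OF u] by (intro borel_measurable_times) auto
qed (auto intro!: AE_I2 simp: indicator_def)

text \<open>All segments needed for a compact \<open>K\<close> form a compact subset of
  \<open>\<Omega> \<inter> W\<close> and so leave room for mollification. The bounds contain neither
  \<open>\<epsilon>\<close> nor \<open>K\<close>, because the mollified square sum of third
  derivatives has total mass \<open>energy\<close>.\<close>

lemma smooth_approx:
  assumes K: "compact K" "K \<subseteq> X" and e: "e > 0" and A': "A' > energy"
  shows "\<exists>g. deriv_family2 g \<and> (\<forall>x\<in>K \<union> cball y0 r. norm (g 0 0 x - u x) \<le> e) \<and>
    (\<forall>x\<in>K. norm (g 0 0 x - grid_interp y0 (r/2) (g 0 0) x) \<le> 768 * d ^ 5 / r ^ 3 * sqrt A' \<and>
      norm (g 1 0 x - grid_interp1 y0 (r/2) (g 0 0) x) \<le> 600 * d ^ 4 / r ^ 3 * sqrt A' \<and>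
      norm (g 0 1 x - grid_interp2 y0 (r/2) (g 0 0) x) \<le> 600 * d ^ 4 / r ^ 3 * sqrt A')"
proof -
  \<comment> \<open>The continuous image of a compact set of parameters, centres and end points;
    compactness yields one positive margin \<open>\<delta>\<close> for all of its points.\<close>
  define S where "S = (\<lambda>(t, y, p). (1 - t) *\<^sub>R y + t *\<^sub>R p) ` ({0..1} \<times> cball y0 r \<times> (K \<union> cball y0 r))"
  have "compact S" unfolding S_def
    by (intro compact_continuous_image compact_Times) (auto intro!: continuous_intros K simp: case_prod_beta')
  have Sseg: "closed_segment y p \<subseteq> S" if "p \<in> K \<union> cball y0 r" "y \<in> cball y0 r" for p y
    using that by (force simp: S_def closed_segment_def)
  have "S \<subseteq> \<Omega> \<inter> W"
  proof
    fix z assume "z \<in> S"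
    then obtain w where "w \<in> {0..1} \<times> cball y0 r \<times> (K \<union> cball y0 r)" "z = (\<lambda>(t, y, p). (1 - t) *\<^sub>R y + t *\<^sub>R p) w"
      unfolding S_def by blast
    then obtain t y p where z: "t \<in> {0..1}" "y \<in> cball y0 r" "p \<in> K \<union> cball y0 r" "z = (1 - t) *\<^sub>R y + t *\<^sub>R p"
      by (cases w) auto
    then have "z \<in> closed_segment y p" by (auto simp: closed_segment_def)
    then show "z \<in> \<Omega> \<inter> W" using seg[of p y] z K by blast
  qed
  obtain \<delta> where \<delta>: "\<delta> > 0" "\<And>z. z \<in> S \<Longrightarrow> ball z \<delta> \<subseteq> \<Omega> \<inter> W"
    using Heine_Borel_lemma[OF \<open>compact S\<close>, of "{\<Omega> \<inter> W}"] \<open>S \<subseteq> _\<close> open_dom open_W by (auto intro: open_Int)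
  have "uniformly_continuous_on (closure \<Omega>) u"
    using bounded_dom cont_u by (intro compact_uniformly_continuous) auto
  then obtain \<eta> where \<eta>: "\<eta> > 0" "\<And>x y. x \<in> closure \<Omega> \<Longrightarrow> y \<in> closure \<Omega> \<Longrightarrow> dist y x < \<eta> \<Longrightarrow> dist (u y) (u x) < e"
    unfolding uniformly_continuous_on_def using e by blast
  \<comment> \<open>Kernels reach as far as \<open>2 * \<epsilon>\<close>, which is at most half of
    \<open>\<delta>\<close> and half of the \<open>\<eta>\<close> of uniform continuity.\<close>
  define \<epsilon> where "\<epsilon> = min \<delta> \<eta> / 4"
  have \<epsilon>: "\<epsilon> > 0" using \<delta> \<eta> by (simp add: \<epsilon>_def)
  have cb: "cball z (2 * \<epsilon>) \<subseteq> \<Omega> \<inter> W" if "z \<in> S" for z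
  proof -
    have "cball z (2 * \<epsilon>) \<subseteq> ball z \<delta>" using \<delta> \<eta> by (auto simp: \<epsilon>_def)
    then show ?thesis using \<delta>(2)[OF that] by blast
  qed
  define H where "H = (\<lambda>x. third_sq \<Omega> u x * indicator W x)"
  have H: "integrable (lebesgue_on \<Omega>) H" "\<And>x. 0 \<le> H x"
    using energy_integrable third_sq_nonneg by (auto simp: H_def)
  define g where "g = (\<lambda>a b. mollify \<Omega> \<epsilon> a b u)"
  define h where "h = mollify \<Omega> \<epsilon> 0 0 H"
  have g: "deriv_family2 g"
    unfolding deriv_family2_def g_def by (auto intro: mollify_has_derivative u_integrable)
  have h: "continuous_on UNIV h" "\<And>x. 0 \<le> h x"
    unfolding h_def by (rule mollify_continuous[OF H(1)])
      (auto simp: mollify_def H mollifier_nonneg[OF \<epsilon>] intro!: integral_nonneg_AE AE_I2)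
  have A: "(\<integral>\<^sup>+x. ennreal (h x) \<partial>lborel) \<le> ennreal energy"
    using nn_integral_mollify[OF \<epsilon> dom_measurable(1) H] by (simp add: h_def energy_def H_def)
  have bound: "norm (g a b z) \<le> (l + h z / l) / 2" if "z \<in> S" "a + b = 3" "l > 0" for z a b l
  proof -
    have w: "has_weak_deriv \<Omega> (dirs a b) u (weak_deriv \<Omega> (dirs a b) u)"
      using weak_deriv_works[OF u] that by simp
    then have i: "integrable (lebesgue_on \<Omega>) (weak_deriv \<Omega> (dirs a b) u)"
      using dom_measurable by (auto simp: has_weak_deriv_def intro: L2_integrable)
    have "g a b z = mollify \<Omega> \<epsilon> 0 0 (weak_deriv \<Omega> (dirs a b) u) z"
      unfolding g_def by (rule mollify_weak_deriv[OF \<epsilon> _ w]) (use cb[OF that(1)] in auto)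
    also have "norm \<dots> \<le> (l + h z / l) / 2" unfolding h_def
    proof (rule mollify_bound[OF \<epsilon> dom_measurable(1) i H(1) that(3)])
      fix y assume "y \<in> cball z (2 * \<epsilon>)"
      then have "y \<in> W" using cb[OF that(1)] by blast
      then show "(norm (weak_deriv \<Omega> (dirs a b) u y))\<^sup>2 \<le> H y" using third_sq_ge[OF that(2)] by (simp add: H_def)
    qed
    finally show ?thesis .
  qed
  have close: "norm (g 0 0 x - u x) \<le> e" if x: "x \<in> K \<union> cball y0 r" for x
    unfolding g_def
  proof (rule mollify_close[OF \<epsilon> dom_measurable(1) u_integrable])
    have "x \<in> S" using Sseg[OF x, of y0] r by auto
    from cb[OF this] show c: "cball x (2 * \<epsilon>) \<subseteq> \<Omega>" by blast
    fix y assume y: "y \<in> cball x (2 * \<epsilon>)"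
    have "x \<in> closure \<Omega>" "y \<in> closure \<Omega>" using c y \<epsilon> closure_subset[of \<Omega>] by (auto simp: subset_iff)
    moreover have "dist y x < \<eta>" using y \<delta> \<eta> by (auto simp: \<epsilon>_def dist_commute)
    ultimately show "norm (u y - u x) \<le> e" using \<eta>(2)[of x y] by (simp add: dist_norm)
  qed
  have "norm (g 0 0 x - grid_interp y0 (r/2) (g 0 0) x) \<le> 768 * d ^ 5 / r ^ 3 * sqrt A' \<and>
      norm (g 1 0 x - grid_interp1 y0 (r/2) (g 0 0) x) \<le> 600 * d ^ 4 / r ^ 3 * sqrt A' \<and>
      norm (g 0 1 x - grid_interp2 y0 (r/2) (g 0 0) x) \<le> 600 * d ^ 4 / r ^ 3 * sqrt A'" if x: "x \<in> K" for x
  proof -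
    have s: "closed_segment y p \<subseteq> S" if "p \<in> insert x (ball y0 r)" "y \<in> ball y0 r" for p y
      using that x by (intro Sseg) auto
    have dd: "norm (x - y) \<le> d" if "y \<in> ball y0 r" for y using dist that x K by blast
    show ?thesis
      using smooth_interp_error[OF g h A energy_nonneg A' r bound s dd d] by blast
  qed
  then show ?thesis using g close by blast
qed

lemma grid_close:
  assumes x: "x \<in> X" and w: "\<And>q. q \<in> cball y0 r \<Longrightarrow> norm (w q) \<le> e"
  shows "norm (grid_interp y0 (r/2) w x) \<le> 11 * (2 * d / r)\<^sup>2 * e"
proof (rule grid_interp_bound(1))
  have n: "norm (x - y0) \<le> d" using dist[OF x, of y0] r by simp
  show "\<bar>x$1 - y0$1\<bar> \<le> 2 * d / r * (r/2)" "\<bar>x$2 - y0$2\<bar> \<le> 2 * d / r * (r/2)"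
    using n component_le_norm_cart[of "x - y0" 1] component_le_norm_cart[of "x - y0" 2] r by auto
  show "1 \<le> 2 * d / r" using d r by simp
  fix s t :: real assume st: "s \<in> {-1,0,1}" "t \<in> {-1,0,1}"
  show "norm (w (pt y0 (r/2) s t)) \<le> e"
  proof (rule w)
    have "norm ((r/2 * s) *\<^sub>R axis 1 1 + (r/2 * t) *\<^sub>R axis 2 1 :: real^2) \<le> \<bar>r/2 * s\<bar> + \<bar>r/2 * t\<bar>"
      using norm_triangle_ineq[of "(r/2 * s) *\<^sub>R axis 1 1 :: real^2" "(r/2 * t) *\<^sub>R axis 2 1"] by simp
    also have "\<dots> \<le> r/2 + r/2" using st r by (intro add_mono) (auto simp: abs_mult)
    finally have "norm (pt y0 (r/2) s t - y0) \<le> r" by (simp add: pt_def add.assoc)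
    then show "pt y0 (r/2) s t \<in> cball y0 r" by (simp add: dist_norm norm_minus_commute)
  qed
qed (use r in simp)

text \<open>Passage to the limit in \<open>smooth_approx\<close>: \<open>grid_interp\<close> depends
  boundedly on finitely many values near \<open>y0\<close>, and these as well as the value at
  \<open>x\<close> are approximated within \<open>e'\<close>.\<close>

lemma interp_error:
  assumes x: "x \<in> X"
  shows "norm (u x - grid_interp y0 (r/2) u x) \<le> 768 * d ^ 5 / r ^ 3 * sqrt energy"
proof (rule sqrt_limit_le[OF energy_nonneg])
  fix A' assume A': "A' > energy"
  define c where "c = 1 + 11 * (2 * d / r)\<^sup>2"
  have c: "c > 0" unfolding c_def by (intro add_pos_nonneg) auto
  show "norm (u x - grid_interp y0 (r/2) u x) \<le> 768 * d ^ 5 / r ^ 3 * sqrt A'"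
  proof (rule field_le_epsilon)
    fix e :: real assume "e > 0"
    define e' where "e' = e / c"
    have e: "e' > 0" "c * e' = e" using c \<open>e > 0\<close> by (simp_all add: e'_def)
    have "compact {x}" "{x} \<subseteq> X" using x by auto
    from smooth_approx[OF this e(1) A'] obtain g :: "nat \<Rightarrow> nat \<Rightarrow> real^2 \<Rightarrow> complex" where "\<forall>x'\<in>{x} \<union> cball y0 r. norm (g 0 0 x' - u x') \<le> e'"
      "\<forall>x\<in>{x}. norm (g 0 0 x - grid_interp y0 (r/2) (g 0 0) x) \<le> 768 * d ^ 5 / r ^ 3 * sqrt A' \<and>
      norm (g 1 0 x - grid_interp1 y0 (r/2) (g 0 0) x) \<le> 600 * d ^ 4 / r ^ 3 * sqrt A' \<and>
      norm (g 0 1 x - grid_interp2 y0 (r/2) (g 0 0) x) \<le> 600 * d ^ 4 / r ^ 3 * sqrt A'" by blast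
    then have g: "\<And>x'. x' \<in> {x} \<union> cball y0 r \<Longrightarrow> norm (g 0 0 x' - u x') \<le> e'"
      "norm (g 0 0 x - grid_interp y0 (r/2) (g 0 0) x) \<le> 768 * d ^ 5 / r ^ 3 * sqrt A'" by blast+
    have "u x - grid_interp y0 (r/2) u x = (g 0 0 x - grid_interp y0 (r/2) (g 0 0) x)
        - (g 0 0 x - u x) + grid_interp y0 (r/2) (\<lambda>x. g 0 0 x - u x) x" by (simp add: grid_interp_diff)
    also have "norm \<dots> \<le> 768 * d ^ 5 / r ^ 3 * sqrt A' + e' + 11 * (2 * d / r)\<^sup>2 * (e')"
      by (rule norm_triangle_mono[OF order_trans[OF norm_triangle_ineq4 add_mono[OF g(2) g(1)]] grid_close[OF x]])
        (use g(1) in auto)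
    also have "\<dots> = 768 * d ^ 5 / r ^ 3 * sqrt A' + c * e'" unfolding c_def by (simp only: distrib_right mult_1_left add.assoc)
    finally show "norm (u x - grid_interp y0 (r/2) u x) \<le> 768 * d ^ 5 / r ^ 3 * sqrt A' + e" using e by simp
  qed
qed

lemma continuous_integrable:
  fixes f :: "real^2 \<Rightarrow> complex"
  assumes "continuous_on UNIV f" shows "integrable (lebesgue_on \<Omega>) f"
proof -
  have "compact (f ` closure \<Omega>)"
    using bounded_dom assms by (intro compact_continuous_image) (auto intro: continuous_on_subset)
  then obtain B where "\<And>x. x \<in> closure \<Omega> \<Longrightarrow> norm (f x) \<le> B" by (metis bounded_iff compact_imp_bounded image_eqI)
  moreover have "f \<in> borel_measurable (lebesgue_on \<Omega>)"
    using borel_measurable_continuous_onI[OF assms] by (intro measurable_restrict_space1 measurable_completion) simp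
  ultimately show ?thesis
    by (intro finite_measure.integrable_const_bound[OF finite_measure_lebesgue_on[OF dom_measurable(2)], of _ B] AE_I2)
      (use closure_subset in auto)
qed

lemma integral_X:
  fixes f :: "real^2 \<Rightarrow> 'b::{banach,second_countable_topology}"
  assumes "\<phi> \<in> test_functions X"
  shows "(\<integral>x. \<phi> x *\<^sub>R f x \<partial>lebesgue_on X) = (\<integral>x. \<phi> x *\<^sub>R f x \<partial>lebesgue_on \<Omega>)"
proof -
  have "\<phi> x = 0" if "x \<notin> X" for x
    using assms that closure_subset[of "{x. \<phi> x \<noteq> 0}"] by (auto simp: test_functions_def)
  then have "indicator X x *\<^sub>R \<phi> x *\<^sub>R f x = indicator \<Omega> x *\<^sub>R \<phi> x *\<^sub>R f x" for x
    using X_sub by (cases "x \<in> X") (auto simp: indicator_def)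
  note eq = this
  have "X \<inter> space lebesgue \<in> sets lebesgue" "\<Omega> \<inter> space lebesgue \<in> sets lebesgue"
    using open_X dom_measurable by auto
  note R = this[THEN integral_restrict_space]
  show ?thesis unfolding R eq ..
qed

text \<open>Both derivatives are moved onto a test function, where uniform convergence of the values
  suffices, and the resulting integral inequality is made pointwise by
  \<open>test_function_bound_AE_complex\<close>, at the price of the factor 2. The parameters
  \<open>gd\<close> and \<open>GI\<close> stand for the derivatives of approximant and interpolant
  along \<open>e\<close>, so that both directions are covered by one proof.\<close>

lemma grad_error:
  fixes w :: "real^2 \<Rightarrow> complex"
  assumes e: "e \<in> Basis" and w: "has_weak_deriv \<Omega> [e] u w"
    and gd: "\<And>g \<phi>. deriv_family2 g \<Longrightarrow> \<phi> \<in> test_functions \<Omega> \<Longrightarrow>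
        (\<integral>x. iterated_deriv [e] \<phi> x *\<^sub>R g 0 0 x \<partial>lebesgue_on \<Omega>) = - (\<integral>x. \<phi> x *\<^sub>R gd g x \<partial>lebesgue_on \<Omega>)"
      "\<And>g. deriv_family2 g \<Longrightarrow> continuous_on UNIV (gd g)"
    and GI: "\<And>v \<phi>. \<phi> \<in> test_functions \<Omega> \<Longrightarrow>
        (\<integral>x. iterated_deriv [e] \<phi> x *\<^sub>R grid_interp y0 (r/2) v x \<partial>lebesgue_on \<Omega>) = - (\<integral>x. \<phi> x *\<^sub>R GI v x \<partial>lebesgue_on \<Omega>)"
      "\<And>v. continuous_on UNIV (GI v)"
    and est: "\<And>K e A'. compact K \<Longrightarrow> K \<subseteq> X \<Longrightarrow> e > 0 \<Longrightarrow> A' > energy \<Longrightarrow>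
       \<exists>g. deriv_family2 g \<and> (\<forall>x\<in>K \<union> cball y0 r. norm (g 0 0 x - u x) \<le> e) \<and>
         (\<forall>x\<in>K. norm (gd g x - GI (g 0 0) x) \<le> c * sqrt A')"
  shows "AE x in lebesgue_on X. norm (w x - GI u x) \<le> 2 * (c * sqrt energy)"
proof (rule test_function_bound_AE_complex[OF open_X])
  have wi: "integrable (lebesgue_on \<Omega>) w"
    using w dom_measurable by (auto simp: has_weak_deriv_def intro: L2_integrable)
  have gi: "integrable (lebesgue_on \<Omega>) (GI v)" for v by (intro continuous_integrable GI)
  have ii: "integrable (lebesgue_on \<Omega>) (grid_interp y0 (r/2) v)" for v
    by (intro continuous_integrable continuous_at_imp_continuous_on ballI has_derivative_continuous[OF grid_interp_has_derivative])
  show "integrable (lebesgue_on X) (\<lambda>x. w x - GI u x)"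
  proof -
    have X: "X \<in> sets lebesgue" using open_X by auto
    have "set_integrable lebesgue \<Omega> (\<lambda>x. w x - GI u x)"
      using wi gi[of u] dom_measurable by (simp add: set_integrable_def integrable_restrict_space[symmetric])
    then have "set_integrable lebesgue X (\<lambda>x. w x - GI u x)" by (rule set_integrable_subset[OF _ X X_sub])
    then show ?thesis using X by (simp add: set_integrable_def integrable_restrict_space)
  qed
  fix \<phi> assume \<phi>X: "\<phi> \<in> test_functions X" and \<phi>0: "\<And>x. 0 \<le> \<phi> x"
  have \<phi>: "\<phi> \<in> test_functions \<Omega>" using \<phi>X X_sub by (auto simp: test_functions_def)
  define \<phi>' where "\<phi>' = iterated_deriv [e] \<phi>"
  have \<phi>'X: "\<phi>' \<in> test_functions X" unfolding \<phi>'_def by (rule test_function_deriv[OF \<phi>X e])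
  obtain B where B: "\<And>x. \<bar>\<phi>' x\<bar> \<le> B" using test_function_bounded[OF \<phi>'X] by blast
  have B0: "B \<ge> 0" using B abs_ge_zero order_trans by blast
  \<comment> \<open>Both supports matter: one of the two integrals to be estimated contains
    \<open>\<phi>\<close>, the other its derivative.\<close>
  define K where "K = closure {x. \<phi> x \<noteq> 0} \<union> closure {x. \<phi>' x \<noteq> 0}"
  have K: "compact K" "K \<subseteq> X" using \<phi>X \<phi>'X by (auto simp: K_def test_functions_def)
  have K0: "\<phi> x = 0" "\<phi>' x = 0" if "x \<notin> K" for x
    using that closure_subset[of "{x. \<phi> x \<noteq> 0}"] closure_subset[of "{x. \<phi>' x \<noteq> 0}"] by (auto simp: K_def)
  have \<phi>i: "integrable (lebesgue_on \<Omega>) \<phi>"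
    using integrable_test_scaleR[of \<Omega> "\<lambda>_. 1::real", OF _ \<phi>] finite_measure_lebesgue_on[OF dom_measurable(2)]
    by (simp add: finite_measure.integrable_const)
  define I\<phi> where "I\<phi> = (\<integral>x. \<phi> x \<partial>lebesgue_on \<Omega>)"
  have ts: "integrable (lebesgue_on \<Omega>) (\<lambda>x. \<phi> x *\<^sub>R f x)" "integrable (lebesgue_on \<Omega>) (\<lambda>x. \<phi>' x *\<^sub>R f x)"
    if "integrable (lebesgue_on \<Omega>) f" for f :: "real^2 \<Rightarrow> complex"
    using that \<phi>X \<phi>'X by (auto intro: integrable_test_scaleR)
  have "norm (\<integral>x. \<phi> x *\<^sub>R (w x - GI u x) \<partial>lebesgue_on \<Omega>) \<le> (c * I\<phi>) * sqrt energy"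
  proof (rule sqrt_limit_le[OF energy_nonneg])
    fix A' assume A': "A' > energy"
    define k where "k = 1 + 11 * (2 * d / r)\<^sup>2"
    have k: "k \<ge> 1" unfolding k_def by auto
    \<comment> \<open>Bounds the effect of the error \<open>e'\<close> on the integral against
      \<open>\<phi>'\<close>; the summand 1 only ensures positivity.\<close>
    define C where "C = measure lebesgue \<Omega> * (B * k) + 1"
    have C: "C > 0" unfolding C_def using B0 k by (intro add_nonneg_pos mult_nonneg_nonneg) auto
    show "norm (\<integral>x. \<phi> x *\<^sub>R (w x - GI u x) \<partial>lebesgue_on \<Omega>) \<le> (c * I\<phi>) * sqrt A'"
    proof (rule field_le_epsilon)
      fix e0 :: real assume "e0 > 0"
      define e' where "e' = e0 / C"
      have e': "e' > 0" "C * e' = e0" using \<open>e0 > 0\<close> C by (simp_all add: e'_def)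
      obtain g :: "nat \<Rightarrow> nat \<Rightarrow> real^2 \<Rightarrow> complex" where g: "deriv_family2 g" "\<forall>x\<in>K \<union> cball y0 r. norm (g 0 0 x - u x) \<le> e'"
         "\<forall>x\<in>K. norm (gd g x - GI (g 0 0) x) \<le> c * sqrt A'"
        using est[OF K e'(1) A'] by blast
      have g0c: "continuous_on UNIV (g 0 0)"
        using g(1) unfolding deriv_family2_def
        by (intro continuous_at_imp_continuous_on ballI) (blast intro: has_derivative_continuous)
      have g0: "integrable (lebesgue_on \<Omega>) (g 0 0)" by (intro continuous_integrable g0c)
      have gdi: "integrable (lebesgue_on \<Omega>) (gd g)" by (intro continuous_integrable gd g)
      \<comment> \<open>The difference of \<open>g 0 0\<close> and \<open>u\<close> minus its
        interpolant. After integration by parts it is the whole discrepancy between the two tested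
        errors, and on \<open>K\<close> it is of order \<open>e'\<close>.\<close>
      define E where "E = (\<lambda>x. (g 0 0 x - u x) - grid_interp y0 (r/2) (\<lambda>x. g 0 0 x - u x) x)"
      have Ei: "integrable (lebesgue_on \<Omega>) E" unfolding E_def
        by (intro Bochner_Integration.integrable_diff g0 u_integrable ii)
      have 1: "(\<integral>x. \<phi> x *\<^sub>R (w x - GI u x) \<partial>lebesgue_on \<Omega>) = (\<integral>x. \<phi>' x *\<^sub>R grid_interp y0 (r/2) u x \<partial>lebesgue_on \<Omega>) - (\<integral>x. \<phi>' x *\<^sub>R u x \<partial>lebesgue_on \<Omega>)"
      proof -
        have "(\<integral>x. \<phi>' x *\<^sub>R u x \<partial>lebesgue_on \<Omega>) = - (\<integral>x. \<phi> x *\<^sub>R w x \<partial>lebesgue_on \<Omega>)"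
          using w \<phi> by (simp add: has_weak_deriv_def \<phi>'_def)
        then show ?thesis using ts(1)[OF wi] ts(1)[OF gi[of u]] GI(1)[OF \<phi>, of u]
          by (simp add: scaleR_diff_right \<phi>'_def)
      qed
      have 2: "(\<integral>x. \<phi> x *\<^sub>R (gd g x - GI (g 0 0) x) \<partial>lebesgue_on \<Omega>) = (\<integral>x. \<phi>' x *\<^sub>R grid_interp y0 (r/2) (g 0 0) x \<partial>lebesgue_on \<Omega>) - (\<integral>x. \<phi>' x *\<^sub>R g 0 0 x \<partial>lebesgue_on \<Omega>)"
        using ts(1)[OF gdi] ts(1)[OF gi[of "g 0 0"]] GI(1)[OF \<phi>, of "g 0 0"] gd(1)[OF g(1) \<phi>]
        by (simp add: scaleR_diff_right \<phi>'_def)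
      have 3: "(\<integral>x. \<phi>' x *\<^sub>R E x \<partial>lebesgue_on \<Omega>) = ((\<integral>x. \<phi>' x *\<^sub>R g 0 0 x \<partial>lebesgue_on \<Omega>) - (\<integral>x. \<phi>' x *\<^sub>R u x \<partial>lebesgue_on \<Omega>))
          - ((\<integral>x. \<phi>' x *\<^sub>R grid_interp y0 (r/2) (g 0 0) x \<partial>lebesgue_on \<Omega>) - (\<integral>x. \<phi>' x *\<^sub>R grid_interp y0 (r/2) u x \<partial>lebesgue_on \<Omega>))"
        unfolding E_def grid_interp_diff scaleR_diff_right
        by (simp add: ts(2) g0 u_integrable ii Bochner_Integration.integrable_diff)
      have "(\<integral>x. \<phi> x *\<^sub>R (w x - GI u x) \<partial>lebesgue_on \<Omega>) = (\<integral>x. \<phi> x *\<^sub>R (gd g x - GI (g 0 0) x) \<partial>lebesgue_on \<Omega>) + (\<integral>x. \<phi>' x *\<^sub>R E x \<partial>lebesgue_on \<Omega>)"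
        unfolding 1 2 3 by simp
      also have "norm \<dots> \<le> (c * I\<phi>) * sqrt A' + e0"
      proof (rule norm_triangle_mono)
        have "norm (\<integral>x. \<phi> x *\<^sub>R (gd g x - GI (g 0 0) x) \<partial>lebesgue_on \<Omega>) \<le> (\<integral>x. (c * sqrt A') * \<phi> x \<partial>lebesgue_on \<Omega>)"
        proof (rule Bochner_Integration.integral_norm_bound_integral)
          show "integrable (lebesgue_on \<Omega>) (\<lambda>x. \<phi> x *\<^sub>R (gd g x - GI (g 0 0) x))"
            by (intro ts Bochner_Integration.integrable_diff gdi gi)
          show "integrable (lebesgue_on \<Omega>) (\<lambda>x. (c * sqrt A') * \<phi> x)" using \<phi>i by simp
          fix x
          show "norm (\<phi> x *\<^sub>R (gd g x - GI (g 0 0) x)) \<le> (c * sqrt A') * \<phi> x"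
          proof (cases "x \<in> K")
            case True
            then have "\<phi> x * norm (gd g x - GI (g 0 0) x) \<le> \<phi> x * (c * sqrt A')"
              using g(3) \<phi>0 by (intro mult_left_mono) auto
            then show ?thesis using \<phi>0[of x] by (simp add: mult.commute)
          qed (simp add: K0)
        qed
        then show "norm (\<integral>x. \<phi> x *\<^sub>R (gd g x - GI (g 0 0) x) \<partial>lebesgue_on \<Omega>) \<le> (c * I\<phi>) * sqrt A'"
          by (simp add: I\<phi>_def mult_ac)
        have "norm (\<integral>x. \<phi>' x *\<^sub>R E x \<partial>lebesgue_on \<Omega>) \<le> (\<integral>x. B * (k * e') \<partial>lebesgue_on \<Omega>)"
        proof (rule Bochner_Integration.integral_norm_bound_integral)
          show "integrable (lebesgue_on \<Omega>) (\<lambda>x. \<phi>' x *\<^sub>R E x)" by (intro ts Ei)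
          show "integrable (lebesgue_on \<Omega>) (\<lambda>x. B * (k * e'))"
            by (intro finite_measure.integrable_const finite_measure_lebesgue_on dom_measurable)
          fix x
          show "norm (\<phi>' x *\<^sub>R E x) \<le> B * (k * e')"
          proof (cases "x \<in> K")
            case True
            have "norm (E x) \<le> e' + 11 * (2 * d / r)\<^sup>2 * e'" unfolding E_def
              by (rule order_trans[OF norm_triangle_ineq4 add_mono[OF _ grid_close]]) (use g(2) True K in auto)
            also have "\<dots> = k * e'" unfolding k_def by (simp only: distrib_right mult_1_left)
            finally show ?thesis unfolding norm_scaleR using B B0 by (intro mult_mono) auto
          next
            case False then show ?thesis using B0 k e'(1) by (simp add: K0)
          qed
        qed
        also have "\<dots> = measure lebesgue \<Omega> * (B * k) * e'"
          using dom_measurable by (simp add: measure_restrict_space mult_ac)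
        also have "\<dots> \<le> C * e'" unfolding C_def using e'(1) by (intro mult_right_mono) auto
        finally show "norm (\<integral>x. \<phi>' x *\<^sub>R E x \<partial>lebesgue_on \<Omega>) \<le> e0" using e' by simp
      qed
      finally show "norm (\<integral>x. \<phi> x *\<^sub>R (w x - GI u x) \<partial>lebesgue_on \<Omega>) \<le> (c * I\<phi>) * sqrt A' + e0" .
    qed
  qed
  then show "norm (\<integral>x. \<phi> x *\<^sub>R (w x - GI u x) \<partial>lebesgue_on X) \<le> (c * sqrt energy) * (\<integral>x. \<phi> x \<partial>lebesgue_on X)"
    using integral_X[OF \<phi>X, of "\<lambda>x. w x - GI u x"] integral_X[OF \<phi>X, of "\<lambda>x. 1::real"] by (simp add: I\<phi>_def mult_ac)
qed

lemma interp_grad_error: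
  "AE x in lebesgue_on X. norm (weak_deriv \<Omega> [axis 1 1] u x - grid_interp1 y0 (r/2) u x) \<le> 2 * (600 * d ^ 4 / r ^ 3 * sqrt energy)"
  "AE x in lebesgue_on X. norm (weak_deriv \<Omega> [axis 2 1] u x - grid_interp2 y0 (r/2) u x) \<le> 2 * (600 * d ^ 4 / r ^ 3 * sqrt energy)"
proof -
  have gc: "continuous_on UNIV (g a b)" if "deriv_family2 g" for g a b
    using that unfolding deriv_family2_def
    by (intro continuous_at_imp_continuous_on ballI) (blast intro: has_derivative_continuous)
  have c1: "continuous_on UNIV (grid_interp1 y0 (r/2) v)" "continuous_on UNIV (grid_interp2 y0 (r/2) v)" for v
    unfolding grid_interp1_def[abs_def] grid_interp2_def[abs_def] by (intro continuous_intros; simp add: r less_imp_neq[symmetric])+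
  have gd: "(g 0 0 has_derivative (\<lambda>h. h$1 *\<^sub>R g 1 0 x + h$2 *\<^sub>R g 0 1 x)) (at x)" if "deriv_family2 g" for g x
    using that by (simp add: deriv_family2_def)
  show "AE x in lebesgue_on X. norm (weak_deriv \<Omega> [axis 1 1] u x - grid_interp1 y0 (r/2) u x) \<le> 2 * (600 * d ^ 4 / r ^ 3 * sqrt energy)"
  proof (rule grad_error[where gd="\<lambda>g. g 1 0" and e="axis 1 1" and GI="grid_interp1 y0 (r/2)"
        and c="600 * d ^ 4 / r ^ 3"])
    show "has_weak_deriv \<Omega> [axis 1 1] u (weak_deriv \<Omega> [axis 1 1] u)"
      using weak_deriv_works[OF u, of 1 0] by (simp add: dirs_unit)
    show "\<exists>g. deriv_family2 g \<and> (\<forall>x\<in>K \<union> cball y0 r. norm (g 0 0 x - u x) \<le> e) \<and>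
         (\<forall>x\<in>K. norm (g 1 0 x - grid_interp1 y0 (r/2) (g 0 0) x) \<le> 600 * d ^ 4 / r ^ 3 * sqrt A')"
      if "compact K" "K \<subseteq> X" "(0::real) < e" "energy < A'" for K e A'
      using smooth_approx[OF that] by blast
    show "axis 1 1 \<in> (Basis :: (real^2) set)" by (simp add: Basis_real2)
    show "continuous_on UNIV (grid_interp1 y0 (r/2) v)" for v by (rule c1)
    show "(\<integral>x. iterated_deriv [axis 1 1] \<phi> x *\<^sub>R grid_interp y0 (r/2) v x \<partial>lebesgue_on \<Omega>) = - (\<integral>x. \<phi> x *\<^sub>R grid_interp1 y0 (r/2) v x \<partial>lebesgue_on \<Omega>)"
      if "\<phi> \<in> test_functions \<Omega>" for v \<phi>
      by (rule weak_deriv_ibp_C1(1)[OF open_dom bounded_dom that grid_interp_has_derivative c1])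
    fix g :: "nat \<Rightarrow> nat \<Rightarrow> real^2 \<Rightarrow> complex" assume g: "deriv_family2 g"
    show "continuous_on UNIV (g 1 0)" by (rule gc[OF g])
    show "(\<integral>x. iterated_deriv [axis 1 1] \<phi> x *\<^sub>R g 0 0 x \<partial>lebesgue_on \<Omega>) = - (\<integral>x. \<phi> x *\<^sub>R g 1 0 x \<partial>lebesgue_on \<Omega>)"
      if "\<phi> \<in> test_functions \<Omega>" for \<phi>
      by (rule weak_deriv_ibp_C1(1)[OF open_dom bounded_dom that gd[OF g] gc[OF g] gc[OF g]])
  qed
  show "AE x in lebesgue_on X. norm (weak_deriv \<Omega> [axis 2 1] u x - grid_interp2 y0 (r/2) u x) \<le> 2 * (600 * d ^ 4 / r ^ 3 * sqrt energy)"
  proof (rule grad_error[where gd="\<lambda>g. g 0 1" and e="axis 2 1" and GI="grid_interp2 y0 (r/2)"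
        and c="600 * d ^ 4 / r ^ 3"])
    show "has_weak_deriv \<Omega> [axis 2 1] u (weak_deriv \<Omega> [axis 2 1] u)"
      using weak_deriv_works[OF u, of 0 1] by (simp add: dirs_unit)
    show "\<exists>g. deriv_family2 g \<and> (\<forall>x\<in>K \<union> cball y0 r. norm (g 0 0 x - u x) \<le> e) \<and>
         (\<forall>x\<in>K. norm (g 0 1 x - grid_interp2 y0 (r/2) (g 0 0) x) \<le> 600 * d ^ 4 / r ^ 3 * sqrt A')"
      if "compact K" "K \<subseteq> X" "(0::real) < e" "energy < A'" for K e A'
      using smooth_approx[OF that] by blast
    show "axis 2 1 \<in> (Basis :: (real^2) set)" by (simp add: Basis_real2)
    show "continuous_on UNIV (grid_interp2 y0 (r/2) v)" for v by (rule c1)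
    show "(\<integral>x. iterated_deriv [axis 2 1] \<phi> x *\<^sub>R grid_interp y0 (r/2) v x \<partial>lebesgue_on \<Omega>) = - (\<integral>x. \<phi> x *\<^sub>R grid_interp2 y0 (r/2) v x \<partial>lebesgue_on \<Omega>)"
      if "\<phi> \<in> test_functions \<Omega>" for v \<phi>
      by (rule weak_deriv_ibp_C1(2)[OF open_dom bounded_dom that grid_interp_has_derivative c1])
    fix g :: "nat \<Rightarrow> nat \<Rightarrow> real^2 \<Rightarrow> complex" assume g: "deriv_family2 g"
    show "continuous_on UNIV (g 0 1)" by (rule gc[OF g])
    show "(\<integral>x. iterated_deriv [axis 2 1] \<phi> x *\<^sub>R g 0 0 x \<partial>lebesgue_on \<Omega>) = - (\<integral>x. \<phi> x *\<^sub>R g 0 1 x \<partial>lebesgue_on \<Omega>)"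
      if "\<phi> \<in> test_functions \<Omega>" for \<phi>
      by (rule weak_deriv_ibp_C1(2)[OF open_dom bounded_dom that gd[OF g] gc[OF g] gc[OF g]])
  qed
qed

end

section \<open>Strictly star-shaped polygons\<close>

definition poly_curve :: "(real^2) list \<Rightarrow> (real^2) set" where
  "poly_curve vs = (\<Union>i<length vs. edge vs i)"

lemma polygon_inter:
  assumes "polygon vs \<Omega>" "i < length vs" "j < length vs" "i \<noteq> j"
  shows "edge vs i \<inter> edge vs j = {edge_start vs i, edge_end vs i} \<inter> {edge_start vs j, edge_end vs j}"
  using assms by (auto simp: polygon_def)

lemma polygon_edge_ne:
  assumes "polygon vs \<Omega>" "i < length vs" shows "edge_start vs i \<noteq> edge_end vs i"
proof -
  have "distinct vs" "length vs \<ge> 3" using assms by (auto simp: polygon_def)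
  moreover have "Suc i mod length vs \<noteq> i" using assms(2) \<open>length vs \<ge> 3\<close> by (cases "Suc i = length vs") auto
  moreover have "Suc i mod length vs < length vs" using \<open>length vs \<ge> 3\<close> by (intro mod_less_divisor) linarith
  ultimately show ?thesis using assms(2) by (simp add: edge_start_def edge_end_def nth_eq_iff_index_eq)
qed

text \<open>Edges are prepended one at a time, starting with the last one, so the end point remains
  \<open>vs ! 0\<close>. The bound \<open>Suc m < length vs\<close> keeps edge 0 out, hence the path
  never closes up.\<close>

lemma polygon_arc:
  assumes P: "polygon vs \<Omega>" and m: "Suc m < length vs"
  shows "\<exists>c. arc c \<and> pathstart c = vs ! (length vs - 1 - m) \<and> pathfinish c = vs ! 0 \<and>
     path_image c = (\<Union>i\<in>{length vs - 1 - m..<length vs}. edge vs i)"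
  using m
proof (induction m)
  case 0
  have d: "distinct vs" and l: "length vs \<ge> 3" using P by (auto simp: polygon_def)
  let ?k = "length vs - 1"
  have S: "Suc ?k = length vs" using l by simp
  have "edge_start vs ?k = vs ! ?k" "edge_end vs ?k = vs ! 0" using S by (simp_all add: edge_start_def edge_end_def)
  moreover have "edge_start vs ?k \<noteq> edge_end vs ?k" using polygon_edge_ne[OF P, of ?k] l by simp
  moreover have "{?k..<length vs} = {?k}" using l by auto
  ultimately show ?case
    by (intro exI[of _ "linepath (vs ! ?k) (vs ! 0)"]) (auto simp: edge_def)
next
  case (Suc m)
  have d: "distinct vs" and l: "length vs \<ge> 3" using P by (auto simp: polygon_def)
  define k where "k = length vs - 1 - Suc m"
  have k: "1 \<le> k" "Suc k < length vs" "length vs - 1 - m = Suc k" using Suc.prems by (auto simp: k_def)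
  obtain c where c: "arc c" "pathstart c = vs ! Suc k" "pathfinish c = vs ! 0" "path_image c = (\<Union>i\<in>{Suc k..<length vs}. edge vs i)"
    using Suc.IH Suc.prems k(3) by auto
  have e: "edge_start vs k = vs ! k" "edge_end vs k = vs ! Suc k" using k by (simp_all add: edge_start_def edge_end_def)
  have ne: "vs ! k \<noteq> vs ! Suc k" using polygon_edge_ne[OF P, of k] k e by simp
  \<comment> \<open>The new edge meets later ones only in common end points, and its start
    \<open>vs ! k\<close> is not an end point of a later edge: the last edge wraps around to index
    0, while \<open>k \<ge> 1\<close>.\<close>
  have sub: "edge vs k \<inter> edge vs j \<subseteq> {vs ! Suc k}" if j: "j \<in> {Suc k..<length vs}" for j
  proof -
    have "vs ! k \<notin> {edge_start vs j, edge_end vs j}"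
    proof -
      have "Suc j mod length vs \<noteq> k" using j k by (cases "Suc j = length vs") auto
      moreover have "Suc j mod length vs < length vs" using l by (intro mod_less_divisor) linarith
      ultimately show ?thesis using j k d by (auto simp: edge_start_def edge_end_def nth_eq_iff_index_eq)
    qed
    then show ?thesis using polygon_inter[OF P, of k j] j k e by auto
  qed
  have "arc (linepath (vs ! k) (vs ! Suc k) +++ c)"
  proof (rule arc_join)
    show "path_image (linepath (vs ! k) (vs ! Suc k)) \<inter> path_image c \<subseteq> {pathstart c}"
      using sub by (force simp: c edge_def e)
  qed (use c ne in auto)
  moreover have "{k..<length vs} = insert k {Suc k..<length vs}" using k by auto
  ultimately show ?case unfolding k_def[symmetric]
    by (intro exI[of _ "linepath (vs ! k) (vs ! Suc k) +++ c"]) (auto simp: path_image_join c edge_def e)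
qed

text \<open>Edge 0 closes the arc formed by all other edges to a simple closed curve. In this form
  the Jordan-Brouwer theorem becomes applicable.\<close>

lemma polygon_homeomorphic_sphere:
  assumes P: "polygon vs \<Omega>"
  shows "poly_curve vs homeomorphic sphere (0::real^2) 1"
proof -
  have l: "length vs \<ge> 3" using P by (auto simp: polygon_def)
  obtain c where c: "arc c" "pathstart c = vs ! 1" "pathfinish c = vs ! 0" "path_image c = (\<Union>i\<in>{1..<length vs}. edge vs i)"
  proof -
    have "Suc (length vs - 2) < length vs" "length vs - 1 - (length vs - 2) = 1" using l by auto
    then show ?thesis using polygon_arc[OF P, of "length vs - 2"] that by auto
  qed
  have e: "edge_start vs 0 = vs ! 0" "edge_end vs 0 = vs ! 1" using l by (simp_all add: edge_start_def edge_end_def)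
  have "0 < length vs" using l by linarith
  then have ne: "vs ! 0 \<noteq> vs ! 1" using polygon_edge_ne[OF P, of 0] e by simp
  have sub: "edge vs 0 \<inter> edge vs j \<subseteq> {vs ! 0, vs ! 1}" if j: "j \<in> {1..<length vs}" for j
    using polygon_inter[OF P \<open>0 < length vs\<close>, of j] j e by auto
  let ?c = "linepath (vs ! 0) (vs ! 1) +++ c"
  have s: "simple_path ?c"
  proof (rule simple_path_join_loop)
    show "path_image (linepath (vs ! 0) (vs ! 1)) \<inter> path_image c \<subseteq> {pathstart (linepath (vs ! 0) (vs ! 1)), pathstart c}"
      using sub by (force simp: c edge_def e)
  qed (use c ne in auto)
  have "{..<length vs} = insert 0 {1..<length vs}" using l by auto
  then have im: "path_image ?c = poly_curve vs" by (auto simp: path_image_join c edge_def e poly_curve_def)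
  have "path_image ?c homeomorphic sphere (0::complex) 1"
    by (rule homeomorphic_simple_path_image_circle[OF s]) (auto simp: c)
  moreover have "sphere (0::complex) 1 homeomorphic sphere (0::real^2) 1"
    by (rule homeomorphic_spheres_gen) auto
  ultimately show ?thesis unfolding im using homeomorphic_trans by blast
qed

lemma poly_curve_compact: "compact (poly_curve vs)"
  unfolding poly_curve_def edge_def by (intro compact_UN) auto

text \<open>By the Jordan-Brouwer theorem every component of the complement has the whole curve as
  its frontier. Hence each point of the curve is a limit of points from inside and from outside, the
  fact that decides on which side of an edge the domain lies.\<close>

lemma polygon_sides:
  assumes P: "polygon vs \<Omega>" and ne: "\<Omega> \<noteq> {}"
  shows "open \<Omega>" "bounded \<Omega>" "open (outside (poly_curve vs))" "\<Omega> \<inter> outside (poly_curve vs) = {}"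
    "\<Omega> \<union> outside (poly_curve vs) = - poly_curve vs" "frontier \<Omega> = poly_curve vs"
    "\<And>x r. x \<in> poly_curve vs \<Longrightarrow> r > 0 \<Longrightarrow> ball x r \<inter> \<Omega> \<noteq> {} \<and> ball x r \<inter> outside (poly_curve vs) \<noteq> {}"
proof -
  let ?G = "poly_curve vs"
  have \<Omega>: "\<Omega> = inside ?G" using P by (simp add: polygon_def poly_curve_def)
  have cl: "closed ?G" "bounded ?G" using poly_curve_compact compact_imp_closed compact_imp_bounded by auto
  show op: "open \<Omega>" "open (outside ?G)" unfolding \<Omega> by (auto intro: open_inside open_outside cl)
  show "bounded \<Omega>" unfolding \<Omega> by (rule bounded_inside[OF cl(2)])
  show "\<Omega> \<inter> outside ?G = {}" "\<Omega> \<union> outside ?G = - ?G" unfolding \<Omega> by (auto simp: inside_Int_outside inside_Un_outside)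
  have comp: "frontier (connected_component_set (- ?G) z) = ?G" if "z \<in> - ?G" for z
    by (rule Jordan_Brouwer_frontier[OF polygon_homeomorphic_sphere[OF P]]) (use that in \<open>auto simp: componentsI\<close>)
  have out: "outside ?G \<noteq> {}" by (rule outside_bounded_nonempty[OF cl(2)])
  have near: "ball x r \<inter> S \<noteq> {}" if x: "x \<in> ?G" "r > 0" and S: "z \<in> S" "connected_component_set (- ?G) z \<subseteq> S" "S \<subseteq> - ?G" for x r S z
  proof -
    have "x \<in> closure (connected_component_set (- ?G) z)"
      using comp[of z] x(1) S by (auto simp: frontier_def)
    then have "connected_component_set (- ?G) z \<inter> ball x r \<noteq> {}"
      using x(2) open_Int_closure_eq_empty[of "ball x r" "connected_component_set (- ?G) z"] by (auto simp: disjoint_iff)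
    then show ?thesis using S by blast
  qed
  show both: "ball x r \<inter> \<Omega> \<noteq> {} \<and> ball x r \<inter> outside ?G \<noteq> {}" if x: "x \<in> ?G" "r > 0" for x r
  proof
    obtain z where "z \<in> \<Omega>" using ne by blast
    then show "ball x r \<inter> \<Omega> \<noteq> {}"
      using near[OF x, of z \<Omega>] unfolding \<Omega> by (metis inside_same_component inside_no_overlap disjoint_eq_subset_Compl mem_Collect_eq subsetI)
    obtain z where "z \<in> outside ?G" using out by blast
    then show "ball x r \<inter> outside ?G \<noteq> {}"
      using near[OF x, of z "outside ?G"] by (metis outside_same_component outside_no_overlap disjoint_eq_subset_Compl mem_Collect_eq subsetI)
  qed
  show "frontier \<Omega> = ?G"
  proof
    show "frontier \<Omega> \<subseteq> ?G" unfolding \<Omega> by (rule frontier_inside_subset[OF cl(1)])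
    show "?G \<subseteq> frontier \<Omega>"
    proof
      fix x assume x: "x \<in> ?G"
      have "x \<notin> \<Omega>" using x unfolding \<Omega> by (metis IntI empty_iff inside_no_overlap)
      moreover have "x \<in> closure \<Omega>"
        using both[OF x] by (auto simp: closure_approachable dist_commute disjoint_iff)
      ultimately show "x \<in> frontier \<Omega>" using op(1) by (simp add: frontier_def interior_open)
    qed
  qed
qed

section \<open>Outward normals and segments towards the central disc\<close>

definition perp :: "real^2 \<Rightarrow> real^2" where
  "perp v = vector [- v$2, v$1]"

lemma perp_nth [simp]: "perp v $ 1 = - v$2" "perp v $ 2 = v$1"
  by (simp_all add: perp_def)

lemma inner_real2: "x \<bullet> y = x$1 * y$1 + x$2 * y$2" for x y :: "real^2"
  by (simp add: inner_vec_def sum_2)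

lemma perp_inner [simp]: "v \<bullet> perp v = 0" "norm (perp v) = norm v"
  by (simp_all add: inner_real2 norm_eq_sqrt_inner mult.commute add.commute)

text \<open>The inner product with \<open>perp v\<close> is the determinant of the pair of vectors;
  the coefficient is that of the orthogonal projection onto \<open>v\<close>.\<close>

lemma perp_parallel:
  assumes "v \<noteq> 0" "w \<bullet> perp v = 0" shows "w = ((w \<bullet> v) / (v \<bullet> v)) *\<^sub>R v"
proof -
  have n: "v$1 * v$1 + v$2 * v$2 \<noteq> 0"
    using assms(1) inner_eq_zero_iff[of v] by (simp add: inner_real2)
  have p: "w$2 * v$1 = w$1 * v$2" using assms(2) by (simp add: inner_real2 algebra_simps)
  have "w$1 * (v$1 * v$1 + v$2 * v$2) = (w$1 * v$1 + w$2 * v$2) * v$1"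
    "w$2 * (v$1 * v$1 + v$2 * v$2) = (w$1 * v$1 + w$2 * v$2) * v$2"
    using p by (algebra, algebra)
  then show ?thesis using n by (simp add: vec_eq_iff forall_2 inner_real2 field_simps)
qed

text \<open>In a small disc around a point that is not a corner the curve is a diameter, and each
  open half disc, being convex and disjoint from the curve, lies entirely inside or entirely
  outside. Both sides occur in the disc, so exactly one half is inside, and the normal points to the
  other.\<close>

lemma outward_normal_exists:
  assumes P: "polygon vs \<Omega>" and ne: "\<Omega> \<noteq> {}" and i: "i < length vs"
    and x: "x \<in> edge vs i" "x \<noteq> edge_start vs i" "x \<noteq> edge_end vs i"
  shows "\<exists>n. outward_normal \<Omega> x n"
proof -
  let ?G = "poly_curve vs"
  note ps = polygon_sides[OF P ne]
  define a where "a = edge_start vs i"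
  define b where "b = edge_end vs i"
  have ab: "a \<noteq> b" using polygon_edge_ne[OF P i] by (simp add: a_def b_def)
  have xe: "x \<in> closed_segment a b" "x \<noteq> a" "x \<noteq> b" using x by (simp_all add: edge_def a_def b_def)
  define F where "F = (\<Union>j\<in>{..<length vs} - {i}. edge vs j)"
  have "closed F" unfolding F_def edge_def by (intro closed_UN) auto
  moreover have "x \<notin> F"
    using polygon_inter[OF P i] x i by (auto simp: F_def)
  ultimately obtain r0 where r0: "r0 > 0" "ball x r0 \<inter> F = {}"
    by (metis open_Compl openE ComplI disjoint_eq_subset_Compl)
  \<comment> \<open>Small enough to miss all other edges and not to contain the end points of this
    one.\<close>
  define r where "r = min r0 (min (dist x a) (dist x b))"
  have r: "r > 0" "r \<le> r0" "r \<le> dist x a" "r \<le> dist x b" using r0 xe by (auto simp: r_def)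
  define v where "v = b - a"
  have v: "v \<noteq> 0" using ab by (simp add: v_def)
  obtain s where s: "0 \<le> s" "s \<le> 1" "x = a + s *\<^sub>R v"
    using xe(1) by (auto simp: closed_segment_def v_def algebra_simps)
  have G: "y \<in> ?G \<longleftrightarrow> (y - x) \<bullet> perp v = 0" if y: "y \<in> ball x r" for y
  proof
    assume "y \<in> ?G"
    then obtain j where j: "j < length vs" "y \<in> edge vs j" by (auto simp: poly_curve_def)
    have "j = i"
    proof (rule ccontr)
      assume "j \<noteq> i"
      then have "y \<in> F" using j by (auto simp: F_def)
      then show False using r0(2) y r(2) by (auto simp: disjoint_iff)
    qed
    then obtain t where t: "y = a + t *\<^sub>R v" using j(2) by (auto simp: edge_def a_def b_def closed_segment_def v_def algebra_simps)
    show "(y - x) \<bullet> perp v = 0" unfolding t s(3) by (simp add: algebra_simps inner_diff_left inner_add_left)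
  next
    assume "(y - x) \<bullet> perp v = 0"
    then obtain t where t: "y - x = t *\<^sub>R v" using perp_parallel[OF v] by blast
    have ts: "\<bar>t\<bar> * norm v < r" using y t by (metis dist_commute dist_norm mem_ball norm_scaleR real_norm_def)
    have da: "dist x a = s * norm v" using s by (simp add: dist_norm)
    have db: "dist x b = (1 - s) * norm v"
    proof -
      have "x - b = (s - 1) *\<^sub>R v" using s by (simp add: v_def algebra_simps)
      then have "dist x b = \<bar>s - 1\<bar> * norm v" by (simp add: dist_norm)
      then show ?thesis using s by simp
    qed
    have "\<bar>t\<bar> * norm v < s * norm v" "\<bar>t\<bar> * norm v < (1 - s) * norm v" using ts r da db by linarith+
    then have "\<bar>t\<bar> < s" "\<bar>t\<bar> < 1 - s" using v by simp_all
    then have "y \<in> closed_segment a b"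
      unfolding closed_segment_def using t s by (auto intro!: exI[of _ "s + t"] simp: v_def algebra_simps)
    then show "y \<in> ?G" using i by (auto simp: poly_curve_def edge_def a_def b_def)
  qed
  define n where "n = perp v /\<^sub>R norm v"
  have nn: "norm n = 1" using v by (simp add: n_def)
  have nG: "y \<in> ?G \<longleftrightarrow> (y - x) \<bullet> n = 0" if "y \<in> ball x r" for y
    using G[OF that] v by (simp add: n_def)
  have side: "S \<subseteq> \<Omega> \<or> S \<subseteq> outside ?G" if "convex S" "S \<inter> ?G = {}" for S
  proof (rule ccontr)
    assume "\<not> ?thesis"
    then have "\<Omega> \<inter> S \<noteq> {}" "outside ?G \<inter> S \<noteq> {}" using that(2) ps(5) by blast+
    moreover have "S \<subseteq> \<Omega> \<union> outside ?G" "\<Omega> \<inter> outside ?G \<inter> S = {}" using that(2) ps(4,5) by blast+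
    ultimately show False using connectedD[OF convex_connected[OF that(1)] ps(1,3)] by blast
  qed
  define Hm where "Hm = {y \<in> ball x r. (y - x) \<bullet> n < 0}"
  define Hp where "Hp = {y \<in> ball x r. (y - x) \<bullet> n > 0}"
  have "Hm = ball x r \<inter> {y. n \<bullet> y < n \<bullet> x}" "Hp = ball x r \<inter> {y. n \<bullet> y > n \<bullet> x}"
    by (auto simp: Hm_def Hp_def inner_diff_left inner_diff_right inner_commute)
  then have cv: "convex Hm" "convex Hp" by (auto intro: convex_Int convex_halfspace_lt convex_halfspace_gt)
  have dj: "Hm \<inter> ?G = {}" "Hp \<inter> ?G = {}" using nG by (auto simp: Hm_def Hp_def)
  have xG: "x \<in> ?G" using x i by (auto simp: poly_curve_def)
  have un: "ball x r - ?G = Hm \<union> Hp" using nG by (auto simp: Hm_def Hp_def)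
  note both = ps(7)[OF xG r(1)]
  have \<Omega>G: "\<Omega> \<inter> ?G = {}" "outside ?G \<inter> ?G = {}" using ps(5) by auto
  from side[OF cv(1) dj(1)] side[OF cv(2) dj(2)]
  consider "Hm \<subseteq> \<Omega>" "Hp \<subseteq> outside ?G" | "Hp \<subseteq> \<Omega>" "Hm \<subseteq> outside ?G"
    | "Hm \<subseteq> \<Omega>" "Hp \<subseteq> \<Omega>" | "Hm \<subseteq> outside ?G" "Hp \<subseteq> outside ?G" by blast
  then show ?thesis
  proof cases
    case 1
    then have "\<Omega> \<inter> ball x r = Hm" using un \<Omega>G ps(4) Hm_def by blast
    then have "outward_normal \<Omega> x n" using nn r unfolding outward_normal_def Hm_def by blast
    then show ?thesis ..
  next
    case 2
    then have "\<Omega> \<inter> ball x r = Hp" using un \<Omega>G ps(4) Hp_def by blast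
    also have "Hp = {y \<in> ball x r. (y - x) \<bullet> (- n) < 0}" by (auto simp: Hp_def)
    finally have "outward_normal \<Omega> x (- n)" using nn r unfolding outward_normal_def by auto
    then show ?thesis ..
  next
    case 3
    then have "ball x r \<inter> outside ?G = {}" using un \<Omega>G ps(4) by blast
    then show ?thesis using both by blast
  next
    case 4
    then have "ball x r \<inter> \<Omega> = {}" using un \<Omega>G ps(4) by blast
    then show ?thesis using both by blast
  qed
qed

lemma vertex_end:
  assumes "polygon vs \<Omega>" "i < length vs" shows "edge_start vs i \<in> set vs" "edge_end vs i \<in> set vs"
proof -
  have "Suc i mod length vs < length vs" using assms by (intro mod_less_divisor) auto
  then show "edge_start vs i \<in> set vs" "edge_end vs i \<in> set vs"
    using assms(2) by (auto simp: edge_start_def edge_end_def)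
qed

text \<open>If the segment leaves \<open>\<Omega>\<close>, then at its last point \<open>x\<close> outside \<open>\<Omega>\<close> the normal satisfies
  \<open>(x - p) \<bullet> n \<ge> c - norm (p - x0) > 0\<close>, so that going on towards \<open>y\<close> would not enter \<open>\<Omega>\<close>. Corners have
  no normal; they are avoided first and handled by perturbation in \<open>star_shaped_ball\<close>.\<close>

lemma star_no_vertex:
  assumes P: "polygon vs \<Omega>" and ss: "strictly_star_shaped \<Omega> x0 c"
    and p: "norm (p - x0) < c" and y: "y \<in> \<Omega>" and nv: "closed_segment p y \<inter> set vs = {}"
  shows "closed_segment p y \<subseteq> \<Omega>"
proof (rule ccontr)
  assume not: "\<not> ?thesis"
  have ne: "\<Omega> \<noteq> {}" using y by blast
  note ps = polygon_sides[OF P ne]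
  define \<gamma> where "\<gamma> t = p + t *\<^sub>R (y - p)" for t
  have \<gamma>s: "\<gamma> t \<in> closed_segment p y" if "0 \<le> t" "t \<le> 1" for t
    using that by (auto simp: \<gamma>_def closed_segment_def algebra_simps intro!: exI[of _ t])
  define B where "B = {0..1} \<inter> \<gamma> -` (- \<Omega>)"
  have "continuous_on UNIV \<gamma>" unfolding \<gamma>_def by (intro continuous_intros)
  then have "closed (\<gamma> -` (- \<Omega>))" using ps(1) by (intro closed_vimage) (auto simp: continuous_on_eq_continuous_at)
  then have "compact B" unfolding B_def by (intro compact_Int_closed) auto
  moreover have "B \<noteq> {}"
  proof -
    obtain z where z: "z \<in> closed_segment p y" "z \<notin> \<Omega>" using not by blast
    then obtain t where "0 \<le> t" "t \<le> 1" "z = (1 - t) *\<^sub>R p + t *\<^sub>R y" by (auto simp: closed_segment_def)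
    moreover from this have "\<gamma> t = z" by (simp add: \<gamma>_def algebra_simps)
    ultimately have "t \<in> B" using z by (auto simp: B_def)
    then show ?thesis by blast
  qed
  ultimately obtain t0 where t0: "t0 \<in> B" "\<And>t. t \<in> B \<Longrightarrow> t \<le> t0" by (meson compact_attains_sup)
  have t01: "0 \<le> t0" "t0 < 1" "\<gamma> t0 \<notin> \<Omega>"
    using t0(1) y by (auto simp: B_def \<gamma>_def order_less_le)
  have after: "\<gamma> t \<in> \<Omega>" if "t0 < t" "t \<le> 1" for t
    using t0(2)[of t] that t01 by (auto simp: B_def)
  define x where "x = \<gamma> t0"
  have lim: "\<exists>\<delta>>0. \<forall>t. t0 < t \<longrightarrow> t < t0 + \<delta> \<longrightarrow> \<gamma> t \<in> ball x r \<and> \<gamma> t \<in> \<Omega>" if "r > 0" for r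
  proof -
    define \<delta> where "\<delta> = min (1 - t0) (r / (norm (y - p) + 1))"
    have n1: "norm (y - p) + 1 > 0" by (simp add: add_nonneg_pos)
    have "\<delta> > 0" using t01 that n1 by (simp add: \<delta>_def)
    moreover have "\<gamma> t \<in> ball x r \<and> \<gamma> t \<in> \<Omega>" if t: "t0 < t" "t < t0 + \<delta>" for t
    proof
      have "x - \<gamma> t = (t0 - t) *\<^sub>R (y - p)" by (simp add: x_def \<gamma>_def algebra_simps)
      then have "dist x (\<gamma> t) = (t - t0) * norm (y - p)" using t by (simp add: dist_norm)
      also have "\<dots> \<le> (t - t0) * (norm (y - p) + 1)" using t by (intro mult_left_mono) auto
      also have "\<dots> < r / (norm (y - p) + 1) * (norm (y - p) + 1)" using t n1 by (intro mult_strict_right_mono) (auto simp: \<delta>_def)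
      finally show "\<gamma> t \<in> ball x r" using n1 by simp
      show "\<gamma> t \<in> \<Omega>" using t by (intro after) (auto simp: \<delta>_def)
    qed
    ultimately show ?thesis by blast
  qed
  have "x \<in> closure \<Omega>"
  proof (rule closure_approachable[THEN iffD2], intro allI impI)
    fix r :: real assume "r > 0"
    from lim[OF this] obtain \<delta> where \<delta>: "\<delta> > 0" "\<And>t. t0 < t \<Longrightarrow> t < t0 + \<delta> \<Longrightarrow> \<gamma> t \<in> ball x r \<and> \<gamma> t \<in> \<Omega>" by blast
    from \<delta>(2)[of "t0 + \<delta>/2"] \<delta>(1) show "\<exists>y\<in>\<Omega>. dist y x < r" by (auto simp: dist_commute)
  qed
  then have xf: "x \<in> frontier \<Omega>" using t01 ps(1) by (simp add: frontier_def interior_open x_def)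
  then obtain i where i: "i < length vs" "x \<in> edge vs i" using ps(6) by (auto simp: poly_curve_def)
  have "x \<notin> set vs" using nv \<gamma>s[of t0] t01 by (auto simp: x_def)
  then obtain n where n: "outward_normal \<Omega> x n"
    using outward_normal_exists[OF P ne i] vertex_end[OF P i(1)] by metis
  have n1: "norm n = 1" using n by (simp add: outward_normal_def)
  obtain r where r: "r > 0" "\<Omega> \<inter> ball x r = {y \<in> ball x r. (y - x) \<bullet> n < 0}" using n by (auto simp: outward_normal_def)
  have "(x - x0) \<bullet> n \<ge> c" using ss xf n by (auto simp: strictly_star_shaped_def)
  moreover have "(p - x0) \<bullet> n < c"
    using norm_cauchy_schwarz[of "p - x0" n] p n1 by simp
  ultimately have "(x - p) \<bullet> n > 0" by (simp add: inner_diff_left)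
  moreover have "(x - p) \<bullet> n = t0 * ((y - p) \<bullet> n)" by (simp add: x_def \<gamma>_def)
  ultimately have dn: "(y - p) \<bullet> n > 0" using t01 by (simp add: zero_less_mult_iff)
  obtain \<delta> where \<delta>: "\<delta> > 0" "\<And>t. t0 < t \<Longrightarrow> t < t0 + \<delta> \<Longrightarrow> \<gamma> t \<in> ball x r \<and> \<gamma> t \<in> \<Omega>" using lim[OF r(1)] by blast
  have "\<gamma> (t0 + \<delta>/2) \<in> \<Omega> \<inter> ball x r" using \<delta>(2)[of "t0 + \<delta>/2"] \<delta>(1) by auto
  then have "(\<gamma> (t0 + \<delta>/2) - x) \<bullet> n < 0" unfolding r(2) by simp
  moreover have "(\<gamma> (t0 + \<delta>/2) - x) \<bullet> n = \<delta>/2 * ((y - p) \<bullet> n)" by (simp add: x_def \<gamma>_def algebra_simps inner_add_left inner_diff_left)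
  ultimately show False using dn \<delta>(1) by (simp add: mult_less_0_iff)
qed

text \<open>A corner has no normal that could be tested, so the point is moved a little along an
  edge. There a normal exists, and \<open>(x - x0) \<bullet> n \<le> norm (x - x0) < c\<close>
  contradicts strict star-shapedness.\<close>

lemma no_vertex_near_centre:
  assumes P: "polygon vs \<Omega>" and ss: "strictly_star_shaped \<Omega> x0 c" and v: "v \<in> set vs"
  shows "norm (v - x0) \<ge> c"
proof (rule ccontr)
  assume "\<not> ?thesis"
  then have lt: "norm (v - x0) < c" by simp
  have ne: "\<Omega> \<noteq> {}" using ss by (auto simp: strictly_star_shaped_def)
  note ps = polygon_sides[OF P ne]
  obtain i where i: "i < length vs" "v = edge_start vs i" using v by (auto simp: in_set_conv_nth edge_start_def)
  define b where "b = edge_end vs i"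
  have vb: "v \<noteq> b" using polygon_edge_ne[OF P i(1)] i by (simp add: b_def)
  \<comment> \<open>The second bound moves \<open>v\<close> by at most half of the gap
    \<open>c - norm (v - x0)\<close>; the first keeps the point before the end
    \<open>b\<close>.\<close>
  define \<epsilon> where "\<epsilon> = min (1/2) ((c - norm (v - x0)) / (2 * norm (b - v)))"
  have nb: "norm (b - v) > 0" using vb by simp
  have \<epsilon>: "\<epsilon> > 0" "\<epsilon> < 1" using lt nb by (auto simp: \<epsilon>_def)
  define x where "x = v + \<epsilon> *\<^sub>R (b - v)"
  have "\<epsilon> * norm (b - v) \<le> (c - norm (v - x0)) / (2 * norm (b - v)) * norm (b - v)"
    by (intro mult_right_mono) (auto simp: \<epsilon>_def)
  also have "\<dots> = (c - norm (v - x0)) / 2" using nb by simp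
  finally have "\<epsilon> * norm (b - v) < c - norm (v - x0)" using lt by simp
  moreover have "norm (x - x0) \<le> norm (v - x0) + \<epsilon> * norm (b - v)"
  proof -
    have "x - x0 = (v - x0) + \<epsilon> *\<^sub>R (b - v)" by (simp add: x_def)
    then have "norm (x - x0) \<le> norm (v - x0) + norm (\<epsilon> *\<^sub>R (b - v))" by (simp only: norm_triangle_ineq)
    then show ?thesis using \<epsilon> by simp
  qed
  ultimately have xc: "norm (x - x0) < c" by linarith
  have xe: "x \<in> edge vs i" unfolding edge_def i(2)[symmetric] b_def[symmetric] closed_segment_def
    using \<epsilon> by (auto simp: x_def algebra_simps intro!: exI[of _ \<epsilon>])
  have xv: "x \<noteq> v" using \<epsilon> vb by (simp add: x_def)
  have xb: "x \<noteq> b"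
  proof
    assume "x = b"
    then have "(1 - \<epsilon>) *\<^sub>R (b - v) = 0" unfolding x_def by (simp only: scaleR_diff_left scaleR_one) (metis add_diff_cancel_left' diff_self)
    then show False using \<epsilon> vb by simp
  qed
  obtain n where n: "outward_normal \<Omega> x n"
    using outward_normal_exists[OF P ne i(1) xe] xv xb i(2) b_def by auto
  have "x \<in> frontier \<Omega>" using xe i(1) unfolding ps(6) by (auto simp: poly_curve_def)
  then have "(x - x0) \<bullet> n \<ge> c" using ss n by (auto simp: strictly_star_shaped_def)
  moreover have "(x - x0) \<bullet> n \<le> norm (x - x0)"
    using norm_cauchy_schwarz[of "x - x0" n] n by (simp add: outward_normal_def)
  ultimately show False using xc by simp
qed

text \<open>If a point \<open>q\<close> of the segment were not in \<open>\<Omega>\<close>, the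
  outside points near \<open>q\<close> would form a nonempty open set, which finitely many lines
  through \<open>p\<close> and a vertex cannot cover. A point \<open>q'\<close> off these lines lies
  on a segment from \<open>p\<close> to some \<open>y'\<close> near \<open>y\<close> that avoids all
  vertices, against \<open>star_no_vertex\<close>.\<close>

lemma star_shaped_ball:
  assumes P: "polygon vs \<Omega>" and ss: "strictly_star_shaped \<Omega> x0 c"
    and p: "p \<in> ball x0 c" and y: "y \<in> \<Omega>"
  shows "closed_segment y p \<subseteq> \<Omega>"
proof
  have ne: "\<Omega> \<noteq> {}" using y by blast
  note ps = polygon_sides[OF P ne]
  let ?O = "outside (poly_curve vs)"
  have x0: "x0 \<in> \<Omega>" "c > 0" using ss by (auto simp: strictly_star_shaped_def)
  have nvb: "ball x0 c \<inter> set vs = {}"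
    using no_vertex_near_centre[OF P ss] by (force simp: dist_norm norm_minus_commute)
  have b\<Omega>: "p' \<in> \<Omega>" if p': "p' \<in> ball x0 c" for p'
  proof -
    have "closed_segment p' x0 \<subseteq> ball x0 c" using p' x0(2) by (intro closed_segment_subset) auto
    then have "closed_segment p' x0 \<inter> set vs = {}" using nvb by blast
    from star_no_vertex[OF P ss _ x0(1) this] p' show ?thesis by (auto simp: dist_norm norm_minus_commute)
  qed
  fix q assume "q \<in> closed_segment y p"
  then have "q \<in> closed_segment p y" by (simp add: closed_segment_commute)
  then obtain t where t: "0 \<le> t" "t \<le> 1" "q = p + t *\<^sub>R (y - p)" by (auto simp: closed_segment_def algebra_simps)
  show "q \<in> \<Omega>"
  proof (cases "t = 0")
    case True then show ?thesis using b\<Omega>[OF p] t by simp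
  next
    case False
    then have t0: "t > 0" using t by simp
    show ?thesis
    proof (rule ccontr)
      assume q: "q \<notin> \<Omega>"
      obtain \<delta> where \<delta>: "\<delta> > 0" "ball y \<delta> \<subseteq> \<Omega>" using ps(1) y openE by blast
      have "ball q (t * \<delta>) \<inter> ?O \<noteq> {}"
      proof (cases "q \<in> ?O")
        case True then show ?thesis using t0 \<delta> by (metis IntI centre_in_ball empty_iff mult_pos_pos)
      next
        case False
        then have "q \<in> poly_curve vs" using q ps(5) by blast
        then show ?thesis using ps(7)[of q "t * \<delta>"] t0 \<delta>(1) by simp
      qed
      moreover have "open (ball q (t * \<delta>) \<inter> ?O)" using ps(3) by blast
      ultimately have nn: "\<not> negligible (ball q (t * \<delta>) \<inter> ?O)" using open_not_negligible by blast
      have ng: "negligible (\<Union>v\<in>set vs. {z. perp (v - p) \<bullet> z = perp (v - p) \<bullet> p})"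
      proof (intro negligible_Union finite_imageI finite_set; clarsimp)
        fix v assume "v \<in> set vs"
        then have "v \<noteq> p" using nvb p by auto
        then have "perp (v - p) \<noteq> 0" using perp_inner(2)[of "v - p"] by (metis norm_eq_zero right_minus_eq)
        then show "negligible {z. perp (v - p) \<bullet> z = perp (v - p) \<bullet> p}" by (intro negligible_hyperplane) auto
      qed
      have "\<not> ball q (t * \<delta>) \<inter> ?O \<subseteq> (\<Union>v\<in>set vs. {z. perp (v - p) \<bullet> z = perp (v - p) \<bullet> p})"
        using nn negligible_subset[OF ng] by blast
      then obtain q' where q': "q' \<in> ball q (t * \<delta>)" "q' \<in> ?O" "\<And>v. v \<in> set vs \<Longrightarrow> perp (v - p) \<bullet> q' \<noteq> perp (v - p) \<bullet> p"
        by blast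
      \<comment> \<open>The dilation about \<open>p\<close> with factor \<open>1/t\<close> takes
        \<open>q\<close> to \<open>y\<close>; it enlarges \<open>t * \<delta>\<close> to
        \<open>\<delta>\<close>, so \<open>y'\<close> stays in \<open>\<Omega>\<close>.\<close>
      define y' where "y' = p + (1/t) *\<^sub>R (q' - p)"
      have q'y: "q' = p + t *\<^sub>R (y' - p)" using t0 by (simp add: y'_def)
      have "y' - y = (1/t) *\<^sub>R (q' - q)" using t0 by (simp add: y'_def t(3) scaleR_diff_right scaleR_add_right)
      then have "norm (y' - y) = norm (q' - q) / t" using t0 by simp
      then have "dist y y' = dist q q' / t" by (simp only: dist_norm norm_minus_commute)
      also have "\<dots> < \<delta>" using q'(1) t0 by (simp add: field_simps)
      finally have y': "y' \<in> \<Omega>" using \<delta>(2) by auto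
      \<comment> \<open>A vertex on this segment would be collinear with \<open>p\<close> and
        \<open>q'\<close>, which the choice of \<open>q'\<close> excludes.\<close>
      have "closed_segment p y' \<inter> set vs = {}"
      proof (rule ccontr)
        assume "closed_segment p y' \<inter> set vs \<noteq> {}"
        then obtain v s where v1: "v \<in> set vs" and v2: "v = (1 - s) *\<^sub>R p + s *\<^sub>R y'" by (auto simp: closed_segment_def)
        have "(1 - s) *\<^sub>R p + s *\<^sub>R y' = p + s *\<^sub>R (y' - p)" by (simp add: algebra_simps)
        with v1 v2 have v: "v \<in> set vs" "v = p + s *\<^sub>R (y' - p)" by simp_all
        have "perp (v - p) \<bullet> (y' - p) = 0"
        proof -
          have s: "s \<noteq> 0" using v nvb p by auto
          have "y' - p = (1/s) *\<^sub>R (v - p)" using s v by simp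
          then show ?thesis by (metis inner_commute inner_scaleR_left mult_zero_right perp_inner(1))
        qed
        then have "perp (v - p) \<bullet> (q' - p) = 0" by (simp add: q'y)
        then show False using q'(3)[OF v(1)] by (simp add: inner_diff_right)
      qed
      from star_no_vertex[OF P ss _ y' this] p have "closed_segment p y' \<subseteq> \<Omega>" by (auto simp: dist_norm norm_minus_commute)
      moreover have "q' \<in> closed_segment p y'"
        using t t0 by (subst q'y) (auto simp: closed_segment_def algebra_simps intro!: exI[of _ t])
      ultimately show False using q'(2) ps(4) by blast
    qed
  qed
qed

lemma polygon_frontier_negligible:
  assumes P: "polygon vs \<Omega>" and ne: "\<Omega> \<noteq> {}" shows "negligible (frontier \<Omega>)"
proof -
  have "negligible (edge vs i)" for i
    unfolding edge_def
    by (intro negligible_convex_interior[THEN iffD2] convex_closed_segment) (simp add: interior_closed_segment_ge2)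
  then show ?thesis unfolding polygon_sides(6)[OF P ne] poly_curve_def
    by (intro negligible_Union) auto
qed

section \<open>Approximation by quadratics on patches of radius \<open>\<rho>\<close>\<close>

lemma grid_interp_in_P2: "grid_interp y \<rho> w \<in> P2"
  unfolding grid_interp_def by (rule centred_quad_in_P2)

lemma grid_interp12_in_P1: "grid_interp1 y \<rho> w \<in> P1" "grid_interp2 y \<rho> w \<in> P1"
proof -
  have *: "(\<lambda>x::real^2. c + ((x$i - a)/s) *\<^sub>R z1 + ((x$j - b)/s) *\<^sub>R z2) = (\<lambda>x. (c - (a/s) *\<^sub>R z1 - (b/s) *\<^sub>R z2) + x$i *\<^sub>R ((1/s) *\<^sub>R z1) + x$j *\<^sub>R ((1/s) *\<^sub>R z2))"
    for c z1 z2 :: complex and i j :: 2 and a b s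
    by (auto simp: fun_eq_iff scaleR_diff_left diff_divide_distrib)
  show "grid_interp1 y \<rho> w \<in> P1" unfolding grid_interp1_def[abs_def] * P1_def by blast
  have **: "c + x$2 *\<^sub>R z2 + x$1 *\<^sub>R z1 = c + x$1 *\<^sub>R z1 + x$2 *\<^sub>R z2" for c z1 z2 :: complex and x :: "real^2" by simp
  show "grid_interp2 y \<rho> w \<in> P1" unfolding grid_interp2_def[abs_def] * ** P1_def by blast
qed

text \<open>Contracting the disc of radius \<open>c\<close> around \<open>x0\<close> towards a point
  by the factor \<open>s = 2 * \<rho> / c\<close> gives a disc of radius \<open>2 * \<rho>\<close>.
  Contraction towards \<open>a\<close> puts its centre at \<open>y0\<close>; contraction towards
  another point of the patch moves the centre by less than \<open>\<rho>\<close>, so all these discs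
  contain the one of radius \<open>r \<le> \<rho> / 2\<close> around \<open>y0\<close>. Once
  \<open>2 * \<rho>\<close> reaches \<open>c\<close>, the factor is capped at 1 and
  \<open>y0\<close> is \<open>x0\<close>.\<close>

lemma star_patch:
  fixes \<Omega> :: "(real^2) set"
  assumes star: "\<And>x p. x \<in> \<Omega> \<Longrightarrow> p \<in> ball x0 c \<Longrightarrow> closed_segment x p \<subseteq> \<Omega>" and c: "c > 0"
    and D: "\<And>a. a \<in> closure \<Omega> \<Longrightarrow> norm (x0 - a) \<le> D"
    and a: "a \<in> closure \<Omega>" and \<rho>: "\<rho> > 0"
    and r: "r = min \<rho> (c/2) / 2" and y0: "y0 = a + min 1 (2 * \<rho> / c) *\<^sub>R (x0 - a)" and \<Lambda>: "\<Lambda> = 2 * D / c + 2"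
  shows "\<And>p. p \<in> (\<Omega> \<inter> ball a \<rho>) \<union> cball y0 r \<Longrightarrow> p \<in> ball a (\<Lambda> * \<rho>)"
    and "\<And>p y. p \<in> (\<Omega> \<inter> ball a \<rho>) \<union> cball y0 r \<Longrightarrow> y \<in> cball y0 r \<Longrightarrow> closed_segment y p \<subseteq> \<Omega> \<inter> ball a (\<Lambda> * \<rho>)"
proof -
  define s where "s = min 1 (2 * \<rho> / c)"
  have s: "0 < s" "s \<le> 1" "s \<le> 2 * \<rho> / c" using c \<rho> by (auto simp: s_def)
  have D0: "D \<ge> 0" using D[OF a] norm_ge_zero order_trans by blast
  have rr: "r > 0" "2 * r \<le> \<rho>" "2 * r \<le> c / 2" using c \<rho> by (auto simp: r)
  have y0': "y0 = a + s *\<^sub>R (x0 - a)" by (simp add: y0 s_def)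
  have "norm (y0 - a) = s * norm (x0 - a)" using s by (simp add: y0')
  also have "\<dots> \<le> (2 * \<rho> / c) * D" using s D[OF a] by (intro mult_mono) auto
  finally have y0a: "norm (y0 - a) \<le> (2 * D / c) * \<rho>" by (simp add: mult_ac)
  have in_cb: "p \<in> ball a (\<Lambda> * \<rho>)" if "p \<in> cball y0 r" for p
  proof -
    have "dist a p \<le> dist a y0 + dist y0 p" by (rule dist_triangle)
    also have "\<dots> \<le> (2 * D / c) * \<rho> + r" using that y0a by (intro add_mono) (auto simp: dist_norm norm_minus_commute)
    also have "\<dots> < \<Lambda> * \<rho>" using rr \<rho> by (simp add: \<Lambda> distrib_right)
    finally show ?thesis by simp
  qed
  have "1 \<le> \<Lambda>" using D0 c by (simp add: \<Lambda>)
  then have "\<rho> \<le> \<Lambda> * \<rho>" using \<rho> by simp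
  then have in_X: "p \<in> ball a (\<Lambda> * \<rho>)" if "p \<in> ball a \<rho>" for p using that by auto
  show inW: "p \<in> ball a (\<Lambda> * \<rho>)" if "p \<in> (\<Omega> \<inter> ball a \<rho>) \<union> cball y0 r" for p
    using that in_cb in_X by blast
  \<comment> \<open>The segment from \<open>x\<close> to \<open>y\<close>, prolonged by the factor
    \<open>1/s\<close>, ends in the disc around \<open>x0\<close>, so it is part of a segment known
    to lie in \<open>\<Omega>\<close>.\<close>
  have key: "\<exists>p\<in>ball x0 c. y \<in> closed_segment x p" if x: "x \<in> ball a \<rho>" and y: "y \<in> cball y0 r" for x y
  proof -
    define p where "p = x + (1/s) *\<^sub>R (y - x)"
    have "y = (1 - s) *\<^sub>R x + s *\<^sub>R p" using s by (simp add: p_def algebra_simps)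
    then have "y \<in> closed_segment x p" using s by (auto simp: closed_segment_def)
    moreover have "norm (p - x0) < c"
    proof -
      have "s *\<^sub>R (p - x0) = (y - y0) + (1 - s) *\<^sub>R (a - x)"
        using s by (simp add: p_def y0' scaleR_diff_right scaleR_add_right algebra_simps)
      then have "s * norm (p - x0) = norm ((y - y0) + (1 - s) *\<^sub>R (a - x))" using s by (metis abs_of_pos norm_scaleR)
      also have "\<dots> \<le> norm (y - y0) + (1 - s) * norm (a - x)" using s norm_triangle_ineq[of "y - y0" "(1 - s) *\<^sub>R (a - x)"] by simp
      also have "\<dots> \<le> r + (1 - s) * \<rho>" using x y s by (intro add_mono mult_left_mono) (auto simp: dist_norm norm_minus_commute)
      also have "\<dots> < s * c"
      proof (cases "2 * \<rho> / c \<le> 1")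
        case True
        then have "s * c = 2 * \<rho>" using c by (simp add: s_def)
        moreover have "(1 - s) * \<rho> \<le> 1 * \<rho>" using s \<rho> by (intro mult_right_mono) auto
        ultimately show ?thesis using rr \<rho> by linarith
      next
        case False
        then have "s = 1" by (simp add: s_def)
        then show ?thesis using rr c by simp
      qed
      finally show ?thesis using s by simp
    qed
    ultimately show ?thesis by (intro bexI[of _ p]) (auto simp: dist_norm norm_minus_commute)
  qed
  have seg1: "closed_segment y x \<subseteq> \<Omega>" if x: "x \<in> \<Omega> \<inter> ball a \<rho>" and y: "y \<in> cball y0 r" for x y
  proof -
    obtain p where "p \<in> ball x0 c" "y \<in> closed_segment x p" using key[of x y] x y by blast
    then have "closed_segment x y \<subseteq> closed_segment x p" by (simp add: subset_closed_segment)
    also have "\<dots> \<subseteq> \<Omega>" using star x \<open>p \<in> ball x0 c\<close> by blast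
    finally show ?thesis by (simp add: closed_segment_commute)
  qed
  obtain x1 where x1: "x1 \<in> \<Omega> \<inter> ball a \<rho>"
    using a \<rho> by (auto simp: closure_approachable dist_commute)
  have cb: "cball y0 r \<subseteq> \<Omega>"
  proof
    fix z assume "z \<in> cball y0 r"
    from seg1[OF x1 this] show "z \<in> \<Omega>" by auto
  qed
  show "closed_segment y p \<subseteq> \<Omega> \<inter> ball a (\<Lambda> * \<rho>)" if p: "p \<in> (\<Omega> \<inter> ball a \<rho>) \<union> cball y0 r" and y: "y \<in> cball y0 r" for p y
  proof -
    have "closed_segment y p \<subseteq> ball a (\<Lambda> * \<rho>)" using inW[OF p] in_cb[OF y] by (intro closed_segment_subset convex_ball) auto
    moreover have "closed_segment y p \<subseteq> \<Omega>"
    proof (cases "p \<in> cball y0 r")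
      case True
      then have "closed_segment y p \<subseteq> cball y0 r" using y by (intro closed_segment_subset) auto
      then show ?thesis using cb by blast
    next
      case False
      then show ?thesis using seg1[of p y] p y by blast
    qed
    ultimately show ?thesis by blast
  qed
qed

definition local_energy :: "(real^2) set \<Rightarrow> (real^2 \<Rightarrow> complex) \<Rightarrow> (real^2) set \<Rightarrow> real" where
  "local_energy \<Omega> u W = (\<integral>x. third_sq \<Omega> u x * indicator W x \<partial>lebesgue_on \<Omega>)"

text \<open>Hides the grid from the finite element part, which only uses that \<open>q\<close> is
  quadratic with affine partial derivatives \<open>q1\<close> and \<open>q2\<close>.\<close>

definition quadratic_approx :: "(real^2) set \<Rightarrow> (real^2 \<Rightarrow> complex) \<Rightarrow> (real^2) set \<Rightarrow> real \<Rightarrow> real \<Rightarrow> bool" where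
  "quadratic_approx \<Omega> u S e0 e1 \<longleftrightarrow>
    (\<exists>q q1 q2. q \<in> P2 \<and> q1 \<in> P1 \<and> q2 \<in> P1 \<and>
      (\<forall>x. (q has_derivative (\<lambda>h. h$1 *\<^sub>R q1 x + h$2 *\<^sub>R q2 x)) (at x)) \<and>
      (\<forall>x\<in>S. norm (u x - q x) \<le> e0) \<and>
      (AE x in lebesgue_on S. norm (weak_deriv \<Omega> [axis 1 1] u x - q1 x) \<le> e1) \<and>
      (AE x in lebesgue_on S. norm (weak_deriv \<Omega> [axis 2 1] u x - q2 x) \<le> e1))"

text \<open>Scaling: \<open>d\<close> and \<open>r\<close> are both of order \<open>\<rho>\<close>,
  so \<open>d ^ 5 / r ^ 3\<close> and \<open>d ^ 4 / r ^ 3\<close> become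
  \<open>\<rho>\<^sup>2\<close> and \<open>\<rho>\<close>. Since \<open>r\<close> is capped in terms
  of \<open>c\<close>, its comparability with \<open>\<rho>\<close> relies on the bound
  \<open>\<rho>max\<close>.\<close>

proposition local_approximation:
  assumes P: "polygon vs \<Omega>" and ss: "strictly_star_shaped \<Omega> x0 c" and \<rho>max: "\<rho>max > 0"
  shows "\<exists>C\<ge>0. \<exists>\<Lambda>\<ge>1. \<forall>u a \<rho>. u \<in> sobolev 3 \<Omega> \<longrightarrow> continuous_on (closure \<Omega>) u \<longrightarrow> a \<in> closure \<Omega> \<longrightarrow> 0 < \<rho> \<longrightarrow> \<rho> \<le> \<rho>max \<longrightarrow>
    quadratic_approx \<Omega> u (\<Omega> \<inter> ball a \<rho>)
      (C * \<rho>\<^sup>2 * sqrt (local_energy \<Omega> u (ball a (\<Lambda> * \<rho>))))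
      (C * \<rho> * sqrt (local_energy \<Omega> u (ball a (\<Lambda> * \<rho>))))"
proof -
  have x0: "x0 \<in> \<Omega>" "c > 0" using ss by (auto simp: strictly_star_shaped_def)
  then have ne: "\<Omega> \<noteq> {}" by blast
  note ps = polygon_sides[OF P ne]
  have "bounded (closure \<Omega>)" using ps(2) by (rule bounded_closure)
  then obtain D where D: "\<And>a. a \<in> closure \<Omega> \<Longrightarrow> norm (x0 - a) \<le> D"
    using bounded_any_center[of "closure \<Omega>" x0] by (auto simp: dist_norm)
  have D0: "D \<ge> 0" using D[of x0] x0 closure_subset by fastforce
  define \<Lambda> where "\<Lambda> = 2 * D / c + 2"
  have \<Lambda>: "\<Lambda> \<ge> 1" using D0 x0 by (simp add: \<Lambda>_def)
  \<comment> \<open>Chosen so that \<open>\<kappa> * \<rho> \<le> r\<close> for all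
    \<open>\<rho> \<le> \<rho>max\<close>, where \<open>r\<close> is the smaller of
    \<open>\<rho> / 2\<close> and \<open>c / 4\<close>.\<close>
  define \<kappa> where "\<kappa> = min 1 (c / (2 * \<rho>max)) / 2"
  have \<kappa>: "\<kappa> > 0" using x0 \<rho>max by (simp add: \<kappa>_def)
  define C where "C = max (768 * (2 * \<Lambda>) ^ 5 / \<kappa> ^ 3) (1200 * (2 * \<Lambda>) ^ 4 / \<kappa> ^ 3)"
  have C0: "C \<ge> 0" using \<Lambda> \<kappa> by (simp add: C_def max.coboundedI1)
  show ?thesis
  proof (rule exI[of _ C], rule conjI[OF C0], rule exI[of _ \<Lambda>], rule conjI[OF \<Lambda>], intro allI impI)
    fix u a \<rho> assume u: "u \<in> sobolev 3 \<Omega>" "continuous_on (closure \<Omega>) u" and a: "a \<in> closure \<Omega>" and \<rho>: "0 < \<rho>" "\<rho> \<le> \<rho>max"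
    define r where "r = min \<rho> (c/2) / 2"
    define y0 where "y0 = a + min 1 (2 * \<rho> / c) *\<^sub>R (x0 - a)"
    note sp = star_patch[OF star_shaped_ball[OF P ss] x0(2) D a \<rho>(1) r_def y0_def \<Lambda>_def]
    define d where "d = 2 * \<Lambda> * \<rho>"
    have r: "r > 0" "r \<le> \<rho>" using x0 \<rho> by (auto simp: r_def)
    interpret L: local_patch \<Omega> "ball a (\<Lambda> * \<rho>)" "\<Omega> \<inter> ball a \<rho>" u y0 r d
    proof
      have "1 * \<rho> \<le> \<Lambda> * \<rho>" using \<Lambda> \<rho> by (intro mult_right_mono) auto
      then have "2 * r \<le> 2 * (\<Lambda> * \<rho>)" using r by linarith
      then show "2 * r \<le> d" by (simp only: d_def mult.assoc)
      show "norm (x - y) \<le> d" if "x \<in> \<Omega> \<inter> ball a \<rho>" "y \<in> ball y0 r" for x y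
      proof -
        have "x \<in> ball a (\<Lambda> * \<rho>)" "y \<in> ball a (\<Lambda> * \<rho>)" using sp(1) that by auto
        then show ?thesis using dist_triangle3[of x y a] by (simp add: d_def dist_norm)
      qed
      show "closed_segment y p \<subseteq> \<Omega> \<inter> ball a (\<Lambda> * \<rho>)" if "p \<in> \<Omega> \<inter> ball a \<rho> \<union> cball y0 r" "y \<in> cball y0 r" for p y
        using sp(2) that by blast
    qed (use ps u r in auto)
    have E: "L.energy = local_energy \<Omega> u (ball a (\<Lambda> * \<rho>))" by (simp add: L.energy_def local_energy_def)
    have \<kappa>r: "\<kappa> * \<rho> \<le> r"
    proof -
      have "\<rho> * (c / (2 * \<rho>max)) \<le> \<rho>max * (c / (2 * \<rho>max))" using \<rho> x0 \<rho>max by (intro mult_right_mono) auto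
      also have "\<dots> = c / 2" using \<rho>max by simp
      finally have "\<rho> * (c / (2 * \<rho>max)) \<le> c / 2" .
      moreover have "min 1 (c / (2 * \<rho>max)) * \<rho> \<le> 1 * \<rho>" using \<rho> by (intro mult_right_mono) auto
      moreover have "min 1 (c / (2 * \<rho>max)) * \<rho> \<le> (c / (2 * \<rho>max)) * \<rho>" using \<rho> by (intro mult_right_mono) auto
      ultimately show ?thesis unfolding \<kappa>_def r_def by (simp add: mult.commute)
    qed
    have k3: "(\<kappa> * \<rho>) ^ 3 \<le> r ^ 3" using \<kappa>r \<kappa> \<rho> by (intro power_mono) auto
    have k30: "0 < (\<kappa> * \<rho>) ^ 3" using \<kappa> \<rho> by simp
    have e0: "0 \<le> sqrt L.energy" using L.energy_nonneg by simp
    have b1: "768 * d ^ 5 / r ^ 3 * sqrt L.energy \<le> C * \<rho>\<^sup>2 * sqrt L.energy"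
    proof (rule mult_right_mono[OF _ e0])
      have "768 * d ^ 5 / r ^ 3 \<le> 768 * d ^ 5 / (\<kappa> * \<rho>) ^ 3" using k3 k30 \<Lambda> \<rho> r by (intro divide_left_mono) (auto simp: d_def)
      also have "\<dots> = (768 * (2 * \<Lambda>) ^ 5 / \<kappa> ^ 3) * \<rho>\<^sup>2" using \<rho> \<kappa> by (simp add: d_def power_mult_distrib eval_nat_numeral field_simps)
      also have "\<dots> \<le> C * \<rho>\<^sup>2" by (intro mult_right_mono) (auto simp: C_def)
      finally show "768 * d ^ 5 / r ^ 3 \<le> C * \<rho>\<^sup>2" .
    qed
    have b2: "2 * (600 * d ^ 4 / r ^ 3 * sqrt L.energy) \<le> C * \<rho> * sqrt L.energy"
    proof -
      have "1200 * d ^ 4 / r ^ 3 \<le> 1200 * d ^ 4 / (\<kappa> * \<rho>) ^ 3" using k3 k30 \<Lambda> \<rho> r by (intro divide_left_mono) (auto simp: d_def)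
      also have "\<dots> = (1200 * (2 * \<Lambda>) ^ 4 / \<kappa> ^ 3) * \<rho>" using \<rho> \<kappa> by (simp add: d_def power_mult_distrib eval_nat_numeral field_simps)
      also have "\<dots> \<le> C * \<rho>" using \<rho> by (intro mult_right_mono) (auto simp: C_def)
      finally have "1200 * d ^ 4 / r ^ 3 * sqrt L.energy \<le> C * \<rho> * sqrt L.energy" by (rule mult_right_mono[OF _ e0])
      then show ?thesis by (simp add: mult.assoc)
    qed
    show "quadratic_approx \<Omega> u (\<Omega> \<inter> ball a \<rho>)
      (C * \<rho>\<^sup>2 * sqrt (local_energy \<Omega> u (ball a (\<Lambda> * \<rho>))))
      (C * \<rho> * sqrt (local_energy \<Omega> u (ball a (\<Lambda> * \<rho>))))"
      unfolding quadratic_approx_def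
    proof (intro exI conjI ballI allI)
      show "grid_interp y0 (r/2) u \<in> P2" by (rule grid_interp_in_P2)
      show "grid_interp1 y0 (r/2) u \<in> P1" "grid_interp2 y0 (r/2) u \<in> P1" by (rule grid_interp12_in_P1)+
      show "(grid_interp y0 (r/2) u has_derivative (\<lambda>h. h$1 *\<^sub>R grid_interp1 y0 (r/2) u x + h$2 *\<^sub>R grid_interp2 y0 (r/2) u x)) (at x)" for x
        by (rule grid_interp_has_derivative)
      show "norm (u x - grid_interp y0 (r/2) u x) \<le> C * \<rho>\<^sup>2 * sqrt (local_energy \<Omega> u (ball a (\<Lambda> * \<rho>)))" if "x \<in> \<Omega> \<inter> ball a \<rho>" for x
        using L.interp_error[OF that] b1 unfolding E by linarith
      show "AE x in lebesgue_on (\<Omega> \<inter> ball a \<rho>). norm (weak_deriv \<Omega> [axis 1 1] u x - grid_interp1 y0 (r/2) u x) \<le> C * \<rho> * sqrt (local_energy \<Omega> u (ball a (\<Lambda> * \<rho>)))"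
        using L.interp_grad_error(1) by eventually_elim (use b2 in \<open>simp add: E\<close>)
      show "AE x in lebesgue_on (\<Omega> \<inter> ball a \<rho>). norm (weak_deriv \<Omega> [axis 2 1] u x - grid_interp2 y0 (r/2) u x) \<le> C * \<rho> * sqrt (local_energy \<Omega> u (ball a (\<Lambda> * \<rho>)))"
        using L.interp_grad_error(2) by eventually_elim (use b2 in \<open>simp add: E\<close>)
    qed
  qed
qed

section \<open>Linear finite elements\<close>

lemma P1_E:
  assumes "p \<in> P1"
  obtains c0 c1 c2 where "p = (\<lambda>x. c0 + x$1 *\<^sub>R c1 + x$2 *\<^sub>R c2)"
  using assms by (auto simp: P1_def)

lemma P1_affine:
  assumes "p \<in> P1" shows "p ((1 - t) *\<^sub>R x + t *\<^sub>R y) = (1 - t) *\<^sub>R p x + t *\<^sub>R p y"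
  using assms by (elim P1_E) (simp add: algebra_simps)

lemma P1_continuous: "p \<in> P1 \<Longrightarrow> continuous_on S (p :: real^2 \<Rightarrow> complex)"
  by (elim P1_E) (auto intro!: continuous_intros)

lemma P1_diff: "p \<in> P1 \<Longrightarrow> q \<in> P1 \<Longrightarrow> (\<lambda>x. p x - q x) \<in> P1"
proof -
  assume "p \<in> P1" "q \<in> P1"
  then obtain c0 c1 c2 d0 d1 d2 where "p = (\<lambda>x. c0 + x$1 *\<^sub>R c1 + x$2 *\<^sub>R c2)" "q = (\<lambda>x. d0 + x$1 *\<^sub>R d1 + x$2 *\<^sub>R d2)"
    by (elim P1_E) blast
  then have "(\<lambda>x. p x - q x) = (\<lambda>x. (c0 - d0) + x$1 *\<^sub>R (c1 - d1) + x$2 *\<^sub>R (c2 - d2))"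
    by (auto simp: algebra_simps)
  then show ?thesis unfolding P1_def by blast
qed

lemma P1_eq_hull:
  assumes p: "p \<in> P1" "q \<in> P1" and eq: "\<And>x. x \<in> C \<Longrightarrow> p x = q x" and x: "x \<in> convex hull C"
  shows "p x = q x"
proof -
  have "convex {x. p x = q x}"
    by (auto simp: convex_alt P1_affine[OF p(1)] P1_affine[OF p(2)])
  then have "convex hull C \<subseteq> {x. p x = q x}" using eq by (intro hull_minimal) auto
  then show ?thesis using x by blast
qed

lemma P1_bound_hull:
  fixes p :: "real^2 \<Rightarrow> complex"
  assumes p: "p \<in> P1" and le: "\<And>x. x \<in> C \<Longrightarrow> norm (p x) \<le> m" and x: "x \<in> convex hull C"
  shows "norm (p x) \<le> m"
proof -
  have "convex {x. norm (p x) \<le> m}"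
    unfolding convex_alt
  proof (intro ballI allI impI)
    fix x y u assume x: "x \<in> {x. norm (p x) \<le> m}" and y: "y \<in> {x. norm (p x) \<le> m}" and u: "0 \<le> u \<and> u \<le> (1::real)"
    have "norm (p ((1 - u) *\<^sub>R x + u *\<^sub>R y)) \<le> norm ((1 - u) *\<^sub>R p x) + norm (u *\<^sub>R p y)"
      unfolding P1_affine[OF p] by (rule norm_triangle_ineq)
    also have "\<dots> = (1 - u) * norm (p x) + u * norm (p y)" using u by simp
    also have "\<dots> \<le> (1 - u) * m + u * m" using x y u by (intro add_mono mult_left_mono) auto
    finally show "(1 - u) *\<^sub>R x + u *\<^sub>R y \<in> {x. norm (p x) \<le> m}" by (simp add: algebra_simps)
  qed
  then have "convex hull C \<subseteq> {x. norm (p x) \<le> m}" using le by (intro hull_minimal) auto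
  then show ?thesis using x by blast
qed

text \<open>The values at \<open>a + (r/2) e\<close> and \<open>a - (r/2) e\<close> differ by
  \<open>r\<close> times the slope along \<open>e\<close>.\<close>

lemma P1_slope_bound:
  fixes c0 c1 c2 :: complex and a :: "real^2"
  assumes r: "r > 0" and le: "\<And>x. x \<in> ball a r \<Longrightarrow> norm (c0 + x$1 *\<^sub>R c1 + x$2 *\<^sub>R c2) \<le> m"
  shows "norm c1 \<le> 2 * m / r" "norm c2 \<le> 2 * m / r"
proof -
  have *: "norm z \<le> 2 * m / r" if b: "a + (r/2) *\<^sub>R e \<in> ball a r" "a - (r/2) *\<^sub>R e \<in> ball a r"
      and z: "(c0 + (a + (r/2) *\<^sub>R e)$1 *\<^sub>R c1 + (a + (r/2) *\<^sub>R e)$2 *\<^sub>R c2) - (c0 + (a - (r/2) *\<^sub>R e)$1 *\<^sub>R c1 + (a - (r/2) *\<^sub>R e)$2 *\<^sub>R c2) = r *\<^sub>R z"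
    for e z
  proof -
    have "r * norm z = norm (r *\<^sub>R z)" using r by simp
    also have "\<dots> \<le> m + m" unfolding z[symmetric]
      by (rule order_trans[OF norm_triangle_ineq4 add_mono[OF le[OF b(1)] le[OF b(2)]]])
    finally show ?thesis using r by (simp add: field_simps)
  qed
  have h: "(r/2) *\<^sub>R z + (r/2) *\<^sub>R z = r *\<^sub>R z" for z :: complex by (simp flip: scaleR_add_left)
  show "norm c1 \<le> 2 * m / r"
    by (rule *[of "axis 1 1"]) (use r in \<open>simp_all add: dist_norm scaleR_add_left scaleR_diff_left h\<close>)
  show "norm c2 \<le> 2 * m / r"
    by (rule *[of "axis 2 1"]) (use r in \<open>simp_all add: dist_norm scaleR_add_left scaleR_diff_left h\<close>)
qed

text \<open>The inner product with \<open>perp\<close> is the determinant of two edge vectors, that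
  is, affine independence in the form in which it is needed as a denominator.\<close>

lemma simplex2_vertices:
  fixes \<tau> :: "(real^2) set"
  assumes "2 simplex \<tau>"
  obtains a b c where "{x. x extreme_point_of \<tau>} = {a, b, c}" "\<tau> = convex hull {a, b, c}"
    "(b - a) \<bullet> perp (c - a) \<noteq> 0"
proof -
  obtain C where C: "\<not> affine_dependent C" "card C = 3" "\<tau> = convex hull C"
    using assms by (auto simp: simplex_def)
  then obtain a b c where abc: "C = {a, b, c}" "a \<noteq> b" "b \<noteq> c" "a \<noteq> c" by (auto simp: card_3_iff)
  have "{x. x extreme_point_of \<tau>} = C"
    using C by (simp add: extreme_point_of_convex_hull_affine_independent)
  moreover have "(b - a) \<bullet> perp (c - a) \<noteq> 0"
  proof
    assume "(b - a) \<bullet> perp (c - a) = 0"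
    from perp_parallel[OF _ this] abc obtain s where "b - a = s *\<^sub>R (c - a)" by auto
    then have "collinear {a, b, c}"
      unfolding collinear_def
      by (intro exI[of _ "c - a"]) (auto intro: exI[of _ 0] exI[of _ 1] exI[of _ "-1"] exI[of _ s] exI[of _ "-s"]
           exI[of _ "s - 1"] exI[of _ "1 - s"] simp: algebra_simps)
    then show False using C abc collinear_3_eq_affine_dependent by auto
  qed
  ultimately show ?thesis using that C abc by auto
qed

lemma P1_interp_exists:
  fixes w :: "real^2 \<Rightarrow> complex"
  assumes "2 simplex \<tau>"
  shows "\<exists>p\<in>P1. \<forall>z. z extreme_point_of \<tau> \<longrightarrow> p z = w z"
proof -
  obtain a b c where abc: "{x. x extreme_point_of \<tau>} = {a, b, c}" "(b - a) \<bullet> perp (c - a) \<noteq> 0"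
    using simplex2_vertices[OF assms] by metis
  define D where "D = (b - a) \<bullet> perp (c - a)"
  have D': "(c - a) \<bullet> perp (b - a) = - D" by (simp add: D_def inner_real2 algebra_simps)
  \<comment> \<open>The first quotient is the barycentric coordinate of \<open>x\<close> belonging
    to \<open>b\<close>, the second, up to sign, the one belonging to \<open>c\<close>, by Cramer's
    rule.\<close>
  define p where "p x = w a + (((x - a) \<bullet> perp (c - a)) / D) *\<^sub>R (w b - w a) - (((x - a) \<bullet> perp (b - a)) / D) *\<^sub>R (w c - w a)" for x
  have D0: "D \<noteq> 0" using abc(2) by (simp add: D_def)
  have "p a = w a" by (simp add: p_def)
  moreover have "p b = w b" using D0 by (simp add: p_def D_def[symmetric])
  moreover have "p c = w c" using D0 by (simp add: p_def D')
  moreover have "p \<in> P1"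
  proof -
    define c1 where "c1 = (- (c - a)$2 / D) *\<^sub>R (w b - w a) + ((b - a)$2 / D) *\<^sub>R (w c - w a)"
    define c2 where "c2 = ((c - a)$1 / D) *\<^sub>R (w b - w a) - ((b - a)$1 / D) *\<^sub>R (w c - w a)"
    have s: "((u + v) / D) *\<^sub>R z = (u / D) *\<^sub>R z + (v / D) *\<^sub>R z" for u v and z :: complex
      by (simp add: add_divide_distrib scaleR_add_left)
    have "p = (\<lambda>x. (w a - a$1 *\<^sub>R c1 - a$2 *\<^sub>R c2) + x$1 *\<^sub>R c1 + x$2 *\<^sub>R c2)"
    proof
      fix x
      have "p x = w a + (x - a)$1 *\<^sub>R c1 + (x - a)$2 *\<^sub>R c2"
        unfolding p_def inner_real2 s c1_def c2_def using D0 by (simp add: scaleR_conv_of_real field_simps)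
      then show "p x = (w a - a$1 *\<^sub>R c1 - a$2 *\<^sub>R c2) + x$1 *\<^sub>R c1 + x$2 *\<^sub>R c2" by (simp add: scaleR_diff_left)
    qed
    then show ?thesis unfolding P1_def by blast
  qed
  ultimately show ?thesis using abc(1) by (intro bexI[of _ p]) (auto simp: set_eq_iff)
qed

lemma has_weak_deriv_cong:
  assumes "has_weak_deriv S bs u g" "\<And>x. x \<in> S \<Longrightarrow> u x = v x" "S \<in> sets lebesgue"
  shows "has_weak_deriv S bs v g"
proof -
  have m: "u \<in> borel_measurable (lebesgue_on S) \<longleftrightarrow> v \<in> borel_measurable (lebesgue_on S)"
    using assms(2) by (intro measurable_cong) simp
  have i: "integrable (lebesgue_on S) (\<lambda>x. (norm (u x))\<^sup>2) \<longleftrightarrow> integrable (lebesgue_on S) (\<lambda>x. (norm (v x))\<^sup>2)"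
    using assms(2) by (intro Bochner_Integration.integrable_cong) auto
  have "(\<integral>x. f x *\<^sub>R u x \<partial>lebesgue_on S) = (\<integral>x. f x *\<^sub>R v x \<partial>lebesgue_on S)" for f :: "'a \<Rightarrow> real"
    using assms(2) by (intro Bochner_Integration.integral_cong) auto
  then show ?thesis using assms(1) m i by (simp add: has_weak_deriv_def L2_def)
qed

lemma has_weak_deriv_Nil: "u \<in> L2 S \<Longrightarrow> has_weak_deriv S [] u u"
  by (simp add: has_weak_deriv_def iterated_deriv_def)

lemma bounded_L2:
  assumes "S \<in> lmeasurable" "u \<in> borel_measurable (lebesgue_on S)" "\<And>x. x \<in> S \<Longrightarrow> norm (u x) \<le> B"
  shows "u \<in> L2 S"
proof -
  interpret finite_measure "lebesgue_on S" by (rule finite_measure_lebesgue_on[OF assms(1)])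
  have "integrable (lebesgue_on S) (\<lambda>x. (norm (u x))\<^sup>2)"
  proof (rule integrable_const_bound[of _ "B\<^sup>2"])
    show "AE x in lebesgue_on S. norm ((norm (u x))\<^sup>2) \<le> B\<^sup>2"
      using assms(3) by (intro AE_I2) (auto intro!: power_mono)
  qed (use assms(2) in auto)
  then show ?thesis using assms(2) by (simp add: L2_def)
qed

section \<open>The linear nodal interpolant on a triangulation and its weak gradient\<close>

locale mesh =
  fixes \<Omega> :: "(real^2) set" and \<T> :: "(real^2) set set"
  assumes open_dom: "open \<Omega>" and bounded_dom: "bounded \<Omega>"
    and triang: "triangulation \<T>" and simplex2: "\<And>\<tau>. \<tau> \<in> \<T> \<Longrightarrow> 2 simplex \<tau>"
    and cover: "\<Union>\<T> = closure \<Omega>"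
begin

lemma finite_mesh: "finite \<T>" using triang by (simp add: triangulation_def)

lemma face: "\<tau> \<in> \<T> \<Longrightarrow> \<tau>' \<in> \<T> \<Longrightarrow> \<tau> \<inter> \<tau>' face_of \<tau>"
  using triang by (simp add: triangulation_def)

lemma triangle_props: "\<tau> \<in> \<T> \<Longrightarrow> compact \<tau>" "\<tau> \<in> \<T> \<Longrightarrow> convex \<tau>" "\<tau> \<in> \<T> \<Longrightarrow> closed \<tau>"
  using simplex2 by (auto intro: compact_simplex convex_simplex closed_simplex)

lemma triangle_hull: "\<tau> \<in> \<T> \<Longrightarrow> \<tau> = convex hull {x. x extreme_point_of \<tau>}"
  by (intro Krein_Milman_Minkowski triangle_props)

lemma interior_rel: "\<tau> \<in> \<T> \<Longrightarrow> interior \<tau> = rel_interior \<tau>"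
proof -
  assume t: "\<tau> \<in> \<T>"
  have "aff_dim \<tau> = int DIM(real^2)" using aff_dim_simplex[OF simplex2[OF t]] by simp
  then have "affine hull \<tau> = UNIV" using aff_dim_eq_full[of \<tau>] by simp
  then show ?thesis by (simp add: rel_interior_interior)
qed

lemma interior_nonempty: "\<tau> \<in> \<T> \<Longrightarrow> interior \<tau> \<noteq> {}"
proof -
  assume t: "\<tau> \<in> \<T>"
  have "\<tau> \<noteq> {}" using simplex2[OF t] by auto
  then show ?thesis using interior_rel[OF t] rel_interior_eq_empty[OF triangle_props(2)[OF t]] by simp
qed

text \<open>A face that meets the relative interior of a convex set is the whole set.\<close>

lemma interior_sub: assumes "\<tau> \<in> \<T>" "\<tau>' \<in> \<T>" "interior \<tau> \<inter> \<tau>' \<noteq> {}" shows "\<tau> \<subseteq> \<tau>'"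
proof -
  have "(\<tau> \<inter> \<tau>') \<inter> rel_interior \<tau> \<noteq> {}"
    using assms interior_rel[OF assms(1)] interior_subset[of \<tau>] by auto
  from subset_of_face_of[OF face[OF assms(1,2)] subset_refl this] show ?thesis by blast
qed

lemma interior_disjoint:
  assumes "\<tau> \<in> \<T>" "\<tau>' \<in> \<T>" "interior \<tau> \<inter> interior \<tau>' \<noteq> {}" shows "\<tau> = \<tau>'"
proof -
  have "interior \<tau> \<inter> \<tau>' \<noteq> {}" "interior \<tau>' \<inter> \<tau> \<noteq> {}" using assms(3) interior_subset by blast+
  then show ?thesis using interior_sub assms by blast
qed

definition pl :: "(real^2 \<Rightarrow> complex) \<Rightarrow> (real^2) set \<Rightarrow> real^2 \<Rightarrow> complex" where
  "pl w \<tau> = (SOME p. p \<in> P1 \<and> (\<forall>z. z extreme_point_of \<tau> \<longrightarrow> p z = w z))"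

lemma pl: assumes "\<tau> \<in> \<T>" shows "pl w \<tau> \<in> P1" "\<And>z. z extreme_point_of \<tau> \<Longrightarrow> pl w \<tau> z = w z"
proof -
  have "\<exists>p. p \<in> P1 \<and> (\<forall>z. z extreme_point_of \<tau> \<longrightarrow> p z = w z)" using P1_interp_exists[OF simplex2[OF assms]] by blast
  from someI_ex[OF this] show "pl w \<tau> \<in> P1" "\<And>z. z extreme_point_of \<tau> \<Longrightarrow> pl w \<tau> z = w z" unfolding pl_def by auto
qed

text \<open>Conformity at work: the intersection is a face of both triangles, so its extreme points
  are vertices of both, where the two affine functions take the same values; hence they agree on the
  convex hull.\<close>

lemma pl_agree:
  assumes \<tau>: "\<tau> \<in> \<T>" "\<tau>' \<in> \<T>" and x: "x \<in> \<tau>" "x \<in> \<tau>'" shows "pl w \<tau> x = pl w \<tau>' x"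
proof -
  have f: "\<tau> \<inter> \<tau>' face_of \<tau>" "\<tau> \<inter> \<tau>' face_of \<tau>'" using face[OF \<tau>] face[OF \<tau>(2,1)] by (simp_all add: Int_commute)
  have "\<tau> \<inter> \<tau>' = convex hull {z. z extreme_point_of (\<tau> \<inter> \<tau>')}"
    by (intro Krein_Milman_Minkowski compact_Int convex_Int triangle_props \<tau>)
  then have "x \<in> convex hull {z. z extreme_point_of (\<tau> \<inter> \<tau>')}" using x by blast
  then show ?thesis
  proof (rule P1_eq_hull[OF pl(1)[OF \<tau>(1)] pl(1)[OF \<tau>(2)], rotated])
    fix z assume "z \<in> {z. z extreme_point_of (\<tau> \<inter> \<tau>')}"
    then have "z extreme_point_of \<tau>" "z extreme_point_of \<tau>'" using extreme_point_of_face[OF f(1)] extreme_point_of_face[OF f(2)] by auto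
    then show "pl w \<tau> z = pl w \<tau>' z" using pl(2) \<tau> by simp
  qed
qed

text \<open>An explicit counterpart of the choice in \<open>nodal_interp\<close>; by
  \<open>pl_agree\<close> every triangle containing \<open>x\<close> gives the same value.\<close>

definition interp :: "(real^2 \<Rightarrow> complex) \<Rightarrow> real^2 \<Rightarrow> complex" where
  "interp w x = (if x \<in> closure \<Omega> then pl w (SOME \<tau>. \<tau> \<in> \<T> \<and> x \<in> \<tau>) x else 0)"

lemma interp_eq: assumes "\<tau> \<in> \<T>" "x \<in> \<tau>" shows "interp w x = pl w \<tau> x"
proof -
  have "\<exists>\<tau>. \<tau> \<in> \<T> \<and> x \<in> \<tau>" using assms by blast
  from someI_ex[OF this] have s: "(SOME \<tau>. \<tau> \<in> \<T> \<and> x \<in> \<tau>) \<in> \<T>" "x \<in> (SOME \<tau>. \<tau> \<in> \<T> \<and> x \<in> \<tau>)" by auto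
  have "x \<in> closure \<Omega>" using assms cover by blast
  then show ?thesis using pl_agree[OF s(1) assms(1) s(2) assms(2)] by (simp add: interp_def)
qed

lemma interp_node: "z \<in> nodes \<T> \<Longrightarrow> interp w z = w z"
proof -
  assume "z \<in> nodes \<T>"
  then obtain \<tau> where t: "\<tau> \<in> \<T>" "z extreme_point_of \<tau>" by (auto simp: nodes_def)
  then have "z \<in> \<tau>" by (simp add: extreme_point_of_def)
  then show ?thesis using interp_eq[OF t(1)] pl(2)[OF t] by simp
qed

lemma interp_unique:
  assumes "\<And>\<tau>. \<tau> \<in> \<T> \<Longrightarrow> \<exists>p\<in>P1. \<forall>x\<in>\<tau>. v x = p x" "\<And>z. z \<in> nodes \<T> \<Longrightarrow> v z = w z" "x \<in> closure \<Omega>"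
  shows "v x = interp w x"
proof -
  obtain \<tau> where t: "\<tau> \<in> \<T>" "x \<in> \<tau>" using assms(3) cover by blast
  obtain p where p: "p \<in> P1" "\<And>x. x \<in> \<tau> \<Longrightarrow> v x = p x" using assms(1)[OF t(1)] by blast
  have "x \<in> convex hull {z. z extreme_point_of \<tau>}" using t triangle_hull by blast
  then have "p x = pl w \<tau> x"
  proof (rule P1_eq_hull[OF p(1) pl(1)[OF t(1)], rotated])
    fix z assume z: "z \<in> {z. z extreme_point_of \<tau>}"
    then have "z \<in> \<tau>" "z \<in> nodes \<T>" using t by (auto simp: extreme_point_of_def nodes_def)
    then show "p z = pl w \<tau> z" using p(2)[of z] assms(2)[of z] pl(2)[OF t(1), of z w] z by simp
  qed
  then show ?thesis using p(2)[OF t(2)] interp_eq[OF t] by simp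
qed

lemma interp_continuous: "continuous_on (closure \<Omega>) (interp w)"
  unfolding cover[symmetric]
proof (rule continuous_on_closed_Union[where U="\<lambda>x. x" and I=\<T>, simplified])
  fix \<tau> assume t: "\<tau> \<in> \<T>"
  show "continuous_on \<tau> (interp w)"
    by (rule continuous_on_eq[OF P1_continuous[OF pl(1)[OF t, of w]]]) (simp add: interp_eq[OF t])
qed (auto simp: finite_mesh triangle_props)

lemma dom_measurable: "\<Omega> \<in> sets lebesgue" "\<Omega> \<in> lmeasurable"
  using open_dom bounded_dom by (auto simp: lmeasurable_open)

lemma interp_measurable: "interp w \<in> borel_measurable (lebesgue_on \<Omega>)"
  using dom_measurable interp_continuous closure_subset
  by (intro continuous_imp_measurable_on_sets_lebesgue) (auto intro: continuous_on_subset)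

lemma interp_L2: "interp w \<in> L2 \<Omega>"
proof -
  have "compact (interp w ` closure \<Omega>)" using bounded_dom by (intro compact_continuous_image interp_continuous) auto
  then obtain B where "\<And>x. x \<in> closure \<Omega> \<Longrightarrow> norm (interp w x) \<le> B" by (metis bounded_iff compact_imp_bounded image_eqI)
  then show ?thesis using closure_subset by (intro bounded_L2[OF dom_measurable(2) interp_measurable, of _ B]) auto
qed

definition slope :: "2 \<Rightarrow> (real^2 \<Rightarrow> complex) \<Rightarrow> (real^2) set \<Rightarrow> complex" where
  "slope i w \<tau> = pl w \<tau> (axis i 1) - pl w \<tau> 0"

lemma pl_slope: assumes "\<tau> \<in> \<T>" shows "pl w \<tau> x = pl w \<tau> 0 + x$1 *\<^sub>R slope 1 w \<tau> + x$2 *\<^sub>R slope 2 w \<tau>"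
  using pl(1)[OF assms, of w] by (elim P1_E) (simp add: slope_def)

text \<open>As a finite sum over open triangles this is plainly measurable; it is zero on the edges,
  which form a null set.\<close>

definition pgrad :: "2 \<Rightarrow> (real^2 \<Rightarrow> complex) \<Rightarrow> real^2 \<Rightarrow> complex" where
  "pgrad i w x = (\<Sum>\<tau>\<in>\<T>. indicator (interior \<tau>) x *\<^sub>R slope i w \<tau>)"

lemma pgrad_eq: assumes "\<tau> \<in> \<T>" "x \<in> interior \<tau>" shows "pgrad i w x = slope i w \<tau>"
proof -
  have "pgrad i w x = (\<Sum>\<tau>'\<in>\<T>. if \<tau>' = \<tau> then slope i w \<tau> else 0)"
    unfolding pgrad_def
  proof (rule sum.cong[OF refl])
    fix \<tau>' assume "\<tau>' \<in> \<T>"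
    then show "indicator (interior \<tau>') x *\<^sub>R slope i w \<tau>' = (if \<tau>' = \<tau> then slope i w \<tau> else 0)"
      using interior_disjoint[OF assms(1), of \<tau>'] assms(2) by (auto simp: indicator_def)
  qed
  then show ?thesis using assms(1) finite_mesh by simp
qed

lemma AE_interior: "AE x in lebesgue_on \<Omega>. \<exists>\<tau>\<in>\<T>. x \<in> interior \<tau>"
proof -
  have n: "negligible (\<Union>\<tau>\<in>\<T>. frontier \<tau>)"
    using finite_mesh by (intro negligible_Union) (auto intro!: negligible_convex_frontier triangle_props)
  have "{x \<in> \<Omega>. \<not> (\<exists>\<tau>\<in>\<T>. x \<in> interior \<tau>)} \<subseteq> (\<Union>\<tau>\<in>\<T>. frontier \<tau>)"
  proof
    fix x assume x: "x \<in> {x \<in> \<Omega>. \<not> (\<exists>\<tau>\<in>\<T>. x \<in> interior \<tau>)}"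
    then obtain \<tau> where "\<tau> \<in> \<T>" "x \<in> \<tau>" using cover closure_subset by blast
    then show "x \<in> (\<Union>\<tau>\<in>\<T>. frontier \<tau>)" using x triangle_props(3) by (auto simp: frontier_def)
  qed
  then show ?thesis using n dom_measurable(1)
    by (subst AE_restrict_space_iff) (auto simp: negligible_iff_null_sets eventually_ae_filter intro!: bexI[of _ "\<Union>\<tau>\<in>\<T>. frontier \<tau>"])
qed

lemma pgrad_measurable: "pgrad i w \<in> borel_measurable (lebesgue_on \<Omega>)"
  unfolding pgrad_def[abs_def]
  by (intro borel_measurable_sum borel_measurable_scaleR borel_measurable_indicator borel_measurable_const measurable_restrict_space1) auto

lemma pgrad_bound: "norm (pgrad i w x) \<le> (\<Sum>\<tau>\<in>\<T>. norm (slope i w \<tau>))"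
  unfolding pgrad_def by (rule sum_norm_le) (auto simp: indicator_def)

lemma pgrad_L2: "pgrad i w \<in> L2 \<Omega>"
  by (rule bounded_L2[OF dom_measurable(2) pgrad_measurable pgrad_bound])

text \<open>The triangles pull back to finitely many closed sets covering the parameter interval,
  and a Lipschitz bound on each of them carries over to the interval. The sum of all slopes serves
  as a common constant.\<close>

lemma interp_lipschitz:
  assumes seg: "closed_segment x (x + t *\<^sub>R axis i 1) \<subseteq> closure \<Omega>"
  shows "norm (interp w (x + t *\<^sub>R axis i 1) - interp w x) \<le> (\<Sum>\<tau>\<in>\<T>. norm (slope i w \<tau>)) * \<bar>t\<bar>"
proof -
  define L where "L = (\<Sum>\<tau>\<in>\<T>. norm (slope i w \<tau>))"
  define f where "f s = interp w (x + (s * t) *\<^sub>R axis i 1)" for s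
  have L0: "L \<ge> 0" by (simp add: L_def sum_nonneg)
  have "(L * \<bar>t\<bar>)-lipschitz_on {0..1} f"
  proof (rule lipschitz_on_closed_Union[where I=\<T> and U="\<lambda>\<tau>. (\<lambda>s. x + (s * t) *\<^sub>R axis i 1) -` \<tau>"])
    fix \<tau> assume t: "\<tau> \<in> \<T>"
    show "(L * \<bar>t\<bar>)-lipschitz_on ((\<lambda>s. x + (s * t) *\<^sub>R axis i 1) -` \<tau>) f"
    proof (rule lipschitz_onI)
      fix s s' assume s: "s \<in> (\<lambda>s. x + (s * t) *\<^sub>R axis i 1) -` \<tau>" "s' \<in> (\<lambda>s. x + (s * t) *\<^sub>R axis i 1) -` \<tau>"
      have "f s - f s' = pl w \<tau> (x + (s * t) *\<^sub>R axis i 1) - pl w \<tau> (x + (s' * t) *\<^sub>R axis i 1)"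
        using s by (simp add: f_def interp_eq[OF t])
      also have "\<dots> = ((s - s') * t) *\<^sub>R slope i w \<tau>"
        using exhaust_2[of i] by (subst (1 2) pl_slope[OF t]) (auto simp: algebra_simps)
      finally have "dist (f s) (f s') = norm (slope i w \<tau>) * \<bar>t\<bar> * \<bar>s - s'\<bar>" by (simp add: dist_norm abs_mult)
      also have "norm (slope i w \<tau>) \<le> L" unfolding L_def by (rule member_le_sum[OF t]) (auto simp: finite_mesh)
      finally show "dist (f s) (f s') \<le> (L * \<bar>t\<bar>) * dist s s'" by (simp add: dist_real_def mult_right_mono)
    qed (simp add: L0)
    show "closed ((\<lambda>s. x + (s * t) *\<^sub>R axis i 1) -` \<tau>)"
      by (intro closed_vimage triangle_props t continuous_intros)
  next
    show "{0..1} \<subseteq> (\<Union>\<tau>\<in>\<T>. (\<lambda>s. x + (s * t) *\<^sub>R axis i 1) -` \<tau>)"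
    proof
      fix s :: real assume s: "s \<in> {0..1}"
      have "x + (s * t) *\<^sub>R axis i 1 \<in> closed_segment x (x + t *\<^sub>R axis i 1)"
        using s by (auto simp: closed_segment_def algebra_simps intro!: exI[of _ s])
      then show "s \<in> (\<Union>\<tau>\<in>\<T>. (\<lambda>s. x + (s * t) *\<^sub>R axis i 1) -` \<tau>)" using seg cover by blast
    qed
  qed (auto simp: finite_mesh L0)
  from lipschitz_onD[OF this, of 1 0] show ?thesis by (simp add: f_def dist_norm L_def)
qed

text \<open>Continuity across edges enters through the Lipschitz bound, and inside the triangles,
  hence almost everywhere, the classical derivative is known. With \<open>weak_deriv_ibp\<close> no
  boundary terms on single triangles appear.\<close>

lemma interp_weak_deriv: "has_weak_deriv \<Omega> [axis i 1] (interp w) (pgrad i w)"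
  unfolding has_weak_deriv_def
proof (intro conjI ballI interp_L2 pgrad_L2)
  fix \<phi> assume \<phi>: "\<phi> \<in> test_functions \<Omega>"
  have "(\<integral>x. iterated_deriv [axis i 1] \<phi> x *\<^sub>R interp w x \<partial>lebesgue_on \<Omega>) = - (\<integral>x. \<phi> x *\<^sub>R pgrad i w x \<partial>lebesgue_on \<Omega>)"
  proof (rule weak_deriv_ibp[OF open_dom _ pgrad_measurable _ _ _ \<phi>])
    show "integrable (lebesgue_on \<Omega>) (interp w)" by (rule L2_integrable[OF interp_L2 dom_measurable(2)])
    show "axis i 1 \<in> (Basis :: (real^2) set)" by (simp add: axis_in_Basis_iff)
    fix K :: "(real^2) set" assume K: "compact K" "K \<subseteq> \<Omega>"
    obtain \<delta> where \<delta>: "\<delta> > 0" "\<And>x. x \<in> K \<Longrightarrow> ball x \<delta> \<subseteq> \<Omega>"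
      using Heine_Borel_lemma[OF K(1), of "{\<Omega>}"] K(2) open_dom by auto
    have "norm (interp w (x + t *\<^sub>R axis i 1) - interp w x) \<le> (\<Sum>\<tau>\<in>\<T>. norm (slope i w \<tau>)) * \<bar>t\<bar>" if "x \<in> K" "\<bar>t\<bar> < \<delta>" for x t
    proof (rule interp_lipschitz)
      have "closed_segment x (x + t *\<^sub>R axis i 1) \<subseteq> ball x \<delta>"
        using that \<delta>(1) by (intro closed_segment_subset) (auto simp: dist_norm)
      then show "closed_segment x (x + t *\<^sub>R axis i 1) \<subseteq> closure \<Omega>" using \<delta>(2)[OF that(1)] closure_subset by blast
    qed
    then show "\<exists>L \<delta>. \<delta> > 0 \<and> (\<forall>x\<in>K. \<forall>t. \<bar>t\<bar> < \<delta> \<longrightarrow> norm (interp w (x + t *\<^sub>R axis i 1) - interp w x) \<le> L * \<bar>t\<bar>)"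
      using \<delta>(1) by blast
  next
    show "AE x in lebesgue_on \<Omega>. ((\<lambda>t. (interp w (x + t *\<^sub>R axis i 1) - interp w x) /\<^sub>R t) \<longlongrightarrow> pgrad i w x) (at 0)"
      using AE_interior
    proof eventually_elim
      case (elim x)
      then obtain \<tau> where t: "\<tau> \<in> \<T>" "x \<in> interior \<tau>" by blast
      then obtain r where r: "r > 0" "ball x r \<subseteq> \<tau>" by (auto simp: mem_interior)
      have "\<forall>\<^sub>F t in at 0. slope i w \<tau> = (interp w (x + t *\<^sub>R axis i 1) - interp w x) /\<^sub>R t"
        unfolding eventually_at
      proof (intro exI[of _ r] conjI r ballI impI)
        fix s :: real assume s: "s \<noteq> 0 \<and> dist s 0 < r"
        have "x + s *\<^sub>R axis i 1 \<in> \<tau>" using s r(2) by (auto simp: subset_iff dist_norm)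
        moreover have "x \<in> \<tau>" using r by auto
        ultimately have "interp w (x + s *\<^sub>R axis i 1) - interp w x = pl w \<tau> (x + s *\<^sub>R axis i 1) - pl w \<tau> x"
          by (simp add: interp_eq[OF t(1)])
        also have "\<dots> = s *\<^sub>R slope i w \<tau>"
          using exhaust_2[of i] by (subst (1 2) pl_slope[OF t(1)]) (auto simp: algebra_simps)
        finally show "slope i w \<tau> = (interp w (x + s *\<^sub>R axis i 1) - interp w x) /\<^sub>R s" using s by simp
      qed
      then show ?case unfolding pgrad_eq[OF t] by (rule Lim_transform_eventually[OF tendsto_const])
    qed
  qed
  then show "(\<integral>x. iterated_deriv [axis i 1] \<phi> x *\<^sub>R interp w x \<partial>lebesgue_on \<Omega>) = (- 1) ^ length [axis i 1 :: real^2] * (\<integral>x. \<phi> x *\<^sub>R pgrad i w x \<partial>lebesgue_on \<Omega>)"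
    by simp
qed

lemma interp_fe: "interp w \<in> fe_space \<Omega> \<T>"
proof -
  have "\<exists>v. has_weak_deriv \<Omega> (dirs a b) (interp w) v" if "a + b \<le> 1" for a b
  proof -
    have "a = 0 \<and> b = 0 \<or> a = Suc 0 \<and> b = 0 \<or> a = 0 \<and> b = Suc 0" using that by arith
    then consider "a = 0" "b = 0" | "a = Suc 0" "b = 0" | "a = 0" "b = Suc 0" by blast
    then show ?thesis
    proof cases
      case 1 then show ?thesis using has_weak_deriv_Nil[OF interp_L2] by (auto simp: dirs_def)
    next
      case 2 then show ?thesis using interp_weak_deriv[of 1] by (auto simp: dirs_unit)
    next
      case 3 then show ?thesis using interp_weak_deriv[of 2] by (auto simp: dirs_unit)
    qed
  qed
  then have "interp w \<in> sobolev 1 \<Omega>" using interp_L2 by (simp add: sobolev_def)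
  then show ?thesis using pl(1) interp_eq by (auto simp: fe_space_def)
qed

text \<open>\<open>interp\<close> shows that the choice is made from a nonempty set, and uniqueness
  on the closure identifies the chosen function with \<open>interp\<close> there.\<close>

lemma nodal_interp:
  shows nodal_interp_fe: "nodal_interp \<Omega> \<T> w \<in> fe_space \<Omega> \<T>"
    and nodal_interp_node: "z \<in> nodes \<T> \<Longrightarrow> nodal_interp \<Omega> \<T> w z = w z"
    and nodal_interp_eq: "x \<in> closure \<Omega> \<Longrightarrow> nodal_interp \<Omega> \<T> w x = interp w x"
proof -
  have "\<exists>v. v \<in> fe_space \<Omega> \<T> \<and> (\<forall>z\<in>nodes \<T>. v z = w z)" using interp_fe interp_node by blast
  from someI_ex[OF this] have s: "nodal_interp \<Omega> \<T> w \<in> fe_space \<Omega> \<T>" "\<forall>z\<in>nodes \<T>. nodal_interp \<Omega> \<T> w z = w z"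
    unfolding nodal_interp_def by auto
  then show "nodal_interp \<Omega> \<T> w \<in> fe_space \<Omega> \<T>" "z \<in> nodes \<T> \<Longrightarrow> nodal_interp \<Omega> \<T> w z = w z" by auto
  show "x \<in> closure \<Omega> \<Longrightarrow> nodal_interp \<Omega> \<T> w x = interp w x"
    by (rule interp_unique) (use s in \<open>auto simp: fe_space_def\<close>)
qed

lemma nodal_interp_grad: "AE x in lebesgue_on \<Omega>. weak_deriv \<Omega> [axis i 1] (nodal_interp \<Omega> \<T> w) x = pgrad i w x"
proof -
  have h: "has_weak_deriv \<Omega> [axis i 1] (nodal_interp \<Omega> \<T> w) (pgrad i w)"
    by (rule has_weak_deriv_cong[OF interp_weak_deriv _ dom_measurable(1)]) (use nodal_interp_eq closure_subset in force)
  then have "has_weak_deriv \<Omega> [axis i 1] (nodal_interp \<Omega> \<T> w) (weak_deriv \<Omega> [axis i 1] (nodal_interp \<Omega> \<T> w))"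
    unfolding weak_deriv_def by (rule someI[where P="has_weak_deriv \<Omega> [axis i 1] (nodal_interp \<Omega> \<T> w)"])
  then show ?thesis using weak_deriv_unique[OF open_dom bounded_dom _ h] by blast
qed

end

section \<open>Least squares fits by quadratics\<close>

type_synonym coeffs = "complex \<times> complex \<times> complex \<times> complex \<times> complex \<times> complex"

text \<open>Coefficients make \<open>P2\<close> the image of a finite dimensional normed space, in
  which compactness arguments are possible.\<close>

definition quad :: "coeffs \<Rightarrow> real^2 \<Rightarrow> complex" where
  "quad c x = (case c of (c0, c1, c2, c3, c4, c5) \<Rightarrow>
     c0 + x$1 *\<^sub>R c1 + x$2 *\<^sub>R c2 + (x$1)\<^sup>2 *\<^sub>R c3 + (x$1 * x$2) *\<^sub>R c4 + (x$2)\<^sup>2 *\<^sub>R c5)"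

lemma P2_quad: "P2 = range quad"
proof -
  have "q \<in> P2 \<longleftrightarrow> (\<exists>c. q = quad c)" for q :: "real^2 \<Rightarrow> complex"
    by (simp add: P2_def quad_def[abs_def] split_paired_Ex)
  then show ?thesis by blast
qed

lemma quad_linear: "quad (a *\<^sub>R c + b *\<^sub>R d) x = a *\<^sub>R quad c x + b *\<^sub>R quad d x"
  by (cases c; cases d) (simp add: quad_def scaleR_add_right scaleR_add_left mult.commute)

lemma quad_scaleR: "quad (a *\<^sub>R c) x = a *\<^sub>R quad c x"
  using quad_linear[of a c 0 0 x] by simp

lemma quad_diff: "quad (c - d) x = quad c x - quad d x"
  using quad_linear[of 1 c "-1" d x] by simp

lemma quad_zero: "quad 0 x = 0"
  using quad_scaleR[of 0 0 x] by simp

lemma quad_continuous: "continuous_on S (\<lambda>c. quad c x)"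
  unfolding quad_def case_prod_beta by (intro continuous_intros)

lemma quad_inj: assumes "\<And>x. quad c x = 0" shows "c = 0"
proof -
  obtain c0 c1 c2 c3 c4 c5 where c: "c = (c0, c1, c2, c3, c4, c5)" by (cases c)
  have e: "c0 + s *\<^sub>R c1 + t *\<^sub>R c2 + s\<^sup>2 *\<^sub>R c3 + (s * t) *\<^sub>R c4 + t\<^sup>2 *\<^sub>R c5 = 0" for s t
    using assms[of "vector [s, t]"] by (simp add: quad_def c)
  have c0: "c0 = 0" using e[of 0 0] by simp
  have 1: "c1 + c3 = 0" "- c1 + c3 = 0" using e[of 1 0] e[of "-1" 0] c0 by simp_all
  have 2: "c2 + c5 = 0" "- c2 + c5 = 0" using e[of 0 1] e[of 0 "-1"] c0 by simp_all
  have "c3 + c3 = (c1 + c3) + (- c1 + c3)" "c5 + c5 = (c2 + c5) + (- c2 + c5)" by simp_all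
  then have "c3 + c3 = 0" "c5 + c5 = 0" using 1 2 by simp_all
  then have 3: "c3 = 0" "c5 = 0" by (simp_all flip: mult_2)
  then have 4: "c1 = 0" "c2 = 0" using 1 2 by simp_all
  have "c4 = 0" using e[of 1 1] c0 3 4 by simp
  then show ?thesis using c c0 3 4 by (simp add: zero_prod_def)
qed

definition unisolvent :: "(real^2) set \<Rightarrow> bool" where
  "unisolvent Y \<longleftrightarrow> finite Y \<and> \<not> (\<exists>q :: real^2 \<Rightarrow> real. q \<in> P2 \<and> q \<noteq> (\<lambda>x. 0) \<and> (\<forall>y\<in>Y. q y = 0))"

text \<open>The sampling condition speaks of real conics; real and imaginary part of a complex
  quadratic are of that kind.\<close>

lemma unisolvent_quad:
  assumes Y: "unisolvent Y" and z: "\<And>y. y \<in> Y \<Longrightarrow> quad c y = 0" shows "c = 0"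
proof (rule quad_inj)
  fix x
  obtain c0 c1 c2 c3 c4 c5 where c: "c = (c0, c1, c2, c3, c4, c5)" by (cases c)
  have l: "(\<lambda>x. l (quad c x)) = (\<lambda>x. 0)" if l: "linear l" for l :: "complex \<Rightarrow> real"
  proof -
    have "(\<lambda>x. l (quad c x)) = (\<lambda>x. l c0 + x$1 *\<^sub>R l c1 + x$2 *\<^sub>R l c2 + (x$1)\<^sup>2 *\<^sub>R l c3 + (x$1 * x$2) *\<^sub>R l c4 + (x$2)\<^sup>2 *\<^sub>R l c5)"
      by (simp add: quad_def c linear_add[OF l] linear_cmul[OF l])
    then have "(\<lambda>x. l (quad c x)) \<in> P2" unfolding P2_def by blast
    moreover have "\<forall>y\<in>Y. l (quad c y) = 0" using z linear_0[OF l] by simp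
    ultimately show ?thesis using Y unfolding unisolvent_def by blast
  qed
  have "linear Re" "linear Im" by (simp_all add: bounded_linear.linear bounded_linear_Re bounded_linear_Im)
  from this[THEN l] have "Re (quad c x) = 0" "Im (quad c x) = 0" by (simp_all add: fun_eq_iff)
  then show "quad c x = 0" by (simp add: complex_eq_iff)
qed

definition residual :: "(real^2) set \<Rightarrow> (real^2 \<Rightarrow> complex) \<Rightarrow> (real^2 \<Rightarrow> complex) \<Rightarrow> real" where
  "residual Y w q = (\<Sum>y\<in>Y. (norm (q y - w y))\<^sup>2)"

text \<open>Unisolvence makes the sum of squared values positive definite in the coefficients, and
  compactness of the unit sphere bounds it below by \<open>n c0\<close> times the squared norm.
  Outside a large ball the residual is therefore at least its value at zero, and inside a minimum is
  attained.\<close>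

lemma residual_min_exists:
  assumes Y: "unisolvent Y"
  shows "\<exists>c. \<forall>d. residual Y w (quad c) \<le> residual Y w (quad d)"
proof -
  have fin: "finite Y" using Y by (simp add: unisolvent_def)
  define n where "n c = (\<Sum>y\<in>Y. (norm (quad c y))\<^sup>2)" for c
  have nc: "continuous_on S n" for S
    unfolding n_def by (intro continuous_intros quad_continuous)
  have rc: "continuous_on S (\<lambda>c. residual Y w (quad c))" for S
    unfolding residual_def by (intro continuous_intros quad_continuous)
  have "\<exists>c\<in>sphere 0 1. \<forall>d\<in>sphere 0 1. n c \<le> n (d :: coeffs)"
  proof (rule continuous_attains_inf[OF _ _ nc])
    have "(1, 0) \<in> sphere (0::coeffs) 1" by (simp add: norm_prod_def)
    then show "sphere (0::coeffs) 1 \<noteq> {}" by blast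
  qed simp
  then obtain c0 :: coeffs where c0: "norm c0 = 1" "\<And>d. norm d = 1 \<Longrightarrow> n c0 \<le> n d" by auto
  have npos: "n c0 > 0"
  proof (rule ccontr)
    assume "\<not> n c0 > 0"
    moreover have "n c0 \<ge> 0" by (simp add: n_def sum_nonneg)
    ultimately have "n c0 = 0" by simp
    then have "\<And>y. y \<in> Y \<Longrightarrow> quad c0 y = 0" using fin by (simp add: n_def sum_nonneg_eq_0_iff)
    then have "c0 = 0" by (rule unisolvent_quad[OF Y])
    then show False using c0(1) by simp
  qed
  have coer: "n c0 * (norm d)\<^sup>2 \<le> n d" for d
  proof (cases "d = 0")
    case False
    have "n d = (norm d)\<^sup>2 * n (d /\<^sub>R norm d)"
      using False by (simp add: n_def quad_scaleR power_mult_distrib sum_distrib_left power_inverse mult.assoc[symmetric])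
    moreover have "(norm d)\<^sup>2 * n c0 \<le> (norm d)\<^sup>2 * n (d /\<^sub>R norm d)" using False by (intro mult_left_mono c0(2)) auto
    ultimately show ?thesis by (simp only: mult.commute)
  qed (simp add: n_def quad_zero)
  define W where "W = residual Y w (quad 0)"
  have W: "W = (\<Sum>y\<in>Y. (norm (w y))\<^sup>2)" by (simp add: W_def residual_def quad_zero)
  have W0: "W \<ge> 0" unfolding W by (intro sum_nonneg) auto
  have low: "n d / 2 - W \<le> residual Y w (quad d)" for d
  proof -
    have "(norm a)\<^sup>2 / 2 - (norm b)\<^sup>2 \<le> (norm (a - b))\<^sup>2" for a b :: complex
    proof -
      have "norm a \<le> norm (a - b) + norm b" using norm_triangle_ineq[of "a - b" b] by simp
      then have "(norm a)\<^sup>2 \<le> (norm (a - b) + norm b)\<^sup>2" by (intro power_mono) auto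
      also have "\<dots> \<le> 2 * (norm (a - b))\<^sup>2 + 2 * (norm b)\<^sup>2"
        using sum_squares_bound[of "norm (a - b)" "norm b"] by (simp add: power2_sum)
      finally show ?thesis by simp
    qed
    then have "(\<Sum>y\<in>Y. (norm (quad d y))\<^sup>2 / 2 - (norm (w y))\<^sup>2) \<le> residual Y w (quad d)"
      unfolding residual_def by (intro sum_mono)
    then show ?thesis by (simp add: n_def W sum_subtractf sum_divide_distrib)
  qed
  \<comment> \<open>Beyond this radius \<open>n d \<ge> 4 * W\<close>, so the lower bound
    \<open>n d / 2 - W\<close> is at least \<open>W\<close>, the residual of the zero
    polynomial.\<close>
  define R where "R = sqrt (4 * W / n c0)"
  have R0: "R \<ge> 0" using W0 npos by (simp add: R_def)
  have "\<exists>c\<in>cball 0 R. \<forall>d\<in>cball 0 R. residual Y w (quad c) \<le> residual Y w (quad d)"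
    by (rule continuous_attains_inf[OF _ _ rc]) (use R0 in auto)
  then obtain c where c0: "\<forall>d\<in>cball 0 R. residual Y w (quad c) \<le> residual Y w (quad d)" by blast
  have c: "residual Y w (quad c) \<le> residual Y w (quad d)" if "norm d \<le> R" for d
    by (rule bspec[OF c0]) (use that in simp)
  have "residual Y w (quad c) \<le> residual Y w (quad d)" for d
  proof (cases "norm d \<le> R")
    case False
    have "R\<^sup>2 \<le> (norm d)\<^sup>2" using False R0 by (intro power_mono) auto
    then have "4 * W / n c0 \<le> (norm d)\<^sup>2" using W0 npos by (simp add: R_def)
    then have "4 * W \<le> n c0 * (norm d)\<^sup>2" using npos by (simp add: field_simps)
    also have "\<dots> \<le> n d" by (rule coer)
    finally have "W \<le> residual Y w (quad d)" using low[of d] by simp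
    moreover have "residual Y w (quad c) \<le> W" unfolding W_def by (rule c) (use R0 in auto)
    ultimately show ?thesis by simp
  qed (rule c)
  then show ?thesis by blast
qed

text \<open>Parallelogram identity: at the midpoint of two minimisers the residual would be smaller
  by a quarter of their squared distance on \<open>Y\<close>. So they agree on \<open>Y\<close>, and
  unisolvence applies.\<close>

lemma residual_min_unique:
  assumes Y: "unisolvent Y" and c: "\<And>d. residual Y w (quad c) \<le> residual Y w (quad d)"
    and c': "\<And>d. residual Y w (quad c') \<le> residual Y w (quad d)"
  shows "c = c'"
proof -
  have fin: "finite Y" using Y by (simp add: unisolvent_def)
  define d where "d = (1/2) *\<^sub>R c + (1/2) *\<^sub>R c'"
  have par: "(norm ((1/2) *\<^sub>R a + (1/2) *\<^sub>R b - v))\<^sup>2 = ((norm (a - v))\<^sup>2 + (norm (b - v))\<^sup>2) / 2 - (norm (a - b))\<^sup>2 / 4" for a b v :: complex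
    unfolding cmod_power2 by (simp add: power2_eq_square field_simps)
  have "residual Y w (quad d) = (\<Sum>y\<in>Y. ((norm (quad c y - w y))\<^sup>2 + (norm (quad c' y - w y))\<^sup>2) / 2 - (norm (quad c y - quad c' y))\<^sup>2 / 4)"
    unfolding residual_def d_def quad_linear par ..
  also have "\<dots> = (residual Y w (quad c) + residual Y w (quad c')) / 2 - (\<Sum>y\<in>Y. (norm (quad c y - quad c' y))\<^sup>2) / 4"
    by (simp add: residual_def sum_subtractf sum.distrib sum_divide_distrib[symmetric])
  finally have e: "residual Y w (quad d) = (residual Y w (quad c) + residual Y w (quad c')) / 2 - (\<Sum>y\<in>Y. (norm (quad c y - quad c' y))\<^sup>2) / 4" .
  have "S \<le> 0" if "D = (C + C') / 2 - S / 4" "C \<le> D" "C' \<le> D" for S C C' D :: real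
  proof -
    have "2 * D = C + C' - S / 2" unfolding that(1) by (simp add: field_simps)
    then show ?thesis using that(2,3) by simp
  qed
  from this[OF e c c'] have "(\<Sum>y\<in>Y. (norm (quad c y - quad c' y))\<^sup>2) \<le> 0" .
  moreover have "0 \<le> (\<Sum>y\<in>Y. (norm (quad c y - quad c' y))\<^sup>2)" by (simp add: sum_nonneg)
  ultimately have "(\<Sum>y\<in>Y. (norm (quad c y - quad c' y))\<^sup>2) = 0" by simp
  then have "quad (c - c') y = 0" if "y \<in> Y" for y using that fin by (simp add: sum_nonneg_eq_0_iff quad_diff)
  then have "c - c' = 0" by (rule unisolvent_quad[OF Y])
  then show ?thesis by simp
qed

text \<open>\<open>arg_min_on\<close> is a mere choice, which gains meaning once a minimiser is
  known to exist.\<close>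

lemma ls_fit_quad:
  assumes Y: "unisolvent Y"
  shows "\<exists>c. ls_fit Y w = quad c \<and> (\<forall>d. residual Y w (quad c) \<le> residual Y w (quad d))"
proof -
  have f: "(\<lambda>q. \<Sum>y\<in>Y. (norm (q y - w y))\<^sup>2) = residual Y w" by (simp add: residual_def fun_eq_iff)
  have iff: "is_arg_min (residual Y w) (\<lambda>x. x \<in> P2) q \<longleftrightarrow> (\<exists>c. q = quad c \<and> (\<forall>d. residual Y w (quad c) \<le> residual Y w (quad d)))" for q
    unfolding is_arg_min_def P2_quad by (auto simp: not_less simp del: split_paired_All split_paired_Ex)
  have "\<exists>q. is_arg_min (residual Y w) (\<lambda>x. x \<in> P2) q" unfolding iff using residual_min_exists[OF Y] by blast
  then have "is_arg_min (residual Y w) (\<lambda>x. x \<in> P2) (ls_fit Y w)"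
    unfolding ls_fit_def f arg_min_on_def arg_min_def by (rule someI_ex)
  then show ?thesis unfolding iff .
qed

lemma ls_fit_eqI:
  assumes Y: "unisolvent Y" and c: "\<And>d. residual Y w (quad c) \<le> residual Y w (quad d)"
  shows "ls_fit Y w = quad c"
  using ls_fit_quad[OF Y, of w] residual_min_unique[OF Y c] by blast

lemma ls_fit_cong: "(\<And>y. y \<in> Y \<Longrightarrow> w y = w' y) \<Longrightarrow> ls_fit Y w = ls_fit Y w'"
  unfolding ls_fit_def by (rule arg_cong[where f="\<lambda>f. arg_min_on f P2"]) (auto intro!: sum.cong)

text \<open>Subtracting \<open>p\<close> maps the competitors \<open>P2\<close> onto themselves and
  preserves residuals, so a minimiser is carried to a minimiser; uniqueness turns this into an
  equation for the chosen fit.\<close>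

lemma ls_fit_diff_P2:
  assumes Y: "unisolvent Y" and p: "p \<in> P2"
  shows "ls_fit Y (\<lambda>x. u x - p x) = (\<lambda>x. ls_fit Y u x - p x)"
proof -
  obtain e where e: "p = quad e" using p by (auto simp: P2_quad)
  obtain c where c: "ls_fit Y u = quad c" "\<And>d. residual Y u (quad c) \<le> residual Y u (quad d)"
    using ls_fit_quad[OF Y, of u] by blast
  have r: "residual Y (\<lambda>x. u x - p x) (quad (d - e)) = residual Y u (quad d)" for d
    by (simp add: residual_def e quad_diff)
  have "ls_fit Y (\<lambda>x. u x - p x) = quad (c - e)"
  proof (rule ls_fit_eqI[OF Y])
    fix d show "residual Y (\<lambda>x. u x - p x) (quad (c - e)) \<le> residual Y (\<lambda>x. u x - p x) (quad d)"
      using r[of c] r[of "d + e"] c(2) by simp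
  qed
  then show ?thesis by (simp add: c e fun_eq_iff quad_diff)
qed

lemma quad_differentiable: "quad c differentiable (at x)"
proof -
  obtain c0 c1 c2 c3 c4 c5 where c: "c = (c0, c1, c2, c3, c4, c5)" by (cases c)
  have "quad c = centred_quad 0 c0 c1 c2 c3 c4 c5" by (simp add: c quad_def centred_quad_def fun_eq_iff)
  then show ?thesis using centred_quad_has_derivative[of 0 c0 c1 c2 c3 c4 c5 x] by (auto simp: differentiable_def)
qed

lemma ls_fit_deriv_diff:
  assumes Y: "unisolvent Y" and p: "p \<in> P2" and p': "(p has_derivative p') (at x)"
  shows "frechet_derivative (ls_fit Y (\<lambda>x. u x - p x)) (at x) e = frechet_derivative (ls_fit Y u) (at x) e - p' e"
proof -
  obtain c where "ls_fit Y u = quad c" using ls_fit_quad[OF Y, of u] by blast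
  then have "(ls_fit Y u has_derivative frechet_derivative (ls_fit Y u) (at x)) (at x)"
    by (simp add: frechet_derivative_works[symmetric] quad_differentiable)
  from has_derivative_diff[OF this p'] show ?thesis
    unfolding ls_fit_diff_P2[OF Y p] by (simp add: frechet_derivative_at[symmetric])
qed

text \<open>An inverse estimate for affine functions. Each \<open>a\<close> in the half disc gives
  \<open>p z = (1 - k) p a + k p (b a)\<close> with \<open>b a\<close> in the disc, and integrating
  over the half disc brings in the \<open>L\<^sup>2\<close> norm. The shape of the triangle enters
  through \<open>\<sigma>\<close> alone.\<close>

lemma P1_point_bound:
  fixes p :: "real^2 \<Rightarrow> complex"
  assumes p: "p \<in> P1" and r: "r > 0" and \<sigma>: "\<sigma> \<ge> 2" and z: "\<And>a. a \<in> ball x r \<Longrightarrow> norm (z - a) \<le> \<sigma> * r"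
  shows "ennreal ((norm (p z))\<^sup>2 * r\<^sup>2) \<le> ennreal (64 * \<sigma>\<^sup>2) * (\<integral>\<^sup>+a. ennreal ((norm (p a))\<^sup>2) * indicator (ball x r) a \<partial>lborel)"
proof -
  \<comment> \<open>The point \<open>b a\<close> lies at the fraction \<open>1/k\<close> of the way
    from \<open>a\<close> to \<open>z\<close>; as \<open>norm (z - a) \<le> \<sigma> * r\<close>,
    this moves \<open>a\<close> by at most \<open>r/2\<close>.\<close>
  define k where "k = 2 * \<sigma>"
  have k: "k \<ge> 4" using \<sigma> by (simp add: k_def)
  define I where "I = (\<integral>\<^sup>+a. ennreal ((norm (p a))\<^sup>2) * indicator (ball x r) a \<partial>lborel)"
  define b where "b a = (1/k) *\<^sub>R z + (1 - 1/k) *\<^sub>R a" for a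
  have [measurable]: "p \<in> borel_measurable borel" by (intro borel_measurable_continuous_onI P1_continuous p)
  have bm0: "(\<lambda>a. ennreal ((norm (p a))\<^sup>2) * indicator (ball x r) a) \<in> borel_measurable borel"
    by (intro borel_measurable_times_ennreal borel_measurable_indicator) auto
  have bz: "p z = (1 - k) *\<^sub>R p a + k *\<^sub>R p (b a)" for a
  proof -
    have "z = (1 - k) *\<^sub>R a + k *\<^sub>R b a" using k by (simp add: b_def algebra_simps)
    then show ?thesis using P1_affine[OF p, of k a "b a"] by simp
  qed
  have bb: "b a \<in> ball x r" if a: "a \<in> ball x (r/2)" for a
  proof -
    have "b a - a = (1/k) *\<^sub>R (z - a)" by (simp add: b_def algebra_simps)
    then have "norm (b a - a) = norm (z - a) / k" using k by simp
    also have "\<dots> \<le> (\<sigma> * r) / k" using z[of a] a r k by (intro divide_right_mono) auto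
    also have "\<dots> = r / 2" using \<sigma> by (simp add: k_def)
    finally have "norm (b a - a) \<le> r / 2" .
    then show ?thesis using a dist_triangle[of x "b a" a] by (simp add: dist_norm norm_minus_commute)
  qed
  have pw: "ennreal ((norm (p z))\<^sup>2) * indicator (ball x (r/2)) a \<le>
     ennreal (2 * k\<^sup>2) * (ennreal ((norm (p a))\<^sup>2) * indicator (ball x r) a + ennreal ((norm (p (b a)))\<^sup>2) * indicator (ball x r) (b a))" for a
  proof (cases "a \<in> ball x (r/2)")
    case True
    have "norm (p z) \<le> \<bar>1 - k\<bar> * norm (p a) + \<bar>k\<bar> * norm (p (b a))"
      unfolding bz[of a] by (rule order_trans[OF norm_triangle_ineq]) simp
    also have "\<dots> \<le> k * norm (p a) + k * norm (p (b a))" using k by (intro add_mono mult_right_mono) auto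
    finally have "(norm (p z))\<^sup>2 \<le> (k * norm (p a) + k * norm (p (b a)))\<^sup>2" by (intro power_mono) auto
    also have "\<dots> \<le> 2 * k\<^sup>2 * ((norm (p a))\<^sup>2 + (norm (p (b a)))\<^sup>2)"
      using sum_squares_bound[of "k * norm (p a)" "k * norm (p (b a))"] by (simp add: power2_sum power_mult_distrib algebra_simps)
    finally have "ennreal ((norm (p z))\<^sup>2) \<le> ennreal (2 * k\<^sup>2) * (ennreal ((norm (p a))\<^sup>2) + ennreal ((norm (p (b a)))\<^sup>2))"
      by (subst ennreal_plus[symmetric], simp, simp, subst ennreal_mult[symmetric]) (auto intro: ennreal_leI)
    moreover have "a \<in> ball x r" using True r by auto
    ultimately show ?thesis using True bb[OF True] by simp
  qed simp
  \<comment> \<open>The map \<open>b\<close> contracts by the factor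
    \<open>1 - 1/k \<ge> 1/2\<close>, so in the plane its Jacobian is at least
    \<open>1/4\<close>.\<close>
  have nb: "(\<integral>\<^sup>+a. ennreal ((norm (p (b a)))\<^sup>2) * indicator (ball x r) (b a) \<partial>lborel) \<le> ennreal 4 * I"
  proof -
    have c: "1 - 1/k \<ge> 1/2" using k by (simp add: field_simps)
    have "I = ennreal (\<bar>1 - 1/k\<bar> ^ DIM(real^2)) * (\<integral>\<^sup>+a. ennreal ((norm (p (b a)))\<^sup>2) * indicator (ball x r) (b a) \<partial>lborel)"
      unfolding I_def b_def by (rule nn_integral_affine[OF bm0]) (use c in auto)
    moreover have "(1/4::real) \<le> \<bar>1 - 1/k\<bar> ^ DIM(real^2)" using power_mono[OF c, of 2] by (simp add: power_divide)
    ultimately have "ennreal (1/4) * (\<integral>\<^sup>+a. ennreal ((norm (p (b a)))\<^sup>2) * indicator (ball x r) (b a) \<partial>lborel) \<le> I"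
      by (simp only:) (intro mult_right_mono ennreal_leI, auto)
    then have "ennreal 4 * (ennreal (1/4) * (\<integral>\<^sup>+a. ennreal ((norm (p (b a)))\<^sup>2) * indicator (ball x r) (b a) \<partial>lborel)) \<le> ennreal 4 * I"
      by (intro mult_left_mono) auto
    moreover have "ennreal 4 * ennreal (1/4) = 1" by (subst ennreal_mult[symmetric]) auto
    ultimately show ?thesis by (simp only: mult.assoc[symmetric] mult_1_left)
  qed
  have v: "emeasure lborel (ball x (r/2)) = ennreal (pi * (r/2)\<^sup>2)"
    using r by (simp add: emeasure_ball unit_ball_vol_2)
  have bm: "(\<lambda>a. ennreal ((norm (p (b a)))\<^sup>2) * indicator (ball x r) (b a)) \<in> borel_measurable lborel"
  proof -
    have "continuous_on UNIV b" unfolding b_def by (intro continuous_intros)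
    then have "b \<in> borel \<rightarrow>\<^sub>M borel" by (rule borel_measurable_continuous_onI)
    from measurable_compose[OF this bm0] show ?thesis by simp
  qed
  have "ennreal ((norm (p z))\<^sup>2 * (pi * (r/2)\<^sup>2)) = (\<integral>\<^sup>+a. ennreal ((norm (p z))\<^sup>2) * indicator (ball x (r/2)) a \<partial>lborel)"
    by (simp add: nn_integral_cmult_indicator v ennreal_mult)
  also have "\<dots> \<le> (\<integral>\<^sup>+a. ennreal (2 * k\<^sup>2) * (ennreal ((norm (p a))\<^sup>2) * indicator (ball x r) a + ennreal ((norm (p (b a)))\<^sup>2) * indicator (ball x r) (b a)) \<partial>lborel)"
    by (intro nn_integral_mono pw)
  also have "\<dots> = ennreal (2 * k\<^sup>2) * (I + (\<integral>\<^sup>+a. ennreal ((norm (p (b a)))\<^sup>2) * indicator (ball x r) (b a) \<partial>lborel))"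
  proof -
    have bm0': "(\<lambda>a. ennreal ((norm (p a))\<^sup>2) * indicator (ball x r) a) \<in> borel_measurable lborel" using bm0 by simp
    show ?thesis
      by (subst nn_integral_cmult, intro borel_measurable_add bm0' bm, subst nn_integral_add[OF bm0' bm], simp add: I_def)
  qed
  also have "\<dots> \<le> ennreal (2 * k\<^sup>2) * (ennreal 1 * I + ennreal 4 * I)"
    using nb by (intro mult_left_mono add_mono) auto
  also have "\<dots> = ennreal (2 * k\<^sup>2 * 5) * I"
  proof -
    have "ennreal 1 + ennreal 4 = ennreal 5" by (subst ennreal_plus[symmetric]) auto
    moreover have "ennreal (2 * k\<^sup>2 * 5) = ennreal (2 * k\<^sup>2) * ennreal 5" by (rule ennreal_mult) auto
    ultimately show ?thesis by (simp only: distrib_right[symmetric] mult.assoc)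
  qed
  finally have main: "ennreal ((norm (p z))\<^sup>2 * (pi * (r/2)\<^sup>2)) \<le> ennreal (2 * k\<^sup>2 * 5) * I" .
  \<comment> \<open>Dividing by the area \<open>pi * r\<^sup>2 / 4\<close> of the half disc leaves
    the factor \<open>160 / pi\<close>, which is below 64.\<close>
  have "ennreal ((norm (p z))\<^sup>2 * r\<^sup>2) = ennreal (4/pi) * ennreal ((norm (p z))\<^sup>2 * (pi * (r/2)\<^sup>2))"
    by (subst ennreal_mult[symmetric]) (auto simp: power_divide)
  also have "\<dots> \<le> ennreal (4/pi) * (ennreal (2 * k\<^sup>2 * 5) * I)" using main by (intro mult_left_mono) auto
  also have "\<dots> = ennreal (160 / pi * \<sigma>\<^sup>2) * I"
    by (simp add: mult.assoc[symmetric] ennreal_mult[symmetric] k_def power_mult_distrib)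
  also have "\<dots> \<le> ennreal (64 * \<sigma>\<^sup>2) * I"
    using pi_gt3 by (intro mult_right_mono ennreal_leI) (auto simp: field_simps)
  finally show ?thesis by (simp add: I_def)
qed

section \<open>Stability of the recovery operator\<close>

locale ppr_mesh = mesh +
  fixes \<sigma> \<kappa> B :: real and M :: nat and N :: "real^2 \<Rightarrow> (real^2) set"
  assumes regular: "regular_mesh \<sigma> \<kappa> \<Omega> \<T>" and sampling: "ppr_sampling M \<T> N"
    and stable: "ppr_bounded B \<Omega> \<T> N" and nonempty: "\<Omega> \<noteq> {}" and frontier_null: "negligible (frontier \<Omega>)"
begin

definition h :: real where "h = mesh_size \<T>"

lemma mesh_nonempty: "\<T> \<noteq> {}"
  using cover nonempty closure_subset[of \<Omega>] by auto

lemma diameter_le: "\<tau> \<in> \<T> \<Longrightarrow> diameter \<tau> \<le> h"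
  unfolding h_def mesh_size_def using finite_mesh by (intro Max_ge) auto

lemma dist_le: assumes "\<tau> \<in> \<T>" "x \<in> \<tau>" "y \<in> \<tau>" shows "dist x y \<le> h"
  using diameter_bounded_bound[OF compact_imp_bounded[OF triangle_props(1)[OF assms(1)]] assms(2,3)] diameter_le[OF assms(1)] by linarith

lemma inner_ball:
  assumes "\<tau> \<in> \<T>"
  obtains x r where "r > 0" "ball x r \<subseteq> \<tau>" "diameter \<tau> \<le> \<sigma> * r" "2 * r \<le> diameter \<tau>"
proof -
  obtain x r where r: "r > 0" "ball x r \<subseteq> \<tau>" "diameter \<tau> \<le> \<sigma> * r"
    using regular assms by (auto simp: regular_mesh_def)
  have "diameter (ball x r) \<le> diameter \<tau>"
    using r(2) compact_imp_bounded[OF triangle_props(1)[OF assms]] by (rule diameter_subset)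
  then have "2 * r \<le> diameter \<tau>" using r(1) by simp
  then show ?thesis using r that by blast
qed

text \<open>The parameters come without sign conditions; the existence of a mesh forces them. An
  inscribed disc has diameter \<open>2 * r\<close>, which is at most
  \<open>\<sigma> * r\<close>.\<close>

lemma constants: "h > 0" "\<sigma> \<ge> 2" "\<kappa> > 0"
proof -
  obtain \<tau> where t: "\<tau> \<in> \<T>" using mesh_nonempty by blast
  obtain x r where r: "r > 0" "ball x r \<subseteq> \<tau>" "diameter \<tau> \<le> \<sigma> * r" "2 * r \<le> diameter \<tau>" using inner_ball[OF t] .
  show h: "h > 0" using r diameter_le[OF t] by linarith
  have "2 * r \<le> \<sigma> * r" using r by linarith
  then show "\<sigma> \<ge> 2" using r(1) by simp
  have "0 < \<kappa> * diameter \<tau>" using regular t h by (auto simp: regular_mesh_def h_def intro: less_le_trans)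
  moreover have "diameter \<tau> > 0" using r by linarith
  ultimately show "\<kappa> > 0" by (simp add: zero_less_mult_iff)
qed

lemma inner_ball_h:
  assumes "\<tau> \<in> \<T>"
  obtains x r where "r > 0" "ball x r \<subseteq> \<tau>" "diameter \<tau> \<le> \<sigma> * r" "h \<le> \<kappa> * \<sigma> * r"
proof -
  obtain x r where r: "r > 0" "ball x r \<subseteq> \<tau>" "diameter \<tau> \<le> \<sigma> * r" using inner_ball[OF assms] by blast
  have "h \<le> \<kappa> * diameter \<tau>" using regular assms by (auto simp: regular_mesh_def h_def)
  also have "\<dots> \<le> \<kappa> * (\<sigma> * r)" using r constants by (intro mult_left_mono) auto
  finally show ?thesis using r that by (simp add: mult.assoc)
qed

lemma nodes_closure: "z \<in> nodes \<T> \<Longrightarrow> z \<in> closure \<Omega>"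
  using cover by (auto simp: nodes_def extreme_point_of_def)

lemma sampling_nodes: "z \<in> nodes \<T> \<Longrightarrow> z \<in> N z" "z \<in> nodes \<T> \<Longrightarrow> N z \<subseteq> nodes \<T>"
  using sampling by (auto simp: ppr_sampling_def)

lemma sampling_unisolvent: "z \<in> nodes \<T> \<Longrightarrow> unisolvent (N z)"
proof -
  assume z: "z \<in> nodes \<T>"
  then have "6 \<le> card (N z)" using sampling by (auto simp: ppr_sampling_def)
  then have "finite (N z)" using card.infinite by fastforce
  then show ?thesis using sampling z unfolding unisolvent_def ppr_sampling_def by blast
qed

text \<open>The patch is connected, so the distances from \<open>z\<close> attained on it fill an interval, of which
  every element covers a length of at most \<open>2 * h\<close>.\<close>

lemma sampling_dist:
  assumes z: "z \<in> nodes \<T>" and y: "y \<in> N z" shows "dist z y \<le> 2 * real M * h"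
proof -
  obtain P where P: "P \<subseteq> \<T>" "card P \<le> M" "connected (\<Union>P)" "z \<in> \<Union>P" "N z \<subseteq> \<Union>P"
  proof -
    have "\<exists>P\<subseteq>\<T>. card P \<le> M \<and> connected (\<Union>P) \<and> z \<in> \<Union>P \<and> N z \<subseteq> \<Union>P"
      using sampling z unfolding ppr_sampling_def by blast
    then show ?thesis using that by blast
  qed
  have fin: "finite P" using P(1) finite_mesh finite_subset by blast
  define L where "L = dist z y"
  have "connected (dist z ` \<Union>P)" by (intro connected_continuous_image P continuous_intros)
  moreover have "0 \<in> dist z ` \<Union>P" "L \<in> dist z ` \<Union>P" using P(4,5) y by (auto simp: L_def image_iff intro: bexI[of _ z])
  ultimately have sub: "{0..L} \<subseteq> dist z ` \<Union>P" by (rule connected_contains_Icc)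
  define c where "c \<tau> = dist z (SOME p. p \<in> \<tau>)" for \<tau> :: "(real^2) set"
  have each: "dist z ` \<tau> \<subseteq> {c \<tau> - h..c \<tau> + h}" if t: "\<tau> \<in> P" for \<tau>
  proof
    fix s assume "s \<in> dist z ` \<tau>"
    then obtain q where q: "q \<in> \<tau>" "s = dist z q" by blast
    have "(SOME p. p \<in> \<tau>) \<in> \<tau>" using q(1) by (rule someI)
    then have "dist (SOME p. p \<in> \<tau>) q \<le> h" using dist_le t P(1) q(1) by blast
    then have "\<bar>dist z q - c \<tau>\<bar> \<le> h" using abs_dist_diff_le[of q z "SOME p. p \<in> \<tau>"] unfolding c_def by (simp add: dist_commute)
    then show "s \<in> {c \<tau> - h..c \<tau> + h}" by (auto simp: q(2))
  qed
  have "(\<Union>\<tau>\<in>P. dist z ` \<tau>) \<subseteq> (\<Union>\<tau>\<in>P. {c \<tau> - h..c \<tau> + h})"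
    by (rule UN_mono[OF subset_refl each])
  with sub have "{0..L} \<subseteq> (\<Union>\<tau>\<in>P. {c \<tau> - h..c \<tau> + h})"
    unfolding image_Union by (rule subset_trans)
  then have "emeasure lborel {0..L} \<le> emeasure lborel (\<Union>\<tau>\<in>P. {c \<tau> - h..c \<tau> + h})" using fin by (intro emeasure_mono) auto
  also have "\<dots> \<le> (\<Sum>\<tau>\<in>P. emeasure lborel {c \<tau> - h..c \<tau> + h})" using fin by (intro emeasure_subadditive_finite) auto
  also have "\<dots> = (\<Sum>\<tau>\<in>P. ennreal (2 * h))" using constants(1) by (intro sum.cong) auto
  also have "\<dots> = ennreal (real (card P) * (2 * h))" using constants(1) by (simp add: ennreal_mult ennreal_of_nat_eq_real_of_nat)
  finally have "L \<le> real (card P) * (2 * h)" using constants(1) by (simp add: L_def)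
  also have "\<dots> \<le> real M * (2 * h)" using P(2) constants(1) by (intro mult_right_mono) auto
  finally show ?thesis by (simp add: L_def mult_ac)
qed

text \<open>Triangles cover the closure of the domain, so a disc in a triangle is known to lie in
  \<open>\<Omega>\<close> up to the frontier, a null set.\<close>

lemma ball_sub_AE: assumes "ball x r \<subseteq> \<tau>" "\<tau> \<in> \<T>" shows "AE y in lebesgue. y \<in> ball x r \<longrightarrow> y \<in> \<Omega>"
proof -
  have "ball x r - frontier \<Omega> \<subseteq> \<Omega>" using assms cover open_dom by (auto simp: frontier_def interior_open)
  moreover have "AE y in lebesgue. y \<notin> frontier \<Omega>"
    using frontier_null by (intro AE_not_in) (simp add: negligible_iff_null_sets)
  ultimately show ?thesis by (auto elim!: eventually_mono)
qed

lemma fe_L2: "v \<in> fe_space \<Omega> \<T> \<Longrightarrow> v \<in> L2 \<Omega>"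
  by (auto simp: fe_space_def sobolev_def)

lemma norm_complex2: "(norm (v :: complex^2))\<^sup>2 = (norm (v$1))\<^sup>2 + (norm (v$2))\<^sup>2"
  by (simp add: norm_vec_def L2_set_def sum_2)

text \<open>The inverse inequality between maximum and \<open>L\<^sup>2\<close> norm, at one vertex:
  a triangle with this vertex contains a disc of radius at least
  \<open>h / (\<kappa> * \<sigma>)\<close>.\<close>

lemma node_value_bound:
  assumes z: "z \<in> nodes \<T>" and v: "\<And>i. (\<lambda>x. V x $ i) \<in> fe_space \<Omega> \<T>"
  shows "norm (V z $ i) \<le> 8 * \<sigma>\<^sup>2 * \<kappa> / h * l2_norm \<Omega> (V :: real^2 \<Rightarrow> complex^2)"
proof -
  obtain \<tau> where t: "\<tau> \<in> \<T>" "z extreme_point_of \<tau>" using z by (auto simp: nodes_def)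
  have z\<tau>: "z \<in> \<tau>" using t(2) by (simp add: extreme_point_of_def)
  obtain x r where r: "r > 0" "ball x r \<subseteq> \<tau>" "diameter \<tau> \<le> \<sigma> * r" "h \<le> \<kappa> * \<sigma> * r" using inner_ball_h[OF t(1)] .
  obtain p where p: "p \<in> P1" "\<And>x. x \<in> \<tau> \<Longrightarrow> V x $ i = p x" using v[of i] t(1) by (auto simp: fe_space_def)
  have zd: "norm (z - a) \<le> \<sigma> * r" if "a \<in> ball x r" for a
    using diameter_bounded_bound[OF compact_imp_bounded[OF triangle_props(1)[OF t(1)]] z\<tau>, of a] that r by (auto simp: dist_norm)
  have L2: "integrable (lebesgue_on \<Omega>) (\<lambda>x. (norm (V x $ j))\<^sup>2)" for j using fe_L2[OF v[of j]] by (simp add: L2_def)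
  define J where "J = (\<integral>x. (norm (V x))\<^sup>2 \<partial>lebesgue_on \<Omega>)"
  have J0: "J \<ge> 0" by (simp add: J_def)
  have "(\<integral>\<^sup>+a. ennreal ((norm (p a))\<^sup>2) * indicator (ball x r) a \<partial>lborel) = (\<integral>\<^sup>+a. ennreal ((norm (p a))\<^sup>2) * indicator (ball x r) a \<partial>lebesgue)"
    by (simp add: nn_integral_completion)
  also have "\<dots> \<le> (\<integral>\<^sup>+a. ennreal ((norm (V a $ i))\<^sup>2) * indicator \<Omega> a \<partial>lebesgue)"
    by (intro nn_integral_mono_AE) (use ball_sub_AE[OF r(2) t(1)] in eventually_elim, use p(2) r(2) in \<open>auto simp: indicator_def\<close>)
  also have "\<dots> = (\<integral>\<^sup>+a. ennreal ((norm (V a $ i))\<^sup>2) \<partial>lebesgue_on \<Omega>)"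
    using dom_measurable by (simp add: nn_integral_restrict_space)
  also have "\<dots> = ennreal (\<integral>a. (norm (V a $ i))\<^sup>2 \<partial>lebesgue_on \<Omega>)" using L2 by (intro nn_integral_eq_integral) auto
  also have "\<dots> \<le> ennreal J"
  proof (rule ennreal_leI)
    have "J = (\<integral>x. (norm (V x $ 1))\<^sup>2 \<partial>lebesgue_on \<Omega>) + (\<integral>x. (norm (V x $ 2))\<^sup>2 \<partial>lebesgue_on \<Omega>)"
      unfolding J_def norm_complex2 by (intro Bochner_Integration.integral_add L2)
    moreover have "0 \<le> (\<integral>x. (norm (V x $ 1))\<^sup>2 \<partial>lebesgue_on \<Omega>)" "0 \<le> (\<integral>x. (norm (V x $ 2))\<^sup>2 \<partial>lebesgue_on \<Omega>)" by simp_all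
    ultimately show "(\<integral>a. (norm (V a $ i))\<^sup>2 \<partial>lebesgue_on \<Omega>) \<le> J" using exhaust_2[of i] by auto
  qed
  finally have "ennreal ((norm (p z))\<^sup>2 * r\<^sup>2) \<le> ennreal (64 * \<sigma>\<^sup>2) * ennreal J"
    using P1_point_bound[OF p(1) r(1) constants(2) zd] by (meson mult_left_mono order_trans zero_le)
  then have "(norm (p z))\<^sup>2 * r\<^sup>2 \<le> 64 * \<sigma>\<^sup>2 * J" using J0 by (simp add: ennreal_mult[symmetric])
  also have "\<dots> = (8 * \<sigma> * sqrt J)\<^sup>2" using J0 by (simp add: power_mult_distrib)
  finally have "(norm (p z) * r)\<^sup>2 \<le> (8 * \<sigma> * sqrt J)\<^sup>2" by (simp add: power_mult_distrib)
  then have n: "norm (p z) * r \<le> 8 * \<sigma> * sqrt J" using constants J0 by (auto intro: power2_le_imp_le)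
  have "norm (p z) * h \<le> norm (p z) * (\<kappa> * \<sigma> * r)" using r by (intro mult_left_mono) auto
  also have "\<dots> = \<kappa> * \<sigma> * (norm (p z) * r)" by simp
  also have "\<dots> \<le> \<kappa> * \<sigma> * (8 * \<sigma> * sqrt J)" using n constants by (intro mult_left_mono) auto
  finally have "norm (p z) \<le> 8 * \<sigma>\<^sup>2 * \<kappa> / h * sqrt J" using constants by (simp add: field_simps power2_eq_square)
  then show ?thesis using p(2)[OF z\<tau>] by (simp add: l2_norm_def J_def)
qed

lemma measure_ball_le: "R \<ge> 0 \<Longrightarrow> measure (lebesgue_on \<Omega>) (\<Omega> \<inter> ball z R) \<le> pi * R\<^sup>2"
proof -
  assume R: "R \<ge> 0"
  have "measure (lebesgue_on \<Omega>) (\<Omega> \<inter> ball z R) = measure lebesgue (\<Omega> \<inter> ball z R)"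
    using dom_measurable by (subst measure_restrict_space) auto
  also have "\<dots> \<le> measure lebesgue (ball z R)"
    using dom_measurable by (intro measure_mono_fmeasurable) auto
  also have "\<dots> = pi * R\<^sup>2" using R by (simp add: content_ball unit_ball_vol_2)
  finally show ?thesis .
qed

lemma integrable_ind_ball: "integrable (lebesgue_on \<Omega>) (\<lambda>x. c * indicator (ball z R) x :: real)"
proof -
  interpret finite_measure "lebesgue_on \<Omega>" by (rule finite_measure_lebesgue_on[OF dom_measurable(2)])
  have "indicator (ball z R) \<in> borel_measurable (lebesgue_on \<Omega>)"
    by (intro measurable_restrict_space1 borel_measurable_indicator) auto
  then have "integrable (lebesgue_on \<Omega>) (indicator (ball z R) :: _ \<Rightarrow> real)"
    by (intro integrable_const_bound[of _ 1]) (auto simp: indicator_def)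
  then show ?thesis by simp
qed

lemma integral_ind_ball_le: "c \<ge> 0 \<Longrightarrow> R \<ge> 0 \<Longrightarrow> (\<integral>x. c * indicator (ball z R) x \<partial>lebesgue_on \<Omega>) \<le> c * (pi * R\<^sup>2)"
proof -
  assume "c \<ge> 0" "R \<ge> 0"
  have "(\<integral>x. indicator (ball z R) x \<partial>lebesgue_on \<Omega>) = measure (lebesgue_on \<Omega>) (ball z R \<inter> \<Omega>)"
    by (metis Bochner_Integration.integral_indicator space_lebesgue_on)
  also have "\<dots> \<le> pi * R\<^sup>2" using measure_ball_le[OF \<open>R \<ge> 0\<close>] by (simp add: Int_commute)
  finally show ?thesis using \<open>c \<ge> 0\<close> by (simp add: mult_left_mono)
qed

text \<open>Slopes are of order \<open>m / h\<close> and vanish on triangles without a vertex in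
  \<open>N z\<close>; the others lie within a distance of order \<open>h\<close> from
  \<open>z\<close>. Squared slope times area is thus independent of \<open>h\<close>.\<close>

lemma nodal_interp_grad_norm:
  assumes z: "z \<in> nodes \<T>" and m: "\<And>y. y \<in> N z \<Longrightarrow> norm (w y) \<le> m" and w0: "\<And>y. y \<notin> N z \<Longrightarrow> w y = 0"
  shows "l2_norm \<Omega> (weak_grad \<Omega> (nodal_interp \<Omega> \<T> w)) \<le> 6 * m * \<kappa> * \<sigma> * (2 * real M + 2)"
proof -
  have m0: "m \<ge> 0" using m[OF sampling_nodes(1)[OF z]] norm_ge_zero order_trans by blast
  \<comment> \<open>Sampling nodes are within \<open>2 * M * h\<close>, a triangle at such a node
    reaches one \<open>h\<close> further, and the second \<open>h\<close> makes the inequality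
    strict.\<close>
  define R where "R = (2 * real M + 2) * h"
  have R: "R > 0" using constants by (simp add: R_def)
  define s0 where "s0 = 2 * m * \<kappa> * \<sigma> / h"
  have s00: "s0 \<ge> 0" using m0 constants by (simp add: s0_def)
  \<comment> \<open>The bound \<open>m'\<close> is left open, because triangles without a vertex in
    \<open>N z\<close> are treated by the same estimate with \<open>m' = 0\<close>.\<close>
  have sl: "norm (slope i w \<tau>) \<le> 2 * m' * \<kappa> * \<sigma> / h" if t: "\<tau> \<in> \<T>" and m': "\<And>y. y extreme_point_of \<tau> \<Longrightarrow> norm (w y) \<le> m'" "m' \<ge> 0" for i \<tau> m'
  proof -
    obtain x r where r: "r > 0" "ball x r \<subseteq> \<tau>" "h \<le> \<kappa> * \<sigma> * r" using inner_ball_h[OF t] by blast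
    have "norm (pl w \<tau> y) \<le> m'" if "y \<in> \<tau>" for y
      by (rule P1_bound_hull[OF pl(1)[OF t], where C="{x. x extreme_point_of \<tau>}"])
        (use pl(2)[OF t] m' triangle_hull[OF t] that in auto)
    then have "norm (pl w \<tau> 0 + y$1 *\<^sub>R slope 1 w \<tau> + y$2 *\<^sub>R slope 2 w \<tau>) \<le> m'" if "y \<in> ball x r" for y
      using that r(2) by (subst pl_slope[OF t, symmetric]) blast
    from P1_slope_bound[OF r(1) this] have "norm (slope i w \<tau>) \<le> 2 * m' / r" using exhaust_2[of i] by auto
    also have "\<dots> \<le> 2 * m' * \<kappa> * \<sigma> / h"
    proof -
      have "2 * m' * h \<le> 2 * m' * (\<kappa> * \<sigma> * r)" using r m' by (intro mult_left_mono) auto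
      then show ?thesis using r constants by (simp add: field_simps)
    qed
    finally show ?thesis .
  qed
  have wm: "norm (w y) \<le> m" for y using m w0 m0 by (cases "y \<in> N z") auto
  have pg: "norm (pgrad i w x) \<le> s0 * indicator (ball z R) x" if t: "\<tau> \<in> \<T>" "x \<in> interior \<tau>" for i x \<tau>
  proof (cases "\<exists>y. y extreme_point_of \<tau> \<and> y \<in> N z")
    case True
    then obtain y where y: "y extreme_point_of \<tau>" "y \<in> N z" by blast
    have "dist z x \<le> dist z y + dist y x" by (rule dist_triangle)
    also have "\<dots> \<le> 2 * real M * h + h" using y t interior_subset[of \<tau>]
      by (intro add_mono sampling_dist[OF z] dist_le[OF t(1)]) (auto simp: extreme_point_of_def)
    also have "\<dots> < R" using constants by (simp add: R_def algebra_simps)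
    finally have "x \<in> ball z R" by simp
    then show ?thesis using sl[OF t(1) wm m0] pgrad_eq[OF t] by (simp add: s0_def)
  next
    case False
    then have "norm (slope i w \<tau>) \<le> 2 * 0 * \<kappa> * \<sigma> / h" using w0 by (intro sl[OF t(1)]) auto
    then show ?thesis using pgrad_eq[OF t] s00 by simp
  qed
  have AE: "AE x in lebesgue_on \<Omega>. (norm (weak_grad \<Omega> (nodal_interp \<Omega> \<T> w) x))\<^sup>2 \<le> (2 * s0\<^sup>2) * indicator (ball z R) x"
    using AE_interior nodal_interp_grad[of 1 w] nodal_interp_grad[of 2 w]
  proof eventually_elim
    case (elim x)
    then obtain \<tau> where t: "\<tau> \<in> \<T>" "x \<in> interior \<tau>" by blast
    have "(norm (weak_grad \<Omega> (nodal_interp \<Omega> \<T> w) x))\<^sup>2 = (norm (pgrad 1 w x))\<^sup>2 + (norm (pgrad 2 w x))\<^sup>2"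
      using elim by (simp add: norm_complex2 weak_grad_def)
    also have "\<dots> \<le> (s0 * indicator (ball z R) x)\<^sup>2 + (s0 * indicator (ball z R) x)\<^sup>2"
      by (intro add_mono power_mono pg[OF t]) auto
    also have "\<dots> = (2 * s0\<^sup>2) * indicator (ball z R) x" by (simp add: indicator_def)
    finally show ?case .
  qed
  have "(\<integral>x. (norm (weak_grad \<Omega> (nodal_interp \<Omega> \<T> w) x))\<^sup>2 \<partial>lebesgue_on \<Omega>) \<le> (\<integral>x. (2 * s0\<^sup>2) * indicator (ball z R) x \<partial>lebesgue_on \<Omega>)"
    by (rule integral_mono_AE'[OF integrable_ind_ball AE]) (auto simp: indicator_def)
  also have "\<dots> \<le> (2 * s0\<^sup>2) * (pi * R\<^sup>2)" using R by (intro integral_ind_ball_le) auto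
  also have "\<dots> \<le> (3 * s0 * R)\<^sup>2"
  proof -
    have "2 * pi * (s0\<^sup>2 * R\<^sup>2) \<le> 9 * (s0\<^sup>2 * R\<^sup>2)" using pi_less_4 by (intro mult_right_mono) auto
    then show ?thesis by (simp add: power_mult_distrib mult_ac)
  qed
  finally have "l2_norm \<Omega> (weak_grad \<Omega> (nodal_interp \<Omega> \<T> w)) \<le> 3 * s0 * R"
    unfolding l2_norm_def using s00 R by (intro real_le_lsqrt) auto
  also have "\<dots> = 6 * m * \<kappa> * \<sigma> * (2 * real M + 2)" using constants by (simp add: s0_def R_def)
  finally show ?thesis .
qed

text \<open>The product of the constants in \<open>node_value_bound\<close>, in the assumed
  stability and in \<open>nodal_interp_grad_norm\<close>; the modulus is taken since no sign of
  \<open>B\<close> is given.\<close>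

definition stab :: real where "stab = 8 * \<sigma>\<^sup>2 * \<kappa> * (\<bar>B\<bar> * (6 * \<kappa> * \<sigma> * (2 * real M + 2)))"

lemma stab_nonneg: "stab \<ge> 0"
  using constants by (simp add: stab_def)

text \<open>The fit at \<open>z\<close> sees only the values on \<open>N z\<close>, so changing all
  other nodal values is free. In this way a global hypothesis yields a local bound without any
  quantitative information on how far the sampling nodes are from a conic.\<close>

lemma recovery_stability:
  assumes z: "z \<in> nodes \<T>" and m: "\<And>y. y \<in> N z \<Longrightarrow> norm (w y) \<le> m"
  shows "norm (frechet_derivative (ls_fit (N z) w) (at z) (axis i 1)) \<le> stab / h * m"
proof -
  define w' where "w' y = (if y \<in> N z then w y else 0)" for y
  define v where "v = nodal_interp \<Omega> \<T> w'"
  have v: "v \<in> fe_space \<Omega> \<T>" unfolding v_def by (rule nodal_interp_fe)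
  have fit: "ls_fit (N z) v = ls_fit (N z) w"
    using sampling_nodes(2)[OF z] by (intro ls_fit_cong) (auto simp: v_def w'_def nodal_interp_node)
  have g: "l2_norm \<Omega> (weak_grad \<Omega> v) \<le> 6 * m * \<kappa> * \<sigma> * (2 * real M + 2)"
    unfolding v_def by (rule nodal_interp_grad_norm[OF z]) (use m in \<open>auto simp: w'_def\<close>)
  have g0: "l2_norm \<Omega> (weak_grad \<Omega> v) \<ge> 0" by (simp add: l2_norm_def)
  have "l2_norm \<Omega> (ppr \<Omega> \<T> N v) \<le> B * l2_norm \<Omega> (weak_grad \<Omega> v)" using stable v by (simp add: ppr_bounded_def)
  also have "\<dots> \<le> \<bar>B\<bar> * l2_norm \<Omega> (weak_grad \<Omega> v)" using g0 by (intro mult_right_mono) auto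
  also have "\<dots> \<le> \<bar>B\<bar> * (6 * m * \<kappa> * \<sigma> * (2 * real M + 2))" using g by (intro mult_left_mono) auto
  finally have l: "l2_norm \<Omega> (ppr \<Omega> \<T> N v) \<le> \<bar>B\<bar> * (6 * m * \<kappa> * \<sigma> * (2 * real M + 2))" .
  have "ppr \<Omega> \<T> N v z $ i = frechet_derivative (ls_fit (N z) v) (at z) (axis i 1)"
    by (simp add: ppr_def nodal_interp_node[OF z])
  moreover have "norm (ppr \<Omega> \<T> N v z $ i) \<le> stab / h * m"
  proof -
    have "norm (ppr \<Omega> \<T> N v z $ i) \<le> 8 * \<sigma>\<^sup>2 * \<kappa> / h * l2_norm \<Omega> (ppr \<Omega> \<T> N v)"
      by (rule node_value_bound[OF z]) (simp add: ppr_def nodal_interp_fe)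
    also have "\<dots> \<le> 8 * \<sigma>\<^sup>2 * \<kappa> / h * (\<bar>B\<bar> * (6 * m * \<kappa> * \<sigma> * (2 * real M + 2)))"
      using l constants by (intro mult_left_mono) auto
    also have "\<dots> = stab / h * m" by (simp add: stab_def)
    finally show ?thesis .
  qed
  ultimately show ?thesis by (simp only: fit)
qed

end

section \<open>The recovery error\<close>

lemma sobolev3_third_sq:
  assumes u: "u \<in> sobolev 3 \<Omega>"
  shows "(\<integral>x. third_sq \<Omega> u x \<partial>lebesgue_on \<Omega>) \<le> (sobolev_norm 3 \<Omega> u)\<^sup>2"
proof -
  let ?n = "\<lambda>(a, b). (l2_norm \<Omega> (weak_deriv \<Omega> (dirs a b) u))\<^sup>2"
  have fin: "finite {(a, b). a + b \<le> (3::nat)}"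
    by (rule finite_subset[of _ "{..3} \<times> {..3}"]) auto
  have "(\<integral>x. third_sq \<Omega> u x \<partial>lebesgue_on \<Omega>) = (\<Sum>a\<le>3. \<integral>x. (norm (weak_deriv \<Omega> (dirs a (3 - a)) u x))\<^sup>2 \<partial>lebesgue_on \<Omega>)"
    unfolding third_sq_def
  proof (rule Bochner_Integration.integral_sum)
    fix a :: nat assume "a \<in> {..3}"
    then have "weak_deriv \<Omega> (dirs a (3 - a)) u \<in> L2 \<Omega>"
      using weak_deriv_works[OF u, of a "3 - a"] by (auto simp: has_weak_deriv_def)
    then show "integrable (lebesgue_on \<Omega>) (\<lambda>x. (norm (weak_deriv \<Omega> (dirs a (3 - a)) u x))\<^sup>2)" by (simp add: L2_def)
  qed
  also have "\<dots> = (\<Sum>a\<le>3. ?n (a, 3 - a))" by (simp add: l2_norm_def)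
  also have "\<dots> = (\<Sum>p\<in>(\<lambda>a. (a, 3 - a)) ` {..3::nat}. ?n p)"
    by (subst sum.reindex) (auto simp: inj_on_def)
  also have "\<dots> \<le> (\<Sum>p\<in>{(a, b). a + b \<le> 3}. ?n p)"
    by (rule sum_mono2[OF fin]) auto
  also have "\<dots> = (sobolev_norm 3 \<Omega> u)\<^sup>2" unfolding sobolev_norm_def
    by (subst real_sqrt_pow2) (auto intro!: sum_nonneg)
  finally show ?thesis .
qed

lemma C_ug_ge:
  assumes "k > 0" shows "sobolev_norm 3 \<Omega> u / k\<^sup>2 \<le> C_ug vs \<Omega> k u g"
proof -
  have s: "sobolev_norm j \<Omega> u \<ge> 0" for j by (auto simp: sobolev_norm_def intro!: sum_nonneg)
  have b: "bdry_seminorm j vs g \<ge> 0" for j by (auto simp: bdry_seminorm_def intro!: sum_nonneg)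
  have "sobolev_norm 3 \<Omega> u / k ^ (3 - 1) \<le> (\<Sum>j=1..3. sobolev_norm j \<Omega> u / k ^ (j - 1))"
    by (rule member_le_sum[of 3 "{1..3}" "\<lambda>j. sobolev_norm j \<Omega> u / k ^ (j - 1)"]) (use assms s in auto)
  moreover have "0 \<le> (\<Sum>j=1..2. bdry_seminorm j vs g / k ^ j)" using b assms by (intro sum_nonneg) auto
  ultimately show ?thesis unfolding C_ug_def by simp
qed

context ppr_mesh
begin

text \<open>Each triangle contains a disc of radius \<open>h / (\<kappa> * \<sigma>)\<close>;
  comparing the total area of the disjoint interiors with that of the big disc bounds their
  number.\<close>

lemma overlap_count:
  assumes L: "L \<ge> 0"
  shows "real (card {\<tau> \<in> \<T>. \<tau> \<subseteq> ball x (L * h)}) \<le> (L * \<kappa> * \<sigma>)\<^sup>2"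
proof -
  define S where "S = {\<tau> \<in> \<T>. \<tau> \<subseteq> ball x (L * h)}"
  have fin: "finite S" using finite_mesh by (simp add: S_def)
  define r0 where "r0 = h / (\<kappa> * \<sigma>)"
  have r0: "r0 > 0" using constants by (simp add: r0_def)
  have e: "ennreal (pi * r0\<^sup>2) \<le> emeasure lborel (interior \<tau>)" if t: "\<tau> \<in> S" for \<tau>
  proof -
    obtain a r where r: "r > 0" "ball a r \<subseteq> \<tau>" "h \<le> \<kappa> * \<sigma> * r" using inner_ball_h t by (metis (no_types, lifting) S_def mem_Collect_eq)
    have "r0 \<le> r" using r constants by (simp add: r0_def field_simps)
    then have "ball a r0 \<subseteq> interior \<tau>" using r by (intro interior_maximal) auto
    then have "emeasure lborel (ball a r0) \<le> emeasure lborel (interior \<tau>)" by (intro emeasure_mono) auto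
    then show ?thesis using r0 by (simp add: emeasure_ball unit_ball_vol_2)
  qed
  have "ennreal (real (card S) * (pi * r0\<^sup>2)) = (\<Sum>\<tau>\<in>S. ennreal (pi * r0\<^sup>2))"
    by (simp add: ennreal_mult ennreal_of_nat_eq_real_of_nat)
  also have "\<dots> \<le> (\<Sum>\<tau>\<in>S. emeasure lborel (interior \<tau>))" by (intro sum_mono e)
  also have "\<dots> = emeasure lborel (\<Union>\<tau>\<in>S. interior \<tau>)"
  proof (rule sum_emeasure)
    show "disjoint_family_on interior S"
      unfolding disjoint_family_on_def using interior_disjoint by (auto simp: S_def)
  qed (use fin in auto)
  also have "\<dots> \<le> emeasure lborel (ball x (L * h))"
    using interior_subset by (intro emeasure_mono) (fastforce simp: S_def)+
  also have "\<dots> = ennreal (pi * (L * h)\<^sup>2)" using L constants by (simp add: emeasure_ball unit_ball_vol_2)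
  finally have "real (card S) * (pi * r0\<^sup>2) \<le> pi * (L * h)\<^sup>2" by simp
  then have "real (card S) * r0\<^sup>2 \<le> (L * h)\<^sup>2" by (simp add: mult.left_commute)
  moreover have "(L * h)\<^sup>2 = (L * \<kappa> * \<sigma>)\<^sup>2 * r0\<^sup>2" using constants by (simp add: r0_def power_mult_distrib power_divide)
  ultimately show ?thesis using r0 by (simp add: S_def)
qed

lemma ppr_interp: "z \<in> nodes \<T> \<Longrightarrow> ls_fit (N z) (nodal_interp \<Omega> \<T> u) = ls_fit (N z) u"
  using sampling_nodes(2) by (intro ls_fit_cong nodal_interp_node) blast

text \<open>On a triangle the recovered field minus the gradient of \<open>q\<close> is affine, so
  its values at the vertices bound it. There it is the recovered gradient of \<open>u - q\<close>,
  the interpolant and \<open>u\<close> having the same values at sampling nodes.\<close>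

lemma triangle_estimate:
  assumes t: "\<tau> \<in> \<T>" and a: "a \<in> \<tau>" and u: "continuous_on (closure \<Omega>) u"
    and \<rho>: "\<rho> = (2 * real M + 2) * h"
    and q: "q \<in> P2" "q1 \<in> P1" "q2 \<in> P1" "\<And>x. (q has_derivative (\<lambda>h. h$1 *\<^sub>R q1 x + h$2 *\<^sub>R q2 x)) (at x)"
    and e0: "\<And>x. x \<in> \<Omega> \<inter> ball a \<rho> \<Longrightarrow> norm (u x - q x) \<le> m0"
    and e1: "AE x in lebesgue_on (\<Omega> \<inter> ball a \<rho>). norm (weak_deriv \<Omega> [axis 1 1] u x - q1 x) \<le> m1"
    and e2: "AE x in lebesgue_on (\<Omega> \<inter> ball a \<rho>). norm (weak_deriv \<Omega> [axis 2 1] u x - q2 x) \<le> m1"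
  shows "AE x in lebesgue_on \<Omega>. x \<in> \<tau> \<longrightarrow>
     (norm (ppr \<Omega> \<T> N (nodal_interp \<Omega> \<T> u) x - weak_grad \<Omega> u x))\<^sup>2 \<le> 2 * (stab / h * m0 + m1)\<^sup>2"
proof -
  have h: "h > 0" by (rule constants)
  \<comment> \<open>From \<open>a\<close> to a vertex the distance is at most \<open>h\<close>, from
    there to its sampling nodes at most \<open>2 * M * h\<close>; the remaining \<open>h\<close> in
    \<open>\<rho>\<close> gives strictness.\<close>
  have Mh: "h < \<rho>" "2 * real M * h + h < \<rho>" using h by (auto simp: \<rho> algebra_simps add_pos_nonneg)
  \<comment> \<open>Sampling nodes may lie on the boundary, while the approximation is known in the
    open domain; continuity of \<open>u\<close> and \<open>q\<close> extends it.\<close>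
  have e0': "norm (u y - q y) \<le> m0" if y: "y \<in> closure \<Omega>" "dist a y < \<rho>" for y
  proof -
    have cq: "continuous_on (closure \<Omega>) q"
      by (intro continuous_at_imp_continuous_on ballI has_derivative_continuous[OF q(4)])
    have "y \<in> closure (\<Omega> \<inter> ball a \<rho>)"
    proof (rule closure_approachable[THEN iffD2], intro allI impI)
      fix e :: real assume "e > 0"
      then have "min e (\<rho> - dist a y) > 0" using y by simp
      then obtain x where x: "x \<in> \<Omega>" "dist x y < min e (\<rho> - dist a y)" using y(1) closure_approachable by metis
      then have "dist a x < \<rho>" using dist_triangle[of a x y] by (simp add: dist_commute)
      then show "\<exists>x\<in>\<Omega> \<inter> ball a \<rho>. dist x y < e" using x by (intro bexI[of _ x]) auto
    qed
    moreover have "closure (\<Omega> \<inter> ball a \<rho>) \<subseteq> closure \<Omega>" by (intro closure_mono) auto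
    then have "continuous_on (closure (\<Omega> \<inter> ball a \<rho>)) (\<lambda>x. norm (u x - q x))"
      using u cq by (intro continuous_intros) (auto intro: continuous_on_subset)
    ultimately show ?thesis
      using continuous_le_on_closure[of "\<Omega> \<inter> ball a \<rho>" "\<lambda>x. norm (u x - q x)" y m0] e0 by blast
  qed
  define Q where "Q i = (if i = (1::2) then q1 else q2)" for i
  have Q: "Q i \<in> P1" for i using q by (simp add: Q_def)
  define G where "G i = nodal_interp \<Omega> \<T> (\<lambda>z. frechet_derivative (ls_fit (N z) (nodal_interp \<Omega> \<T> u)) (at z) (axis i 1))" for i
  have vtx: "norm (G i z - Q i z) \<le> stab / h * m0" if z: "z extreme_point_of \<tau>" for z i
  proof -
    have zn: "z \<in> nodes \<T>" "z \<in> \<tau>" using z t by (auto simp: nodes_def extreme_point_of_def)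
    have "G i z = frechet_derivative (ls_fit (N z) u) (at z) (axis i 1)"
      by (simp add: G_def nodal_interp_node[OF zn(1)] ppr_interp[OF zn(1)])
    moreover have "axis i 1 $ 1 *\<^sub>R q1 z + axis i 1 $ 2 *\<^sub>R q2 z = Q i z" using exhaust_2[of i] by (auto simp: Q_def)
    ultimately have "G i z - Q i z = frechet_derivative (ls_fit (N z) (\<lambda>x. u x - q x)) (at z) (axis i 1)"
      using ls_fit_deriv_diff[OF sampling_unisolvent[OF zn(1)] q(1) q(4), of u z "axis i 1"] by simp
    also have "norm \<dots> \<le> stab / h * m0"
    proof (rule recovery_stability[OF zn(1)])
      fix y assume y: "y \<in> N z"
      have "dist a y \<le> dist a z + dist z y" by (rule dist_triangle)
      also have "\<dots> \<le> h + 2 * real M * h" by (intro add_mono dist_le[OF t a zn(2)] sampling_dist[OF zn(1) y])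
      finally have "dist a y < \<rho>" using Mh by linarith
      then show "norm (u y - q y) \<le> m0" using sampling_nodes(2)[OF zn(1)] y nodes_closure by (intro e0') auto
    qed
    finally show ?thesis .
  qed
  have on: "norm (G i x - Q i x) \<le> stab / h * m0" if x: "x \<in> \<tau>" for x i
  proof -
    obtain p where p: "p \<in> P1" "\<And>x. x \<in> \<tau> \<Longrightarrow> G i x = p x"
      using nodal_interp_fe[of "\<lambda>z. frechet_derivative (ls_fit (N z) (nodal_interp \<Omega> \<T> u)) (at z) (axis i 1)"] t
      unfolding G_def fe_space_def by auto
    have "norm (p x - Q i x) \<le> stab / h * m0"
    proof (rule P1_bound_hull[OF P1_diff[OF p(1) Q]])
      show "x \<in> convex hull {z. z extreme_point_of \<tau>}" using x triangle_hull[OF t] by blast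
      fix z assume z: "z \<in> {z. z extreme_point_of \<tau>}"
      then have "z \<in> \<tau>" by (simp add: extreme_point_of_def)
      then show "norm (p z - Q i z) \<le> stab / h * m0" using vtx[of z i] p(2) z by simp
    qed
    then show ?thesis using p(2)[OF x] by simp
  qed
  have sub: "\<tau> \<subseteq> ball a \<rho>" using dist_le[OF t a] Mh by fastforce
  have tr: "AE x in lebesgue_on \<Omega>. x \<in> ball a \<rho> \<longrightarrow> P x" if "AE x in lebesgue_on (\<Omega> \<inter> ball a \<rho>). P x" for P
  proof -
    have m: "\<Omega> \<inter> ball a \<rho> \<in> sets lebesgue" using dom_measurable by auto
    have "AE x in lebesgue. x \<in> \<Omega> \<inter> ball a \<rho> \<longrightarrow> P x" using that m by (simp add: AE_restrict_space_iff)
    then show ?thesis using dom_measurable by (simp add: AE_restrict_space_iff) (auto elim: eventually_mono)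
  qed
  show ?thesis using tr[OF e1] tr[OF e2]
  proof eventually_elim
    case (elim x)
    show ?case
    proof
      assume x: "x \<in> \<tau>"
      define T where "T = stab / h * m0 + m1"
      have b: "norm (G i x - weak_deriv \<Omega> [axis i 1] u x) \<le> T" for i
      proof -
        have "norm (weak_deriv \<Omega> [axis i 1] u x - Q i x) \<le> m1" using elim x sub exhaust_2[of i] by (auto simp: Q_def)
        moreover have "norm ((G i x - Q i x) - (weak_deriv \<Omega> [axis i 1] u x - Q i x))
          \<le> norm (G i x - Q i x) + norm (weak_deriv \<Omega> [axis i 1] u x - Q i x)" by (rule norm_triangle_ineq4)
        ultimately show ?thesis using on[OF x, of i] by (simp add: T_def)
      qed
      have "(norm (ppr \<Omega> \<T> N (nodal_interp \<Omega> \<T> u) x - weak_grad \<Omega> u x))\<^sup>2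
        = (norm (G 1 x - weak_deriv \<Omega> [axis 1 1] u x))\<^sup>2 + (norm (G 2 x - weak_deriv \<Omega> [axis 2 1] u x))\<^sup>2"
        by (simp add: norm_complex2 ppr_def weak_grad_def G_def)
      also have "\<dots> \<le> T\<^sup>2 + T\<^sup>2" by (intro add_mono power_mono b) auto
      finally show "(norm (ppr \<Omega> \<T> N (nodal_interp \<Omega> \<T> u) x - weak_grad \<Omega> u x))\<^sup>2 \<le> 2 * (stab / h * m0 + m1)\<^sup>2"
        by (simp add: T_def)
    qed
  qed
qed

text \<open>The bounds on single triangles are combined into one integrable majorant, a sum of
  multiples of indicators of discs of radius \<open>2 * h\<close>, so that no integral over a
  triangle has to be evaluated.\<close>

lemma global_estimate:
  assumes u: "u \<in> sobolev 3 \<Omega>" "continuous_on (closure \<Omega>) u" and C: "C \<ge> 0" and \<Lambda>: "\<Lambda> \<ge> 1"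
    and loc: "\<And>a. a \<in> closure \<Omega> \<Longrightarrow> quadratic_approx \<Omega> u (\<Omega> \<inter> ball a \<rho>)
      (C * \<rho>\<^sup>2 * sqrt (local_energy \<Omega> u (ball a (\<Lambda> * \<rho>))))
      (C * \<rho> * sqrt (local_energy \<Omega> u (ball a (\<Lambda> * \<rho>))))"
    and \<rho>: "\<rho> = J * h" "J = 2 * real M + 2"
  shows "l2_norm \<Omega> (\<lambda>x. ppr \<Omega> \<T> N (nodal_interp \<Omega> \<T> u) x - weak_grad \<Omega> u x)
      \<le> (6 * (stab * J + 1) * C * J * ((\<Lambda> * J + 2) * \<kappa> * \<sigma>)) * h\<^sup>2 * sobolev_norm 3 \<Omega> u"
proof -
  have h: "h > 0" by (rule constants)
  have J: "J \<ge> 2" using \<rho> by simp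
  define a where "a \<tau> = (SOME x. x \<in> \<tau>)" for \<tau> :: "(real^2) set"
  have a: "a \<tau> \<in> \<tau>" if "\<tau> \<in> \<T>" for \<tau>
  proof -
    have "\<tau> \<noteq> {}" using interior_nonempty[OF that] by auto
    then show ?thesis unfolding a_def by (simp add: some_in_eq)
  qed
  define E where "E \<tau> = local_energy \<Omega> u (ball (a \<tau>) (\<Lambda> * \<rho>))" for \<tau>
  have ti: "integrable (lebesgue_on \<Omega>) (third_sq \<Omega> u)" by (rule third_sq_integrable[OF u(1)])
  have Ei: "integrable (lebesgue_on \<Omega>) (\<lambda>x. third_sq \<Omega> u x * indicator (ball z R) x)" for z R
  proof (rule Bochner_Integration.integrable_bound[OF ti])
    have "(indicator (ball z R) :: _ \<Rightarrow> real) \<in> borel_measurable (lebesgue_on \<Omega>)"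
      by (intro measurable_restrict_space1 borel_measurable_indicator) auto
    then show "(\<lambda>x. third_sq \<Omega> u x * indicator (ball z R) x) \<in> borel_measurable (lebesgue_on \<Omega>)"
      using ti by (intro borel_measurable_times) auto
  qed (auto intro!: AE_I2 simp: indicator_def)
  have E0: "E \<tau> \<ge> 0" for \<tau> unfolding E_def local_energy_def
    by (intro integral_nonneg_AE AE_I2) (simp add: third_sq_nonneg)
  \<comment> \<open>The total factor of \<open>sqrt (E \<tau>)\<close> in
    \<open>stab / h * m0 + m1\<close>, with \<open>\<rho> = J * h\<close> inserted.\<close>
  define K where "K = (stab * J + 1) * C * J * h"
  have K0: "K \<ge> 0" using stab_nonneg C J h by (simp add: K_def)
  define F where "F x = (norm (ppr \<Omega> \<T> N (nodal_interp \<Omega> \<T> u) x - weak_grad \<Omega> u x))\<^sup>2" for x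
  have each: "AE x in lebesgue_on \<Omega>. x \<in> \<tau> \<longrightarrow> F x \<le> 2 * K\<^sup>2 * E \<tau>" if t: "\<tau> \<in> \<T>" for \<tau>
  proof -
    have "a \<tau> \<in> closure \<Omega>" using a[OF t] t cover by blast
    from loc[OF this] obtain q q1 q2 where q: "q \<in> P2" "q1 \<in> P1" "q2 \<in> P1" "\<And>x. (q has_derivative (\<lambda>h. h$1 *\<^sub>R q1 x + h$2 *\<^sub>R q2 x)) (at x)"
      "\<And>x. x\<in>\<Omega> \<inter> ball (a \<tau>) \<rho> \<Longrightarrow> norm (u x - q x) \<le> C * \<rho>\<^sup>2 * sqrt (E \<tau>)"
      "AE x in lebesgue_on (\<Omega> \<inter> ball (a \<tau>) \<rho>). norm (weak_deriv \<Omega> [axis 1 1] u x - q1 x) \<le> C * \<rho> * sqrt (E \<tau>)"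
      "AE x in lebesgue_on (\<Omega> \<inter> ball (a \<tau>) \<rho>). norm (weak_deriv \<Omega> [axis 2 1] u x - q2 x) \<le> C * \<rho> * sqrt (E \<tau>)"
      unfolding E_def quadratic_approx_def by blast
    have "stab / h * (C * \<rho>\<^sup>2 * sqrt (E \<tau>)) + C * \<rho> * sqrt (E \<tau>) = K * sqrt (E \<tau>)"
      using h by (simp add: K_def \<rho>(1) power2_eq_square field_simps)
    then have "2 * (stab / h * (C * \<rho>\<^sup>2 * sqrt (E \<tau>)) + C * \<rho> * sqrt (E \<tau>))\<^sup>2 = 2 * K\<^sup>2 * E \<tau>"
      using E0[of \<tau>] by (simp add: power_mult_distrib)
    then show ?thesis
      using triangle_estimate[OF t a[OF t] u(2) _ q] \<rho> unfolding F_def by (simp add: mult.assoc)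
  qed
  have "AE x in lebesgue_on \<Omega>. \<forall>\<tau>\<in>\<T>. x \<in> \<tau> \<longrightarrow> F x \<le> 2 * K\<^sup>2 * E \<tau>"
    using finite_mesh each by (intro AE_finite_allI) auto
  then have AEF: "AE x in lebesgue_on \<Omega>. F x \<le> (\<Sum>\<tau>\<in>\<T>. (2 * K\<^sup>2 * E \<tau>) * indicator (ball (a \<tau>) (2 * h)) x)"
    using AE_interior
  proof eventually_elim
    case (elim x)
    then obtain \<tau> where t: "\<tau> \<in> \<T>" "x \<in> \<tau>" using interior_subset by blast
    have "dist (a \<tau>) x \<le> h" by (rule dist_le[OF t(1) a[OF t(1)] t(2)])
    then have xb: "x \<in> ball (a \<tau>) (2 * h)" using h by simp
    have "F x \<le> (2 * K\<^sup>2 * E \<tau>) * indicator (ball (a \<tau>) (2 * h)) x" using elim t xb by simp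
    also have "\<dots> \<le> (\<Sum>\<tau>\<in>\<T>. (2 * K\<^sup>2 * E \<tau>) * indicator (ball (a \<tau>) (2 * h)) x)"
      by (rule member_le_sum[OF t(1)]) (use finite_mesh E0 in \<open>auto simp: indicator_def\<close>)
    finally show ?case .
  qed
  have "(\<integral>x. F x \<partial>lebesgue_on \<Omega>) \<le> (\<integral>x. (\<Sum>\<tau>\<in>\<T>. (2 * K\<^sup>2 * E \<tau>) * indicator (ball (a \<tau>) (2 * h)) x) \<partial>lebesgue_on \<Omega>)"
    by (rule integral_mono_AE'[OF _ AEF]) (auto intro!: Bochner_Integration.integrable_sum integrable_ind_ball sum_nonneg AE_I2 E0 mult_nonneg_nonneg)
  also have "\<dots> = (\<Sum>\<tau>\<in>\<T>. \<integral>x. (2 * K\<^sup>2 * E \<tau>) * indicator (ball (a \<tau>) (2 * h)) x \<partial>lebesgue_on \<Omega>)"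
    by (intro Bochner_Integration.integral_sum integrable_ind_ball)
  also have "\<dots> \<le> (\<Sum>\<tau>\<in>\<T>. (2 * K\<^sup>2 * E \<tau>) * (pi * (2 * h)\<^sup>2))"
    using h E0 by (intro sum_mono integral_ind_ball_le) auto
  also have "\<dots> = (2 * K\<^sup>2 * (pi * (2 * h)\<^sup>2)) * (\<Sum>\<tau>\<in>\<T>. E \<tau>)"
    unfolding sum_distrib_left by (intro sum.cong) (auto simp: mult_ac)
  finally have F1: "(\<integral>x. F x \<partial>lebesgue_on \<Omega>) \<le> (2 * K\<^sup>2 * (pi * (2 * h)\<^sup>2)) * (\<Sum>\<tau>\<in>\<T>. E \<tau>)" .
  \<comment> \<open>If \<open>x\<close> is within \<open>\<Lambda> * \<rho>\<close> of
    \<open>a \<tau>\<close>, all of \<open>\<tau>\<close> is within \<open>L * h\<close> of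
    \<open>x\<close>, where \<open>2 * h\<close> generously covers the extent of the
    triangle.\<close>
  define L where "L = \<Lambda> * J + 2"
  have L: "L \<ge> 0" using \<Lambda> J by (simp add: L_def)
  have "(\<Sum>\<tau>\<in>\<T>. E \<tau>) = (\<integral>x. (\<Sum>\<tau>\<in>\<T>. third_sq \<Omega> u x * indicator (ball (a \<tau>) (\<Lambda> * \<rho>)) x) \<partial>lebesgue_on \<Omega>)"
    unfolding E_def local_energy_def by (intro Bochner_Integration.integral_sum[symmetric] Ei)
  also have "\<dots> \<le> (\<integral>x. (L * \<kappa> * \<sigma>)\<^sup>2 * third_sq \<Omega> u x \<partial>lebesgue_on \<Omega>)"
  proof (rule integral_mono)
    fix x
    have "(\<Sum>\<tau>\<in>\<T>. third_sq \<Omega> u x * indicator (ball (a \<tau>) (\<Lambda> * \<rho>)) x) = third_sq \<Omega> u x * real (card {\<tau> \<in> \<T>. x \<in> ball (a \<tau>) (\<Lambda> * \<rho>)})"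
      unfolding sum_distrib_left[symmetric] using finite_mesh by (simp add: indicator_def sum.If_cases Int_def)
    also have "\<dots> \<le> third_sq \<Omega> u x * (L * \<kappa> * \<sigma>)\<^sup>2"
    proof (rule mult_left_mono[OF _ third_sq_nonneg])
      have "{\<tau> \<in> \<T>. x \<in> ball (a \<tau>) (\<Lambda> * \<rho>)} \<subseteq> {\<tau> \<in> \<T>. \<tau> \<subseteq> ball x (L * h)}"
      proof (clarify)
        fix \<tau> y assume t: "\<tau> \<in> \<T>" "x \<in> ball (a \<tau>) (\<Lambda> * \<rho>)" and y: "y \<in> \<tau>"
        have "dist x y \<le> dist x (a \<tau>) + dist (a \<tau>) y" by (rule dist_triangle)
        also have "\<dots> < \<Lambda> * \<rho> + 2 * h" using t(2) dist_le[OF t(1) a[OF t(1)] y] h by (simp add: dist_commute)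
        also have "\<dots> = L * h" by (simp add: L_def \<rho>(1) algebra_simps)
        finally show "y \<in> ball x (L * h)" by simp
      qed
      then have "card {\<tau> \<in> \<T>. x \<in> ball (a \<tau>) (\<Lambda> * \<rho>)} \<le> card {\<tau> \<in> \<T>. \<tau> \<subseteq> ball x (L * h)}"
        using finite_mesh by (intro card_mono) auto
      then show "real (card {\<tau> \<in> \<T>. x \<in> ball (a \<tau>) (\<Lambda> * \<rho>)}) \<le> (L * \<kappa> * \<sigma>)\<^sup>2"
        using overlap_count[OF L, of x] by linarith
    qed
    finally show "(\<Sum>\<tau>\<in>\<T>. third_sq \<Omega> u x * indicator (ball (a \<tau>) (\<Lambda> * \<rho>)) x) \<le> (L * \<kappa> * \<sigma>)\<^sup>2 * third_sq \<Omega> u x"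
      by (simp add: mult.commute)
  qed (use ti in \<open>auto intro!: Bochner_Integration.integrable_sum Ei\<close>)
  also have "\<dots> = (L * \<kappa> * \<sigma>)\<^sup>2 * (\<integral>x. third_sq \<Omega> u x \<partial>lebesgue_on \<Omega>)" by simp
  also have "\<dots> \<le> (L * \<kappa> * \<sigma>)\<^sup>2 * (sobolev_norm 3 \<Omega> u)\<^sup>2" by (intro mult_left_mono sobolev3_third_sq u) auto
  finally have E1: "(\<Sum>\<tau>\<in>\<T>. E \<tau>) \<le> (L * \<kappa> * \<sigma> * sobolev_norm 3 \<Omega> u)\<^sup>2" by (simp add: power_mult_distrib)
  have sn: "sobolev_norm 3 \<Omega> u \<ge> 0" by (auto simp: sobolev_norm_def intro!: sum_nonneg)
  define Z where "Z = L * \<kappa> * \<sigma> * sobolev_norm 3 \<Omega> u"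
  have Z0: "Z \<ge> 0" using L constants sn by (simp add: Z_def)
  have "(\<integral>x. F x \<partial>lebesgue_on \<Omega>) \<le> (2 * K\<^sup>2 * (pi * (2 * h)\<^sup>2)) * Z\<^sup>2"
    by (rule order_trans[OF F1]) (use E1 in \<open>auto simp: Z_def intro!: mult_left_mono\<close>)
  also have "\<dots> = (8 * pi) * (K * h * Z)\<^sup>2" by (simp add: power_mult_distrib)
  \<comment> \<open>Since \<open>8 * pi < 36\<close>, the square root yields the leading constant
    6.\<close>
  also have "\<dots> \<le> 36 * (K * h * Z)\<^sup>2" using pi_less_4 by (intro mult_right_mono) auto
  also have "\<dots> = (6 * K * h * Z)\<^sup>2" by (simp add: power_mult_distrib)
  finally have "l2_norm \<Omega> (\<lambda>x. ppr \<Omega> \<T> N (nodal_interp \<Omega> \<T> u) x - weak_grad \<Omega> u x) \<le> 6 * K * h * Z"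
    unfolding l2_norm_def F_def using K0 h Z0 by (intro real_le_lsqrt) auto
  also have "\<dots> = (6 * (stab * J + 1) * C * J * ((\<Lambda> * J + 2) * \<kappa> * \<sigma>)) * h\<^sup>2 * sobolev_norm 3 \<Omega> u"
    by (simp add: K_def Z_def L_def power2_eq_square)
  finally show ?thesis .
qed

end

theorem theorem4p2:
  fixes vs :: "(real^2) list" and \<Omega> :: "(real^2) set" and x\<^sub>\<Omega> :: "real^2"
    and c\<^sub>\<Omega> k\<^sub>0 \<sigma> \<kappa> B :: real and M :: nat
  assumes "polygon vs \<Omega>" and "strictly_star_shaped \<Omega> x\<^sub>\<Omega> c\<^sub>\<Omega>" and "k\<^sub>0 > 0"
  shows "\<exists>C>0. \<forall>(k::real) \<T> N f g u.
    k \<ge> k\<^sub>0 \<longrightarrow> regular_mesh \<sigma> \<kappa> \<Omega> \<T> \<longrightarrow> ppr_sampling M \<T> N \<longrightarrow> ppr_bounded B \<Omega> \<T> N \<longrightarrow>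
    f \<in> sobolev 1 \<Omega> \<longrightarrow> g \<in> bdry_sobolev 2 vs \<longrightarrow> helmholtz_solution vs \<Omega> k f g u \<longrightarrow>
    l2_norm \<Omega> (\<lambda>x. ppr \<Omega> \<T> N (nodal_interp \<Omega> \<T> u) x - weak_grad \<Omega> u x)
      \<le> C * (k * mesh_size \<T>)\<^sup>2 * C_ug vs \<Omega> k u g"
proof -
  have ne: "\<Omega> \<noteq> {}" using assms(2) by (auto simp: strictly_star_shaped_def)
  note ps = polygon_sides[OF assms(1) ne]
  define J where "J = 2 * real M + 2"
  \<comment> \<open>No mesh size exceeds the diameter of the closure, so \<open>J * h\<close> is at
    most this value. The constants of the local approximation can therefore be fixed before any mesh
    is given.\<close>
  define \<rho>max where "\<rho>max = J * (diameter (closure \<Omega>) + 1)"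
  have bc: "bounded (closure \<Omega>)" using ps(2) by (rule bounded_closure)
  have J: "J > 0" by (simp add: J_def)
  have "\<rho>max > 0" using J diameter_ge_0[OF bc] by (simp add: \<rho>max_def add_nonneg_pos)
  then obtain C \<Lambda> where C: "C \<ge> 0" "\<Lambda> \<ge> 1" and loc: "\<And>u a \<rho>. u \<in> sobolev 3 \<Omega> \<Longrightarrow> continuous_on (closure \<Omega>) u \<Longrightarrow> a \<in> closure \<Omega> \<Longrightarrow> 0 < \<rho> \<Longrightarrow> \<rho> \<le> \<rho>max \<Longrightarrow>
    quadratic_approx \<Omega> u (\<Omega> \<inter> ball a \<rho>)
      (C * \<rho>\<^sup>2 * sqrt (local_energy \<Omega> u (ball a (\<Lambda> * \<rho>))))
      (C * \<rho> * sqrt (local_energy \<Omega> u (ball a (\<Lambda> * \<rho>))))"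
    using local_approximation[OF assms(1,2)] by blast
  \<comment> \<open>The constant \<open>stab\<close> written out, as it is needed before a mesh, and
    with it the locale, is at hand.\<close>
  define s0 where "s0 = 8 * \<sigma>\<^sup>2 * \<kappa> * (\<bar>B\<bar> * (6 * \<kappa> * \<sigma> * (2 * real M + 2)))"
  define C1 where "C1 = 6 * (s0 * J + 1) * C * J * ((\<Lambda> * J + 2) * \<kappa> * \<sigma>)"
  \<comment> \<open>The witness is positive whatever the sign of \<open>C1\<close>, including
    parameters \<open>\<sigma>\<close> and \<open>\<kappa>\<close> that admit no mesh.\<close>
  show ?thesis
  proof (rule exI[of _ "\<bar>C1\<bar> + 1"], intro conjI allI impI)
    fix k :: real and \<T> N f g u
    assume k: "k \<ge> k\<^sub>0" and mesh: "regular_mesh \<sigma> \<kappa> \<Omega> \<T>" "ppr_sampling M \<T> N" "ppr_bounded B \<Omega> \<T> N"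
      and u: "helmholtz_solution vs \<Omega> k f g u"
    have u3: "u \<in> sobolev 3 \<Omega>" "continuous_on (closure \<Omega>) u" using u by (auto simp: helmholtz_solution_def)
    interpret ppr_mesh \<Omega> \<T> \<sigma> \<kappa> B M N
      by unfold_locales (use ps(1,2) mesh ne polygon_frontier_negligible[OF assms(1) ne] in \<open>auto simp: regular_mesh_def\<close>)
    have "h \<le> diameter (closure \<Omega>)"
    proof -
      have "h \<in> diameter ` \<T>" unfolding h_def mesh_size_def using finite_mesh mesh_nonempty by (intro Max_in) auto
      then obtain \<tau> where "\<tau> \<in> \<T>" "h = diameter \<tau>" by blast
      then show ?thesis using cover by (auto intro!: diameter_subset[OF _ bc])
    qed
    then have hJ: "J * h \<le> \<rho>max" unfolding \<rho>max_def using J by (intro mult_left_mono) auto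
    have h0: "h > 0" by (rule constants)
    have k0: "k > 0" using k assms(3) by simp
    have sn: "sobolev_norm 3 \<Omega> u \<ge> 0" by (auto simp: sobolev_norm_def intro!: sum_nonneg)
    have "l2_norm \<Omega> (\<lambda>x. ppr \<Omega> \<T> N (nodal_interp \<Omega> \<T> u) x - weak_grad \<Omega> u x) \<le> C1 * h\<^sup>2 * sobolev_norm 3 \<Omega> u"
      using global_estimate[OF u3 C loc[OF u3 _ _ hJ] refl J_def] J h0 by (simp add: C1_def s0_def stab_def)
    also have "\<dots> \<le> (\<bar>C1\<bar> + 1) * h\<^sup>2 * sobolev_norm 3 \<Omega> u" using sn by (intro mult_right_mono) auto
    \<comment> \<open>Multiplying and dividing by \<open>k\<^sup>2\<close>, possible as
      \<open>k \<ge> k\<^sub>0 > 0\<close>, exposes the summand of \<open>C_ug\<close> with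
      \<open>j = 3\<close>.\<close>
    also have "\<dots> = (\<bar>C1\<bar> + 1) * (k * h)\<^sup>2 * (sobolev_norm 3 \<Omega> u / k\<^sup>2)" using k0 by (simp add: power_mult_distrib)
    also have "\<dots> \<le> (\<bar>C1\<bar> + 1) * (k * h)\<^sup>2 * C_ug vs \<Omega> k u g"
      by (intro mult_left_mono C_ug_ge k0) auto
    finally show "l2_norm \<Omega> (\<lambda>x. ppr \<Omega> \<T> N (nodal_interp \<Omega> \<T> u) x - weak_grad \<Omega> u x)
      \<le> (\<bar>C1\<bar> + 1) * (k * mesh_size \<T>)\<^sup>2 * C_ug vs \<Omega> k u g" by (simp only: h_def)
  qed simp
qed

end
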